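(* $\ker(\tilde Z)=\{0\}$. Consequently $\tilde V:H\to L^2_q$ is surjective, i.e. a unitary operator from $H$ onto $L^2_q$, and $\tilde V$ is a spectral representation of $H$ relative to $A$ (it satisfies $\tilde V(\psi(A)f)=M_\psi\tilde Vf$ for all bounded measurable $\psi$ and $f\in H$).
   Context: Fix an integer $n\ge 2$, constants $c_1,\dots,c_n>0$ and $0\le a_1\le\dots\le a_n<\infty$. Let $N_1,\dots,N_n$ be $n$ disjoint copies of $(0,\infty)$ and $N$ the star-shaped network obtained from $\overline{N_1},\dots,\overline{N_n}$ by identifying their endpoints $0$; functions on $N$ are $n$-tuples of functions on the $N_k$, $\int_N g\,dx:=\sum_k\int_{N_k}g_k\,dx$. $H=L^2(N)=\prod_kL^2(N_k)$. $A$: $D(A)=\{u\in\prod_kH^2(N_k): u_i(0)=u_k(0)\ \forall i,k,\ \sum_kc_ku_k'(0^+)=0\}$, $Au=(-c_ku_k''+a_ku_k)_k$ (self-adjoint). Complex square root: $\sqrt{re^{i\phi}}=\sqrt re^{i\phi/2}$, $r\ge0$, $\phi\in[-\pi,\pi)$. For $\lambda\in\mathbb C$: $\xi_k(\lambda)=\sqrt{(\lambda-a_k)/c_k}$, $s_k(\lambda)=-\sum_{l\ne k}c_l\xi_l(\lambda)/(c_k\xi_k(\lambda))$. $F^{-,j}_\lambda:N\to\mathbb C$ is given for $x\in\overline{N_k}$ by $F^{-,j}_\lambda(x)=\cos(\xi_j(\lambda)x)-is_j(\lambda)\sin(\xi_j(\lambda)x)$ if $k=j$ and $\exp(-i\xi_k(\lambda)x)$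 if $k\ne j$. For real $\lambda$, $w(\lambda):=-i\sum_jc_j\xi_j(\lambda)$, $q_l(\lambda)=0$ if $\lambda<a_l$ and $q_l(\lambda)=c_l\xi_l(\lambda)/(\pi|w(\lambda)|^2)$ if $\lambda>a_l$. $L^2_q:=\prod_kL^2((a_k,\infty),q_k\,d\lambda)$. For $f\in L^1(N)$, $(Vf)_k(\lambda)=\int_Nf\,\overline{F^{-,k}_\lambda}\,dx$; $\tilde V:H\to L^2_q$ is the unique isometric extension of $V$ from $\prod_kC_c^\infty(N_k)$. Fix $\chi\in C^\infty(\mathbb R)$ with $\chi=0$ on $(-\infty,a_n+1)$, $\chi=1$ on $(a_n+2,\infty)$; $X$ is the (dense) set of $(G_1,\dots,G_n)\in L^2_q$ with $G_k\in C^\infty([a_k,\infty))$ and $\chi G_k$ (extended by $0$) in $\mathcal S(\mathbb R)$. For $G\in X$, $Z(G)(x)=\sum_k\int_{a_k}^\infty q_kG_kF^{-,k}_\lambda(x)\,d\lambda$; $\tilde Z:L^2_q\to H$ is the unique bounded extension of $Z$. $M_\psi$ is multiplication by $\psi(\lambda)$ in each component of $L^2_q$. *)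

theory Defs
  imports "HOL-Analysis.Analysis"
begin

(* Star-shaped network with n edges N_1..N_n (indices k in {1..n}), each a copy of (0,oo).
   A function on N is represented by f :: nat => real => complex, f k x = value on N_k at x.
   Parameters: c a :: nat => real. *)

definition parg :: "complex \<Rightarrow> real" where
  "parg z = (if Im z = 0 \<and> Re z < 0 then - pi else Arg z)"

definition psqrt :: "complex \<Rightarrow> complex" where
  "psqrt z = complex_of_real (sqrt (cmod z)) * exp (\<i> * complex_of_real (parg z / 2))"

definition xi :: "(nat \<Rightarrow> real) \<Rightarrow> (nat \<Rightarrow> real) \<Rightarrow> nat \<Rightarrow> complex \<Rightarrow> complex" where
  "xi c a k z = psqrt ((z - of_real (a k)) / of_real (c k))"

definition sfun :: "nat \<Rightarrow> (nat \<Rightarrow> real) \<Rightarrow> (nat \<Rightarrow> real) \<Rightarrow> nat \<Rightarrow> complex \<Rightarrow> complex" where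
  "sfun n c a k z = - (\<Sum>l\<in>{1..n} - {k}. of_real (c l) * xi c a l z) / (of_real (c k) * xi c a k z)"

text \<open>Fm n c a z j k x = F^{-,j}_z(x) for x on the edge N_k.\<close>
definition Fm :: "nat \<Rightarrow> (nat \<Rightarrow> real) \<Rightarrow> (nat \<Rightarrow> real) \<Rightarrow> complex \<Rightarrow> nat \<Rightarrow> nat \<Rightarrow> real \<Rightarrow> complex" where
  "Fm n c a z j k x =
     (if k = j then cos (xi c a j z * of_real x) - \<i> * sfun n c a j z * sin (xi c a j z * of_real x)
      else exp (- \<i> * xi c a k z * of_real x))"

definition wfun :: "nat \<Rightarrow> (nat \<Rightarrow> real) \<Rightarrow> (nat \<Rightarrow> real) \<Rightarrow> real \<Rightarrow> complex" where
  "wfun n c a t = - \<i> * (\<Sum>j\<in>{1..n}. of_real (c j) * xi c a j (of_real t))"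

text \<open>For t > a l the number c_l xi_l(t) is a positive real; we take its real part.
  The value at t = a l (a null set) is set to 0.\<close>
definition qfun :: "nat \<Rightarrow> (nat \<Rightarrow> real) \<Rightarrow> (nat \<Rightarrow> real) \<Rightarrow> nat \<Rightarrow> real \<Rightarrow> real" where
  "qfun n c a l t = (if a l < t then Re (of_real (c l) * xi c a l (of_real t)) / (pi * (cmod (wfun n c a t))\<^sup>2) else 0)"

definition MN :: "real measure" where
  "MN = density lborel (\<lambda>x. indicator {0<..} x)"

definition Mq :: "nat \<Rightarrow> (nat \<Rightarrow> real) \<Rightarrow> (nat \<Rightarrow> real) \<Rightarrow> nat \<Rightarrow> real measure" where
  "Mq n c a l = density lborel (\<lambda>t. ennreal (qfun n c a l t))"

definition inL2N :: "(real \<Rightarrow> complex) \<Rightarrow> bool" where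
  "inL2N g \<longleftrightarrow> g \<in> borel_measurable lborel \<and> integrable MN (\<lambda>x. (cmod (g x))\<^sup>2)"

definition inH :: "nat \<Rightarrow> (nat \<Rightarrow> real \<Rightarrow> complex) \<Rightarrow> bool" where
  "inH n f \<longleftrightarrow> (\<forall>k\<in>{1..n}. inL2N (f k))"

definition normH :: "nat \<Rightarrow> (nat \<Rightarrow> real \<Rightarrow> complex) \<Rightarrow> real" where
  "normH n f = sqrt (\<Sum>k\<in>{1..n}. \<integral>x. (cmod (f k x))\<^sup>2 \<partial>MN)"

definition innerH :: "nat \<Rightarrow> (nat \<Rightarrow> real \<Rightarrow> complex) \<Rightarrow> (nat \<Rightarrow> real \<Rightarrow> complex) \<Rightarrow> complex" where
  "innerH n f g = (\<Sum>k\<in>{1..n}. \<integral>x. f k x * cnj (g k x) \<partial>MN)"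

definition eqH :: "nat \<Rightarrow> (nat \<Rightarrow> real \<Rightarrow> complex) \<Rightarrow> (nat \<Rightarrow> real \<Rightarrow> complex) \<Rightarrow> bool" where
  "eqH n f g \<longleftrightarrow> (\<forall>k\<in>{1..n}. AE x in MN. f k x = g k x)"

definition inLq :: "nat \<Rightarrow> (nat \<Rightarrow> real) \<Rightarrow> (nat \<Rightarrow> real) \<Rightarrow> (nat \<Rightarrow> real \<Rightarrow> complex) \<Rightarrow> bool" where
  "inLq n c a G \<longleftrightarrow> (\<forall>k\<in>{1..n}. G k \<in> borel_measurable lborel \<and>
       integrable (Mq n c a k) (\<lambda>t. (cmod (G k t))\<^sup>2))"

definition normq :: "nat \<Rightarrow> (nat \<Rightarrow> real) \<Rightarrow> (nat \<Rightarrow> real) \<Rightarrow> (nat \<Rightarrow> real \<Rightarrow> complex) \<Rightarrow> real" where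
  "normq n c a G = sqrt (\<Sum>k\<in>{1..n}. \<integral>t. (cmod (G k t))\<^sup>2 \<partial>(Mq n c a k))"

definition eqq :: "nat \<Rightarrow> (nat \<Rightarrow> real) \<Rightarrow> (nat \<Rightarrow> real) \<Rightarrow> (nat \<Rightarrow> real \<Rightarrow> complex) \<Rightarrow> (nat \<Rightarrow> real \<Rightarrow> complex) \<Rightarrow> bool" where
  "eqq n c a G G' \<longleftrightarrow> (\<forall>k\<in>{1..n}. AE t in Mq n c a k. G k t = G' k t)"

definition smooth_on :: "real set \<Rightarrow> (real \<Rightarrow> 'b::real_normed_vector) \<Rightarrow> bool" where
  "smooth_on S f \<longleftrightarrow> (\<exists>D :: nat \<Rightarrow> real \<Rightarrow> 'b. (\<forall>x\<in>S. D 0 x = f x) \<and>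
      (\<forall>m. \<forall>x\<in>S. (D m has_vector_derivative D (Suc m) x) (at x within S)))"

definition schwartz :: "(real \<Rightarrow> complex) \<Rightarrow> bool" where
  "schwartz f \<longleftrightarrow> (\<exists>D :: nat \<Rightarrow> real \<Rightarrow> complex. D 0 = f \<and>
      (\<forall>m x. (D m has_vector_derivative D (Suc m) x) (at x)) \<and>
      (\<forall>m p. \<exists>B. \<forall>x. cmod (of_real (x ^ p) * D m x) \<le> B))"

definition testN :: "nat \<Rightarrow> (nat \<Rightarrow> real \<Rightarrow> complex) \<Rightarrow> bool" where
  "testN n f \<longleftrightarrow> (\<forall>k\<in>{1..n}. smooth_on {0<..} (f k) \<and> (\<forall>x\<le>0. f k x = 0) \<and>
      (\<exists>\<alpha> \<beta>. 0 < \<alpha> \<and> \<alpha> \<le> \<beta> \<and> (\<forall>x. f k x \<noteq> 0 \<longrightarrow> x \<in> {\<alpha>..\<beta>})))"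

definition Vop :: "nat \<Rightarrow> (nat \<Rightarrow> real) \<Rightarrow> (nat \<Rightarrow> real) \<Rightarrow> (nat \<Rightarrow> real \<Rightarrow> complex) \<Rightarrow> nat \<Rightarrow> real \<Rightarrow> complex" where
  "Vop n c a f k t = (\<Sum>j\<in>{1..n}. \<integral>x. f j x * cnj (Fm n c a (of_real t) k j x) \<partial>MN)"

text \<open>Graph of the isometric extension V~ of V from the test functions (closure of the graph).\<close>
definition Vt :: "nat \<Rightarrow> (nat \<Rightarrow> real) \<Rightarrow> (nat \<Rightarrow> real) \<Rightarrow> (nat \<Rightarrow> real \<Rightarrow> complex) \<Rightarrow> (nat \<Rightarrow> real \<Rightarrow> complex) \<Rightarrow> bool" where
  "Vt n c a f G \<longleftrightarrow> inH n f \<and> inLq n c a G \<and>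
     (\<exists>\<phi>. (\<forall>m. testN n (\<phi> m)) \<and>
        (\<lambda>m. normH n (\<lambda>k x. \<phi> m k x - f k x)) \<longlonglongrightarrow> 0 \<and>
        (\<lambda>m. normq n c a (\<lambda>k t. Vop n c a (\<phi> m) k t - G k t)) \<longlonglongrightarrow> 0)"

definition inX :: "nat \<Rightarrow> (nat \<Rightarrow> real) \<Rightarrow> (nat \<Rightarrow> real) \<Rightarrow> (real \<Rightarrow> real) \<Rightarrow> (nat \<Rightarrow> real \<Rightarrow> complex) \<Rightarrow> bool" where
  "inX n c a chi G \<longleftrightarrow> inLq n c a G \<and>
     (\<forall>k\<in>{1..n}. smooth_on {a k..} (G k) \<and>
        schwartz (\<lambda>t. if a k \<le> t then of_real (chi t) * G k t else 0))"

definition Zop :: "nat \<Rightarrow> (nat \<Rightarrow> real) \<Rightarrow> (nat \<Rightarrow> real) \<Rightarrow> (nat \<Rightarrow> real \<Rightarrow> complex) \<Rightarrow> nat \<Rightarrow> real \<Rightarrow> complex" where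
  "Zop n c a G k x = (\<Sum>j\<in>{1..n}.
      set_lebesgue_integral lborel {a j<..} (\<lambda>t. of_real (qfun n c a j t) * G j t * Fm n c a (of_real t) j k x))"

text \<open>Graph of the bounded extension Z~ of Z from X (closure of the graph).\<close>
definition Zt :: "nat \<Rightarrow> (nat \<Rightarrow> real) \<Rightarrow> (nat \<Rightarrow> real) \<Rightarrow> (real \<Rightarrow> real) \<Rightarrow> (nat \<Rightarrow> real \<Rightarrow> complex) \<Rightarrow> (nat \<Rightarrow> real \<Rightarrow> complex) \<Rightarrow> bool" where
  "Zt n c a chi G f \<longleftrightarrow> inLq n c a G \<and> inH n f \<and>
     (\<exists>Gs. (\<forall>m. inX n c a chi (Gs m)) \<and>
        (\<lambda>m. normq n c a (\<lambda>k t. Gs m k t - G k t)) \<longlonglongrightarrow> 0 \<and>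
        (\<lambda>m. normH n (\<lambda>k x. Zop n c a (Gs m) k x - f k x)) \<longlonglongrightarrow> 0)"

text \<open>H^2(0,oo) written out: continuous representative U0 with U0' = U1 absolutely continuous,
  U1' = U2, all three in L^2(0,oo); boundary values are U0(0), U1(0) = u'(0+).\<close>
definition H2rep :: "(real \<Rightarrow> complex) \<Rightarrow> (real \<Rightarrow> complex) \<Rightarrow> (real \<Rightarrow> complex) \<Rightarrow> bool" where
  "H2rep U0 U1 U2 \<longleftrightarrow> inL2N U0 \<and> inL2N U1 \<and> inL2N U2 \<and>
     (\<forall>x\<ge>0. set_integrable lborel {0..x} U2 \<and> set_integrable lborel {0..x} U1 \<and>
        U1 x = U1 0 + set_lebesgue_integral lborel {0..x} U2 \<and>
        U0 x = U0 0 + set_lebesgue_integral lborel {0..x} U1)"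

text \<open>isA u v: u \<in> D(A) and A u = v (up to a.e. equality).\<close>
definition isA :: "nat \<Rightarrow> (nat \<Rightarrow> real) \<Rightarrow> (nat \<Rightarrow> real) \<Rightarrow> (nat \<Rightarrow> real \<Rightarrow> complex) \<Rightarrow> (nat \<Rightarrow> real \<Rightarrow> complex) \<Rightarrow> bool" where
  "isA n c a u v \<longleftrightarrow> inH n u \<and> inH n v \<and>
     (\<exists>U0 U1 U2. (\<forall>k\<in>{1..n}. H2rep (U0 k) (U1 k) (U2 k) \<and> (AE x in MN. u k x = U0 k x)) \<and>
        (\<forall>i\<in>{1..n}. \<forall>k\<in>{1..n}. U0 i 0 = U0 k 0) \<and>
        (\<Sum>k\<in>{1..n}. of_real (c k) * U1 k 0) = 0 \<and>
        eqH n v (\<lambda>k x. - of_real (c k) * U2 k x + of_real (a k) * U0 k x))"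

definition bddBorel :: "(real \<Rightarrow> complex) \<Rightarrow> bool" where
  "bddBorel \<psi> \<longleftrightarrow> \<psi> \<in> borel_measurable borel \<and> bounded (range \<psi>)"

text \<open>Phi is the bounded Borel functional calculus psi \<mapsto> psi(A) of the self-adjoint operator A
  (characterised as the unique normal *-homomorphism from bounded Borel functions into B(H),
   continuous under bounded pointwise convergence, sending 1/(t-z) to the resolvent (A-z)^{-1}).\<close>
definition is_fcalc :: "nat \<Rightarrow> (nat \<Rightarrow> real) \<Rightarrow> (nat \<Rightarrow> real)
    \<Rightarrow> ((real \<Rightarrow> complex) \<Rightarrow> (nat \<Rightarrow> real \<Rightarrow> complex) \<Rightarrow> (nat \<Rightarrow> real \<Rightarrow> complex)) \<Rightarrow> bool" where
  "is_fcalc n c a \<Phi> \<longleftrightarrow>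
     (\<forall>\<psi> f. bddBorel \<psi> \<and> inH n f \<longrightarrow> inH n (\<Phi> \<psi> f)) \<and>
     (\<forall>\<psi> f g. bddBorel \<psi> \<and> inH n f \<and> inH n g \<and> eqH n f g \<longrightarrow> eqH n (\<Phi> \<psi> f) (\<Phi> \<psi> g)) \<and>
     (\<forall>\<psi> f g z. bddBorel \<psi> \<and> inH n f \<and> inH n g \<longrightarrow>
        eqH n (\<Phi> \<psi> (\<lambda>k x. f k x + z * g k x)) (\<lambda>k x. \<Phi> \<psi> f k x + z * \<Phi> \<psi> g k x)) \<and>
     (\<forall>\<psi>. bddBorel \<psi> \<longrightarrow> (\<exists>C. \<forall>f. inH n f \<longrightarrow> normH n (\<Phi> \<psi> f) \<le> C * normH n f)) \<and>
     (\<forall>\<psi>1 \<psi>2 f z. bddBorel \<psi>1 \<and> bddBorel \<psi>2 \<and> inH n f \<longrightarrow>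
        eqH n (\<Phi> (\<lambda>t. \<psi>1 t + z * \<psi>2 t) f) (\<lambda>k x. \<Phi> \<psi>1 f k x + z * \<Phi> \<psi>2 f k x)) \<and>
     (\<forall>\<psi>1 \<psi>2 f. bddBorel \<psi>1 \<and> bddBorel \<psi>2 \<and> inH n f \<longrightarrow>
        eqH n (\<Phi> (\<lambda>t. \<psi>1 t * \<psi>2 t) f) (\<Phi> \<psi>1 (\<Phi> \<psi>2 f))) \<and>
     (\<forall>f. inH n f \<longrightarrow> eqH n (\<Phi> (\<lambda>t. 1) f) f) \<and>
     (\<forall>\<psi> f g. bddBorel \<psi> \<and> inH n f \<and> inH n g \<longrightarrow>
        innerH n (\<Phi> \<psi> f) g = innerH n f (\<Phi> (\<lambda>t. cnj (\<psi> t)) g)) \<and>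
     (\<forall>\<psi>s \<psi> f. (\<forall>m. bddBorel (\<psi>s m)) \<and> bddBorel \<psi> \<and> (\<exists>B. \<forall>m t. cmod (\<psi>s m t) \<le> B) \<and>
        (\<forall>t. (\<lambda>m. \<psi>s m t) \<longlonglongrightarrow> \<psi> t) \<and> inH n f \<longrightarrow>
        (\<lambda>m. normH n (\<lambda>k x. \<Phi> (\<psi>s m) f k x - \<Phi> \<psi> f k x)) \<longlonglongrightarrow> 0) \<and>
     (\<forall>z f. Im z \<noteq> 0 \<and> inH n f \<longrightarrow>
        (\<exists>v. isA n c a (\<Phi> (\<lambda>t. 1 / (of_real t - z)) f) v \<and>
             eqH n (\<lambda>k x. v k x - z * \<Phi> (\<lambda>t. 1 / (of_real t - z)) f k x) f))"

end

(* Everything is reduced to the functions exp(-p x) on a single edge, whose transforms are explicit.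
   Their inner products in L^2_q are -1/pi times the integral of Im f plus an elementary diagonal
   term, where f(z) = 1 / (sigma(z) (p + kap_k(z)) (r + kap_l(z))) with kap_k = sqrt((a_k - z)/c_k)
   and sigma = sum_k c_k kap_k.  Since f is holomorphic in the lower half-plane and decays like
   |z|^(-3/2), its integral over the real line vanishes, so V is isometric on exponentials.  They are
   dense in L^1 and L^2 simultaneously (Weierstrass in the variable exp(-x)), hence V extends to an
   isometry.

   The resolvent of A maps exp(-p x) to an explicit combination of exponentials, which gives
   V (A - z)^(-1) = (t - z)^(-1) V; a monotone class argument extends this to all bounded Borel
   functions of A.  The range of V is therefore closed and invariant under multiplication by bounded
   Borel functions.  It contains (1,...,1)/(t + 1) and, after subtracting a multiple of it from the
   transform of exp(-x) on the edge k, a nowhere vanishing function in component k alone, so it is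
   everything.  By Fubini Z inverts V on X, so Z is isometric and has trivial kernel. *)
theory Submission
  imports Defs "HOL-Complex_Analysis.Cauchy_Integral_Theorem"
begin

section \<open>Finite families of square integrable functions\<close>

text \<open>The branch \<open>[- pi, pi)\<close> of the root is continuous from below, so the
  analysis takes place in the lower half-plane. There every \<open>kap\<close> lies in the first
  quadrant, so \<open>sig\<close> suffers no cancellation: it dominates each of its terms, which
  gives both its nonvanishing and its growth. Of the exponent -3/2, one half comes from
  \<open>sig\<close> and 1 from the two shifted factors together.

  \<open>Vt\<close> and \<open>Zt\<close> are only closures of graphs, so that they are isometric
  must itself be proved. Convergence in L^1 gives pointwise convergence of the transforms,
  convergence in L^2 controls the norms, and Fatou's lemma identifies the two limits; hence the
  insistence on approximating in both norms at once.

  Multiplication by functions of t acts alike in all components and cannot separate them. The vector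
  (1,...,1)/(t + 1) achieves this. Up to a factor it is the transform of the Green function of A + 1
  with pole at the vertex: all eigenfunctions equal 1 there, so a unit mass at the vertex is
  transformed into (1,...,1).\<close>

definition sqint :: "'a measure \<Rightarrow> ('a \<Rightarrow> complex) \<Rightarrow> bool" where
  "sqint M f \<longleftrightarrow> f \<in> borel_measurable M \<and> integrable M (\<lambda>x. (cmod (f x))\<^sup>2)"

definition l2norm :: "'a measure \<Rightarrow> ('a \<Rightarrow> complex) \<Rightarrow> real" where
  "l2norm M f = sqrt (\<integral>x. (cmod (f x))\<^sup>2 \<partial>M)"

lemma l2norm_nonneg [simp]: "0 \<le> l2norm M f"
  by (simp add: l2norm_def)

lemma l2norm_square: "(l2norm M f)\<^sup>2 = (\<integral>x. (cmod (f x))\<^sup>2 \<partial>M)"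
  by (simp add: l2norm_def)

lemma sqintD: "sqint M f \<Longrightarrow> f \<in> borel_measurable M" "sqint M f \<Longrightarrow> integrable M (\<lambda>x. (cmod (f x))\<^sup>2)"
  by (auto simp: sqint_def)

lemma sqint_prod_integrable:
  assumes "sqint M f" "sqint M g"
  shows "integrable M (\<lambda>x. cmod (f x) * cmod (g x))"
proof (rule Bochner_Integration.integrable_bound)
  note [measurable] = assms[THEN sqintD(1)]
  show "integrable M (\<lambda>x. (cmod (f x))\<^sup>2 + (cmod (g x))\<^sup>2)"
    using assms by (auto simp: sqint_def)
  show "(\<lambda>x. cmod (f x) * cmod (g x)) \<in> borel_measurable M" by measurable
  show "AE x in M. norm (cmod (f x) * cmod (g x)) \<le> norm ((cmod (f x))\<^sup>2 + (cmod (g x))\<^sup>2)"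
  proof (intro AE_I2)
    fix x
    have "0 \<le> (cmod (f x) - cmod (g x))\<^sup>2" by simp
    hence "2 * (cmod (f x) * cmod (g x)) \<le> (cmod (f x))\<^sup>2 + (cmod (g x))\<^sup>2"
      by (simp add: power2_diff algebra_simps)
    moreover have "0 \<le> cmod (f x) * cmod (g x)" by simp
    ultimately show "norm (cmod (f x) * cmod (g x)) \<le> norm ((cmod (f x))\<^sup>2 + (cmod (g x))\<^sup>2)"
      by (simp only: real_norm_def)
  qed
qed

lemma borel_measurable_cnj [measurable]: "cnj \<in> borel_measurable borel"
  by (intro borel_measurable_continuous_onI continuous_intros)

lemma sqint_cnj_integrable:
  assumes "sqint M f" "sqint M g"
  shows "integrable M (\<lambda>x. f x * cnj (g x))"
proof (rule Bochner_Integration.integrable_bound[OF sqint_prod_integrable[OF assms]])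
  note [measurable] = assms[THEN sqintD(1)]
  show "(\<lambda>x. f x * cnj (g x)) \<in> borel_measurable M" by measurable
qed (simp add: norm_mult)

lemma weighted_am_gm:
  fixes p q x y :: real
  assumes "0 < p" "0 < q"
  shows "2 * (x * y) \<le> q / p * x\<^sup>2 + p / q * y\<^sup>2"
proof -
  have "0 \<le> (q * x - p * y)\<^sup>2 / (p * q)" using assms by simp
  also have "\<dots> = q / p * x\<^sup>2 + p / q * y\<^sup>2 - 2 * (x * y)"
    using assms by (simp add: power2_diff power_mult_distrib diff_divide_distrib add_divide_distrib) (simp add: power2_eq_square)
  finally show ?thesis by simp
qed

text \<open>The weighted inequality above is sharp when the weight is the quotient of the two norms.
  Enlarging both norms by \<open>e\<close> keeps the quotient meaningful when a norm vanishes; then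
  \<open>e\<close> tends to 0.\<close>

lemma cauchy_schwarz_l2norm:
  assumes "sqint M f" "sqint M g"
  shows "(\<integral>x. cmod (f x) * cmod (g x) \<partial>M) \<le> l2norm M f * l2norm M g"
proof -
  define A where "A = l2norm M f"
  define B where "B = l2norm M g"
  have AB: "0 \<le> A" "0 \<le> B" by (simp_all add: A_def B_def)
  have bound: "(\<integral>x. cmod (f x) * cmod (g x) \<partial>M) \<le> (A + e) * (B + e)" if e: "0 < e" for e
  proof -
    have "(\<integral>x. 2 * (cmod (f x) * cmod (g x)) \<partial>M)
        \<le> (\<integral>x. (B + e) / (A + e) * (cmod (f x))\<^sup>2 + (A + e) / (B + e) * (cmod (g x))\<^sup>2 \<partial>M)"
    proof (rule integral_mono)
      fix x
      show "2 * (cmod (f x) * cmod (g x))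
          \<le> (B + e) / (A + e) * (cmod (f x))\<^sup>2 + (A + e) / (B + e) * (cmod (g x))\<^sup>2"
        using AB e by (intro weighted_am_gm) auto
    qed (use assms sqint_prod_integrable[OF assms] in \<open>auto simp: sqint_def\<close>)
    also have "\<dots> = (B + e) / (A + e) * A\<^sup>2 + (A + e) / (B + e) * B\<^sup>2"
      using assms by (simp add: sqint_def A_def B_def l2norm_square)
    also have "\<dots> \<le> (B + e) / (A + e) * (A + e)\<^sup>2 + (A + e) / (B + e) * (B + e)\<^sup>2"
      using AB e by (intro add_mono mult_left_mono power_mono) auto
    also have "\<dots> = 2 * ((A + e) * (B + e))"
      using AB e by (simp add: power2_eq_square)
    finally show ?thesis by simp
  qed
  have "((\<lambda>e. (A + e) * (B + e)) \<longlongrightarrow> (A + 0) * (B + 0)) (at_right 0)"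
    by (intro tendsto_intros)
  moreover have "\<forall>\<^sub>F e in at_right 0. (\<integral>x. cmod (f x) * cmod (g x) \<partial>M) \<le> (A + e) * (B + e)"
    using bound by (auto simp: eventually_at_right_less intro: eventually_at_rightI[of 0 1])
  ultimately show ?thesis
    unfolding A_def B_def by (intro tendsto_lowerbound) auto
qed

lemma sqint_add:
  assumes "sqint M f" "sqint M g"
  shows "sqint M (\<lambda>x. f x + g x)"
proof -
  note [measurable] = assms[THEN sqintD(1)]
  have "integrable M (\<lambda>x. (cmod (f x + g x))\<^sup>2)"
  proof (rule Bochner_Integration.integrable_bound)
    show "integrable M (\<lambda>x. 2 * (cmod (f x))\<^sup>2 + 2 * (cmod (g x))\<^sup>2)"
      using assms by (auto simp: sqint_def)
    have "(cmod (f x + g x))\<^sup>2 \<le> 2 * (cmod (f x))\<^sup>2 + 2 * (cmod (g x))\<^sup>2" for x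
    proof -
      have "(cmod (f x + g x))\<^sup>2 \<le> (cmod (f x) + cmod (g x))\<^sup>2"
        by (intro power_mono norm_triangle_ineq) auto
      also have "\<dots> \<le> 2 * (cmod (f x))\<^sup>2 + 2 * (cmod (g x))\<^sup>2"
        using sum_squares_bound[of "cmod (f x)" "cmod (g x)"] by (simp add: power2_sum)
      finally show ?thesis .
    qed
    thus "AE x in M. norm ((cmod (f x + g x))\<^sup>2) \<le> norm (2 * (cmod (f x))\<^sup>2 + 2 * (cmod (g x))\<^sup>2)"
      by auto
  qed measurable
  thus ?thesis by (auto simp: sqint_def)
qed

lemma sqint_bounded_mult:
  assumes "sqint M f" "\<psi> \<in> borel_measurable M" "\<And>x. cmod (\<psi> x) \<le> B"
  shows "sqint M (\<lambda>x. \<psi> x * f x)"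
proof -
  note [measurable] = assms(1)[THEN sqintD(1)] assms(2)
  have "integrable M (\<lambda>x. (cmod (\<psi> x * f x))\<^sup>2)"
  proof (rule Bochner_Integration.integrable_bound)
    show "integrable M (\<lambda>x. B\<^sup>2 * (cmod (f x))\<^sup>2)" using assms by (auto simp: sqint_def)
    show "AE x in M. norm ((cmod (\<psi> x * f x))\<^sup>2) \<le> norm (B\<^sup>2 * (cmod (f x))\<^sup>2)"
      using assms(3) by (auto simp: norm_mult power_mult_distrib intro!: mult_right_mono power_mono)
  qed measurable
  thus ?thesis by (auto simp: sqint_def)
qed

lemma sqint_scale: "sqint M f \<Longrightarrow> sqint M (\<lambda>x. z * f x)"
  by (rule sqint_bounded_mult[where B = "cmod z"]) auto

lemma sqint_zero [simp]: "sqint M (\<lambda>x. 0)"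
  by (simp add: sqint_def)

lemma sqint_diff: "sqint M f \<Longrightarrow> sqint M g \<Longrightarrow> sqint M (\<lambda>x. f x - g x)"
  using sqint_add[OF _ sqint_scale[of M g "-1"]] by fastforce

lemma l2norm_triangle:
  assumes "sqint M f" "sqint M g"
  shows "l2norm M (\<lambda>x. f x + g x) \<le> l2norm M f + l2norm M g"
proof (rule power2_le_imp_le)
  have "(l2norm M (\<lambda>x. f x + g x))\<^sup>2 = (\<integral>x. (cmod (f x + g x))\<^sup>2 \<partial>M)"
    by (rule l2norm_square)
  also have "\<dots> \<le> (\<integral>x. (cmod (f x))\<^sup>2 + 2 * (cmod (f x) * cmod (g x)) + (cmod (g x))\<^sup>2 \<partial>M)"
  proof (rule integral_mono)
    fix x
    have "(cmod (f x + g x))\<^sup>2 \<le> (cmod (f x) + cmod (g x))\<^sup>2"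
      by (intro power_mono norm_triangle_ineq) auto
    thus "(cmod (f x + g x))\<^sup>2 \<le> (cmod (f x))\<^sup>2 + 2 * (cmod (f x) * cmod (g x)) + (cmod (g x))\<^sup>2"
      by (simp add: power2_sum)
  qed (use assms sqint_add[OF assms] sqint_prod_integrable[OF assms] in \<open>auto simp: sqint_def\<close>)
  also have "\<dots> = (l2norm M f)\<^sup>2 + 2 * (\<integral>x. cmod (f x) * cmod (g x) \<partial>M) + (l2norm M g)\<^sup>2"
    using assms sqint_prod_integrable[OF assms] by (simp add: l2norm_square sqint_def)
  also have "\<dots> \<le> (l2norm M f + l2norm M g)\<^sup>2"
    using cauchy_schwarz_l2norm[OF assms] by (simp add: power2_sum)
  finally show "(l2norm M (\<lambda>x. f x + g x))\<^sup>2 \<le> (l2norm M f + l2norm M g)\<^sup>2" .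
qed simp

text \<open>Each index carries its own measure, so that H (all measures equal to \<open>MN\<close>)
  and L^2_q (measures \<open>Mq n c a k\<close>) become instances of one theory.\<close>

definition sqints :: "nat \<Rightarrow> (nat \<Rightarrow> 'a measure) \<Rightarrow> (nat \<Rightarrow> 'a \<Rightarrow> complex) \<Rightarrow> bool" where
  "sqints n M f \<longleftrightarrow> (\<forall>k\<in>{1..n}. sqint (M k) (f k))"

definition nrm :: "nat \<Rightarrow> (nat \<Rightarrow> 'a measure) \<Rightarrow> (nat \<Rightarrow> 'a \<Rightarrow> complex) \<Rightarrow> real" where
  "nrm n M f = sqrt (\<Sum>k\<in>{1..n}. \<integral>x. (cmod (f k x))\<^sup>2 \<partial>(M k))"

lemma nrm_L2_set: "nrm n M f = L2_set (\<lambda>k. l2norm (M k) (f k)) {1..n}"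
  by (simp add: nrm_def L2_set_def l2norm_square)

lemma nrm_nonneg [simp]: "0 \<le> nrm n M f"
  by (simp add: nrm_L2_set L2_set_nonneg)

lemma nrm_square: "(nrm n M f)\<^sup>2 = (\<Sum>k\<in>{1..n}. \<integral>x. (cmod (f k x))\<^sup>2 \<partial>(M k))"
  by (simp add: nrm_def sum_nonneg)

lemma nrm_component:
  assumes "k \<in> {1..n}"
  shows "(\<integral>x. (cmod (f k x))\<^sup>2 \<partial>(M k)) \<le> (nrm n M f)\<^sup>2"
  unfolding nrm_square
  using member_le_sum[of k "{1..n}" "\<lambda>k. \<integral>x. (cmod (f k x))\<^sup>2 \<partial>(M k)"] assms by simp

lemma sqints_add: "sqints n M f \<Longrightarrow> sqints n M g \<Longrightarrow> sqints n M (\<lambda>k x. f k x + g k x)"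
  by (simp add: sqints_def sqint_add)

lemma sqints_diff: "sqints n M f \<Longrightarrow> sqints n M g \<Longrightarrow> sqints n M (\<lambda>k x. f k x - g k x)"
  by (simp add: sqints_def sqint_diff)

lemma sqints_scale: "sqints n M f \<Longrightarrow> sqints n M (\<lambda>k x. z * f k x)"
  by (simp add: sqints_def sqint_scale)

lemma sqints_zero [simp]: "sqints n M (\<lambda>k x. 0)"
  by (simp add: sqints_def)

lemma nrm_triangle:
  assumes "sqints n M f" "sqints n M g"
  shows "nrm n M (\<lambda>k x. f k x + g k x) \<le> nrm n M f + nrm n M g"
proof -
  have "nrm n M (\<lambda>k x. f k x + g k x) \<le> L2_set (\<lambda>k. l2norm (M k) (f k) + l2norm (M k) (g k)) {1..n}"
    unfolding nrm_L2_set using assms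
    by (intro L2_set_mono) (auto simp: sqints_def intro!: l2norm_triangle)
  also have "\<dots> \<le> nrm n M f + nrm n M g"
    unfolding nrm_L2_set by (rule L2_set_triangle_ineq)
  finally show ?thesis .
qed

lemma nrm_scale: "nrm n M (\<lambda>k x. z * f k x) = cmod z * nrm n M f"
  by (simp add: nrm_def norm_mult power_mult_distrib real_sqrt_mult flip: sum_distrib_left)

lemma nrm_minus_commute: "nrm n M (\<lambda>k x. f k x - g k x) = nrm n M (\<lambda>k x. g k x - f k x)"
  by (simp add: nrm_def norm_minus_commute)

lemma nrm_zero [simp]: "nrm n M (\<lambda>k x. 0) = 0"
  by (simp add: nrm_def)

lemma nrm_diff_triangle:
  assumes "sqints n M f" "sqints n M g" "sqints n M h"
  shows "nrm n M (\<lambda>k x. f k x - h k x) \<le> nrm n M (\<lambda>k x. f k x - g k x) + nrm n M (\<lambda>k x. g k x - h k x)"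
  using nrm_triangle[OF sqints_diff[OF assms(1,2)] sqints_diff[OF assms(2,3)]] by simp

lemma nrm_le_diff:
  assumes "sqints n M f" "sqints n M g"
  shows "nrm n M f \<le> nrm n M (\<lambda>k x. f k x - g k x) + nrm n M g"
  using nrm_diff_triangle[OF assms sqints_zero] by simp

lemma nrm_tendsto:
  assumes "\<And>m. sqints n M (F m)" "sqints n M f" "(\<lambda>m. nrm n M (\<lambda>k x. F m k x - f k x)) \<longlonglongrightarrow> 0"
  shows "(\<lambda>m. nrm n M (F m)) \<longlonglongrightarrow> nrm n M f"
proof (rule tendsto_sandwich)
  have 1: "nrm n M f - nrm n M (\<lambda>k x. F m k x - f k x) \<le> nrm n M (F m)" for m
    using nrm_le_diff[OF assms(2) assms(1)[of m]] nrm_minus_commute[of n M f "F m"] by linarith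
  have 2: "nrm n M (F m) \<le> nrm n M (\<lambda>k x. F m k x - f k x) + nrm n M f" for m
    using nrm_le_diff[OF assms(1,2)] .
  show "\<forall>\<^sub>F m in sequentially. nrm n M f - nrm n M (\<lambda>k x. F m k x - f k x) \<le> nrm n M (F m)"
    "\<forall>\<^sub>F m in sequentially. nrm n M (F m) \<le> nrm n M (\<lambda>k x. F m k x - f k x) + nrm n M f"
    using 1 2 by auto
  show "(\<lambda>m. nrm n M f - nrm n M (\<lambda>k x. F m k x - f k x)) \<longlonglongrightarrow> nrm n M f"
    "(\<lambda>m. nrm n M (\<lambda>k x. F m k x - f k x) + nrm n M f) \<longlonglongrightarrow> nrm n M f"
    using tendsto_diff[OF tendsto_const assms(3), of "nrm n M f"]
      tendsto_add[OF assms(3) tendsto_const, of "nrm n M f"] by simp_all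
qed

lemma nrm_zero_iff:
  assumes "sqints n M f"
  shows "nrm n M f = 0 \<longleftrightarrow> (\<forall>k\<in>{1..n}. AE x in M k. f k x = 0)"
proof -
  have "nrm n M f = 0 \<longleftrightarrow> (\<forall>k\<in>{1..n}. (\<integral>x. (cmod (f k x))\<^sup>2 \<partial>(M k)) = 0)"
    unfolding nrm_def by (simp add: sum_nonneg_eq_0_iff)
  also have "\<dots> \<longleftrightarrow> (\<forall>k\<in>{1..n}. AE x in M k. f k x = 0)"
    using assms by (intro ball_cong refl) (subst integral_nonneg_eq_0_iff_AE, auto simp: sqints_def sqint_def)
  finally show ?thesis .
qed

lemma nrm_cong_AE:
  assumes "sqints n M f" "sqints n M g" "\<And>k. k \<in> {1..n} \<Longrightarrow> AE x in M k. f k x = g k x"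
  shows "nrm n M f = nrm n M g"
proof -
  have "(\<integral>x. (cmod (f k x))\<^sup>2 \<partial>(M k)) = (\<integral>x. (cmod (g k x))\<^sup>2 \<partial>(M k))" if k: "k \<in> {1..n}" for k
  proof (rule integral_cong_AE)
    show "AE x in M k. (cmod (f k x))\<^sup>2 = (cmod (g k x))\<^sup>2" using assms(3)[OF k] by auto
  qed (use assms k in \<open>auto simp: sqints_def sqint_def\<close>)
  thus ?thesis by (simp add: nrm_def)
qed

lemma nrm_tendsto0_iff:
  "(\<lambda>m. nrm n M (F m)) \<longlonglongrightarrow> 0 \<longleftrightarrow> (\<forall>k\<in>{1..n}. (\<lambda>m. \<integral>x. (cmod (F m k x))\<^sup>2 \<partial>(M k)) \<longlonglongrightarrow> 0)"
proof
  assume L: "(\<lambda>m. nrm n M (F m)) \<longlonglongrightarrow> 0"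
  show "\<forall>k\<in>{1..n}. (\<lambda>m. \<integral>x. (cmod (F m k x))\<^sup>2 \<partial>(M k)) \<longlonglongrightarrow> 0"
  proof
    fix k assume k: "k \<in> {1..n}"
    have le: "norm (\<integral>x. (cmod (F m k x))\<^sup>2 \<partial>(M k)) \<le> (nrm n M (F m))\<^sup>2" for m
      using nrm_component[OF k, where f = "F m" and M = M]
        Bochner_Integration.integral_nonneg[of "M k" "\<lambda>x. (cmod (F m k x))\<^sup>2"] by simp
    have lim: "(\<lambda>m. (nrm n M (F m))\<^sup>2) \<longlonglongrightarrow> 0"
      using tendsto_power[OF L, of 2] by simp
    show "(\<lambda>m. \<integral>x. (cmod (F m k x))\<^sup>2 \<partial>(M k)) \<longlonglongrightarrow> 0"
      by (rule Lim_null_comparison[OF always_eventually lim]) (use le in blast)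
  qed
next
  assume R: "\<forall>k\<in>{1..n}. (\<lambda>m. \<integral>x. (cmod (F m k x))\<^sup>2 \<partial>(M k)) \<longlonglongrightarrow> 0"
  have "(\<lambda>m. sqrt (\<Sum>k\<in>{1..n}. \<integral>x. (cmod (F m k x))\<^sup>2 \<partial>(M k))) \<longlonglongrightarrow> sqrt (\<Sum>k\<in>{1..n}. 0)"
    using R by (intro tendsto_real_sqrt tendsto_sum) auto
  thus "(\<lambda>m. nrm n M (F m)) \<longlonglongrightarrow> 0" by (simp add: nrm_def)
qed

lemma nrm_dominated:
  assumes h: "sqints n M h"
    and meas: "\<And>m k. k \<in> {1..n} \<Longrightarrow> F m k \<in> borel_measurable (M k)"
    and bound: "\<And>m k x. k \<in> {1..n} \<Longrightarrow> cmod (F m k x) \<le> cmod (h k x)"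
    and lim: "\<And>k. k \<in> {1..n} \<Longrightarrow> AE x in M k. (\<lambda>m. F m k x) \<longlonglongrightarrow> 0"
  shows "(\<lambda>m. nrm n M (F m)) \<longlonglongrightarrow> 0"
  unfolding nrm_tendsto0_iff
proof
  fix k assume k: "k \<in> {1..n}"
  note [measurable] = meas[OF k]
  have "(\<lambda>m. \<integral>x. (cmod (F m k x))\<^sup>2 \<partial>(M k)) \<longlonglongrightarrow> (\<integral>x. 0 \<partial>(M k))"
  proof (rule integral_dominated_convergence)
    show "integrable (M k) (\<lambda>x. (cmod (h k x))\<^sup>2)" using h k by (auto simp: sqints_def sqint_def)
    show "AE x in M k. (\<lambda>m. (cmod (F m k x))\<^sup>2) \<longlonglongrightarrow> 0"
      using lim[OF k] by eventually_elim (auto intro!: tendsto_eq_intros)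
    show "AE x in M k. norm ((cmod (F m k x))\<^sup>2) \<le> (cmod (h k x))\<^sup>2" for m
      using bound[OF k] by (auto intro!: power_mono)
  qed measurable
  thus "(\<lambda>m. \<integral>x. (cmod (F m k x))\<^sup>2 \<partial>(M k)) \<longlonglongrightarrow> 0" by simp
qed

lemma sqints_bounded_mult:
  assumes "sqints n M f" "\<And>k. k \<in> {1..n} \<Longrightarrow> \<psi> \<in> borel_measurable (M k)" "\<And>x. cmod (\<psi> x) \<le> B"
  shows "sqints n M (\<lambda>k x. \<psi> x * f k x)" "nrm n M (\<lambda>k x. \<psi> x * f k x) \<le> B * nrm n M f"
proof -
  show *: "sqints n M (\<lambda>k x. \<psi> x * f k x)"
    unfolding sqints_def using assms by (auto simp: sqints_def intro!: sqint_bounded_mult)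
  have B: "0 \<le> B" using assms(3) norm_ge_zero order_trans by blast
  have "(nrm n M (\<lambda>k x. \<psi> x * f k x))\<^sup>2 \<le> (\<Sum>k\<in>{1..n}. \<integral>x. B\<^sup>2 * (cmod (f k x))\<^sup>2 \<partial>(M k))"
    unfolding nrm_square
  proof (rule sum_mono)
    fix k assume k: "k \<in> {1..n}"
    show "(\<integral>x. (cmod (\<psi> x * f k x))\<^sup>2 \<partial>(M k)) \<le> (\<integral>x. B\<^sup>2 * (cmod (f k x))\<^sup>2 \<partial>(M k))"
      using * assms k
      by (intro integral_mono) (auto simp: sqints_def sqint_def norm_mult power_mult_distrib
          intro!: mult_right_mono power_mono)
  qed
  also have "\<dots> = (B * nrm n M f)\<^sup>2"
    by (simp add: power_mult_distrib nrm_square sum_distrib_left)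
  finally show "nrm n M (\<lambda>k x. \<psi> x * f k x) \<le> B * nrm n M f"
    by (rule power2_le_imp_le) (use B in auto)
qed

section \<open>Fatou's lemma and completeness\<close>

lemma sqint_fatou:
  assumes F: "\<And>m. sqint M (F m)" and f: "f \<in> borel_measurable M"
    and lim: "AE x in M. (\<lambda>m. F m x) \<longlonglongrightarrow> f x"
    and C: "\<And>m. (\<integral>x. (cmod (F m x))\<^sup>2 \<partial>M) \<le> C m" and CL: "C \<longlonglongrightarrow> L"
  shows "sqint M f \<and> (\<integral>x. (cmod (f x))\<^sup>2 \<partial>M) \<le> L"
proof -
  note [measurable] = F[THEN sqintD(1)] f
  have C0: "0 \<le> C m" for m by (rule order_trans[OF _ C[of m]]) simp
  have L0: "0 \<le> L" using C0 CL by (intro LIMSEQ_le_const) auto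
  have "(\<integral>\<^sup>+x. ennreal ((cmod (f x))\<^sup>2) \<partial>M) = (\<integral>\<^sup>+x. liminf (\<lambda>m. ennreal ((cmod (F m x))\<^sup>2)) \<partial>M)"
  proof (rule nn_integral_cong_AE)
    show "AE x in M. ennreal ((cmod (f x))\<^sup>2) = liminf (\<lambda>m. ennreal ((cmod (F m x))\<^sup>2))"
      using lim
    proof eventually_elim
      case (elim x)
      have "(\<lambda>m. ennreal ((cmod (F m x))\<^sup>2)) \<longlonglongrightarrow> ennreal ((cmod (f x))\<^sup>2)"
        using elim by (intro tendsto_ennrealI tendsto_intros)
      thus ?case by (intro lim_imp_Liminf[symmetric]) auto
    qed
  qed
  also have "\<dots> \<le> liminf (\<lambda>m. \<integral>\<^sup>+x. ennreal ((cmod (F m x))\<^sup>2) \<partial>M)"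
    by (rule nn_integral_liminf) measurable
  also have "\<dots> = liminf (\<lambda>m. ennreal (\<integral>x. (cmod (F m x))\<^sup>2 \<partial>M))"
    using F by (subst nn_integral_eq_integral) (auto simp: sqint_def)
  also have "\<dots> \<le> liminf (\<lambda>m. ennreal (C m))"
    using C by (intro Liminf_mono always_eventually) (auto intro!: ennreal_leI)
  also have "\<dots> = ennreal L"
    using CL by (intro lim_imp_Liminf tendsto_ennrealI) auto
  finally have le: "(\<integral>\<^sup>+x. ennreal ((cmod (f x))\<^sup>2) \<partial>M) \<le> ennreal L" .
  have int: "integrable M (\<lambda>x. (cmod (f x))\<^sup>2)"
    using le_less_trans[OF le ennreal_less_top] by (intro integrableI_bounded) auto
  have "ennreal (\<integral>x. (cmod (f x))\<^sup>2 \<partial>M) \<le> ennreal L"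
    using le by (subst nn_integral_eq_integral[symmetric, OF int]) auto
  with L0 int show ?thesis by (auto simp: sqint_def)
qed

text \<open>Identifies a pointwise limit as a limit in norm: for fixed m, Fatou's lemma in l carries
  the Cauchy bound from \<open>F m - F l\<close> over to \<open>F m - f\<close>. The intended
  sequences are transforms, whose pointwise limit is known beforehand.\<close>

lemma nrm_fatou:
  assumes F: "\<And>m. sqints n M (F m)"
    and f: "\<And>k. k \<in> {1..n} \<Longrightarrow> f k \<in> borel_measurable (M k)"
    and lim: "\<And>k. k \<in> {1..n} \<Longrightarrow> AE x in M k. (\<lambda>m. F m k x) \<longlonglongrightarrow> f k x"
    and cauchy: "\<And>e. 0 < e \<Longrightarrow> \<exists>m0. \<forall>m\<ge>m0. \<forall>l\<ge>m0. nrm n M (\<lambda>k x. F m k x - F l k x) < e"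
  shows "sqints n M f" "(\<lambda>m. nrm n M (\<lambda>k x. F m k x - f k x)) \<longlonglongrightarrow> 0"
proof -
  have tail: "\<exists>m0. \<forall>m\<ge>m0. sqint (M k) (\<lambda>x. F m k x - f k x) \<and>
      (\<integral>x. (cmod (F m k x - f k x))\<^sup>2 \<partial>(M k)) \<le> e\<^sup>2" if e: "0 < e" and k: "k \<in> {1..n}" for e k
  proof -
    obtain m0 where m0: "\<And>m l. m \<ge> m0 \<Longrightarrow> l \<ge> m0 \<Longrightarrow> nrm n M (\<lambda>k x. F m k x - F l k x) < e"
      using cauchy[OF e] by blast
    have "sqint (M k) (\<lambda>x. F m k x - f k x) \<and> (\<integral>x. (cmod (F m k x - f k x))\<^sup>2 \<partial>(M k)) \<le> e\<^sup>2"
      if m: "m \<ge> m0" for m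
    proof (rule sqint_fatou[where F = "\<lambda>l x. F m k x - F (l + m0) k x" and C = "\<lambda>_. e\<^sup>2"])
      show "sqint (M k) (\<lambda>x. F m k x - F (l + m0) k x)" for l
        using F k by (intro sqint_diff) (auto simp: sqints_def)
      show "(\<lambda>x. F m k x - f k x) \<in> borel_measurable (M k)"
      proof -
        have [measurable]: "F m k \<in> borel_measurable (M k)" using F[of m] k by (auto simp: sqints_def sqint_def)
        note [measurable] = f[OF k]
        show ?thesis by measurable
      qed
      show "AE x in M k. (\<lambda>l. F m k x - F (l + m0) k x) \<longlonglongrightarrow> F m k x - f k x"
        using lim[OF k] by eventually_elim (intro tendsto_intros LIMSEQ_ignore_initial_segment)
      fix l
      have "(\<integral>x. (cmod (F m k x - F (l + m0) k x))\<^sup>2 \<partial>(M k)) \<le> (nrm n M (\<lambda>k x. F m k x - F (l + m0) k x))\<^sup>2"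
        by (rule nrm_component[OF k, where f = "\<lambda>k x. F m k x - F (l + m0) k x"])
      also have "\<dots> \<le> e\<^sup>2" using m0[OF m, of "l + m0"] by (intro power_mono) auto
      finally show "(\<integral>x. (cmod (F m k x - F (l + m0) k x))\<^sup>2 \<partial>(M k)) \<le> e\<^sup>2" .
    qed auto
    thus ?thesis by blast
  qed
  show "sqints n M f" unfolding sqints_def
  proof
    fix k assume k: "k \<in> {1..n}"
    obtain m where "sqint (M k) (\<lambda>x. F m k x - f k x)" using tail[OF zero_less_one k] by blast
    from sqint_diff[OF _ this, of "F m k"] F[of m] k show "sqint (M k) (f k)" by (simp add: sqints_def)
  qed
  show "(\<lambda>m. nrm n M (\<lambda>k x. F m k x - f k x)) \<longlonglongrightarrow> 0"
    unfolding nrm_tendsto0_iff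
  proof (intro ballI LIMSEQ_I)
    fix k and r :: real assume k: "k \<in> {1..n}" and r: "0 < r"
    have s: "0 < sqrt (r / 2)" using r by simp
    obtain m0 where "\<And>m. m \<ge> m0 \<Longrightarrow> (\<integral>x. (cmod (F m k x - f k x))\<^sup>2 \<partial>(M k)) \<le> (sqrt (r / 2))\<^sup>2"
      using tail[OF s k] by blast
    hence "norm ((\<integral>x. (cmod (F m k x - f k x))\<^sup>2 \<partial>(M k)) - 0) < r" if "m \<ge> m0" for m
      using that r by fastforce
    thus "\<exists>no. \<forall>m\<ge>no. norm ((\<integral>x. (cmod (F m k x - f k x))\<^sup>2 \<partial>(M k)) - 0) < r" by blast
  qed
qed

text \<open>Riesz-Fischer. Along a subsequence with increments \<open>d j\<close> of norm below
  \<open>(1/2)^j\<close>, even the sum of \<open>2^j * (cmod (d j k x))\<^sup>2\<close> has finite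
  integral; the extra weight converts this into absolute convergence of the increments almost
  everywhere.\<close>

lemma nrm_complete:
  assumes F: "\<And>m. sqints n M (F m)"
    and cauchy: "\<And>e. 0 < e \<Longrightarrow> \<exists>m0. \<forall>m\<ge>m0. \<forall>l\<ge>m0. nrm n M (\<lambda>k x. F m k x - F l k x) < e"
  shows "\<exists>f. sqints n M f \<and> (\<lambda>m. nrm n M (\<lambda>k x. F m k x - f k x)) \<longlonglongrightarrow> 0"
proof -
  have "\<forall>j. \<exists>m0. \<forall>m\<ge>m0. \<forall>l\<ge>m0. nrm n M (\<lambda>k x. F m k x - F l k x) < (1/2)^j"
  proof
    fix j :: nat
    show "\<exists>m0. \<forall>m\<ge>m0. \<forall>l\<ge>m0. nrm n M (\<lambda>k x. F m k x - F l k x) < (1/2)^j"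
      by (rule cauchy) simp
  qed
  from choice[OF this] obtain N where
    "\<forall>j. \<forall>m\<ge>N j. \<forall>l\<ge>N j. nrm n M (\<lambda>k x. F m k x - F l k x) < (1/2)^j" by blast
  hence N: "\<And>j m l. m \<ge> N j \<Longrightarrow> l \<ge> N j \<Longrightarrow> nrm n M (\<lambda>k x. F m k x - F l k x) < (1/2)^j"
    by blast
  \<comment> \<open>Partial sums of \<open>N\<close>, plus j: an increasing index that is at least
    \<open>N j\<close> and at least j.\<close>
  define s where "s j = (\<Sum>i\<le>j. N i) + j" for j
  have sN: "s j \<ge> N j" for j by (auto simp: s_def intro!: trans_le_add1 member_le_sum)
  have s_step: "s j \<le> s (Suc j)" for j by (simp add: s_def)
  define d where "d j k x = F (s (Suc j)) k x - F (s j) k x" for j k x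
  have d2: "(\<integral>x. (cmod (d j k x))\<^sup>2 \<partial>(M k)) \<le> (1/4)^j" if k: "k \<in> {1..n}" for j k
  proof -
    have "(\<integral>x. (cmod (d j k x))\<^sup>2 \<partial>(M k)) \<le> (nrm n M (d j))\<^sup>2"
      by (rule nrm_component[OF k, where f = "d j"])
    also have "\<dots> \<le> ((1/2)^j)\<^sup>2"
      using N[of j "s (Suc j)" "s j"] sN[of j] s_step[of j]
      by (intro power_mono) (auto simp: d_def[abs_def] intro: less_imp_le)
    also have "\<dots> = (1/4::real)^j" by (simp add: power2_eq_square flip: power_mult_distrib)
    finally show ?thesis .
  qed
  have dm: "d j k \<in> borel_measurable (M k)" "integrable (M k) (\<lambda>x. (cmod (d j k x))\<^sup>2)" if "k \<in> {1..n}" for j k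
    using sqints_diff[OF F[of "s (Suc j)"] F[of "s j"]] that by (auto simp: sqints_def sqint_def d_def[abs_def])
  have conv: "AE x in M k. convergent (\<lambda>j. F (s j) k x)" if k: "k \<in> {1..n}" for k
  proof -
    note [measurable] = dm(1)[OF k]
    have "(\<integral>\<^sup>+x. (\<Sum>j. ennreal (2^j * (cmod (d j k x))\<^sup>2)) \<partial>(M k))
        = (\<Sum>j. \<integral>\<^sup>+x. ennreal (2^j * (cmod (d j k x))\<^sup>2) \<partial>(M k))"
      by (rule nn_integral_suminf) measurable
    also have "\<dots> = (\<Sum>j. ennreal (2^j * (\<integral>x. (cmod (d j k x))\<^sup>2 \<partial>(M k))))"
      using dm(2)[OF k] by (subst nn_integral_eq_integral) auto
    also have "\<dots> \<le> (\<Sum>j. ennreal ((1/2)^j))"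
    proof (rule suminf_le)
      fix j
      have "2^j * (\<integral>x. (cmod (d j k x))\<^sup>2 \<partial>(M k)) \<le> 2^j * (1/4)^j"
        using d2[OF k] by (intro mult_left_mono) auto
      also have "\<dots> = (1/2::real)^j" by (simp flip: power_mult_distrib)
      finally show "ennreal (2^j * (\<integral>x. (cmod (d j k x))\<^sup>2 \<partial>(M k))) \<le> ennreal ((1/2)^j)"
        by (rule ennreal_leI)
    qed auto
    also have "\<dots> = ennreal (\<Sum>j. (1/2)^j)"
      by (rule suminf_ennreal2) (auto intro!: summable_geometric)
    also have "\<dots> < top" by simp
    finally have "AE x in M k. (\<Sum>j. ennreal (2^j * (cmod (d j k x))\<^sup>2)) \<noteq> \<infinity>"
      by (intro nn_integral_PInf_AE) (auto simp: infinity_ennreal_def)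
    thus ?thesis
    proof eventually_elim
      case (elim x)
      have "summable (\<lambda>j. 2^j * (cmod (d j k x))\<^sup>2)"
        using elim by (intro summable_suminf_not_top) (auto simp: infinity_ennreal_def)
      hence "summable (\<lambda>j. 2^j * (cmod (d j k x))\<^sup>2 + (1/2)^j)"
        by (intro summable_add summable_geometric) auto
      hence "summable (\<lambda>j. cmod (d j k x))"
      proof (rule summable_comparison_test')
        fix j :: nat
        have e: "2^j * (1/2)^j = (1::real)" by (simp flip: power_mult_distrib)
        \<comment> \<open>The inequality 2 u \<le> u^2 + 1 for u =
          \<open>2^j * cmod (d j k x)\<close>; division by \<open>2^j\<close> then leaves a summable
          bound.\<close>
        have "2 * ((2^j * cmod (d j k x)) * 1) \<le> (2^j * cmod (d j k x))\<^sup>2 + 1\<^sup>2"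
          using sum_squares_bound[of "2^j * cmod (d j k x)" 1] by simp
        hence "2^j * (2 * cmod (d j k x)) \<le> 2^j * (2^j * (cmod (d j k x))\<^sup>2 + (1/2)^j)"
          by (simp add: distrib_left e power_mult_distrib power2_eq_square mult.assoc mult.left_commute)
        hence "2 * cmod (d j k x) \<le> 2^j * (cmod (d j k x))\<^sup>2 + (1/2)^j" by simp
        moreover have "0 \<le> cmod (d j k x)" by simp
        ultimately show "norm (cmod (d j k x)) \<le> 2^j * (cmod (d j k x))\<^sup>2 + (1/2)^j" by (simp only: real_norm_def abs_norm_cancel)
      qed
      hence "summable (\<lambda>j. F (s (Suc j)) k x - F (s j) k x)"
        unfolding d_def by (rule summable_norm_cancel)
      then obtain L where "(\<lambda>N. \<Sum>j<N. F (s (Suc j)) k x - F (s j) k x) \<longlonglongrightarrow> L"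
        by (auto simp: summable_def sums_def)
      hence "(\<lambda>N. F (s N) k x - F (s 0) k x) \<longlonglongrightarrow> L"
        using sum_lessThan_telescope[of "\<lambda>j. F (s j) k x"] by simp
      from tendsto_add[OF this tendsto_const[of "F (s 0) k x"]]
      show ?case by (auto simp: convergent_def)
    qed
  qed
  define f where "f k x = lim (\<lambda>j. F (s j) k x)" for k x
  have subcauchy: "\<exists>m0. \<forall>m\<ge>m0. \<forall>l\<ge>m0. nrm n M (\<lambda>k x. F (s m) k x - F (s l) k x) < e" if e: "0 < e" for e
  proof -
    obtain m0 where "\<forall>m\<ge>m0. \<forall>l\<ge>m0. nrm n M (\<lambda>k x. F m k x - F l k x) < e" using cauchy[OF e] by blast
    moreover have "s j \<ge> m0" if "j \<ge> m0" for j using that by (simp add: s_def)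
    ultimately show ?thesis by blast
  qed
  have meas: "f k \<in> borel_measurable (M k)" if "k \<in> {1..n}" for k
    unfolding f_def using F that by (intro borel_measurable_lim_metric) (auto simp: sqints_def sqint_def)
  have lim: "AE x in M k. (\<lambda>m. F (s m) k x) \<longlonglongrightarrow> f k x" if "k \<in> {1..n}" for k
    using conv[OF that] by eventually_elim (simp add: f_def convergent_LIMSEQ_iff)
  note f = nrm_fatou[where F = "\<lambda>j. F (s j)", OF F meas lim subcauchy]
  have "(\<lambda>m. nrm n M (\<lambda>k x. F m k x - f k x)) \<longlonglongrightarrow> 0"
  proof (rule LIMSEQ_I)
    fix r :: real assume "0 < r"
    hence r: "0 < r / 2" by simp
    obtain m0 where m0: "\<And>m l. m \<ge> m0 \<Longrightarrow> l \<ge> m0 \<Longrightarrow> nrm n M (\<lambda>k x. F m k x - F l k x) < r / 2"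
      using cauchy[OF r] by blast
    obtain j0 where j0: "\<And>j. j \<ge> j0 \<Longrightarrow> nrm n M (\<lambda>k x. F (s j) k x - f k x) < r / 2"
      using LIMSEQ_D[OF f(2) r] by auto
    have "norm (nrm n M (\<lambda>k x. F m k x - f k x) - 0) < r" if "m \<ge> m0" for m
    proof -
      define j where "j = max j0 m0"
      have "s j \<ge> m0" by (simp add: s_def j_def)
      thus ?thesis using nrm_diff_triangle[OF F[of m] F[of "s j"] f(1)] m0[OF that, of "s j"] j0[of j]
        by (simp add: j_def)
    qed
    thus "\<exists>no. \<forall>m\<ge>no. norm (nrm n M (\<lambda>k x. F m k x - f k x) - 0) < r" by blast
  qed
  with f(1) show ?thesis by blast
qed

section \<open>The generalized eigenfunctions\<close>

text \<open>On the real line \<open>kap = \<i> xi\<close>, but \<open>Re kap \<ge> 0\<close> everywhere and \<open>kap\<close> is holomorphic in the open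
  lower half-plane and continuous up to the real line.\<close>
definition kap :: "(nat \<Rightarrow> real) \<Rightarrow> (nat \<Rightarrow> real) \<Rightarrow> nat \<Rightarrow> complex \<Rightarrow> complex" where
  "kap c a k z = csqrt ((of_real (a k) - z) / of_real (c k))"

text \<open>The functions \<open>exp (- kap x)\<close> have slope \<open>- kap\<close> at the
  vertex, so \<open>- sig\<close> is their Kirchhoff sum. On the real line \<open>- sig\<close>
  coincides with \<open>wfun\<close>.\<close>

definition sig :: "nat \<Rightarrow> (nat \<Rightarrow> real) \<Rightarrow> (nat \<Rightarrow> real) \<Rightarrow> complex \<Rightarrow> complex" where
  "sig n c a z = (\<Sum>k\<in>{1..n}. of_real (c k) * kap c a k z)"

lemma cmod_mono:
  assumes "0 \<le> Re w" "Re w \<le> Re v" "0 \<le> Im w" "Im w \<le> Im v"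
  shows "cmod w \<le> cmod v"
  unfolding cmod_def using assms by (intro real_sqrt_le_mono add_mono power_mono) auto

lemma cmod_add_real_ge:
  assumes "0 \<le> Re w" "0 < p"
  shows "p\<^sup>2 + (cmod w)\<^sup>2 \<le> (cmod (of_real p + w))\<^sup>2"
proof -
  have "0 \<le> 2 * p * Re w" using assms by simp
  thus ?thesis unfolding cmod_power2 by (simp add: power2_sum)
qed

text \<open>The angle \<open>- pi\<close> on the negative reals produces \<open>- \<i>\<close>,
  where \<open>csqrt\<close> has \<open>\<i>\<close>. Thus
  \<open>psqrt r = - \<i> * csqrt (- r)\<close> for real r, which is why \<open>kap\<close> is built
  from \<open>a k - z\<close>.\<close>

lemma psqrt_of_real:
  "psqrt (of_real r) = (if r < 0 then - \<i> * of_real (sqrt (- r)) else of_real (sqrt r))"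
proof (cases "r < 0")
  case True
  have "exp (\<i> * complex_of_real (- pi / 2)) = - \<i>"
    using cis_conv_exp[of "- pi / 2"] by (simp add: cis.ctr complex_eq_iff)
  with True show ?thesis by (simp add: psqrt_def parg_def)
next
  case False
  hence "parg (of_real r) = 0"
    by (cases "r = 0") (auto simp: parg_def Arg_of_real Arg_zero)
  with False show ?thesis by (simp add: psqrt_def)
qed

lemma kap_square: "(kap c a k z)\<^sup>2 = (of_real (a k) - z) / of_real (c k)"
  by (simp add: kap_def)

lemma Re_kap_nonneg: "0 \<le> Re (kap c a k z)"
  unfolding kap_def by (rule Re_csqrt)

lemma cmod_kap: "0 < c k \<Longrightarrow> cmod (kap c a k z) = sqrt (cmod (z - of_real (a k)) / c k)"
  by (simp add: kap_def norm_divide norm_minus_commute del: csqrt.simps)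

text \<open>For z in the closed lower half-plane the radicand lies in the closed upper one, which
  \<open>csqrt\<close> maps into the closed first quadrant.\<close>

lemma Im_kap_nonneg:
  assumes "0 < c k" "Im z \<le> 0"
  shows "0 \<le> Im (kap c a k z)"
proof -
  have "0 \<le> Im ((of_real (a k) - z) / of_real (c k))" using assms
    by (simp add: Im_divide_of_real divide_nonpos_pos)
  moreover have "0 \<le> Im (csqrt w)" if "0 \<le> Im w" for w
    using that complex_Re_le_cmod[of w] by (auto simp: sgn_if)
  ultimately show ?thesis unfolding kap_def by blast
qed

text \<open>A root on the imaginary axis would make the radicand a nonpositive real, and the
  assumption keeps it away from those.\<close>

lemma Re_kap_pos:
  assumes "0 < c k" "Im z \<noteq> 0 \<or> Re z < a k"
  shows "0 < Re (kap c a k z)"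
proof -
  have nr: "(of_real (a k) - z) / of_real (c k) \<notin> \<real>\<^sub>\<le>\<^sub>0"
    using assms by (auto simp: complex_nonpos_Reals_iff Im_divide_of_real Re_divide_of_real divide_le_0_iff)
  have sq: "(csqrt w)\<^sup>2 = w" for w by simp
  have "Re (csqrt w) \<noteq> 0" if "w \<notin> \<real>\<^sub>\<le>\<^sub>0" for w
  proof
    assume "Re (csqrt w) = 0"
    then obtain y where y: "csqrt w = \<i> * complex_of_real y"
      by (metis Complex_eq add_0 complex_surj of_real_0)
    have "w = (\<i> * complex_of_real y)\<^sup>2" unfolding y[symmetric] by simp
    also have "\<dots> = - complex_of_real (y\<^sup>2)" by (simp add: power_mult_distrib)
    finally have "w = - complex_of_real (y\<^sup>2)" .
    moreover have "- complex_of_real (y\<^sup>2) \<in> \<real>\<^sub>\<le>\<^sub>0"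
      by (simp add: complex_nonpos_Reals_iff)
    ultimately show False using that by simp
  qed
  from this[OF nr] show ?thesis using Re_kap_nonneg[of c a k z] unfolding kap_def by linarith
qed

lemma kap_of_real:
  assumes "0 < c k"
  shows "kap c a k (of_real t) =
    (if t < a k then of_real (sqrt ((a k - t) / c k)) else \<i> * of_real (sqrt ((t - a k) / c k)))"
proof -
  have "(of_real (a k) - of_real t) / of_real (c k) = complex_of_real ((a k - t) / c k)" by simp
  moreover have "\<bar>(a k - t) / c k\<bar> = (t - a k) / c k" if "\<not> t < a k"
    using that assms by (simp add: abs_if divide_less_0_iff minus_divide_left)
  ultimately show ?thesis unfolding kap_def using assms
    by (auto simp: divide_le_0_iff simp del: csqrt.simps of_real_divide of_real_diff)
qed

lemma xi_of_real:
  assumes "0 < c k"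
  shows "xi c a k (of_real t) = - \<i> * kap c a k (of_real t)"
proof -
  have eq: "(of_real t - of_real (a k)) / of_real (c k) = complex_of_real ((t - a k) / c k)" by simp
  have "- ((t - a k) / c k) = (a k - t) / c k" by (simp add: minus_divide_left)
  thus ?thesis unfolding xi_def eq psqrt_of_real kap_of_real[of c k a t, OF assms] using assms
    by (auto simp: divide_less_0_iff simp del: of_real_divide of_real_diff)
qed

section \<open>The star network: weights and eigenfunctions expressed through the roots\<close>

locale star =
  fixes n :: nat and c a :: "nat \<Rightarrow> real"
  assumes n_pos: "1 \<le> n"
    and c_pos: "\<And>k. k \<in> {1..n} \<Longrightarrow> 0 < c k"
    and a_nonneg: "\<And>k. k \<in> {1..n} \<Longrightarrow> 0 \<le> a k"
begin

abbreviation K where "K \<equiv> kap c a"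
abbreviation S where "S \<equiv> sig n c a"
abbreviation q where "q \<equiv> qfun n c a"

text \<open>For \<open>Im z \<le> 0\<close> all terms of \<open>S z\<close> lie in the closed first
  quadrant. Adding such numbers can only increase both coordinates, hence the modulus.\<close>

lemma sig_ge:
  assumes "k \<in> {1..n}" "Im z \<le> 0"
  shows "c k * cmod (K k z) \<le> cmod (S z)"
proof -
  have "cmod (of_real (c k) * K k z) \<le> cmod (S z)"
  proof (rule cmod_mono)
    have nn: "0 \<le> c l * Re (K l z)" "0 \<le> c l * Im (K l z)" if "l \<in> {1..n}" for l
      using c_pos[OF that] assms(2) by (auto intro!: mult_nonneg_nonneg Re_kap_nonneg Im_kap_nonneg)
    show "0 \<le> Re (of_real (c k) * K k z)" "0 \<le> Im (of_real (c k) * K k z)"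
      using nn[OF assms(1)] by auto
    show "Re (of_real (c k) * K k z) \<le> Re (S z)" "Im (of_real (c k) * K k z) \<le> Im (S z)"
      unfolding sig_def using nn assms(1)
        member_le_sum[of k "{1..n}" "\<lambda>l. c l * Re (K l z)"] member_le_sum[of k "{1..n}" "\<lambda>l. c l * Im (K l z)"]
      by auto
  qed
  thus ?thesis using c_pos[OF assms(1)] by (simp add: norm_mult)
qed

lemma kap_nonzero: "k \<in> {1..n} \<Longrightarrow> z \<noteq> of_real (a k) \<Longrightarrow> K k z \<noteq> 0"
  using c_pos[of k] by (auto simp: kap_def simp del: csqrt.simps)

lemma sig_nonzero:
  assumes "k \<in> {1..n}" "Im z \<le> 0" "z \<noteq> of_real (a k)"
  shows "S z \<noteq> 0"
proof -
  have "0 < c k * cmod (K k z)" using assms c_pos[of k] kap_nonzero[of k z] by simp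
  thus ?thesis using sig_ge[OF assms(1,2)] by auto
qed

lemma Re_sig_pos:
  assumes "Im z \<noteq> 0 \<or> Re z < 0"
  shows "0 < Re (S z)"
proof -
  have "0 < (\<Sum>k\<in>{1..n}. c k * Re (K k z))"
    using n_pos assms c_pos a_nonneg
    by (intro sum_pos mult_pos_pos Re_kap_pos) (auto intro: less_le_trans)
  thus ?thesis by (simp add: sig_def)
qed

text \<open>Up to the threshold \<open>K k\<close> is real, so its imaginary part already produces
  the zero of the weight there and one formula serves all t.\<close>

lemma qfun_eq: "k \<in> {1..n} \<Longrightarrow> q k t = c k * Im (K k (of_real t)) / (pi * (cmod (S (of_real t)))\<^sup>2)"
proof -
  assume k: "k \<in> {1..n}"
  have "wfun n c a t = - S (of_real t)"
  proof -
    have "(\<Sum>j\<in>{1..n}. of_real (c j) * xi c a j (of_real t)) = (\<Sum>j\<in>{1..n}. - \<i> * (of_real (c j) * K j (of_real t)))"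
      by (intro sum.cong refl) (simp add: xi_of_real[of c] c_pos)
    also have "\<dots> = - \<i> * S (of_real t)" unfolding sig_def by (rule sum_distrib_left[symmetric])
    finally show ?thesis unfolding wfun_def by simp
  qed
  moreover have "Im (K k (of_real t)) = 0" if "t \<le> a k"
    using that c_pos[OF k] by (auto simp: kap_of_real)
  ultimately show ?thesis
    unfolding qfun_def using c_pos[OF k] by (auto simp: xi_of_real)
qed

lemma qfun_nonneg: "k \<in> {1..n} \<Longrightarrow> 0 \<le> q k t"
  using c_pos[of k] by (auto simp: qfun_eq intro!: divide_nonneg_nonneg mult_nonneg_nonneg Im_kap_nonneg)

lemma qfun_le:
  assumes "k \<in> {1..n}"
  shows "q k t \<le> 1 / (pi * cmod (S (of_real t)))"
proof (cases "S (of_real t) = 0")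
  case False
  have "c k * Im (K k (of_real t)) \<le> c k * cmod (K k (of_real t))"
    using c_pos[OF assms] abs_Im_le_cmod[of "K k (of_real t)"] by (intro mult_left_mono) auto
  also have "\<dots> \<le> cmod (S (of_real t))" by (rule sig_ge[OF assms]) simp
  finally show ?thesis using False by (simp add: qfun_eq[OF assms] field_simps power2_eq_square)
qed (simp add: qfun_eq[OF assms])

text \<open>The form in which transforms are computed: the exponential \<open>exp (- K k x)\<close>,
  the same for every j, plus a multiple of the hyperbolic sine of \<open>K j x\<close> on the edge j
  alone. The second part vanishes at the vertex, so every eigenfunction is 1 there.\<close>

lemma Fm_eq:
  assumes j: "j \<in> {1..n}" and k: "k \<in> {1..n}" and t: "t \<noteq> a j"
  shows "Fm n c a (of_real t) j k x = exp (- K k (of_real t) * of_real x) +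
    (if k = j then S (of_real t) / (2 * of_real (c j) * K j (of_real t)) *
       (exp (K j (of_real t) * of_real x) - exp (- K j (of_real t) * of_real x)) else 0)"
proof -
  let ?K = "\<lambda>k. K k (of_real t)"
  have K0: "?K j \<noteq> 0" using t kap_nonzero[OF j] by auto
  have cj: "complex_of_real (c j) \<noteq> 0" using c_pos[OF j] by simp
  have split: "S (of_real t) = of_real (c j) * ?K j + (\<Sum>l\<in>{1..n} - {j}. of_real (c l) * ?K l)"
    unfolding sig_def using j by (intro sum.remove) auto
  have num: "(\<Sum>l\<in>{1..n} - {j}. of_real (c l) * xi c a l (of_real t)) = - \<i> * (S (of_real t) - of_real (c j) * ?K j)"
  proof -
    have "(\<Sum>l\<in>{1..n} - {j}. of_real (c l) * xi c a l (of_real t)) = (\<Sum>l\<in>{1..n} - {j}. - \<i> * (of_real (c l) * ?K l))"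
      by (intro sum.cong refl) (simp add: xi_of_real[of c] c_pos)
    also have "\<dots> = - \<i> * (S (of_real t) - of_real (c j) * ?K j)"
      unfolding split sum_distrib_left[symmetric] by simp
    finally show ?thesis .
  qed
  have s: "sfun n c a j (of_real t) = 1 - S (of_real t) / (of_real (c j) * ?K j)"
    unfolding sfun_def num xi_of_real[of c j, OF c_pos[OF j]] using K0 cj by (simp add: field_simps)
  have e: "\<i> * (- \<i> * ?K j * of_real x) = ?K j * of_real x"
    "- (\<i> * (- \<i> * ?K j * of_real x)) = - ?K j * of_real x" by (auto simp flip: mult.assoc)
  show ?thesis
  proof (cases "k = j")
    case True
    have "Fm n c a (of_real t) j k x = (exp (?K j * of_real x) + exp (- ?K j * of_real x)) / 2
      - \<i> * sfun n c a j (of_real t) * ((exp (?K j * of_real x) - exp (- ?K j * of_real x)) / (2 * \<i>))"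
      unfolding Fm_def xi_of_real[of c j, OF c_pos[OF j]] cos_exp_eq sin_exp_eq e using True by simp
    note F1 = this
    have F2: "\<i> * s * (X / (2 * \<i>)) = s * (X / 2)" for s X :: complex
      by (simp add: divide_simps mult_ac)
    have "Fm n c a (of_real t) j k x = (exp (?K j * of_real x) + exp (- ?K j * of_real x)) / 2
      - sfun n c a j (of_real t) * ((exp (?K j * of_real x) - exp (- ?K j * of_real x)) / 2)"
      using F1 unfolding F2 .
    also have "\<dots> = exp (- ?K j * of_real x) + S (of_real t) / (2 * of_real (c j) * ?K j) *
       (exp (?K j * of_real x) - exp (- ?K j * of_real x))"
      unfolding s using K0 cj by (simp add: divide_simps) (simp add: algebra_simps)
    finally show ?thesis using True by simp
  next
    case False
    have "Fm n c a (of_real t) j k x = exp (- \<i> * (- \<i> * ?K k) * of_real x)"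
      unfolding Fm_def xi_of_real[of c k, OF c_pos[OF k]] using False by simp
    also have "- \<i> * (- \<i> * ?K k) * of_real x = - ?K k * of_real x" by (simp flip: mult.assoc)
    finally show ?thesis using False by simp
  qed
qed

text \<open>Above the threshold \<open>K j\<close> is purely imaginary, so both exponentials on the
  edge j have modulus 1; on the other edges the real part of the root is nonnegative.\<close>

lemma cmod_Fm_le:
  assumes j: "j \<in> {1..n}" and k: "k \<in> {1..n}" and t: "a j < t" and x: "0 \<le> x"
  shows "cmod (Fm n c a (of_real t) j k x) \<le> 1 + cmod (S (of_real t)) / (c j * cmod (K j (of_real t)))"
proof -
  let ?K = "\<lambda>k. K k (of_real t)"
  have e: "cmod (exp (- ?K k * of_real x)) \<le> 1"
    using x by (simp add: norm_exp_eq_Re Re_kap_nonneg mult_nonneg_nonneg)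
  have Re0: "Re (?K j) = 0" using t c_pos[OF j] by (simp add: kap_of_real)
  have "cmod (exp (?K j * of_real x) - exp (- ?K j * of_real x)) \<le> cmod (exp (?K j * of_real x)) + cmod (exp (- ?K j * of_real x))"
    by (rule norm_triangle_ineq4)
  also have "\<dots> = 2" by (simp add: norm_exp_eq_Re Re0)
  finally have d: "cmod (exp (?K j * of_real x) - exp (- ?K j * of_real x)) \<le> 2" .
  have cj: "0 < c j" by (rule c_pos[OF j])
  have "cmod (S (of_real t) / (2 * of_real (c j) * ?K j) * (exp (?K j * of_real x) - exp (- ?K j * of_real x)))
      = cmod (S (of_real t)) / (2 * (c j * cmod (?K j))) * cmod (exp (?K j * of_real x) - exp (- ?K j * of_real x))"
    using cj by (simp add: norm_mult norm_divide)
  also have "\<dots> \<le> cmod (S (of_real t)) / (2 * (c j * cmod (?K j))) * 2"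
    using cj d by (intro mult_left_mono) auto
  also have "\<dots> = cmod (S (of_real t)) / (c j * cmod (?K j))" by simp
  finally have b: "cmod (S (of_real t) / (2 * of_real (c j) * ?K j) * (exp (?K j * of_real x) - exp (- ?K j * of_real x)))
    \<le> cmod (S (of_real t)) / (c j * cmod (?K j))" .
  have p: "0 \<le> cmod (S (of_real t)) / (c j * cmod (?K j))" using cj by simp
  have "t \<noteq> a j" using t by simp
  note F = Fm_eq[OF j k this]
  show ?thesis
  proof (cases "k = j")
    case True
    show ?thesis using norm_triangle_mono[OF e b] unfolding F if_P[OF True] .
  next
    case False
    show ?thesis unfolding F if_not_P[OF False] add_0_right using e p by linarith
  qed
qed

text \<open>The eigenfunction is singular at the threshold like \<open>1 / K j\<close>, but the
  weight contains the factor \<open>Im (K j)\<close>; in the product only \<open>1 / S\<close> is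
  left.\<close>

lemma qfun_Fm_le:
  assumes j: "j \<in> {1..n}" and k: "k \<in> {1..n}" and t: "a j < t" and x: "0 \<le> x"
  shows "q j t * cmod (Fm n c a (of_real t) j k x) \<le> 2 / (pi * cmod (S (of_real t)))"
proof -
  let ?s = "cmod (S (of_real t))" and ?k = "cmod (K j (of_real t))"
  have s: "0 < ?s" using sig_nonzero[OF j, of "of_real t"] t by auto
  have cj: "0 < c j" by (rule c_pos[OF j])
  have kp: "0 < ?k" using kap_nonzero[OF j, of "of_real t"] t by auto
  have "q j t * cmod (Fm n c a (of_real t) j k x) \<le> q j t * (1 + ?s / (c j * ?k))"
    by (intro mult_left_mono cmod_Fm_le assms qfun_nonneg)
  also have "\<dots> = q j t + q j t * (?s / (c j * ?k))" by (simp add: algebra_simps)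
  also have "q j t * (?s / (c j * ?k)) \<le> 1 / (pi * ?s)"
  proof -
    have "q j t * (?s / (c j * ?k)) = Im (K j (of_real t)) / ?k * (1 / (pi * ?s))"
      using s cj kp by (simp add: qfun_eq[OF j] field_simps power2_eq_square)
    also have "\<dots> \<le> 1 * (1 / (pi * ?s))"
      using kp s abs_Im_le_cmod[of "K j (of_real t)"] by (intro mult_right_mono) (auto simp: field_simps)
    finally show ?thesis by simp
  qed
  finally show ?thesis using qfun_le[OF j, of t] by (simp add: field_simps)
qed

lemma kap_measurable [measurable]:
  assumes "k \<in> {1..n}"
  shows "(\<lambda>t. K k (of_real t)) \<in> borel_measurable borel"
  unfolding kap_of_real[of c k, OF c_pos[OF assms]] by measurable

lemma sig_measurable [measurable]: "(\<lambda>t. S (of_real t)) \<in> borel_measurable borel"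
  unfolding sig_def by measurable

lemma qfun_measurable:
  assumes k: "k \<in> {1..n}"
  shows "q k \<in> borel_measurable borel"
proof -
  note [measurable] = kap_measurable[OF k]
  have "(\<lambda>t. c k * Im (K k (of_real t)) / (pi * (cmod (S (of_real t)))\<^sup>2)) \<in> borel_measurable borel"
    by measurable
  thus ?thesis by (subst measurable_cong[OF qfun_eq[OF k]])
qed

lemma Fm_measurable:
  assumes j: "j \<in> {1..n}" and k: "k \<in> {1..n}"
  shows "(\<lambda>(t, x). Fm n c a (of_real t) j k x) \<in> borel_measurable (borel \<Otimes>\<^sub>M borel)"
proof -
  have [measurable]: "(\<lambda>t. xi c a l (of_real t)) \<in> borel_measurable borel" if "l \<in> {1..n}" for l
  proof -
    note [measurable] = kap_measurable[OF that]
    show ?thesis unfolding xi_of_real[of c l, OF c_pos[OF that]] by measurable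
  qed
  note [measurable] = this[OF j] this[OF k]
  have [measurable]: "(\<lambda>t. sfun n c a j (of_real t)) \<in> borel_measurable borel"
    unfolding sfun_def by measurable
  have [measurable]: "(cos :: complex \<Rightarrow> complex) \<in> borel_measurable borel"
    "(sin :: complex \<Rightarrow> complex) \<in> borel_measurable borel" "(exp :: complex \<Rightarrow> complex) \<in> borel_measurable borel"
    by (intro borel_measurable_continuous_onI continuous_intros)+
  show ?thesis unfolding Fm_def by measurable
qed

end

section \<open>Integrals over the real line\<close>

lemma filterlim_divide_pos_at_top:
  fixes f :: "'a \<Rightarrow> real"
  assumes "filterlim f at_top F" "0 < c"
  shows "filterlim (\<lambda>x. f x / c) at_top F"
  using filterlim_tendsto_pos_mult_at_top[OF tendsto_const[of "1 / c"] _ assms(1)] assms(2) by simp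

text \<open>The common majorant for integrals in t: of order -1/2 at the threshold b and of order
  -3/2 at infinity. On each side of b its primitive is \<open>2 * arctan (sqrt x)\<close> in the
  distance x from b.\<close>

lemma sqrt_weight_integrable:
  "integrable lborel (\<lambda>x. 1 / (sqrt \<bar>x - b\<bar> * (1 + \<bar>x - b\<bar>)))"
proof -
  let ?w = "\<lambda>x::real. 1 / (sqrt x * (1 + x))"
  have "set_integrable lborel (einterval 0 \<infinity>) ?w"
  proof (rule interval_integral_FTC_nonneg(1))
    fix x :: real assume "0 < ereal x"
    hence x: "0 < x" by simp
    show "((\<lambda>x. 2 * arctan (sqrt x)) has_real_derivative ?w x) (at x)"
      proof -
      have "inverse (1 + (sqrt x)\<^sup>2) * (inverse (sqrt x) / 2) * 2 = ?w x"
        using x by (simp add: divide_simps)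
      moreover have "((\<lambda>x. 2 * arctan (sqrt x)) has_real_derivative inverse (1 + (sqrt x)\<^sup>2) * (inverse (sqrt x) / 2) * 2) (at x)"
        using x by (auto intro!: derivative_eq_intros)
      ultimately show ?thesis by simp
    qed
    show "isCont ?w x"
      using x by (intro continuous_intros) (auto simp: add_pos_pos)
  next
    show "(((\<lambda>x. 2 * arctan (sqrt x)) \<circ> real_of_ereal) \<longlongrightarrow> 0) (at_right 0)"
      unfolding zero_ereal_def ereal_tendsto_simps by (auto intro!: tendsto_eq_intros)
    have "((\<lambda>x. 2 * arctan (sqrt x)) \<longlongrightarrow> 2 * (pi / 2)) at_top"
      by (intro tendsto_intros filterlim_compose[OF tendsto_arctan_at_top] sqrt_at_top)
    thus "(((\<lambda>x. 2 * arctan (sqrt x)) \<circ> real_of_ereal) \<longlongrightarrow> pi) (at_left \<infinity>)"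
      unfolding ereal_tendsto_simps by simp
  qed auto
  hence w: "integrable lborel (\<lambda>x. indicator {0<..} x * ?w x)"
    by (simp add: set_integrable_def zero_ereal_def einterval_eq)
  have "integrable lborel (\<lambda>x. indicator {0<..} (- b + 1 * x) * ?w (- b + 1 * x)
      + indicator {0<..} (b + (-1) * x) * ?w (b + (-1) * x))"
    using lborel_integrable_real_affine[OF w, of 1 "- b"] lborel_integrable_real_affine[OF w, of "-1" b]
    by (intro Bochner_Integration.integrable_add) auto
  moreover have "(\<lambda>x. indicator {0<..} (- b + 1 * x) * ?w (- b + 1 * x)
      + indicator {0<..} (b + (-1) * x) * ?w (b + (-1) * x)) = (\<lambda>x. 1 / (sqrt \<bar>x - b\<bar> * (1 + \<bar>x - b\<bar>)))"
  proof
    fix x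
    consider "x < b" | "x = b" | "b < x" by linarith
    thus "indicator {0<..} (- b + 1 * x) * ?w (- b + 1 * x)
      + indicator {0<..} (b + (-1) * x) * ?w (b + (-1) * x) = 1 / (sqrt \<bar>x - b\<bar> * (1 + \<bar>x - b\<bar>))"
      by cases (auto simp: abs_if)
  qed
  ultimately show ?thesis by simp
qed

text \<open>The primitive of \<open>f\<close> has the same value, in the limit, at both ends of a horizontal line, because
  the ends can be joined through \<open>b - i (R + d)\<close> by segments on which \<open>f\<close> is of order \<open>R powr (-3/2)\<close>.\<close>
lemma horizontal_line_integral_zero:
  fixes f :: "complex \<Rightarrow> complex" and b B d :: real
  assumes hol: "f holomorphic_on {z. Im z < 0}" and d: "0 < d"
    and bound: "\<And>z. Im z < 0 \<Longrightarrow> cmod (f z) \<le> B / (sqrt (cmod (z - of_real b)) * (1 + cmod (z - of_real b)))"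
  shows "integrable lborel (\<lambda>x. f (Complex x (- d)))" "(\<integral>x. f (Complex x (- d)) \<partial>lborel) = 0"
proof -
  let ?g = "\<lambda>x. f (Complex x (- d))"
  let ?w = "\<lambda>x. B * (1 / (sqrt \<bar>x - b\<bar> * (1 + \<bar>x - b\<bar>)))"
  have "0 \<le> B / (sqrt (cmod (- \<i> - of_real b)) * (1 + cmod (- \<i> - of_real b)))"
    by (rule order_trans[OF norm_ge_zero bound]) simp
  moreover have "cmod (- \<i> - of_real b) \<noteq> 0" by (simp add: complex_eq_iff)
  ultimately have B: "0 \<le> B"
    by (smt (verit) divide_neg_pos mult_pos_pos norm_ge_zero real_sqrt_gt_zero)
  have contg: "continuous_on UNIV ?g"
  proof (rule continuous_on_compose2[OF holomorphic_on_imp_continuous_on[OF hol]])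
    have "continuous_on UNIV (\<lambda>x. complex_of_real x - \<i> * of_real d)" by (intro continuous_intros)
    thus "continuous_on UNIV (\<lambda>x. Complex x (- d))" by (simp add: Complex_eq)
  qed (use d in auto)
  have [measurable]: "?g \<in> borel_measurable borel"
    using contg by (rule borel_measurable_continuous_onI)
  have mono: "B / (sqrt v * (1 + v)) \<le> B / (sqrt u * (1 + u))" if "0 < u" "u \<le> v" for u v
    using that B by (intro divide_left_mono mult_mono mult_pos_pos) (auto intro: less_le_trans)
  have gw: "cmod (?g x) \<le> ?w x" if "x \<noteq> b" for x
  proof -
    have "\<bar>x - b\<bar> \<le> cmod (Complex x (- d) - of_real b)"
      using abs_Re_le_cmod[of "Complex x (- d) - of_real b"] by simp
    thus ?thesis using order_trans[OF bound mono] d that by simp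
  qed
  have wint: "integrable lborel ?w"
    by (intro integrable_mult_right sqrt_weight_integrable)
  have AEb: "AE x in lborel. x \<noteq> b" by (rule AE_lborel_singleton)
  show int: "integrable lborel ?g"
  proof (rule Bochner_Integration.integrable_bound[OF wint])
    show "AE x in lborel. norm (?g x) \<le> norm (?w x)"
      using AEb by eventually_elim (use gw in \<open>simp only: real_norm_def\<close>, rule order_trans[OF gw abs_ge_self])
  qed measurable
  obtain F where F: "\<And>z. Im z < 0 \<Longrightarrow> (F has_field_derivative f z) (at z)"
  proof -
    have cv: "convex {z. Im z < 0}" by (rule convex_halfspace_Im_lt)
    have op: "open {z. Im z < 0}" by (rule open_halfspace_Im_lt)
    obtain F where "\<And>x. x \<in> {z. Im z < 0} \<Longrightarrow> (F has_field_derivative f x) (at x within {z. Im z < 0})"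
      using holomorphic_convex_primitive'[OF cv op hol] by blast
    thus ?thesis using that at_within_open[OF _ op] by (metis mem_Collect_eq)
  qed
  define I where "I m = (\<integral>x. indicator {b - real m..b + real m} x *\<^sub>R ?g x \<partial>lborel)" for m :: nat
  have I_eq: "I m = F (Complex (b + m) (- d)) - F (Complex (b - m) (- d))" for m
    unfolding I_def
  proof (rule integral_FTC_atLeastAtMost)
    fix x assume "b - real m \<le> x" "x \<le> b + real m"
    have A: "((\<lambda>x. complex_of_real x - \<i> * of_real d) has_vector_derivative 1) (at x within {b - real m..b + real m})"
      by (auto intro!: derivative_eq_intros)
    have B: "(F has_field_derivative f (of_real x - \<i> * of_real d))
         (at (of_real x - \<i> * of_real d) within (\<lambda>x. complex_of_real x - \<i> * of_real d) ` {b - real m..b + real m})"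
      by (rule has_field_derivative_at_within[OF F]) (use d in simp)
    have e: "Complex y (- d) = of_real y - \<i> * of_real d" for y by (simp add: complex_eq_iff)
    show "((\<lambda>x. F (Complex x (- d))) has_vector_derivative ?g x) (at x within {b - real m..b + real m})"
      using field_vector_diff_chain_within[OF A B] unfolding o_def e mult_1 .
  qed (auto intro: continuous_on_subset[OF contg])
  \<comment> \<open>Starting from the deep point, the imaginary part on the first half of the
    segment and the real part on the second keep z at distance \<open>R / 2\<close> from b. This
    bounds f on the whole segment, whose length is at most \<open>2 * R\<close>.\<close>
  have seg: "cmod (F (Complex (b + s * R) (- d)) - F (Complex b (- (R + d)))) \<le> 4 * B / sqrt (R / 2)"
    if R: "0 < R" and s: "s = 1 \<or> s = -1" for R s
  proof -
    let ?u = "Complex (b + s * R) (- d)" and ?v = "Complex b (- (R + d))"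
    have "norm (F ?u - F ?v) \<le> B / (sqrt (R / 2) * (R / 2)) * norm (?u - ?v)"
    proof (rule field_differentiable_bound[of "closed_segment ?v ?u"])
      fix z assume "z \<in> closed_segment ?v ?u"
      then obtain w where w: "0 \<le> w" "w \<le> 1" "z = (1 - w) *\<^sub>R ?v + w *\<^sub>R ?u"
        by (auto simp: closed_segment_def)
      have im: "Im z = - (d + (1 - w) * R)" and re: "Re z = b + w * (s * R)"
        unfolding w(3) by (simp_all add: algebra_simps)
      have wR: "0 \<le> (1 - w) * R" "0 \<le> w * R" using w R by auto
      have imz: "Im z < 0" using wR(1) d by (simp add: im)
      have "R / 2 \<le> cmod (z - of_real b)"
      proof (cases "w \<le> 1 / 2")
        case True
        hence "1 / 2 * R \<le> (1 - w) * R" using R by (intro mult_right_mono) auto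
        moreover have "Im (z - of_real b) = - (d + (1 - w) * R)" by (simp add: im)
        ultimately have "R / 2 \<le> \<bar>Im (z - of_real b)\<bar>" using d by linarith
        thus ?thesis using abs_Im_le_cmod[of "z - of_real b"] by linarith
      next
        case False
        hence "1 / 2 * R \<le> w * R" using R by (intro mult_right_mono) auto
        moreover have "\<bar>Re (z - of_real b)\<bar> = w * R" using s w(1) R by (auto simp: re abs_mult)
        ultimately have "R / 2 \<le> \<bar>Re (z - of_real b)\<bar>" by linarith
        thus ?thesis using abs_Re_le_cmod[of "z - of_real b"] by linarith
      qed
      hence "cmod (f z) \<le> B / (sqrt (R / 2) * (1 + R / 2))"
        using order_trans[OF bound[OF imz] mono, of "R / 2"] R by simp
      also have "\<dots> \<le> B / (sqrt (R / 2) * (R / 2))"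
        using R B by (intro divide_left_mono mult_left_mono mult_pos_pos) auto
      finally show "norm (f z) \<le> B / (sqrt (R / 2) * (R / 2))" .
      show "(F has_field_derivative f z) (at z within closed_segment ?v ?u)"
        using F[OF imz] by (rule has_field_derivative_at_within)
    qed (auto simp: convex_closed_segment)
    also have "\<dots> \<le> B / (sqrt (R / 2) * (R / 2)) * (2 * R)"
    proof (rule mult_left_mono)
      show "norm (?u - ?v) \<le> 2 * R" using cmod_le[of "?u - ?v"] s R by auto
    qed (use B R in auto)
    also have "B / (sqrt (R / 2) * (R / 2)) * (2 * R) = 4 * B / sqrt (R / 2)"
      using R by (simp add: field_simps)
    finally show ?thesis .
  qed
  have "I \<longlonglongrightarrow> 0"
  proof (rule Lim_null_comparison)
    have "norm (I m) \<le> 8 * B / sqrt (real m / 2)" if "1 \<le> m" for m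
    proof -
      have "I m = (F (Complex (b + 1 * real m) (- d)) - F (Complex b (- (real m + d))))
        - (F (Complex (b + (-1) * real m) (- d)) - F (Complex b (- (real m + d))))" by (simp add: I_eq)
      also have "norm \<dots> \<le> 4 * B / sqrt (real m / 2) + 4 * B / sqrt (real m / 2)"
        by (intro norm_triangle_le_diff add_mono seg) (use that in auto)
      finally show ?thesis by simp
    qed
    thus "\<forall>\<^sub>F m in sequentially. norm (I m) \<le> 8 * B / sqrt (real m / 2)"
      using eventually_sequentially by blast
    show "(\<lambda>m. 8 * B / sqrt (real m / 2)) \<longlonglongrightarrow> 0"
      by (intro tendsto_divide_0[OF tendsto_const] filterlim_at_top_imp_at_infinity
        filterlim_compose[OF sqrt_at_top] filterlim_divide_pos_at_top filterlim_real_sequentially) simp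
  qed
  moreover have "I \<longlonglongrightarrow> (\<integral>x. ?g x \<partial>lborel)"
    unfolding I_def
  proof (rule integral_dominated_convergence[OF _ _ integrable_norm[OF int]])
    show "AE x in lborel. (\<lambda>m. indicator {b - real m..b + real m} x *\<^sub>R ?g x) \<longlonglongrightarrow> ?g x"
    proof (intro AE_I2 tendsto_eventually)
      fix x
      obtain m0 where m0: "\<bar>x - b\<bar> \<le> real m0" using real_arch_simple by blast
      have "indicator {b - real m..b + real m} x *\<^sub>R ?g x = ?g x" if "m \<ge> m0" for m
      proof -
        have "\<bar>x - b\<bar> \<le> real m" using m0 that by linarith
        hence "x \<in> {b - real m..b + real m}" by auto
        thus ?thesis by simp
      qed
      thus "\<forall>\<^sub>F m in sequentially. indicator {b - real m..b + real m} x *\<^sub>R ?g x = ?g x"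
        using eventually_sequentially by blast
    qed
  qed (auto simp: indicator_def)
  ultimately show "(\<integral>x. ?g x \<partial>lborel) = 0" using LIMSEQ_unique by blast
qed

text \<open>The line of integration is raised to the real axis. The majorant is independent of the
  depth, so dominated convergence applies along the depths \<open>1 / Suc m\<close>. Limits are
  taken from below only, because the roots jump across the real axis.\<close>

lemma boundary_integral_zero:
  fixes f :: "complex \<Rightarrow> complex" and b B :: real
  assumes hol: "f holomorphic_on {z. Im z < 0}"
    and bound: "\<And>z. Im z \<le> 0 \<Longrightarrow> z \<noteq> of_real b \<Longrightarrow>
      cmod (f z) \<le> B / (sqrt (cmod (z - of_real b)) * (1 + cmod (z - of_real b)))"
    and lim: "\<And>x. x \<noteq> b \<Longrightarrow> (\<lambda>m. f (Complex x (- (1 / real (Suc m))))) \<longlonglongrightarrow> f (of_real x)"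
    and meas: "(\<lambda>x. f (of_real x)) \<in> borel_measurable borel"
  shows "integrable lborel (\<lambda>x. f (of_real x))" "(\<integral>x. f (of_real x) \<partial>lborel) = 0"
proof -
  note [measurable] = meas
  let ?w = "\<lambda>x. B * (1 / (sqrt \<bar>x - b\<bar> * (1 + \<bar>x - b\<bar>)))"
  have wint: "integrable lborel ?w"
    by (intro integrable_mult_right sqrt_weight_integrable)
  have AEb: "AE x in lborel. x \<noteq> b" by (rule AE_lborel_singleton)
  have B: "0 \<le> B"
  proof -
    have "0 \<le> B / (sqrt (cmod (of_real (b + 1) - of_real b)) * (1 + cmod (of_real (b + 1) - of_real b)))"
      by (rule order_trans[OF norm_ge_zero bound]) auto
    thus ?thesis by simp
  qed
  have bound': "cmod (f z) \<le> B / (sqrt (cmod (z - of_real b)) * (1 + cmod (z - of_real b)))" if "Im z < 0" for z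
    using that by (intro bound) auto
  note line = horizontal_line_integral_zero[OF hol _ bound']
  have d: "0 < 1 / real (Suc m)" for m by simp
  have le: "cmod (f (Complex x (- d))) \<le> ?w x" if "x \<noteq> b" "0 \<le> d" for x d
  proof -
    have 1: "\<bar>x - b\<bar> \<le> cmod (Complex x (- d) - of_real b)"
      using abs_Re_le_cmod[of "Complex x (- d) - of_real b"] by simp
    have "cmod (f (Complex x (- d))) \<le> B / (sqrt (cmod (Complex x (- d) - of_real b)) * (1 + cmod (Complex x (- d) - of_real b)))"
      using that by (intro bound) (auto simp: complex_eq_iff)
    also have "\<dots> \<le> B / (sqrt \<bar>x - b\<bar> * (1 + \<bar>x - b\<bar>))"
      using 1 B that(1) by (intro divide_left_mono mult_mono mult_pos_pos) (auto intro: add_pos_nonneg)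
    finally show ?thesis by simp
  qed
  show "integrable lborel (\<lambda>x. f (of_real x))"
  proof (rule Bochner_Integration.integrable_bound[OF wint])
    show "AE x in lborel. norm (f (of_real x)) \<le> norm (?w x)"
      using AEb
    proof eventually_elim
      case (elim x)
      have "cmod (f (of_real x)) \<le> ?w x" using le[of x 0] elim by (simp add: complex_of_real_def)
      thus ?case unfolding real_norm_def by (rule order_trans[OF _ abs_ge_self])
    qed
  qed measurable
  have "(\<lambda>m. \<integral>x. f (Complex x (- (1 / real (Suc m)))) \<partial>lborel) \<longlonglongrightarrow> (\<integral>x. f (of_real x) \<partial>lborel)"
  proof (rule integral_dominated_convergence[OF _ _ wint])
    show "(\<lambda>x. f (Complex x (- (1 / real (Suc m))))) \<in> borel_measurable lborel" for m
      using line(1)[OF d] by (rule borel_measurable_integrable)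
    show "AE x in lborel. (\<lambda>m. f (Complex x (- (1 / real (Suc m))))) \<longlonglongrightarrow> f (of_real x)"
      using AEb by eventually_elim (rule lim)
    show "AE x in lborel. norm (f (Complex x (- (1 / real (Suc m))))) \<le> ?w x" for m
      using AEb by eventually_elim (rule le, auto)
  qed measurable
  moreover have "(\<integral>x. f (Complex x (- (1 / real (Suc m)))) \<partial>lborel) = 0" for m
    by (rule line(2)[OF d])
  ultimately have "(\<lambda>m. 0) \<longlonglongrightarrow> (\<integral>x. f (of_real x) \<partial>lborel)" by simp
  thus "(\<integral>x. f (of_real x) \<partial>lborel) = 0"
    by (rule LIMSEQ_unique[OF _ tendsto_const])
qed

section \<open>The integral of the diagonal term\<close>

lemma arctan_scaled_tendsto: "0 < p \<Longrightarrow> ((\<lambda>y. arctan (y / p)) \<longlongrightarrow> pi / 2) at_top"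
  by (intro filterlim_compose[OF tendsto_arctan_at_top] filterlim_divide_pos_at_top filterlim_ident)

lemma DERIV_arctan_scaled:
  fixes p y :: real
  assumes "0 < p"
  shows "((\<lambda>y. arctan (y / p)) has_real_derivative p / (p\<^sup>2 + y\<^sup>2)) (at y)"
proof -
  have "0 < p\<^sup>2 + y\<^sup>2" using assms by (simp add: add_pos_nonneg)
  hence "inverse (1 + (y / p)\<^sup>2) * (1 / p) = p / (p\<^sup>2 + y\<^sup>2)"
    using assms by (simp add: divide_simps power2_eq_square) 
  moreover have "((\<lambda>y. arctan (y / p)) has_real_derivative inverse (1 + (y / p)\<^sup>2) * (1 / p)) (at y)"
    using assms by (auto intro!: derivative_eq_intros)
  ultimately show ?thesis by simp
qed

text \<open>Partial fractions: up to the factor \<open>2 / (p\<^sup>2 - r\<^sup>2)\<close> the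
  integrand is the difference of \<open>p\<^sup>2 / (p\<^sup>2 + y\<^sup>2)\<close> and
  \<open>r\<^sup>2 / (r\<^sup>2 + y\<^sup>2)\<close>. For p = r the double pole calls for a
  different primitive, with the corresponding limit.\<close>

lemma rational_primitive:
  fixes p r :: real
  assumes "0 < p" "0 < r"
  obtains G where "\<And>y. (G has_real_derivative 2 * y\<^sup>2 / ((p\<^sup>2 + y\<^sup>2) * (r\<^sup>2 + y\<^sup>2))) (at y)"
    "G 0 = 0" "(G \<longlongrightarrow> pi / (p + r)) at_top"
proof (cases "p = r")
  case False
  have ne: "p\<^sup>2 - r\<^sup>2 \<noteq> 0" using False assms by (simp add: power2_eq_iff)
  define G where "G y = 2 / (p\<^sup>2 - r\<^sup>2) * (p * arctan (y / p) - r * arctan (y / r))" for y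
  have "(G has_real_derivative 2 * y\<^sup>2 / ((p\<^sup>2 + y\<^sup>2) * (r\<^sup>2 + y\<^sup>2))) (at y)" for y
  proof -
    have pos: "p\<^sup>2 + y\<^sup>2 \<noteq> 0" "r\<^sup>2 + y\<^sup>2 \<noteq> 0" using assms by (auto simp: add_pos_nonneg sum_power2_eq_zero_iff)
    have "(G has_real_derivative 2 / (p\<^sup>2 - r\<^sup>2) * (p * (p / (p\<^sup>2 + y\<^sup>2)) - r * (r / (r\<^sup>2 + y\<^sup>2)))) (at y)"
      unfolding G_def by (intro DERIV_cmult DERIV_diff DERIV_arctan_scaled assms)
    also have "p * (p / (p\<^sup>2 + y\<^sup>2)) - r * (r / (r\<^sup>2 + y\<^sup>2)) = (p\<^sup>2 - r\<^sup>2) * (y\<^sup>2 / ((p\<^sup>2 + y\<^sup>2) * (r\<^sup>2 + y\<^sup>2)))"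
      using pos by (simp add: divide_simps) (simp add: power2_eq_square algebra_simps)
    finally show ?thesis using ne by simp
  qed
  moreover have "G 0 = 0" by (simp add: G_def)
  moreover have "(G \<longlongrightarrow> 2 / (p\<^sup>2 - r\<^sup>2) * (p * (pi / 2) - r * (pi / 2))) at_top"
    unfolding G_def by (intro tendsto_intros arctan_scaled_tendsto assms)
  moreover have "2 / (p\<^sup>2 - r\<^sup>2) * (p * (pi / 2) - r * (pi / 2)) = pi / (p + r)"
  proof -
    have "p\<^sup>2 - r\<^sup>2 = (p + r) * (p - r)" by (simp add: power2_eq_square algebra_simps)
    thus ?thesis using assms False by (simp add: divide_simps) (simp add: algebra_simps)
  qed
  ultimately show ?thesis by (intro that[of G]) simp_all
next
  case True
  define G where "G y = arctan (y / p) / p - y / (p\<^sup>2 + y\<^sup>2)" for y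
  have "(G has_real_derivative 2 * y\<^sup>2 / ((p\<^sup>2 + y\<^sup>2) * (p\<^sup>2 + y\<^sup>2))) (at y)" for y
  proof -
    have pos: "p\<^sup>2 + y\<^sup>2 \<noteq> 0" using assms by (auto simp: add_pos_nonneg sum_power2_eq_zero_iff)
    have "((\<lambda>y. y / (p\<^sup>2 + y\<^sup>2)) has_real_derivative (1 * (p\<^sup>2 + y\<^sup>2) - y * (2 * y)) / ((p\<^sup>2 + y\<^sup>2) * (p\<^sup>2 + y\<^sup>2))) (at y)"
      using pos by (intro DERIV_divide) (auto intro!: derivative_eq_intros)
    from DERIV_diff[OF DERIV_cdivide[OF DERIV_arctan_scaled[OF assms(1)], of p] this]
    have "(G has_real_derivative p / (p\<^sup>2 + y\<^sup>2) / p - (1 * (p\<^sup>2 + y\<^sup>2) - y * (2 * y)) / ((p\<^sup>2 + y\<^sup>2) * (p\<^sup>2 + y\<^sup>2))) (at y)"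
      by (simp add: G_def[abs_def])
    also have "p / (p\<^sup>2 + y\<^sup>2) / p - (1 * (p\<^sup>2 + y\<^sup>2) - y * (2 * y)) / ((p\<^sup>2 + y\<^sup>2) * (p\<^sup>2 + y\<^sup>2))
        = 2 * y\<^sup>2 / ((p\<^sup>2 + y\<^sup>2) * (p\<^sup>2 + y\<^sup>2))"
      using pos assms by (simp add: divide_simps) (simp add: power2_eq_square algebra_simps)
    finally show ?thesis .
  qed
  moreover have "G 0 = 0" by (simp add: G_def)
  moreover have "(G \<longlongrightarrow> pi / 2 / p - 0) at_top"
    unfolding G_def
  proof (intro tendsto_diff tendsto_divide arctan_scaled_tendsto assms tendsto_const)
    show "((\<lambda>y. y / (p\<^sup>2 + y\<^sup>2)) \<longlongrightarrow> 0) at_top"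
    proof (rule Lim_null_comparison)
      show "\<forall>\<^sub>F y in at_top. norm (y / (p\<^sup>2 + y\<^sup>2)) \<le> 1 / y"
      proof (rule eventually_mono[OF eventually_gt_at_top[of 0]])
        fix y :: real assume y: "0 < y"
        have "0 < p\<^sup>2 + y\<^sup>2" using y by (simp add: add_nonneg_pos)
        thus "norm (y / (p\<^sup>2 + y\<^sup>2)) \<le> 1 / y" using y by (simp add: divide_simps power2_eq_square)
      qed
      show "((\<lambda>y::real. 1 / y) \<longlongrightarrow> 0) at_top"
        by (intro tendsto_divide_0[OF tendsto_const] filterlim_at_top_imp_at_infinity filterlim_ident)
    qed
  qed (use assms in auto)
  ultimately show ?thesis using True by (intro that[of G]) simp_all
qed

text \<open>The substitution \<open>y = sqrt ((t - a0) / c0)\<close> turns the factors of the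
  denominator into \<open>c0 * (p\<^sup>2 + y\<^sup>2)\<close> and
  \<open>c0 * (r\<^sup>2 + y\<^sup>2)\<close>. The value is pi times the inner product of
  \<open>exp (- p x)\<close> and \<open>exp (- r x)\<close> on the half-line.\<close>

lemma diagonal_integral:
  fixes p r c0 a0 :: real
  assumes "0 < p" "0 < r" and c0: "0 < c0"
  defines "h \<equiv> \<lambda>t. c0 * sqrt ((t - a0) / c0) / ((c0 * p\<^sup>2 - a0 + t) * (c0 * r\<^sup>2 - a0 + t))"
  shows "set_integrable lborel {a0<..} h" "set_lebesgue_integral lborel {a0<..} h = pi / (p + r)"
proof -
  obtain G where G: "\<And>y. (G has_real_derivative 2 * y\<^sup>2 / ((p\<^sup>2 + y\<^sup>2) * (r\<^sup>2 + y\<^sup>2))) (at y)"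
    "G 0 = 0" "(G \<longlongrightarrow> pi / (p + r)) at_top"
    using rational_primitive[OF assms(1,2)] by blast
  let ?y = "\<lambda>t. sqrt ((t - a0) / c0)"
  have contG: "isCont G y" for y using G(1) by (rule DERIV_isCont)
  have dens: "c0 * s\<^sup>2 - a0 + t \<noteq> 0" if "a0 < t" "0 < s" for s t
  proof -
    have "0 < c0 * s\<^sup>2" using that c0 by simp
    thus ?thesis using that by linarith
  qed
  have F: "((\<lambda>t. G (?y t)) has_real_derivative h t) (at t)" if t: "a0 < t" for t
  proof -
    have yp: "0 < (t - a0) / c0" using t c0 by simp
    have 1: "(?y has_real_derivative inverse (?y t) / 2 * (1 / c0)) (at t)"
      using yp c0 by (auto intro!: derivative_eq_intros)
    have y2: "(?y t)\<^sup>2 = (t - a0) / c0" using yp by simp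
    have D: "c0 * s\<^sup>2 - a0 + t = c0 * (s\<^sup>2 + (?y t)\<^sup>2)" for s unfolding y2 using c0 by (simp add: field_simps)
    have pp: "s\<^sup>2 + (?y t)\<^sup>2 \<noteq> 0" if "0 < s" for s using that by (simp add: add_pos_nonneg sum_power2_eq_zero_iff)
    have yne: "?y t \<noteq> 0" using t c0 by simp
    have "2 * Y\<^sup>2 / ((p\<^sup>2 + Y\<^sup>2) * (r\<^sup>2 + Y\<^sup>2)) * (inverse Y / 2 * (1 / c0))
      = c0 * Y / ((c0 * (p\<^sup>2 + Y\<^sup>2)) * (c0 * (r\<^sup>2 + Y\<^sup>2)))" if "Y \<noteq> 0" for Y
      using that c0 by (simp add: divide_simps power2_eq_square)
    from this[OF yne] DERIV_chain2[OF G(1) 1] show ?thesis unfolding h_def D by simp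
  qed
  have conth: "isCont h t" if t: "a0 < t" for t
    unfolding h_def using dens[OF t assms(1)] dens[OF t assms(2)] c0 by (intro continuous_intros) auto
  have nonneg: "0 \<le> h t" if t: "a0 < t" for t
  proof -
    have "0 < c0 * p\<^sup>2" "0 < c0 * r\<^sup>2" using assms by auto
    thus ?thesis unfolding h_def using t c0 by (intro divide_nonneg_nonneg mult_nonneg_nonneg) auto
  qed
  have L0: "((\<lambda>t. G (?y t)) \<longlongrightarrow> 0) (at_right a0)"
  proof -
    have "((\<lambda>t. G (?y t)) \<longlongrightarrow> G (?y a0)) (at_right a0)"
      by (intro isCont_tendsto_compose[OF contG] tendsto_intros) (use c0 in auto)
    thus ?thesis by (simp add: G)
  qed
  have "filterlim (\<lambda>t. t - a0) at_top at_top"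
    using filterlim_tendsto_add_at_top[OF tendsto_const[of "- a0"] filterlim_ident] by simp
  hence "filterlim (\<lambda>t. (t - a0) / c0) at_top at_top"
    using c0 by (intro filterlim_divide_pos_at_top)
  hence L1: "((\<lambda>t. G (?y t)) \<longlongrightarrow> pi / (p + r)) at_top"
    by (intro filterlim_compose[OF G(3)] filterlim_compose[OF sqrt_at_top])
  have *: "set_integrable lborel (einterval (ereal a0) \<infinity>) h" "(LBINT x=ereal a0..\<infinity>. h x) = pi / (p + r) - 0"
    using F conth nonneg L0 L1
    by (intro interval_integral_FTC_nonneg[where F = "\<lambda>t. G (?y t)"]; simp add: ereal_tendsto_simps)+
  show "set_integrable lborel {a0<..} h" "set_lebesgue_integral lborel {a0<..} h = pi / (p + r)"
    using * by (simp_all add: interval_lebesgue_integral_def einterval_eq)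
qed

text \<open>\<open>csqrt\<close> jumps across the negative reals. Restricted to the closed upper
  half-plane its real and imaginary parts are given by formulas without a sign function, and these
  are continuous.\<close>

lemma csqrt_tendsto_upper:
  assumes "\<And>m. 0 < Im (w m)" "w \<longlonglongrightarrow> w0"
  shows "(\<lambda>m. csqrt (w m)) \<longlonglongrightarrow> csqrt w0"
proof -
  have eq: "csqrt v = Complex (sqrt ((cmod v + Re v) / 2)) (sqrt ((cmod v - Re v) / 2))" if "0 \<le> Im v" for v
    using that by (intro complex_eqI) (auto simp: sgn_if)
  have "(\<lambda>m. Im (w m)) \<longlonglongrightarrow> Im w0" using assms(2) by (rule tendsto_Im)
  hence "0 \<le> Im w0" using assms(1) by (intro LIMSEQ_le_const[of "\<lambda>m. Im (w m)"]) (auto intro: less_imp_le)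
  moreover have "(\<lambda>m. Complex (sqrt ((cmod (w m) + Re (w m)) / 2)) (sqrt ((cmod (w m) - Re (w m)) / 2)))
      \<longlonglongrightarrow> Complex (sqrt ((cmod w0 + Re w0) / 2)) (sqrt ((cmod w0 - Re w0) / 2))"
    by (intro tendsto_Complex tendsto_intros assms(2)) auto
  ultimately show ?thesis using assms(1) by (simp add: eq less_imp_le del: csqrt.simps)
qed

text \<open>With every imaginary part written as a difference of conjugates, all terms containing
  \<open>u * w\<close> cancel; the two remaining terms are conjugate to each other. This condenses
  the contributions to an inner product into the imaginary part of one function.\<close>

lemma wronskian_identity:
  fixes s u w :: complex
  assumes s: "s \<noteq> 0"
  shows "u * w * of_real (Im s / (cmod s)\<^sup>2) + of_real (Im u) * w / s - u * of_real (Im w) / cnj s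
    = of_real (- Im (cnj u * w / s))"
proof -
  have im: "of_real (Im z) = (z - cnj z) / (2 * \<i>)" for z
    unfolding complex_diff_cnj by (subst nonzero_eq_divide_eq) simp_all
  have n: "complex_of_real ((cmod s)\<^sup>2) = s * cnj s"
    using complex_norm_square[of s] by simp
  have "of_real (Im s / (cmod s)\<^sup>2) = (s - cnj s) / (2 * \<i>) / (s * cnj s)"
    unfolding of_real_divide im n ..
  hence 1: "u * w * of_real (Im s / (cmod s)\<^sup>2) + of_real (Im u) * w / s - u * of_real (Im w) / cnj s
    = u * w * ((s - cnj s) / (2 * \<i>) / (s * cnj s)) + (u - cnj u) / (2 * \<i>) * w / s - u * ((w - cnj w) / (2 * \<i>)) / cnj s"
    unfolding im by simp
  have 2: "of_real (- Im (cnj u * w / s)) = - ((cnj u * w / s - u * cnj w / cnj s) / (2 * \<i>))"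
    using im[of "cnj u * w / s"] by simp
  show ?thesis unfolding 1 2 using s by (simp add: divide_simps) (simp add: algebra_simps)
qed

section \<open>The resolvent kernel has vanishing integral over the real line\<close>

context star
begin

lemma kap_tendsto_below:
  assumes k: "k \<in> {1..n}"
  shows "(\<lambda>m. K k (Complex x (- (1 / real (Suc m))))) \<longlonglongrightarrow> K k (of_real x)"
  unfolding kap_def
proof (rule csqrt_tendsto_upper)
  show "0 < Im ((of_real (a k) - Complex x (- (1 / real (Suc m)))) / of_real (c k))" for m
    using c_pos[OF k] by (simp add: Im_divide_of_real divide_neg_pos)
  have "(\<lambda>m. Complex x (- (1 / real (Suc m)))) \<longlonglongrightarrow> Complex x (- 0)"
    by (intro tendsto_Complex tendsto_const tendsto_minus LIMSEQ_inverse_real_of_nat[unfolded inverse_eq_divide])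
  hence lim: "(\<lambda>m. Complex x (- (1 / real (Suc m)))) \<longlonglongrightarrow> of_real x" by (simp add: complex_of_real_def)
  show "(\<lambda>m. (of_real (a k) - Complex x (- (1 / real (Suc m)))) / of_real (c k)) \<longlonglongrightarrow> (of_real (a k) - of_real x) / of_real (c k)"
    using c_pos[OF k] by (intro tendsto_divide tendsto_diff tendsto_const lim) simp
qed

lemma sig_tendsto_below: "(\<lambda>m. S (Complex x (- (1 / real (Suc m))))) \<longlonglongrightarrow> S (of_real x)"
  unfolding sig_def by (intro tendsto_sum tendsto_mult tendsto_const kap_tendsto_below)

lemma kap_holomorphic_lower:
  assumes k: "k \<in> {1..n}"
  shows "K k holomorphic_on {z. Im z < 0}"
  unfolding kap_def
proof (intro holomorphic_intros)
  show "complex_of_real (c k) \<noteq> 0" using c_pos[OF k] by simp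
  fix z :: complex assume "z \<in> {z. Im z < 0}"
  hence "0 < Im ((of_real (a k) - z) / of_real (c k))"
    using c_pos[OF k] by (simp add: Im_divide_of_real divide_neg_pos)
  thus "(of_real (a k) - z) / of_real (c k) \<notin> \<real>\<^sub>\<le>\<^sub>0"
    by (metis complex_nonpos_Reals_iff less_irrefl)
qed

lemma sig_holomorphic_lower: "S holomorphic_on {z. Im z < 0}"
  unfolding sig_def by (intro holomorphic_intros kap_holomorphic_lower)

text \<open>Since the root has nonnegative real part, the squared modulus is at least
  \<open>p\<^sup>2\<close> plus that of the root, which grows linearly. The centre b is arbitrary
  because the factors of two edges with different thresholds must be estimated about one
  point.\<close>

lemma kap_shift_ge:
  assumes k: "k \<in> {1..n}" and p: "0 < p"
  shows "\<exists>m>0. \<forall>z. m * (1 + cmod (z - of_real b)) \<le> (cmod (of_real p + K k z))\<^sup>2"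
proof -
  let ?e = "1 + \<bar>a k - b\<bar>"
  \<comment> \<open>Of \<open>p\<^sup>2 + cmod (z - a k) / c k\<close> the first summand has to pay
    for the constant \<open>?e\<close>, the second for the growth; the minimum satisfies
    both.\<close>
  define m where "m = min (p\<^sup>2 / ?e) (1 / c k)"
  have m: "0 < m" "m * ?e \<le> p\<^sup>2" "m \<le> 1 / c k"
  proof -
    show "0 < m" using p c_pos[OF k] by (simp add: m_def)
    have "m \<le> p\<^sup>2 / ?e" by (simp add: m_def)
    thus "m * ?e \<le> p\<^sup>2" by (simp add: pos_le_divide_eq)
  qed (simp add: m_def)
  have "m * (1 + cmod (z - of_real b)) \<le> (cmod (of_real p + K k z))\<^sup>2" for z
  proof -
    have "cmod (z - of_real b) \<le> cmod (z - of_real (a k)) + cmod (of_real (a k) - of_real b)"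
      using norm_triangle_ineq[of "z - of_real (a k)" "of_real (a k) - of_real b"] by simp
    also have "cmod (of_real (a k) - of_real b) = \<bar>a k - b\<bar>"
      by (simp flip: of_real_diff)
    finally have "m * (1 + cmod (z - of_real b)) \<le> m * (?e + cmod (z - of_real (a k)))"
      using m(1) by (intro mult_left_mono) auto
    also have "\<dots> = m * ?e + m * cmod (z - of_real (a k))" by (simp add: algebra_simps)
    also have "\<dots> \<le> p\<^sup>2 + 1 / c k * cmod (z - of_real (a k))"
      by (intro add_mono mult_right_mono m) auto
    also have "1 / c k * cmod (z - of_real (a k)) = (cmod (K k z))\<^sup>2"
      using c_pos[OF k] by (simp add: cmod_kap)
    also have "p\<^sup>2 + (cmod (K k z))\<^sup>2 \<le> (cmod (of_real p + K k z))\<^sup>2"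
      by (rule cmod_add_real_ge[OF Re_kap_nonneg p])
    finally show ?thesis .
  qed
  with m(1) show ?thesis by blast
qed

lemma shift_kap_nonzero: "0 < Re p \<Longrightarrow> p + K k z \<noteq> 0"
  using Re_kap_nonneg[of c a k z] by (metis add_pos_nonneg less_irrefl plus_complex.sel(1) zero_complex.sel(1))

text \<open>\<open>sig_ge\<close> contributes the square root of the distance to \<open>a k\<close>,
  and each shifted factor contributes the square root of one plus that distance.\<close>

lemma resolvent_kernel_bound:
  assumes k: "k \<in> {1..n}" and l: "l \<in> {1..n}" and p: "0 < p" and r: "0 < r"
  shows "\<exists>B. \<forall>z. Im z \<le> 0 \<longrightarrow> z \<noteq> of_real (a k) \<longrightarrow>
    cmod (1 / (S z * (of_real p + K k z) * (of_real r + K l z)))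
      \<le> B / (sqrt (cmod (z - of_real (a k))) * (1 + cmod (z - of_real (a k))))"
proof -
  obtain m1 where m1: "0 < m1" "\<And>z. m1 * (1 + cmod (z - of_real (a k))) \<le> (cmod (of_real p + K k z))\<^sup>2"
    using kap_shift_ge[OF k p, of "a k"] by blast
  obtain m2 where m2: "0 < m2" "\<And>z. m2 * (1 + cmod (z - of_real (a k))) \<le> (cmod (of_real r + K l z))\<^sup>2"
    using kap_shift_ge[OF l r, of "a k"] by blast
  define B where "B = 1 / (sqrt (c k) * sqrt (m1 * m2))"
  have "cmod (1 / (S z * (of_real p + K k z) * (of_real r + K l z)))
      \<le> B / (sqrt (cmod (z - of_real (a k))) * (1 + cmod (z - of_real (a k))))"
    if z: "Im z \<le> 0" "z \<noteq> of_real (a k)" for z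
  proof -
    let ?d = "cmod (z - of_real (a k))"
    have d: "0 < ?d" using z by simp
    have ck: "0 < c k" by (rule c_pos[OF k])
    have "sqrt (c k) * sqrt ?d = c k * cmod (K k z)"
    proof -
      have "c k * sqrt (?d / c k) = c k / sqrt (c k) * sqrt ?d" by (simp add: real_sqrt_divide)
      thus ?thesis using ck by (simp add: cmod_kap real_div_sqrt)
    qed
    also have "\<dots> \<le> cmod (S z)" by (rule sig_ge[OF k z(1)])
    finally have 1: "sqrt (c k) * sqrt ?d \<le> cmod (S z)" .
    have "(sqrt (m1 * m2) * (1 + ?d))\<^sup>2 = (m1 * (1 + ?d)) * (m2 * (1 + ?d))"
      using m1 m2 by (simp add: power_mult_distrib) (simp add: power2_eq_square)
    also have "\<dots> \<le> (cmod (of_real p + K k z))\<^sup>2 * (cmod (of_real r + K l z))\<^sup>2"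
      using m1(1) m2(1) by (intro mult_mono m1(2) m2(2)) auto
    also have "\<dots> = (cmod (of_real p + K k z) * cmod (of_real r + K l z))\<^sup>2" by (simp add: power_mult_distrib)
    finally have 2: "sqrt (m1 * m2) * (1 + ?d) \<le> cmod (of_real p + K k z) * cmod (of_real r + K l z)"
      by (rule power2_le_imp_le) simp
    have "(sqrt (c k) * sqrt ?d) * (sqrt (m1 * m2) * (1 + ?d))
        \<le> cmod (S z) * (cmod (of_real p + K k z) * cmod (of_real r + K l z))"
      using m1(1) m2(1) ck by (intro mult_mono 1 2) auto
    note L = this
    have P: "0 < (sqrt (c k) * sqrt ?d) * (sqrt (m1 * m2) * (1 + ?d))"
      using m1(1) m2(1) ck d by (intro mult_pos_pos) (auto simp: add_pos_pos)
    have "1 / (cmod (S z) * (cmod (of_real p + K k z) * cmod (of_real r + K l z)))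
        \<le> 1 / ((sqrt (c k) * sqrt ?d) * (sqrt (m1 * m2) * (1 + ?d)))"
      by (rule divide_left_mono[OF L]) (use mult_pos_pos[OF less_le_trans[OF P L] P] in auto)
    also have "\<dots> = B / (sqrt ?d * (1 + ?d))" by (simp add: B_def)
    finally show ?thesis by (simp add: norm_divide norm_mult mult.assoc)
  qed
  thus ?thesis by blast
qed

lemma resolvent_kernel_integral:
  assumes k: "k \<in> {1..n}" and l: "l \<in> {1..n}" and p: "0 < p" and r: "0 < r"
  defines "f \<equiv> \<lambda>z. 1 / (S z * (of_real p + K k z) * (of_real r + K l z))"
  shows "integrable lborel (\<lambda>x. f (of_real x))" "(\<integral>x. f (of_real x) \<partial>lborel) = 0"
proof -
  note [measurable] = kap_measurable[OF k] kap_measurable[OF l]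
  obtain B where B: "\<And>z. Im z \<le> 0 \<Longrightarrow> z \<noteq> of_real (a k) \<Longrightarrow>
      cmod (f z) \<le> B / (sqrt (cmod (z - of_real (a k))) * (1 + cmod (z - of_real (a k))))"
    using resolvent_kernel_bound[OF assms(1-4)] unfolding f_def by blast
  have pk: "of_real p + K k z \<noteq> 0" for z using shift_kap_nonzero[of "of_real p" k z] p by simp
  have rl: "of_real r + K l z \<noteq> 0" for z using shift_kap_nonzero[of "of_real r" l z] r by simp
  have hol: "f holomorphic_on {z. Im z < 0}"
    unfolding f_def using pk rl
    by (intro holomorphic_intros kap_holomorphic_lower sig_holomorphic_lower k l)
       (auto intro: sig_nonzero[OF k, THEN notE, rotated 2])
  have lim: "(\<lambda>m. f (Complex x (- (1 / real (Suc m))))) \<longlonglongrightarrow> f (of_real x)" if "x \<noteq> a k" for x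
    unfolding f_def using pk rl sig_nonzero[OF k, of "of_real x"] that
    by (intro tendsto_divide tendsto_mult tendsto_add tendsto_const kap_tendsto_below sig_tendsto_below k l) auto
  have meas: "(\<lambda>x. f (of_real x)) \<in> borel_measurable borel"
    unfolding f_def by measurable
  show "integrable lborel (\<lambda>x. f (of_real x))" "(\<integral>x. f (of_real x) \<partial>lborel) = 0"
    using boundary_integral_zero[OF hol B lim meas] by auto
qed

text \<open>The transform of the function \<open>exp (- p x)\<close> supported on the edge \<open>k\<close>, component \<open>j\<close>.\<close>
definition expV :: "nat \<Rightarrow> complex \<Rightarrow> nat \<Rightarrow> real \<Rightarrow> complex" where
  "expV k p j t = 1 / (p + cnj (K k (of_real t))) +
     (if j = k then cnj (S (of_real t)) / (of_real (c k) * p\<^sup>2 - of_real (a k) + of_real t) else 0)"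

section \<open>Inner products of the transformed exponentials\<close>

lemma expV_measurable:
  assumes k: "k \<in> {1..n}"
  shows "expV k p j \<in> borel_measurable borel"
proof -
  note [measurable] = kap_measurable[OF k]
  have "(\<lambda>t. expV k p j t) \<in> borel_measurable borel" unfolding expV_def by measurable
  thus ?thesis by simp
qed

text \<open>Above the threshold \<open>c k * p\<^sup>2 - a k + t\<close> is \<open>c k\<close> times
  the squared modulus of \<open>p + K k\<close>, below it both sides vanish. Thus weight times
  diagonal denominator becomes an imaginary part, as \<open>wronskian_identity\<close>
  requires.\<close>

lemma Im_inverse_shift:
  assumes k: "k \<in> {1..n}" and p: "0 < p"
  shows "c k * Im (K k (of_real t)) / (c k * p\<^sup>2 - a k + t) = Im (1 / (of_real p + cnj (K k (of_real t))))"
    and "- (c k * Im (K k (of_real t)) / (c k * p\<^sup>2 - a k + t)) = Im (1 / (of_real p + K k (of_real t)))"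
proof -
  have ck: "0 < c k" by (rule c_pos[OF k])
  show 1: "c k * Im (K k (of_real t)) / (c k * p\<^sup>2 - a k + t) = Im (1 / (of_real p + cnj (K k (of_real t))))"
  proof (cases "t < a k")
    case True
    thus ?thesis using ck by (simp add: kap_of_real flip: of_real_add)
  next
    case False
    define y where "y = sqrt ((t - a k) / c k)"
    have Ky: "K k (of_real t) = \<i> * of_real y" using False ck by (simp add: kap_of_real y_def)
    have "y\<^sup>2 = (t - a k) / c k" using False ck by (simp add: y_def)
    hence D: "c k * p\<^sup>2 - a k + t = c k * (p\<^sup>2 + y\<^sup>2)" using ck by (simp add: field_simps)
    have "0 < p\<^sup>2 + y\<^sup>2" using p by (simp add: add_pos_nonneg)
    moreover have "Im (1 / (of_real p + cnj (\<i> * of_real y))) = y / (p\<^sup>2 + y\<^sup>2)"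
      by (simp add: Im_divide power2_eq_square)
    ultimately show ?thesis unfolding D Ky using ck by simp
  qed
  have "Im (cnj v) = - Im v" for v by simp
  from this[of "1 / (of_real p + cnj (K k (of_real t)))"]
  have "Im (1 / (of_real p + K k (of_real t))) = - Im (1 / (of_real p + cnj (K k (of_real t))))"
    by (simp only: complex_cnj_divide complex_cnj_one complex_cnj_add complex_cnj_complex_of_real complex_cnj_cnj)
  thus "- (c k * Im (K k (of_real t)) / (c k * p\<^sup>2 - a k + t)) = Im (1 / (of_real p + K k (of_real t)))"
    by (simp only: 1)
qed

lemma expV_density:
  assumes k: "k \<in> {1..n}" and l: "l \<in> {1..n}" and p: "0 < p" and r: "0 < r"
    and t: "t \<noteq> a k"
  shows "(\<Sum>j\<in>{1..n}. of_real (q j t) * (expV k (of_real p) j t * cnj (expV l (of_real r) j t))) =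
    of_real ((- Im (1 / (S (of_real t) * (of_real p + K k (of_real t)) * (of_real r + K l (of_real t))))
      + (if k = l then c k * Im (K k (of_real t)) / ((c k * p\<^sup>2 - a k + t) * (c k * r\<^sup>2 - a k + t)) else 0)) / pi)"
proof -
  let ?s = "S (of_real t)"
  define u where "u = 1 / (of_real p + cnj (K k (of_real t)))"
  define w where "w = 1 / (of_real r + K l (of_real t))"
  define D where "D = c k * p\<^sup>2 - a k + t"
  define D' where "D' = c l * r\<^sup>2 - a l + t"
  have s: "?s \<noteq> 0" using sig_nonzero[OF k, of "of_real t"] t by auto
  have n: "complex_of_real ((cmod ?s)\<^sup>2) = ?s * cnj ?s" using complex_norm_square[of ?s] by simp
  have eV: "expV k (of_real p) j t = u + (if j = k then cnj ?s / of_real D else 0)" for j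
    unfolding expV_def u_def D_def by simp
  have eV': "cnj (expV l (of_real r) j t) = w + (if j = l then ?s / of_real D' else 0)" for j
    unfolding expV_def w_def D'_def by simp
  let ?q = "\<lambda>j. complex_of_real (q j t)"
  \<comment> \<open>The product splits into common times common, two mixed terms and a diagonal
    term. Only the first meets all weights, and these add up to
    \<open>Im ?s / (pi * (cmod ?s)\<^sup>2)\<close>; the others select one component.\<close>
  have "(\<Sum>j\<in>{1..n}. ?q j * (expV k (of_real p) j t * cnj (expV l (of_real r) j t)))
    = (\<Sum>j\<in>{1..n}. ?q j * (u * w) + (if j = k then ?q j * (cnj ?s / of_real D * w) else 0)
        + (if j = l then ?q j * (u * (?s / of_real D')) else 0)
        + (if j = k then (if j = l then ?q j * (cnj ?s / of_real D * (?s / of_real D')) else 0) else 0))"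
    unfolding eV eV' by (intro sum.cong refl) (auto simp: algebra_simps)
  also have "\<dots> = (\<Sum>j\<in>{1..n}. ?q j) * (u * w) + ?q k * (cnj ?s / of_real D * w) + ?q l * (u * (?s / of_real D'))
      + (if k = l then ?q k * (cnj ?s / of_real D * (?s / of_real D')) else 0)"
    using k l by (simp add: sum.distrib sum_distrib_right)
  also have "(\<Sum>j\<in>{1..n}. ?q j) = of_real (Im ?s / (cmod ?s)\<^sup>2) / of_real pi"
  proof -
    have "(\<Sum>j\<in>{1..n}. q j t) = (\<Sum>j\<in>{1..n}. c j * Im (K j (of_real t)) / (pi * (cmod ?s)\<^sup>2))"
      by (intro sum.cong refl qfun_eq)
    also have "\<dots> = (\<Sum>j\<in>{1..n}. c j * Im (K j (of_real t))) / (pi * (cmod ?s)\<^sup>2)"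
      by (simp add: sum_divide_distrib)
    also have "(\<Sum>j\<in>{1..n}. c j * Im (K j (of_real t))) = Im ?s" by (simp add: sig_def)
    finally have "(\<Sum>j\<in>{1..n}. q j t) = Im ?s / (cmod ?s)\<^sup>2 / pi" by simp
    thus ?thesis by (metis of_real_sum of_real_divide)
  qed
  \<comment> \<open>In a mixed term one factor of \<open>?s * cnj ?s\<close> in the denominator of
    the weight cancels, and \<open>Im_inverse_shift\<close> recognises what is left.\<close>
  also have "?q k * (cnj ?s / of_real D * w) = of_real (Im u) * w / ?s / of_real pi"
  proof -
    have iu: "Im u = c k * Im (K k (of_real t)) / D" unfolding u_def D_def by (rule Im_inverse_shift(1)[OF k p, symmetric])
    have "?q k = of_real (c k * Im (K k (of_real t))) / (of_real pi * (?s * cnj ?s))"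
      unfolding qfun_eq[OF k] using n by simp
    thus ?thesis unfolding iu using s by (simp add: mult_ac)
  qed
  also have "?q l * (u * (?s / of_real D')) = - (u * of_real (Im w) / cnj ?s / of_real pi)"
  proof -
    have iw: "Im w = - (c l * Im (K l (of_real t)) / D')" unfolding w_def D'_def by (rule Im_inverse_shift(2)[OF l r, symmetric])
    have "?q l = of_real (c l * Im (K l (of_real t))) / (of_real pi * (?s * cnj ?s))"
      unfolding qfun_eq[OF l] using n by simp
    thus ?thesis unfolding iw using s by (simp add: mult_ac)
  qed
  also have "(if k = l then ?q k * (cnj ?s / of_real D * (?s / of_real D')) else 0)
      = (if k = l then of_real (c k * Im (K k (of_real t)) / (D * D')) else 0) / of_real pi"
  proof -
    have "?q k = of_real (c k * Im (K k (of_real t))) / (of_real pi * (?s * cnj ?s))"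
      unfolding qfun_eq[OF k] using n by simp
    hence "?q k * (cnj ?s / of_real D * (?s / of_real D')) = of_real (c k * Im (K k (of_real t)) / (D * D')) / of_real pi"
      using s by (simp add: mult_ac)
    thus ?thesis by (simp only: if_cancel div_0 split: if_split) simp
  qed
  finally have total: "(\<Sum>j\<in>{1..n}. ?q j * (expV k (of_real p) j t * cnj (expV l (of_real r) j t)))
    = (u * w * of_real (Im ?s / (cmod ?s)\<^sup>2) + of_real (Im u) * w / ?s - u * of_real (Im w) / cnj ?s
      + (if k = l then of_real (c k * Im (K k (of_real t)) / (D * D')) else 0)) / of_real pi"
    by (simp add: add_divide_distrib diff_divide_distrib mult.commute)
  have E: "cnj u * w / ?s = 1 / (?s * (of_real p + K k (of_real t)) * (of_real r + K l (of_real t)))"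
    unfolding u_def w_def by simp
  show ?thesis
    unfolding total wronskian_identity[OF s] E by (cases "k = l") (simp_all add: D_def D'_def)
qed

text \<open>The sum over the components stays under the integral, because the cancellation in
  \<open>expV_density\<close> happens only after summation. The values are the inner products of the
  original exponentials.\<close>

lemma expV_orthogonality:
  assumes k: "k \<in> {1..n}" and l: "l \<in> {1..n}" and p: "0 < p" and r: "0 < r"
  shows "integrable lborel (\<lambda>t. \<Sum>j\<in>{1..n}. of_real (q j t) * (expV k (of_real p) j t * cnj (expV l (of_real r) j t)))"
    and "(\<integral>t. (\<Sum>j\<in>{1..n}. of_real (q j t) * (expV k (of_real p) j t * cnj (expV l (of_real r) j t))) \<partial>lborel)
      = (if k = l then 1 / of_real (p + r) else 0)"
proof -
  let ?f = "\<lambda>t. 1 / (S (of_real t) * (of_real p + K k (of_real t)) * (of_real r + K l (of_real t)))"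
  define h where "h t = (if k = l then c k * Im (K k (of_real t)) / ((c k * p\<^sup>2 - a k + t) * (c k * r\<^sup>2 - a k + t)) else 0)" for t
  have ck: "0 < c k" by (rule c_pos[OF k])
  have h_eq: "h t = (if k = l then indicator {a k<..} t *\<^sub>R (c k * sqrt ((t - a k) / c k) / ((c k * p\<^sup>2 - a k + t) * (c k * r\<^sup>2 - a k + t))) else 0)" for t
  proof -
    have "Im (K k (of_real t)) = (if a k < t then sqrt ((t - a k) / c k) else 0)"
      using ck by (cases t "a k" rule: linorder_cases) (auto simp: kap_of_real)
    thus ?thesis by (auto simp: h_def indicator_def)
  qed
  have h: "integrable lborel h" "(\<integral>t. h t \<partial>lborel) = (if k = l then pi / (p + r) else 0)"
    using diagonal_integral[OF p r ck, of "a k"]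
    unfolding h_eq[abs_def] set_integrable_def set_lebesgue_integral_def by (cases "k = l"; simp)+
  note f = resolvent_kernel_integral[OF assms]
  have int: "integrable lborel (\<lambda>t. complex_of_real ((- Im (?f t) + h t) / pi))"
    using f(1) h(1) by (intro integrable_of_real integrable_divide Bochner_Integration.integrable_add integrable_minus integrable_Im)
  have AE: "AE t in lborel. (\<Sum>j\<in>{1..n}. of_real (q j t) * (expV k (of_real p) j t * cnj (expV l (of_real r) j t)))
      = complex_of_real ((- Im (?f t) + h t) / pi)"
    using AE_lborel_singleton[of "a k"]
  proof eventually_elim
    case (elim t)
    show ?case unfolding h_def by (rule expV_density[OF assms elim])
  qed
  have meas: "(\<lambda>t. \<Sum>j\<in>{1..n}. of_real (q j t) * (expV k (of_real p) j t * cnj (expV l (of_real r) j t))) \<in> borel_measurable lborel"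
  proof (intro borel_measurable_sum)
    fix j assume j: "j \<in> {1..n}"
    note [measurable] = qfun_measurable[OF j] expV_measurable[OF k] expV_measurable[OF l]
    show "(\<lambda>t. of_real (q j t) * (expV k (of_real p) j t * cnj (expV l (of_real r) j t))) \<in> borel_measurable lborel" by measurable
  qed
  show "integrable lborel (\<lambda>t. \<Sum>j\<in>{1..n}. of_real (q j t) * (expV k (of_real p) j t * cnj (expV l (of_real r) j t)))"
    using integrable_cong_AE[OF meas borel_measurable_integrable[OF int] AE] int by blast
  have "(\<integral>t. (\<Sum>j\<in>{1..n}. of_real (q j t) * (expV k (of_real p) j t * cnj (expV l (of_real r) j t))) \<partial>lborel)
      = (\<integral>t. complex_of_real ((- Im (?f t) + h t) / pi) \<partial>lborel)"
    by (rule integral_cong_AE[OF meas borel_measurable_integrable[OF int] AE])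
  also have "\<dots> = complex_of_real (\<integral>t. (- Im (?f t) + h t) / pi \<partial>lborel)" by (rule integral_complex_of_real)
  also have "(\<integral>t. (- Im (?f t) + h t) / pi \<partial>lborel) = (- Im (\<integral>t. ?f t \<partial>lborel) + (\<integral>t. h t \<partial>lborel)) / pi"
    using f(1) h(1) by (simp add: integral_Im)
  also have "\<dots> = (if k = l then 1 / (p + r) else 0)" using f(2) h(2) by simp
  finally show "(\<integral>t. (\<Sum>j\<in>{1..n}. of_real (q j t) * (expV k (of_real p) j t * cnj (expV l (of_real r) j t))) \<partial>lborel)
      = (if k = l then 1 / of_real (p + r) else 0)" by simp
qed

end

section \<open>The transform of exponentials and test functions\<close>

definition inn :: "nat \<Rightarrow> (nat \<Rightarrow> 'a measure) \<Rightarrow> (nat \<Rightarrow> 'a \<Rightarrow> complex) \<Rightarrow> (nat \<Rightarrow> 'a \<Rightarrow> complex) \<Rightarrow> complex" where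
  "inn n M f g = (\<Sum>k\<in>{1..n}. \<integral>x. f k x * cnj (g k x) \<partial>(M k))"

lemma sqint_sum:
  assumes "finite E" "\<And>e. e \<in> E \<Longrightarrow> sqint M (g e)"
  shows "sqint M (\<lambda>x. \<Sum>e\<in>E. A e * g e x)"
  using assms by (induction E rule: finite_induct) (auto intro!: sqint_add sqint_scale)

text \<open>The norm of a linear combination depends only on the Gram matrix of its members, so
  families with equal Gram matrices have isometric spans.\<close>

lemma nrm_sum_square:
  assumes E: "finite E" and g: "\<And>e. e \<in> E \<Longrightarrow> sqints n M (g e)"
  shows "complex_of_real ((nrm n M (\<lambda>k x. \<Sum>e\<in>E. A e * g e k x))\<^sup>2)
    = (\<Sum>e\<in>E. \<Sum>e'\<in>E. A e * cnj (A e') * inn n M (g e) (g e'))"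
proof -
  have gk: "sqint (M k) (g e k)" if "e \<in> E" "k \<in> {1..n}" for e k using g that by (auto simp: sqints_def)
  have "complex_of_real (\<integral>x. (cmod (\<Sum>e\<in>E. A e * g e k x))\<^sup>2 \<partial>(M k))
      = (\<Sum>e\<in>E. \<Sum>e'\<in>E. A e * cnj (A e') * (\<integral>x. g e k x * cnj (g e' k x) \<partial>(M k)))" if k: "k \<in> {1..n}" for k
  proof -
    have "complex_of_real (\<integral>x. (cmod (\<Sum>e\<in>E. A e * g e k x))\<^sup>2 \<partial>(M k))
      = (\<integral>x. complex_of_real ((cmod (\<Sum>e\<in>E. A e * g e k x))\<^sup>2) \<partial>(M k))"
      by (rule integral_complex_of_real[symmetric])
    also have "\<dots> = (\<integral>x. (\<Sum>e\<in>E. \<Sum>e'\<in>E. A e * cnj (A e') * (g e k x * cnj (g e' k x))) \<partial>(M k))"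
      unfolding complex_norm_square cnj_sum sum_product complex_cnj_mult
      by (intro Bochner_Integration.integral_cong sum.cong refl) (simp only: mult_ac)
    also have "\<dots> = (\<Sum>e\<in>E. \<Sum>e'\<in>E. A e * cnj (A e') * (\<integral>x. g e k x * cnj (g e' k x) \<partial>(M k)))"
      using sqint_cnj_integrable[OF gk gk] k by (simp add: Bochner_Integration.integral_sum)
    finally show ?thesis .
  qed
  hence "complex_of_real ((nrm n M (\<lambda>k x. \<Sum>e\<in>E. A e * g e k x))\<^sup>2)
    = (\<Sum>k\<in>{1..n}. \<Sum>e\<in>E. \<Sum>e'\<in>E. A e * cnj (A e') * (\<integral>x. g e k x * cnj (g e' k x) \<partial>(M k)))"
    unfolding nrm_square of_real_sum by (intro sum.cong refl)
  also have "\<dots> = (\<Sum>e\<in>E. \<Sum>e'\<in>E. \<Sum>k\<in>{1..n}. A e * cnj (A e') * (\<integral>x. g e k x * cnj (g e' k x) \<partial>(M k)))"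
    by (subst sum.swap, intro sum.cong refl, rule sum.swap)
  finally show ?thesis unfolding inn_def sum_distrib_left .
qed

lemma nrm_add_scale_square:
  assumes "sqints n M f" "sqints n M g"
  shows "(nrm n M (\<lambda>k x. f k x + z * g k x))\<^sup>2
    = (nrm n M f)\<^sup>2 + 2 * Re (cnj z * inn n M f g) + (cmod z)\<^sup>2 * (nrm n M g)\<^sup>2"
proof -
  have "(\<integral>x. (cmod (f k x + z * g k x))\<^sup>2 \<partial>(M k)) = (\<integral>x. (cmod (f k x))\<^sup>2 \<partial>(M k))
     + 2 * Re (cnj z * (\<integral>x. f k x * cnj (g k x) \<partial>(M k))) + (cmod z)\<^sup>2 * (\<integral>x. (cmod (g k x))\<^sup>2 \<partial>(M k))"
    if k: "k \<in> {1..n}" for k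
  proof -
    have int: "integrable (M k) (\<lambda>x. (cmod (f k x))\<^sup>2)" "integrable (M k) (\<lambda>x. (cmod (g k x))\<^sup>2)"
      "integrable (M k) (\<lambda>x. f k x * cnj (g k x))"
      using assms k by (auto simp: sqints_def sqint_def intro: sqint_cnj_integrable)
    have "(cmod (f k x + z * g k x))\<^sup>2 = (cmod (f k x))\<^sup>2 + 2 * Re (cnj z * (f k x * cnj (g k x))) + (cmod z)\<^sup>2 * (cmod (g k x))\<^sup>2" for x
      unfolding cmod_power2 by (simp add: power2_eq_square algebra_simps)
    hence "(\<integral>x. (cmod (f k x + z * g k x))\<^sup>2 \<partial>(M k)) = (\<integral>x. (cmod (f k x))\<^sup>2 + 2 * Re (cnj z * (f k x * cnj (g k x))) + (cmod z)\<^sup>2 * (cmod (g k x))\<^sup>2 \<partial>(M k))"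
      by simp
    also have "\<dots> = (\<integral>x. (cmod (f k x))\<^sup>2 \<partial>(M k)) + 2 * (\<integral>x. Re (cnj z * (f k x * cnj (g k x))) \<partial>(M k)) + (cmod z)\<^sup>2 * (\<integral>x. (cmod (g k x))\<^sup>2 \<partial>(M k))"
      using int by (simp del: Re_complex_of_real times_complex.sel)
    also have "(\<integral>x. Re (cnj z * (f k x * cnj (g k x))) \<partial>(M k)) = Re (cnj z * (\<integral>x. f k x * cnj (g k x) \<partial>(M k)))"
      using int by (subst integral_Re) auto
    finally show ?thesis .
  qed
  thus ?thesis
    unfolding nrm_square inn_def
    by (simp add: sum.distrib sum_distrib_left sum_subtractf)
qed

section \<open>The measures of the two spaces and integrals of exponentials\<close>

lemma sets_MN [measurable_cong, simp]: "sets MN = sets borel" by (simp add: MN_def)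
lemma space_MN [simp]: "space MN = UNIV" by (simp add: MN_def)
lemma sets_Mq [measurable_cong, simp]: "sets (Mq n c a k) = sets borel" by (simp add: Mq_def)
lemma space_Mq [simp]: "space (Mq n c a k) = UNIV" by (simp add: Mq_def)

lemma MN_density: "MN = density lborel (\<lambda>x. ennreal (indicator {0<..} x))"
  by (simp add: MN_def ennreal_indicator)

lemma integrable_MN_iff:
  fixes g :: "real \<Rightarrow> 'b::{banach, second_countable_topology}"
  assumes "g \<in> borel_measurable borel"
  shows "integrable MN g \<longleftrightarrow> integrable lborel (\<lambda>x. indicator {0<..} x *\<^sub>R g x)"
  unfolding MN_density using assms by (intro integrable_density) auto

lemma integral_MN:
  fixes g :: "real \<Rightarrow> 'b::{banach, second_countable_topology}"
  assumes "g \<in> borel_measurable borel"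
  shows "integral\<^sup>L MN g = (\<integral>x. indicator {0<..} x *\<^sub>R g x \<partial>lborel)"
  unfolding MN_density using assms by (intro integral_density) auto

lemma AE_MN_iff: "(AE x in MN. P x) \<longleftrightarrow> (AE x in lborel. 0 < x \<longrightarrow> P x)"
  unfolding MN_def by (subst AE_density) (auto simp: indicator_def)

lemma AE_MN_I: "(\<And>x. 0 < x \<Longrightarrow> P x) \<Longrightarrow> AE x in MN. P x"
  by (simp add: AE_MN_iff)

lemma inH_eq: "inH n f \<longleftrightarrow> sqints n (\<lambda>_. MN) f"
  by (simp add: inH_def inL2N_def sqints_def sqint_def cong: measurable_cong_sets)

lemma normH_eq: "normH n f = nrm n (\<lambda>_. MN) f"
  by (simp add: normH_def nrm_def)

lemma inLq_eq: "inLq n c a f \<longleftrightarrow> sqints n (Mq n c a) f"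
  by (simp add: inLq_def sqints_def sqint_def cong: measurable_cong_sets)

lemma normq_eq: "normq n c a f = nrm n (Mq n c a) f"
  by (simp add: normq_def nrm_def)

lemma integral_MN_FTC:
  fixes F f :: "real \<Rightarrow> complex"
  assumes deriv: "\<And>x. 0 \<le> x \<Longrightarrow> (F has_vector_derivative f x) (at x)"
    and cont: "continuous_on UNIV f" and int: "integrable MN f"
    and lim: "(\<lambda>m. F (real m)) \<longlonglongrightarrow> L"
  shows "integral\<^sup>L MN f = L - F 0"
proof -
  have meas [measurable]: "f \<in> borel_measurable borel" using cont by (rule borel_measurable_continuous_onI)
  have int': "integrable lborel (\<lambda>x. indicator {0<..} x *\<^sub>R f x)" using int integrable_MN_iff[OF meas] by simp
  have AE0: "AE x in lborel. x \<noteq> (0::real)" by (rule AE_lborel_singleton)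
  have "(\<lambda>m. \<integral>x. indicator {0..real m} x *\<^sub>R f x \<partial>lborel) \<longlonglongrightarrow> (\<integral>x. indicator {0<..} x *\<^sub>R f x \<partial>lborel)"
  proof (rule integral_dominated_convergence[OF _ _ integrable_norm[OF int']])
    show "AE x in lborel. (\<lambda>m. indicator {0..real m} x *\<^sub>R f x) \<longlonglongrightarrow> indicator {0<..} x *\<^sub>R f x"
      using AE0
    proof eventually_elim
      case (elim x)
      obtain m0 where m0: "x \<le> real m0" using real_arch_simple by blast
      have "indicator {0..real m} x *\<^sub>R f x = indicator {0<..} x *\<^sub>R f x" if "m \<ge> m0" for m
        using m0 that elim by (auto simp: indicator_def)
      thus ?case using eventually_sequentially by (intro tendsto_eventually) blast
    qed
    show "AE x in lborel. norm (indicator {0..real m} x *\<^sub>R f x) \<le> norm (indicator {0<..} x *\<^sub>R f x)" for m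
      using AE0 by eventually_elim (auto simp: indicator_def)
  qed measurable
  moreover have "(\<integral>x. indicator {0..real m} x *\<^sub>R f x \<partial>lborel) = F (real m) - F 0" for m
    by (rule integral_FTC_atLeastAtMost)
       (auto intro: continuous_on_subset[OF cont] has_vector_derivative_at_within deriv)
  ultimately have "(\<lambda>m. F (real m) - F 0) \<longlonglongrightarrow> integral\<^sup>L MN f" by (simp add: integral_MN[OF meas])
  moreover have "(\<lambda>m. F (real m) - F 0) \<longlonglongrightarrow> L - F 0" by (intro tendsto_intros lim)
  ultimately show ?thesis by (rule LIMSEQ_unique)
qed

lemma integrable_exp_real:
  fixes b :: real
  assumes b: "0 < b"
  shows "integrable MN (\<lambda>x. exp (- (b * x)))"
proof -
  have "set_integrable lborel (einterval 0 \<infinity>) (\<lambda>x. exp (- (b * x)))"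
  proof (rule interval_integral_FTC_nonneg(1))
    show "((\<lambda>x. - exp (- (b * x)) / b) has_real_derivative exp (- (b * x))) (at x)" for x
      using b by (auto intro!: derivative_eq_intros)
    have "((\<lambda>x. - exp (- (b * x)) / b) \<longlongrightarrow> - exp (- (b * 0)) / b) (at_right 0)"
      using b by (intro tendsto_intros) auto
    thus "(((\<lambda>x. - exp (- (b * x)) / b) \<circ> real_of_ereal) \<longlongrightarrow> - exp (- (b * 0)) / b) (at_right 0)"
      unfolding zero_ereal_def ereal_tendsto_simps .
    have "filterlim (\<lambda>x. b * x) at_top at_top"
      using b by (intro filterlim_tendsto_pos_mult_at_top[OF tendsto_const] filterlim_ident)
    hence "((\<lambda>x. exp (- (b * x))) \<longlongrightarrow> 0) at_top"
      by (intro filterlim_compose[OF exp_at_bot]) (simp add: filterlim_uminus_at_bot)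
    hence "((\<lambda>x. - exp (- (b * x)) / b) \<longlongrightarrow> - 0 / b) at_top"
      using b by (intro tendsto_intros) auto
    thus "(((\<lambda>x. - exp (- (b * x)) / b) \<circ> real_of_ereal) \<longlongrightarrow> 0) (at_left \<infinity>)"
      unfolding ereal_tendsto_simps by simp
  qed (auto intro!: continuous_intros)
  thus ?thesis by (subst integrable_MN_iff) (auto simp: set_integrable_def zero_ereal_def einterval_eq)
qed

lemma integral_exp:
  fixes w :: complex
  assumes w: "0 < Re w"
  shows "integrable MN (\<lambda>x. exp (- (w * of_real x)))" "(\<integral>x. exp (- (w * of_real x)) \<partial>MN) = 1 / w"
proof -
  have meas: "(\<lambda>x. exp (- (w * of_real x))) \<in> borel_measurable borel"
    by (intro borel_measurable_continuous_onI continuous_intros)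
  show int: "integrable MN (\<lambda>x. exp (- (w * of_real x)))"
    by (rule Bochner_Integration.integrable_bound[OF integrable_exp_real[OF w]])
       (use meas in \<open>auto cong: measurable_cong_sets\<close>)
  have w0: "w \<noteq> 0" using w by auto
  have "(\<integral>x. exp (- (w * of_real x)) \<partial>MN) = 0 - (- exp (- (w * of_real 0)) / w)"
  proof (rule integral_MN_FTC[OF _ _ int])
    fix x
    have "((\<lambda>z. - exp (- (w * z)) / w) has_field_derivative exp (- (w * of_real x))) (at (of_real x))"
      using w0 by (auto intro!: derivative_eq_intros)
    thus "((\<lambda>x. - exp (- (w * of_real x)) / w) has_vector_derivative exp (- (w * of_real x))) (at x)"
      by (rule has_vector_derivative_real_field)
    have "filterlim (\<lambda>x. Re w * real x) at_top sequentially"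
      using w by (intro filterlim_tendsto_pos_mult_at_top[OF tendsto_const] filterlim_real_sequentially)
    hence "(\<lambda>m. exp (- (Re w * real m))) \<longlonglongrightarrow> 0"
      by (intro filterlim_compose[OF exp_at_bot]) (simp add: filterlim_uminus_at_bot)
    hence "(\<lambda>m. exp (- (w * of_real (real m)))) \<longlonglongrightarrow> 0"
      by (intro tendsto_norm_zero_cancel[of "\<lambda>m. exp (- (w * of_real (real m)))"]) (simp add: norm_exp_eq_Re)
    hence "(\<lambda>m. - exp (- (w * of_real (real m))) / w) \<longlonglongrightarrow> - 0 / w"
      using w0 by (intro tendsto_intros) auto
    thus "(\<lambda>m. - exp (- (w * of_real (real m))) / w) \<longlonglongrightarrow> 0" by simp
  qed (intro continuous_intros)
  thus "(\<integral>x. exp (- (w * of_real x)) \<partial>MN) = 1 / w" by simp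
qed

definition edge_exp :: "nat \<Rightarrow> complex \<Rightarrow> nat \<Rightarrow> real \<Rightarrow> complex" where
  "edge_exp k p i x = (if i = k then exp (- (p * of_real x)) else 0)"

text \<open>Integrability makes \<open>Vop\<close> an absolutely convergent integral for each t
  above the threshold; square integrability places the function in H.\<close>

definition L12 :: "nat \<Rightarrow> (nat \<Rightarrow> real \<Rightarrow> complex) \<Rightarrow> bool" where
  "L12 n f \<longleftrightarrow> (\<forall>k\<in>{1..n}. f k \<in> borel_measurable borel \<and> integrable MN (f k) \<and> integrable MN (\<lambda>x. (cmod (f k x))\<^sup>2))"

definition L12_conv :: "nat \<Rightarrow> (nat \<Rightarrow> nat \<Rightarrow> real \<Rightarrow> complex) \<Rightarrow> (nat \<Rightarrow> real \<Rightarrow> complex) \<Rightarrow> bool" where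
  "L12_conv n F f \<longleftrightarrow> (\<forall>k\<in>{1..n}. (\<lambda>m. \<integral>x. cmod (F m k x - f k x) \<partial>MN) \<longlonglongrightarrow> 0
     \<and> (\<lambda>m. \<integral>x. (cmod (F m k x - f k x))\<^sup>2 \<partial>MN) \<longlonglongrightarrow> 0)"

lemma L12_sqints: "L12 n f \<Longrightarrow> sqints n (\<lambda>_. MN) f"
  by (auto simp: L12_def sqints_def sqint_def cong: measurable_cong_sets)

lemma L12_add_scale:
  assumes "L12 n f" "L12 n g"
  shows "L12 n (\<lambda>k x. f k x + z * g k x)"
  using assms sqints_add[OF L12_sqints sqints_scale[OF L12_sqints]]
  unfolding L12_def sqints_def sqint_def by (auto 4 4 cong: measurable_cong_sets)

lemma L12_diff: "L12 n f \<Longrightarrow> L12 n g \<Longrightarrow> L12 n (\<lambda>k x. f k x - g k x)"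
  using L12_add_scale[of n f g "-1"] by simp

lemma L12_zero [simp]: "L12 n (\<lambda>k x. 0)" by (simp add: L12_def)

lemma L12_conv_nrm: "L12_conv n F f \<Longrightarrow> (\<lambda>m. nrm n (\<lambda>_. MN) (\<lambda>k x. F m k x - f k x)) \<longlonglongrightarrow> 0"
  unfolding nrm_tendsto0_iff by (simp add: L12_conv_def)

lemma L12_edge_exp:
  assumes "0 < Re p"
  shows "L12 n (edge_exp k p)"
proof -
  have meas: "(\<lambda>x. exp (- (p * of_real x))) \<in> borel_measurable borel"
    by (intro borel_measurable_continuous_onI continuous_intros)
  have "integrable MN (\<lambda>x. exp (- (2 * Re p * x)))" using assms by (intro integrable_exp_real) auto
  moreover have "(cmod (exp (- (p * of_real x))))\<^sup>2 = exp (- (2 * Re p * x))" for x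
    by (simp add: norm_exp_eq_Re flip: exp_double)
  moreover have "edge_exp k p i = (if i = k then (\<lambda>x. exp (- (p * of_real x))) else (\<lambda>x. 0))" for i
    by (auto simp: edge_exp_def)
  ultimately show ?thesis using meas integral_exp(1)[OF assms] by (auto simp: L12_def simp del: norm_exp_eq_Re)
qed

context star
begin

abbreviation V where "V \<equiv> Vop n c a"
abbreviation nH where "nH \<equiv> nrm n (\<lambda>_. MN)"
abbreviation nq where "nq \<equiv> nrm n (Mq n c a)"

lemma integrable_Mq_iff:
  fixes g :: "real \<Rightarrow> 'b::{banach, second_countable_topology}"
  assumes "k \<in> {1..n}" "g \<in> borel_measurable borel"
  shows "integrable (Mq n c a k) g \<longleftrightarrow> integrable lborel (\<lambda>t. q k t *\<^sub>R g t)"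
  unfolding Mq_def using assms qfun_measurable[OF assms(1)] qfun_nonneg[OF assms(1)]
  by (intro integrable_density) auto

lemma integral_Mq:
  fixes g :: "real \<Rightarrow> 'b::{banach, second_countable_topology}"
  assumes "k \<in> {1..n}" "g \<in> borel_measurable borel"
  shows "integral\<^sup>L (Mq n c a k) g = (\<integral>t. q k t *\<^sub>R g t \<partial>lborel)"
  unfolding Mq_def using assms qfun_measurable[OF assms(1)] qfun_nonneg[OF assms(1)]
  by (intro integral_density) auto

text \<open>The weight vanishes up to \<open>a k\<close>, so a formula proved above the threshold
  holds almost everywhere.\<close>

lemma AE_Mq_I:
  assumes "k \<in> {1..n}" "\<And>t. a k < t \<Longrightarrow> P t"
  shows "AE t in Mq n c a k. P t"
proof -
  have [measurable]: "q k \<in> borel_measurable borel" by (rule qfun_measurable[OF assms(1)])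
  have "q k t \<le> 0" if "\<not> P t" for t using assms(2) that by (auto simp: qfun_def)
  thus ?thesis unfolding Mq_def by (subst AE_density) (auto simp: ennreal_neg not_less[symmetric] intro!: AE_I2)
qed

lemma Fm_measurable2:
  assumes "k \<in> {1..n}" "j \<in> {1..n}"
  shows "Fm n c a (of_real t) k j \<in> borel_measurable borel"
  using measurable_compose[OF measurable_Pair1' Fm_measurable[OF assms], of t] by simp

lemma Vop_integrand:
  assumes k: "k \<in> {1..n}" and j: "j \<in> {1..n}" and t: "a k < t"
    and f: "f \<in> borel_measurable borel" "integrable MN f"
  shows "integrable MN (\<lambda>x. f x * cnj (Fm n c a (of_real t) k j x))"
    and "cmod (\<integral>x. f x * cnj (Fm n c a (of_real t) k j x) \<partial>MN)
      \<le> (1 + cmod (S (of_real t)) / (c k * cmod (K k (of_real t)))) * (\<integral>x. cmod (f x) \<partial>MN)"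
proof -
  let ?B = "1 + cmod (S (of_real t)) / (c k * cmod (K k (of_real t)))"
  note [measurable] = f(1) Fm_measurable2[OF k j, of t]
  have B: "cmod (f x * cnj (Fm n c a (of_real t) k j x)) \<le> ?B * cmod (f x)" if "0 < x" for x
    using mult_right_mono[OF cmod_Fm_le[OF k j t, of x] norm_ge_zero[of "f x"]] that by (simp add: norm_mult mult.commute)
  have c0: "0 < c k" by (rule c_pos[OF k])
  have int: "integrable MN (\<lambda>x. ?B * cmod (f x))" using f(2) by (intro integrable_mult_right integrable_norm)
  show int2: "integrable MN (\<lambda>x. f x * cnj (Fm n c a (of_real t) k j x))"
  proof (rule Bochner_Integration.integrable_bound[OF int])
    show "AE x in MN. norm (f x * cnj (Fm n c a (of_real t) k j x)) \<le> norm (?B * cmod (f x))"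
      unfolding real_norm_def by (rule AE_MN_I) (rule order_trans[OF B abs_ge_self])
  qed measurable
  have "cmod (\<integral>x. f x * cnj (Fm n c a (of_real t) k j x) \<partial>MN) \<le> (\<integral>x. cmod (f x * cnj (Fm n c a (of_real t) k j x)) \<partial>MN)"
    by (rule integral_norm_bound)
  also have "\<dots> \<le> (\<integral>x. ?B * cmod (f x) \<partial>MN)"
    by (rule integral_mono_AE[OF integrable_norm[OF int2] int]) (rule AE_MN_I, rule B)
  finally show "cmod (\<integral>x. f x * cnj (Fm n c a (of_real t) k j x) \<partial>MN) \<le> ?B * (\<integral>x. cmod (f x) \<partial>MN)" by simp
qed

lemma Vop_add_scale:
  assumes k: "k \<in> {1..n}" and t: "a k < t" and f: "L12 n f" and g: "L12 n g"
  shows "V (\<lambda>k x. f k x + z * g k x) k t = V f k t + z * V g k t"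
proof -
  have "(\<integral>x. (f j x + z * g j x) * cnj (Fm n c a (of_real t) k j x) \<partial>MN)
    = (\<integral>x. f j x * cnj (Fm n c a (of_real t) k j x) \<partial>MN) + z * (\<integral>x. g j x * cnj (Fm n c a (of_real t) k j x) \<partial>MN)"
    if j: "j \<in> {1..n}" for j
  proof -
    have "(\<integral>x. (f j x + z * g j x) * cnj (Fm n c a (of_real t) k j x) \<partial>MN)
      = (\<integral>x. f j x * cnj (Fm n c a (of_real t) k j x) + z * (g j x * cnj (Fm n c a (of_real t) k j x)) \<partial>MN)"
      by (simp add: algebra_simps)
    thus ?thesis using Vop_integrand(1)[OF k j t] f g j by (simp add: L12_def)
  qed
  thus ?thesis unfolding Vop_def by (simp add: sum.distrib sum_distrib_left)
qed

lemma Vop_diff: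
  assumes "k \<in> {1..n}" "a k < t" "L12 n f" "L12 n g"
  shows "V (\<lambda>k x. f k x - g k x) k t = V f k t - V g k t"
  using Vop_add_scale[OF assms, of "-1"] by simp

text \<open>Both conclusions are proved together: splitting off a summand under the integral
  requires integrability of the remaining sum.\<close>

lemma Vop_sum:
  assumes k: "k \<in> {1..n}" and t: "a k < t" and E: "finite E" "\<And>e. e \<in> E \<Longrightarrow> L12 n (g e)"
  shows "L12 n (\<lambda>k x. \<Sum>e\<in>E. A e * g e k x) \<and> V (\<lambda>k x. \<Sum>e\<in>E. A e * g e k x) k t = (\<Sum>e\<in>E. A e * V (g e) k t)"
  using E
proof (induction E rule: finite_induct)
  case empty
  show ?case by (simp add: Vop_def)
next
  case (insert e E)
  hence IH: "L12 n (\<lambda>k x. \<Sum>e\<in>E. A e * g e k x)" "V (\<lambda>k x. \<Sum>e\<in>E. A e * g e k x) k t = (\<Sum>e\<in>E. A e * V (g e) k t)"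
    and ge: "L12 n (g e)" by auto
  have eq: "(\<lambda>k x. \<Sum>e\<in>insert e E. A e * g e k x) = (\<lambda>k x. (\<Sum>e\<in>E. A e * g e k x) + A e * g e k x)"
    using insert by (simp add: add.commute)
  show ?case unfolding eq using L12_add_scale[OF IH(1) ge, of "A e"] Vop_add_scale[OF k t IH(1) ge, of "A e"] IH(2) insert
    by (simp add: add.commute)
qed

lemma Vop_measurable:
  assumes k: "k \<in> {1..n}" and f: "\<And>j. j \<in> {1..n} \<Longrightarrow> f j \<in> borel_measurable borel"
  shows "V f k \<in> borel_measurable borel"
proof -
  have "(\<lambda>t. \<Sum>j\<in>{1..n}. \<integral>x. f j x * cnj (Fm n c a (of_real t) k j x) \<partial>MN) \<in> borel_measurable borel"
  proof (intro borel_measurable_sum)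
    fix j assume j: "j \<in> {1..n}"
    note [measurable] = f[OF j] Fm_measurable[OF k j] Fm_measurable2[OF k j]
    have eq: "(\<integral>x. f j x * cnj (Fm n c a (of_real t) k j x) \<partial>MN)
        = (\<integral>x. indicator {0<..} x *\<^sub>R (f j x * cnj (Fm n c a (of_real t) k j x)) \<partial>lborel)" for t
      by (rule integral_MN) measurable
    show "(\<lambda>t. \<integral>x. f j x * cnj (Fm n c a (of_real t) k j x) \<partial>MN) \<in> borel_measurable borel"
      unfolding eq by (rule lborel.borel_measurable_lebesgue_integral) measurable
  qed
  thus ?thesis unfolding Vop_def[abs_def] .
qed

lemma Vop_edge_exp:
  assumes k: "k \<in> {1..n}" and j: "j \<in> {1..n}" and t: "a j < t" and p: "0 < Re p"
  shows "V (edge_exp k p) j t = expV k p j t"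
proof -
  let ?T = "complex_of_real t"
  have ne: "t \<noteq> a j" using t by simp
  have "V (edge_exp k p) j t = (\<Sum>i\<in>{1..n}. if i = k then (\<integral>x. exp (- (p * of_real x)) * cnj (Fm n c a ?T j k x) \<partial>MN) else 0)"
    unfolding Vop_def by (intro sum.cong refl) (auto simp: edge_exp_def)
  also have "\<dots> = (\<integral>x. exp (- (p * of_real x)) * cnj (Fm n c a ?T j k x) \<partial>MN)" using k by simp
  also have "\<dots> = expV k p j t"
  proof (cases "k = j")
    case False
    have "exp (- (p * of_real x)) * cnj (Fm n c a ?T j k x) = exp (- ((p + cnj (K k ?T)) * of_real x))" for x
      unfolding Fm_eq[OF j k ne] using False by (simp add: exp_cnj exp_add[symmetric] algebra_simps)
    thus ?thesis using integral_exp(2)[of "p + cnj (K k ?T)"] p Re_kap_nonneg[of c a k ?T] False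
      by (simp add: expV_def add_pos_nonneg)
  next
    case True
    have cj: "0 < c j" by (rule c_pos[OF j])
    define U where "U = cnj (K j ?T)"
    have U0: "U \<noteq> 0" using kap_nonzero[OF j, of ?T] ne by (simp add: U_def)
    \<comment> \<open>Above the threshold \<open>U\<close> is purely imaginary, so
      \<open>exp (U x)\<close> does not spoil integrability: \<open>p - U\<close> and
      \<open>p + U\<close> both have real part \<open>Re p\<close>.\<close>
    have ReU: "Re U = 0" using t cj by (simp add: U_def kap_of_real)
    have pm: "0 < Re (p - U)" "0 < Re (p + U)" using p ReU by auto
    have nz: "p - U \<noteq> 0" "p + U \<noteq> 0" using pm by (metis less_irrefl zero_complex.sel(1))+
    have cU: "of_real (c j) * U\<^sup>2 = of_real (a j) - ?T"
    proof -
      have "U\<^sup>2 = cnj ((K j ?T)\<^sup>2)" by (simp add: U_def)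
      thus ?thesis unfolding kap_square using cj by simp
    qed
    define A where "A = cnj (S ?T) / (2 * of_real (c j) * U)"
    have "exp (- (p * of_real x)) * cnj (Fm n c a ?T j k x) = exp (- ((p + U) * of_real x))
        + A * (exp (- ((p - U) * of_real x)) - exp (- ((p + U) * of_real x)))" for x
    proof -
      have e1: "exp (- ((p + U) * of_real x)) = exp (- (p * of_real x)) * exp (- (U * of_real x))"
        and e2: "exp (- ((p - U) * of_real x)) = exp (- (p * of_real x)) * exp (U * of_real x)"
        by (simp_all add: algebra_simps flip: exp_add)
      have F: "cnj (Fm n c a ?T j k x) = exp (- (U * of_real x)) + A * (exp (U * of_real x) - exp (- (U * of_real x)))"
        unfolding Fm_eq[OF j k ne] using True by (simp add: exp_cnj U_def A_def)
      show ?thesis unfolding e1 e2 F by (simp add: algebra_simps)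
    qed
    hence "(\<integral>x. exp (- (p * of_real x)) * cnj (Fm n c a ?T j k x) \<partial>MN) = 1 / (p + U) + A * (1 / (p - U) - 1 / (p + U))"
      using integral_exp[OF pm(1)] integral_exp[OF pm(2)] by simp
    also have "1 / (p - U) - 1 / (p + U) = 2 * U / (p\<^sup>2 - U\<^sup>2)"
    proof -
      have "1 * (p + U) - 1 * (p - U) = 2 * U" "(p - U) * (p + U) = p\<^sup>2 - U\<^sup>2"
        by (simp_all add: algebra_simps power2_eq_square)
      thus ?thesis by (simp only: diff_frac_eq[OF nz])
    qed
    also have "A * (2 * U / (p\<^sup>2 - U\<^sup>2)) = cnj (S ?T) / (of_real (c j) * (p\<^sup>2 - U\<^sup>2))"
      using U0 by (simp add: A_def)
    also have "of_real (c j) * (p\<^sup>2 - U\<^sup>2) = of_real (c j) * p\<^sup>2 - of_real (a j) + ?T"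
      using cU by (simp add: algebra_simps)
    finally show ?thesis using True by (simp add: expV_def U_def)
  qed
  finally show ?thesis .
qed

end

lemma sqints_cong_AE:
  assumes "sqints n M g" "\<And>k. k \<in> {1..n} \<Longrightarrow> f k \<in> borel_measurable (M k)"
    "\<And>k. k \<in> {1..n} \<Longrightarrow> AE x in M k. f k x = g k x"
  shows "sqints n M f"
  unfolding sqints_def sqint_def
proof (intro ballI conjI assms(2))
  fix k assume k: "k \<in> {1..n}"
  have g: "integrable (M k) (\<lambda>x. (cmod (g k x))\<^sup>2)" using assms(1) k by (auto simp: sqints_def sqint_def)
  note [measurable] = assms(2)[OF k]
  have "integrable (M k) (\<lambda>x. (cmod (f k x))\<^sup>2) \<longleftrightarrow> integrable (M k) (\<lambda>x. (cmod (g k x))\<^sup>2)"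
  proof (rule integrable_cong_AE)
    show "AE x in M k. (cmod (f k x))\<^sup>2 = (cmod (g k x))\<^sup>2" using assms(3)[OF k] by auto
  qed (use g in \<open>auto intro: borel_measurable_integrable\<close>)
  with g show "integrable (M k) (\<lambda>x. (cmod (f k x))\<^sup>2)" by simp
qed

text \<open>One weighted supremum bound controls the L^1 and the L^2 norm simultaneously; for this
  reason approximations are measured against \<open>exp (- x)\<close>.\<close>

lemma integrable_exp_bound:
  fixes f :: "real \<Rightarrow> complex"
  assumes f: "f \<in> borel_measurable borel" and C: "\<And>x. 0 < x \<Longrightarrow> cmod (f x) \<le> C * exp (- x)" "0 \<le> C"
  shows "integrable MN f" "(\<integral>x. cmod (f x) \<partial>MN) \<le> C"
    "integrable MN (\<lambda>x. (cmod (f x))\<^sup>2)" "(\<integral>x. (cmod (f x))\<^sup>2 \<partial>MN) \<le> C\<^sup>2"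
proof -
  have f' [measurable]: "f \<in> borel_measurable MN" using f by (simp cong: measurable_cong_sets)
  have e: "integrable MN (\<lambda>x. C * exp (- x))" "(\<integral>x. C * exp (- x) \<partial>MN) = C"
  proof -
    have "(\<integral>x. complex_of_real (exp (- x)) \<partial>MN) = 1"
      using integral_exp(2)[of 1] by (simp add: exp_of_real flip: of_real_minus)
    hence "(\<integral>x. exp (- x) \<partial>MN) = 1" by (simp only: integral_complex_of_real of_real_eq_1_iff)
    thus "integrable MN (\<lambda>x. C * exp (- x))" "(\<integral>x. C * exp (- x) \<partial>MN) = C"
      using integrable_exp_real[of 1] by auto
  qed
  have b: "AE x in MN. cmod (f x) \<le> C * exp (- x)" by (rule AE_MN_I) (rule C)
  show 1: "integrable MN f"
    by (rule Bochner_Integration.integrable_bound[OF e(1) f'])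
       (use b C(2) in \<open>auto elim!: eventually_mono\<close>)
  show "(\<integral>x. cmod (f x) \<partial>MN) \<le> C"
    using integral_mono_AE[OF integrable_norm[OF 1] e(1) b] unfolding e(2) .
  have b2: "AE x in MN. (cmod (f x))\<^sup>2 \<le> C * (C * exp (- x))"
  proof (rule AE_MN_I)
    fix x :: real assume x: "0 < x"
    have "exp (- x) \<le> 1" using x by simp
    from mult_left_mono[OF this C(2)] have "cmod (f x) \<le> C * 1" using C(1)[OF x] by linarith
    thus "(cmod (f x))\<^sup>2 \<le> C * (C * exp (- x))"
      using mult_mono[OF _ C(1)[OF x], of "cmod (f x)" C] C(2) by (simp add: power2_eq_square)
  qed
  have e2: "integrable MN (\<lambda>x. C * (C * exp (- x)))" using e(1) by (rule integrable_mult_right)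
  show 2: "integrable MN (\<lambda>x. (cmod (f x))\<^sup>2)"
    by (rule Bochner_Integration.integrable_bound[OF e2])
       (use b2 C(2) in \<open>auto elim!: eventually_mono\<close>)
  have "(\<integral>x. C * (C * exp (- x)) \<partial>MN) = C * (\<integral>x. C * exp (- x) \<partial>MN)" by (rule integral_mult_right_zero)
  hence "(\<integral>x. C * (C * exp (- x)) \<partial>MN) = C\<^sup>2" unfolding e(2) power2_eq_square .
  thus "(\<integral>x. (cmod (f x))\<^sup>2 \<partial>MN) \<le> C\<^sup>2"
    using integral_mono_AE[OF 2 e2 b2] by (simp only:)
qed

section \<open>Test functions and their approximation by exponentials\<close>

lemma testN_elim:
  assumes "testN n f" "k \<in> {1..n}"
  obtains \<alpha> \<beta> D where "0 < \<alpha>" "\<alpha> \<le> \<beta>" "\<And>x. f k x \<noteq> 0 \<Longrightarrow> x \<in> {\<alpha>..\<beta>}"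
    "\<And>x. 0 < x \<Longrightarrow> D 0 x = f k x"
    "\<And>m x. 0 < x \<Longrightarrow> (D m has_vector_derivative D (Suc m) x) (at x)"
proof -
  have A: "smooth_on {0<..} (f k)" and B: "\<exists>\<alpha> \<beta>. 0 < \<alpha> \<and> \<alpha> \<le> \<beta> \<and> (\<forall>x. f k x \<noteq> 0 \<longrightarrow> x \<in> {\<alpha>..\<beta>})"
    using assms unfolding testN_def by blast+
  obtain \<alpha> \<beta> where ab: "0 < \<alpha>" "\<alpha> \<le> \<beta>" "\<And>x. f k x \<noteq> 0 \<Longrightarrow> x \<in> {\<alpha>..\<beta>}"
    using B by blast
  obtain D where D: "\<forall>x\<in>{0<..}. D 0 x = f k x"
    "\<forall>m. \<forall>x\<in>{0<..}. (D m has_vector_derivative D (Suc m) x) (at x within {0<..})"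
    using A unfolding smooth_on_def by blast
  have "(D m has_vector_derivative D (Suc m) x) (at x)" if "0 < x" for m x
  proof -
    have x: "x \<in> {0<..}" using that by simp
    show ?thesis using D(2)[rule_format, OF x, of m] unfolding at_within_open[OF x open_greaterThan] .
  qed
  with D(1) ab show ?thesis by (intro that[of \<alpha> \<beta> D]) auto
qed

text \<open>Smoothness is given on the open half-line only. At the points up to 0 continuity comes
  from the support, which starts at a positive \<alpha>.\<close>

lemma testN_continuous:
  assumes "testN n f" "k \<in> {1..n}"
  shows "continuous_on UNIV (f k)"
proof -
  obtain \<alpha> \<beta> D where \<alpha>: "0 < \<alpha>" "\<alpha> \<le> \<beta>" "\<And>x. f k x \<noteq> 0 \<Longrightarrow> x \<in> {\<alpha>..\<beta>}"
    and D: "\<And>x. 0 < x \<Longrightarrow> D 0 x = f k x"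
      "\<And>m x. 0 < x \<Longrightarrow> (D m has_vector_derivative D (Suc m) x) (at x)"
    by (rule testN_elim[OF assms]) blast
  have "isCont (f k) x" for x
  proof (cases "x < \<alpha>")
    case True
    have "\<forall>\<^sub>F y in nhds x. y \<in> {..<\<alpha>}" using True by (intro eventually_nhds_in_open) auto
    hence "\<forall>\<^sub>F y in nhds x. f k y = (\<lambda>_. 0) y"
      by eventually_elim (use \<alpha>(3) in force)
    thus ?thesis using isCont_cong[of "f k" "\<lambda>_. 0" x] by simp
  next
    case False
    hence x: "0 < x" using \<alpha>(1) by simp
    have "isCont (D 0) x"
      using D(2)[OF x, of 0] by (rule has_vector_derivative_continuous)
    moreover have "\<forall>\<^sub>F y in nhds x. y \<in> {0<..}" using x by (intro eventually_nhds_in_open) auto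
    hence "\<forall>\<^sub>F y in nhds x. f k y = D 0 y" by eventually_elim (simp add: D(1))
    ultimately show ?thesis using isCont_cong[of "f k" "D 0" x] by simp
  qed
  thus ?thesis by (simp add: continuous_on_eq_continuous_at)
qed

lemma testN_exp_bound:
  assumes "testN n f" "k \<in> {1..n}"
  shows "\<exists>C\<ge>0. \<forall>x. cmod (f k x) \<le> C * exp (- x)"
proof -
  obtain \<alpha> \<beta> where \<beta>: "\<And>x. f k x \<noteq> 0 \<Longrightarrow> x \<in> {\<alpha>..\<beta>}"
    by (rule testN_elim[OF assms]) blast
  have "bounded (f k ` {\<alpha>..\<beta>})"
    by (intro compact_imp_bounded compact_continuous_image continuous_on_subset[OF testN_continuous[OF assms]]) auto
  then obtain B where B: "\<And>x. x \<in> {\<alpha>..\<beta>} \<Longrightarrow> cmod (f k x) \<le> B" unfolding bounded_iff by blast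
  have "cmod (f k x) \<le> (\<bar>B\<bar> * exp \<beta>) * exp (- x)" for x
  proof (cases "f k x = 0")
    case False
    hence x: "x \<in> {\<alpha>..\<beta>}" by (rule \<beta>)
    have "cmod (f k x) \<le> \<bar>B\<bar> * 1" using B[OF x] by simp
    also have "\<dots> \<le> \<bar>B\<bar> * exp (\<beta> - x)" using x by (intro mult_left_mono) auto
    finally show ?thesis by (simp add: exp_diff exp_minus field_simps)
  qed simp
  thus ?thesis by (intro exI[of _ "\<bar>B\<bar> * exp \<beta>"]) simp
qed

lemma testN_L12: "testN n f \<Longrightarrow> L12 n f"
  unfolding L12_def
proof
  fix k assume f: "testN n f" and k: "k \<in> {1..n}"
  have m: "f k \<in> borel_measurable borel" by (rule borel_measurable_continuous_onI[OF testN_continuous[OF f k]])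
  obtain C where "0 \<le> C" "\<And>x. cmod (f k x) \<le> C * exp (- x)" using testN_exp_bound[OF f k] by blast
  with integrable_exp_bound[OF m, of C] m
  show "f k \<in> borel_measurable borel \<and> integrable MN (f k) \<and> integrable MN (\<lambda>x. (cmod (f k x))\<^sup>2)" by blast
qed

lemma testN_add_scale:
  assumes "testN n f" "testN n g"
  shows "testN n (\<lambda>k x. f k x + z * g k x)"
  unfolding testN_def
proof (intro ballI conjI)
  fix k assume k: "k \<in> {1..n}"
  obtain \<alpha> \<beta> D where f: "0 < \<alpha>" "\<alpha> \<le> \<beta>" "\<And>x. f k x \<noteq> 0 \<Longrightarrow> x \<in> {\<alpha>..\<beta>}"
    "\<And>x. 0 < x \<Longrightarrow> D 0 x = f k x"
    "\<And>m x. 0 < x \<Longrightarrow> (D m has_vector_derivative D (Suc m) x) (at x)"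
    by (rule testN_elim[OF assms(1) k]) blast
  obtain \<alpha>' \<beta>' D' where g: "0 < \<alpha>'" "\<alpha>' \<le> \<beta>'" "\<And>x. g k x \<noteq> 0 \<Longrightarrow> x \<in> {\<alpha>'..\<beta>'}"
    "\<And>x. 0 < x \<Longrightarrow> D' 0 x = g k x"
    "\<And>m x. 0 < x \<Longrightarrow> (D' m has_vector_derivative D' (Suc m) x) (at x)"
    by (rule testN_elim[OF assms(2) k]) blast
  show "smooth_on {0<..} (\<lambda>x. f k x + z * g k x)"
    unfolding smooth_on_def
  proof (rule exI[of _ "\<lambda>m x. D m x + z * D' m x"], intro conjI ballI allI)
    fix m and x :: real assume "x \<in> {0<..}"
    hence x: "0 < x" by simp
    show "D 0 x + z * D' 0 x = f k x + z * g k x" using f(4)[OF x] g(4)[OF x] by simp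
    show "((\<lambda>x. D m x + z * D' m x) has_vector_derivative D (Suc m) x + z * D' (Suc m) x) (at x within {0<..})"
      by (rule has_vector_derivative_at_within)
         (intro has_vector_derivative_add has_vector_derivative_mult_right f(5)[OF x] g(5)[OF x])
  qed
  show "\<forall>x\<le>0. f k x + z * g k x = 0" using assms k by (auto simp: testN_def)
  show "\<exists>\<alpha> \<beta>. 0 < \<alpha> \<and> \<alpha> \<le> \<beta> \<and> (\<forall>x. f k x + z * g k x \<noteq> 0 \<longrightarrow> x \<in> {\<alpha>..\<beta>})"
  proof (intro exI conjI allI impI)
    show "0 < min \<alpha> \<alpha>'" "min \<alpha> \<alpha>' \<le> max \<beta> \<beta>'" using f(1,2) g(1,2) by auto
    fix x assume "f k x + z * g k x \<noteq> 0"
    hence "f k x \<noteq> 0 \<or> g k x \<noteq> 0" by auto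
    thus "x \<in> {min \<alpha> \<alpha>'..max \<beta> \<beta>'}" using f(3)[of x] g(3)[of x] by auto
  qed
qed

lemma testN_diff: "testN n f \<Longrightarrow> testN n g \<Longrightarrow> testN n (\<lambda>k x. f k x - g k x)"
  using testN_add_scale[of n f g "-1"] by simp

text \<open>Weierstrass approximation in the variable \<open>y = exp (- x)\<close> of the function \<open>f (- ln y) / y\<close>.\<close>
lemma exp_polynomial_approx:
  fixes f :: "real \<Rightarrow> complex"
  assumes cont: "continuous_on UNIV f" and supp: "\<And>x. f x \<noteq> 0 \<Longrightarrow> x \<le> \<beta>" and e: "0 < e"
  shows "\<exists>N A. \<forall>x>0. cmod (f x - (\<Sum>i\<le>N. A i * exp (- (of_nat (Suc i) * of_real x)))) \<le> e * exp (- x)"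
proof -
  \<comment> \<open>For 0 < y < d both \<open>f (- ln y)\<close> and \<open>f (- ln d)\<close>
    vanish. Hence \<open>max y d\<close> leaves g unchanged for positive y while it removes the
    singularities of \<open>ln\<close> and of the quotient at 0.\<close>
  define d where "d = exp (- (\<bar>\<beta>\<bar> + 1))"
  define g where "g y = f (- ln (max y d)) / of_real (max y d)" for y
  have d: "0 < d" by (simp add: d_def)
  have g_eq: "g y = f (- ln y) / of_real y" if y: "0 < y" for y
  proof (cases "d \<le> y")
    case False
    have "ln y < ln d" using False y d by simp
    hence "\<beta> < - ln y" "\<beta> < - ln d" by (auto simp: d_def)
    hence "f (- ln y) = 0" "f (- ln d) = 0" using supp by force+
    thus ?thesis using False by (simp add: g_def)
  qed (simp add: g_def max_def)
  have contg: "continuous_on {0..1} g"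
    unfolding g_def using d
    by (intro continuous_on_divide continuous_on_compose2[OF cont] continuous_intros) auto
  have "continuous_on {0..1} (\<lambda>y. Re (g y))" "continuous_on {0..1} (\<lambda>y. Im (g y))"
    using contg by (auto intro: continuous_intros)
  from Stone_Weierstrass_real_polynomial_function[OF _ this(1), of "e / 2"] Stone_Weierstrass_real_polynomial_function[OF _ this(2), of "e / 2"]
  obtain P Q where P: "real_polynomial_function P" "\<And>y. y \<in> {0..1} \<Longrightarrow> \<bar>Re (g y) - P y\<bar> < e / 2"
    and Q: "real_polynomial_function Q" "\<And>y. y \<in> {0..1} \<Longrightarrow> \<bar>Im (g y) - Q y\<bar> < e / 2"
    using e by (metis compact_Icc half_gt_zero)
  obtain p N where p: "P = (\<lambda>y. \<Sum>i\<le>N. p i * y ^ i)" using P(1) unfolding real_polynomial_function_iff_sum by blast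
  obtain r M where r: "Q = (\<lambda>y. \<Sum>i\<le>M. r i * y ^ i)" using Q(1) unfolding real_polynomial_function_iff_sum by blast
  define A where "A i = complex_of_real (if i \<le> N then p i else 0) + \<i> * complex_of_real (if i \<le> M then r i else 0)" for i
  have pad: "(\<Sum>i\<le>N0. w i * y ^ i) = (\<Sum>i\<le>max N M. (if i \<le> N0 then w i else 0) * y ^ i)" if "N0 \<le> max N M" for N0 y and w :: "nat \<Rightarrow> real"
    using that by (intro sum.mono_neutral_cong_left) auto
  have AP: "(\<Sum>i\<le>max N M. A i * of_real y ^ i) = of_real (P y) + \<i> * of_real (Q y)" for y
    unfolding p r pad[where w = p, OF max.cobounded1] pad[where w = r, OF max.cobounded2] A_def
    by (simp add: sum.distrib sum_distrib_left algebra_simps)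
  have "cmod (f x - (\<Sum>i\<le>max N M. A i * exp (- (of_nat (Suc i) * of_real x)))) \<le> e * exp (- x)" if x: "0 < x" for x
  proof -
    \<comment> \<open>The factor y split off from f raises the exponents from i to
      \<open>Suc i\<close>, so that every exponential decays, and turns the uniform error e into
      \<open>e * exp (- x)\<close>.\<close>
    define y where "y = exp (- x)"
    have y: "0 < y" "y \<in> {0..1}" using x by (auto simp: y_def)
    have fx: "f x = of_real y * g y" using g_eq[OF y(1)] y(1) by (simp add: y_def)
    have ex: "exp (- (of_nat (Suc i) * of_real x)) = complex_of_real y * of_real y ^ i" for i
    proof -
      have "exp (- (of_nat (Suc i) * of_real x)) = exp (of_nat (Suc i) * of_real (- x) :: complex)" by simp
      also have "\<dots> = exp (of_real (- x)) ^ Suc i" by (rule exp_of_nat_mult)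
      finally show ?thesis by (simp only: y_def exp_of_real power_Suc)
    qed
    have "(\<Sum>i\<le>max N M. A i * exp (- (of_nat (Suc i) * of_real x))) = of_real y * (\<Sum>i\<le>max N M. A i * of_real y ^ i)"
      unfolding ex sum_distrib_left by (intro sum.cong refl) (simp only: mult_ac)
    hence "f x - (\<Sum>i\<le>max N M. A i * exp (- (of_nat (Suc i) * of_real x))) = of_real y * (g y - (of_real (P y) + \<i> * of_real (Q y)))"
      unfolding fx AP by (simp add: algebra_simps)
    moreover have "cmod (g y - (of_real (P y) + \<i> * of_real (Q y))) \<le> e"
      using cmod_le[of "g y - (of_real (P y) + \<i> * of_real (Q y))"] P(2)[OF y(2)] Q(2)[OF y(2)] by simp
    ultimately show ?thesis using y(1) by (simp add: norm_mult y_def)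
  qed
  thus ?thesis by blast
qed

lemma L12_conv_exp_bound:
  assumes "\<And>m. L12 n (F m)" "L12 n f"
    and "\<And>m k x. k \<in> {1..n} \<Longrightarrow> 0 < x \<Longrightarrow> cmod (F m k x - f k x) \<le> e m * exp (- x)"
    and e: "\<And>m. 0 \<le> e m" "e \<longlonglongrightarrow> 0"
  shows "L12_conv n F f"
  unfolding L12_conv_def
proof (intro ballI conjI)
  fix k assume k: "k \<in> {1..n}"
  have m: "(\<lambda>x. F m k x - f k x) \<in> borel_measurable borel" for m
    using L12_diff[OF assms(1,2)] k by (auto simp: L12_def)
  note b = integrable_exp_bound[OF m assms(3)[OF k] e(1)]
  show "(\<lambda>m. \<integral>x. cmod (F m k x - f k x) \<partial>MN) \<longlonglongrightarrow> 0"
    by (rule Lim_null_comparison[OF always_eventually e(2)]) (use b(2) in auto)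
  have "(\<lambda>m. (e m)\<^sup>2) \<longlonglongrightarrow> 0" using tendsto_power[OF e(2), of 2] by simp
  thus "(\<lambda>m. \<integral>x. (cmod (F m k x - f k x))\<^sup>2 \<partial>MN) \<longlonglongrightarrow> 0"
    by (rule Lim_null_comparison[OF always_eventually, rotated]) (use b(4) in auto)
qed

section \<open>Isometry on exponential sums and on test functions\<close>

context star
begin

lemma Vop_L12_measurable:
  "L12 n f \<Longrightarrow> k \<in> {1..n} \<Longrightarrow> V f k \<in> borel_measurable (Mq n c a k)"
  using Vop_measurable[of k f] by (auto simp: L12_def cong: measurable_cong_sets)

text \<open>At a fixed t above the threshold the eigenfunction is bounded on the whole network, so
  the L^1 half of the convergence suffices.\<close>

lemma Vop_L12_conv:
  assumes k: "k \<in> {1..n}" and t: "a k < t" and F: "\<And>m. L12 n (F m)" and f: "L12 n f" and conv: "L12_conv n F f"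
  shows "(\<lambda>m. V (F m) k t) \<longlonglongrightarrow> V f k t"
proof -
  let ?B = "1 + cmod (S (of_real t)) / (c k * cmod (K k (of_real t)))"
  have le: "cmod (V (F m) k t - V f k t) \<le> (\<Sum>j\<in>{1..n}. ?B * (\<integral>x. cmod (F m j x - f j x) \<partial>MN))" for m
  proof -
    have "V (F m) k t - V f k t = V (\<lambda>k x. F m k x - f k x) k t" by (rule Vop_diff[OF k t F f, symmetric])
    also have "cmod \<dots> \<le> (\<Sum>j\<in>{1..n}. ?B * (\<integral>x. cmod (F m j x - f j x) \<partial>MN))"
      unfolding Vop_def using L12_diff[OF F[of m] f]
      by (intro sum_norm_le Vop_integrand(2)[OF k _ t]) (auto simp: L12_def)
    finally show ?thesis .
  qed
  have lim: "(\<lambda>m. \<Sum>j\<in>{1..n}. ?B * (\<integral>x. cmod (F m j x - f j x) \<partial>MN)) \<longlonglongrightarrow> (\<Sum>j\<in>{1..n}. ?B * 0)"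
    using conv by (intro tendsto_sum tendsto_mult tendsto_const) (auto simp: L12_conv_def)
  have "(\<lambda>m. V (F m) k t - V f k t) \<longlonglongrightarrow> 0"
    by (rule Lim_null_comparison[OF always_eventually lim[unfolded mult_zero_right sum.neutral_const]]) (use le in blast)
  thus ?thesis by (rule LIM_zero_cancel)
qed

definition isom :: "(nat \<Rightarrow> real \<Rightarrow> complex) \<Rightarrow> bool" where
  "isom f \<longleftrightarrow> L12 n f \<and> sqints n (Mq n c a) (V f) \<and> nq (V f) = nH f"

lemma nq_Vop_diff:
  assumes "isom f" "isom g" "isom (\<lambda>k x. f k x - g k x)"
  shows "nq (\<lambda>k t. V f k t - V g k t) = nH (\<lambda>k x. f k x - g k x)"
proof -
  have "nq (\<lambda>k t. V f k t - V g k t) = nq (V (\<lambda>k x. f k x - g k x))"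
    using assms by (intro nrm_cong_AE sqints_diff) (auto simp: isom_def intro!: AE_Mq_I Vop_diff[symmetric])
  thus ?thesis using assms(3) by (simp add: isom_def)
qed

text \<open>Isometry of the differences makes the transforms a Cauchy sequence in L^2_q. L^1
  convergence supplies their pointwise limit, and \<open>nrm_fatou\<close> shows that this is the
  limit in norm.\<close>

lemma isom_limit:
  assumes F: "\<And>m. isom (F m)" "\<And>m l. isom (\<lambda>k x. F m k x - F l k x)" and f: "L12 n f" and conv: "L12_conv n F f"
  shows "isom f" "(\<lambda>m. nq (\<lambda>k t. V (F m) k t - V f k t)) \<longlonglongrightarrow> 0"
proof -
  have FL: "L12 n (F m)" and FV: "sqints n (Mq n c a) (V (F m))" for m using F(1) by (auto simp: isom_def)
  note sq = L12_sqints[OF FL] L12_sqints[OF f]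
  have lim: "(\<lambda>m. nH (\<lambda>k x. F m k x - f k x)) \<longlonglongrightarrow> 0" by (rule L12_conv_nrm[OF conv])
  have cauchy: "\<exists>m0. \<forall>m\<ge>m0. \<forall>l\<ge>m0. nq (\<lambda>k t. V (F m) k t - V (F l) k t) < e" if e: "0 < e" for e
  proof -
    obtain m0 where m0: "\<And>m. m \<ge> m0 \<Longrightarrow> nH (\<lambda>k x. F m k x - f k x) < e / 2"
      using LIMSEQ_D[OF lim, of "e / 2"] e by auto
    have "nq (\<lambda>k t. V (F m) k t - V (F l) k t) < e" if "m \<ge> m0" "l \<ge> m0" for m l
    proof -
      have "nq (\<lambda>k t. V (F m) k t - V (F l) k t) = nH (\<lambda>k x. F m k x - F l k x)"
        by (rule nq_Vop_diff[OF F(1) F(1) F(2)])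
      also have "\<dots> \<le> nH (\<lambda>k x. F m k x - f k x) + nH (\<lambda>k x. f k x - F l k x)"
        by (rule nrm_diff_triangle[OF sq(1) sq(2) sq(1)])
      also have "nH (\<lambda>k x. f k x - F l k x) = nH (\<lambda>k x. F l k x - f k x)" by (rule nrm_minus_commute)
      finally show ?thesis using m0[OF that(1)] m0[OF that(2)] by linarith
    qed
    thus ?thesis by blast
  qed
  have AE: "AE t in Mq n c a k. (\<lambda>m. V (F m) k t) \<longlonglongrightarrow> V f k t" if k: "k \<in> {1..n}" for k
    by (rule AE_Mq_I[OF k Vop_L12_conv[OF k _ FL f conv]])
  note fat = nrm_fatou[where F = "\<lambda>m. V (F m)" and f = "V f" and M = "Mq n c a" and n = n, OF FV Vop_L12_measurable[OF f] AE cauchy]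
  show "(\<lambda>m. nq (\<lambda>k t. V (F m) k t - V f k t)) \<longlonglongrightarrow> 0" by (rule fat(2))
  have "(\<lambda>m. nq (V (F m))) \<longlonglongrightarrow> nq (V f)" by (rule nrm_tendsto[OF FV fat])
  moreover have "(\<lambda>m. nq (V (F m))) \<longlonglongrightarrow> nH f"
    using nrm_tendsto[OF sq lim] F(1) by (simp add: isom_def)
  ultimately have "nq (V f) = nH f" by (rule LIMSEQ_unique)
  with fat(1) f show "isom f" by (simp add: isom_def)
qed

text \<open>For k = l and p = r the integrand of \<open>expV_orthogonality\<close> is a sum of
  nonnegative terms, and each of them is dominated by the integrable sum.\<close>

lemma sqints_expV:
  assumes k: "k \<in> {1..n}" and p: "0 < p"
  shows "sqints n (Mq n c a) (expV k (of_real p))"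
  unfolding sqints_def sqint_def
proof (intro ballI conjI)
  fix j assume j: "j \<in> {1..n}"
  note [measurable] = expV_measurable[OF k] qfun_measurable[OF j]
  show "expV k (of_real p) j \<in> borel_measurable (Mq n c a j)" by measurable
  have "integrable lborel (\<lambda>t. q j t *\<^sub>R (cmod (expV k (of_real p) j t))\<^sup>2)"
  proof (rule Bochner_Integration.integrable_bound[OF expV_orthogonality(1)[OF k k p p]])
    have eq: "(\<Sum>j\<in>{1..n}. of_real (q j t) * (expV k (of_real p) j t * cnj (expV k (of_real p) j t)))
        = complex_of_real (\<Sum>j\<in>{1..n}. q j t * (cmod (expV k (of_real p) j t))\<^sup>2)" for t
      unfolding of_real_sum by (intro sum.cong refl) (simp only: of_real_mult complex_norm_square)
    have "q j t * (cmod (expV k (of_real p) j t))\<^sup>2 \<le> (\<Sum>j\<in>{1..n}. q j t * (cmod (expV k (of_real p) j t))\<^sup>2)" for t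
      using j qfun_nonneg by (intro member_le_sum) auto
    moreover have "0 \<le> q j t * (cmod (expV k (of_real p) j t))\<^sup>2" for t using qfun_nonneg[OF j] by simp
    ultimately show "AE t in lborel. norm (q j t *\<^sub>R (cmod (expV k (of_real p) j t))\<^sup>2)
        \<le> norm (\<Sum>j\<in>{1..n}. of_real (q j t) * (expV k (of_real p) j t * cnj (expV k (of_real p) j t)))"
      unfolding eq norm_of_real by (intro AE_I2) (smt (verit) real_norm_def real_scaleR_def)
  qed measurable
  thus "integrable (Mq n c a j) (\<lambda>t. (cmod (expV k (of_real p) j t))\<^sup>2)"
    by (subst integrable_Mq_iff[OF j]) auto
qed

lemma inn_expV:
  assumes k: "k \<in> {1..n}" and l: "l \<in> {1..n}" and p: "0 < p" and r: "0 < r"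
  shows "inn n (Mq n c a) (expV k (of_real p)) (expV l (of_real r)) = (if k = l then 1 / of_real (p + r) else 0)"
proof -
  let ?h = "\<lambda>j t. expV k (of_real p) j t * cnj (expV l (of_real r) j t)"
  note [measurable] = expV_measurable[OF k] expV_measurable[OF l]
  have meas: "?h j \<in> borel_measurable borel" for j by measurable
  have int: "integrable lborel (\<lambda>t. q j t *\<^sub>R ?h j t)" if j: "j \<in> {1..n}" for j
    using sqint_cnj_integrable[of "Mq n c a j" "expV k (of_real p) j" "expV l (of_real r) j"]
      sqints_expV[OF k p] sqints_expV[OF l r] j integrable_Mq_iff[OF j meas] by (auto simp: sqints_def)
  have "inn n (Mq n c a) (expV k (of_real p)) (expV l (of_real r)) = (\<Sum>j\<in>{1..n}. \<integral>t. q j t *\<^sub>R ?h j t \<partial>lborel)"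
    unfolding inn_def by (intro sum.cong refl integral_Mq meas)
  also have "\<dots> = (\<integral>t. (\<Sum>j\<in>{1..n}. q j t *\<^sub>R ?h j t) \<partial>lborel)"
    using int by (rule Bochner_Integration.integral_sum[symmetric])
  also have "\<dots> = (if k = l then 1 / of_real (p + r) else 0)"
    using expV_orthogonality(2)[OF assms] by (simp add: scaleR_conv_of_real)
  finally show ?thesis .
qed

lemma inn_edge_exp:
  assumes k: "k \<in> {1..n}" and l: "l \<in> {1..n}" and p: "0 < p" and r: "0 < r"
  shows "inn n (\<lambda>_. MN) (edge_exp k (of_real p)) (edge_exp l (of_real r)) = (if k = l then 1 / of_real (p + r) else 0)"
proof -
  have "(\<integral>x. edge_exp k (of_real p) j x * cnj (edge_exp l (of_real r) j x) \<partial>MN) = (if j = k then (if k = l then 1 / of_real (p + r) else 0) else 0)" for j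
  proof (cases "j = k \<and> k = l")
    case True
    have "edge_exp k (of_real p) j x * cnj (edge_exp l (of_real r) j x) = exp (- (of_real (p + r) * of_real x))" for x
      using True by (simp add: edge_exp_def exp_cnj algebra_simps flip: exp_add)
    thus ?thesis using True integral_exp(2)[of "of_real (p + r)"] p r by simp
  next
    case False
    hence "(\<lambda>x. edge_exp k (of_real p) j x * cnj (edge_exp l (of_real r) j x)) = (\<lambda>x. 0)"
      by (auto simp: edge_exp_def fun_eq_iff)
    thus ?thesis using False by (auto simp only: Bochner_Integration.integral_zero split: if_split)
  qed
  thus ?thesis using k by (simp add: inn_def)
qed

text \<open>A pair \<open>e\<close> encodes the edge \<open>fst e\<close> and the decay rate
  \<open>Suc (snd e)\<close>, the rates that Weierstrass approximation produces.\<close>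

definition expsum :: "(nat \<Rightarrow> real \<Rightarrow> complex) \<Rightarrow> bool" where
  "expsum f \<longleftrightarrow> (\<exists>E A. finite E \<and> (\<forall>e\<in>E. fst e \<in> {1..n}) \<and>
     f = (\<lambda>k x. \<Sum>e\<in>E. A e * edge_exp (fst e) (of_real (real (Suc (snd e)))) k x))"

lemma expsum_isom:
  assumes "expsum f"
  shows "isom f"
proof -
  obtain E A where E: "finite E" "\<And>e. e \<in> E \<Longrightarrow> fst e \<in> {1..n}"
    and f: "f = (\<lambda>k x. \<Sum>e\<in>E. A e * edge_exp (fst e) (of_real (real (Suc (snd e)))) k x)"
    using assms unfolding expsum_def by blast
  let ?p = "\<lambda>e::nat\<times>nat. real (Suc (snd e))"
  let ?g = "\<lambda>e. edge_exp (fst e) (of_real (?p e))" and ?v = "\<lambda>e. expV (fst e) (of_real (?p e))"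
  have pp: "0 < ?p e" for e by simp
  have gL: "L12 n (?g e)" for e by (rule L12_edge_exp) simp
  have gV: "sqints n (Mq n c a) (?v e)" if "e \<in> E" for e by (rule sqints_expV[OF E(2)[OF that] pp])
  \<comment> \<open>\<open>Vop_sum\<close> delivers membership together with a formula at a point,
    hence an edge and a point above its threshold have to be named; \<open>a 1 + 1\<close> is
    arbitrary.\<close>
  have L: "L12 n f" using Vop_sum[of 1 "a 1 + 1" E ?g A] E(1) gL n_pos unfolding f by simp
  have Vf: "V f k t = (\<Sum>e\<in>E. A e * ?v e k t)" if k: "k \<in> {1..n}" and t: "a k < t" for k t
  proof -
    have "V f k t = (\<Sum>e\<in>E. A e * V (?g e) k t)" unfolding f using Vop_sum[of k t E ?g A, OF k t E(1) gL] by blast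
    also have "\<dots> = (\<Sum>e\<in>E. A e * ?v e k t)"
      by (intro sum.cong refl arg_cong2[where f = "(*)"] Vop_edge_exp[OF E(2) k t]) auto
    finally show ?thesis .
  qed
  have AE: "AE t in Mq n c a k. V f k t = (\<Sum>e\<in>E. A e * ?v e k t)" if k: "k \<in> {1..n}" for k
    by (rule AE_Mq_I[OF k Vf[OF k]])
  have sum: "sqints n (Mq n c a) (\<lambda>k t. \<Sum>e\<in>E. A e * ?v e k t)"
    unfolding sqints_def using gV by (intro ballI sqint_sum E(1)) (auto simp: sqints_def)
  have Vsq: "sqints n (Mq n c a) (V f)"
    by (rule sqints_cong_AE[OF sum Vop_L12_measurable[OF L] AE])
  have "complex_of_real ((nq (V f))\<^sup>2) = complex_of_real ((nq (\<lambda>k t. \<Sum>e\<in>E. A e * ?v e k t))\<^sup>2)"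
    using nrm_cong_AE[OF Vsq sum AE] by simp
  also have "\<dots> = (\<Sum>e\<in>E. \<Sum>e'\<in>E. A e * cnj (A e') * inn n (Mq n c a) (?v e) (?v e'))"
    by (rule nrm_sum_square[OF E(1) gV])
  also have "\<dots> = (\<Sum>e\<in>E. \<Sum>e'\<in>E. A e * cnj (A e') * inn n (\<lambda>_. MN) (?g e) (?g e'))"
    by (intro sum.cong refl) (simp only: inn_expV[OF E(2) E(2) pp pp] inn_edge_exp[OF E(2) E(2) pp pp])
  also have "\<dots> = complex_of_real ((nH f)\<^sup>2)"
    unfolding f by (rule nrm_sum_square[OF E(1) L12_sqints[OF gL], symmetric])
  finally have "(nq (V f))\<^sup>2 = (nH f)\<^sup>2" by (simp only: of_real_eq_iff)
  hence "nq (V f) = nH f" by (simp add: power2_eq_iff_nonneg)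
  with L Vsq show ?thesis by (simp add: isom_def)
qed

lemma expsum_diff:
  assumes "expsum f" "expsum g"
  shows "expsum (\<lambda>k x. f k x - g k x)"
proof -
  obtain E A where E: "finite E" "\<And>e. e \<in> E \<Longrightarrow> fst e \<in> {1..n}"
    and f: "f = (\<lambda>k x. \<Sum>e\<in>E. A e * edge_exp (fst e) (of_real (real (Suc (snd e)))) k x)"
    using assms(1) unfolding expsum_def by blast
  obtain E' A' where E': "finite E'" "\<And>e. e \<in> E' \<Longrightarrow> fst e \<in> {1..n}"
    and g: "g = (\<lambda>k x. \<Sum>e\<in>E'. A' e * edge_exp (fst e) (of_real (real (Suc (snd e)))) k x)"
    using assms(2) unfolding expsum_def by blast
  define B where "B e = (if e \<in> E then A e else 0) - (if e \<in> E' then A' e else 0)" for e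
  have pad: "(\<Sum>e\<in>E0. C e * h e) = (\<Sum>e\<in>E \<union> E'. (if e \<in> E0 then C e else 0) * h e)"
    if "E0 \<subseteq> E \<union> E'" for E0 C and h :: "nat \<times> nat \<Rightarrow> complex"
    using that E(1) E'(1) by (intro sum.mono_neutral_cong_left) auto
  have "(\<lambda>k x. f k x - g k x) = (\<lambda>k x. \<Sum>e\<in>E \<union> E'. B e * edge_exp (fst e) (of_real (real (Suc (snd e)))) k x)"
    unfolding f g pad[of E A, OF Un_upper1] pad[of E' A', OF Un_upper2] B_def
    by (simp only: sum_subtractf left_diff_distrib)
  thus ?thesis unfolding expsum_def using E E' by (intro exI[of _ "E \<union> E'"] exI[of _ B]) auto
qed

lemma testN_expsum_approx:
  assumes f: "testN n f" and e: "0 < e"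
  shows "\<exists>g. expsum g \<and> (\<forall>k\<in>{1..n}. \<forall>x>0. cmod (g k x - f k x) \<le> e * exp (- x))"
proof -
  have "\<forall>k\<in>{1..n}. \<exists>N A. \<forall>x>0. cmod (f k x - (\<Sum>i\<le>N. A i * exp (- (of_nat (Suc i) * of_real x)))) \<le> e * exp (- x)"
  proof
    fix k assume k: "k \<in> {1..n}"
    obtain \<alpha> \<beta> where "\<And>x. f k x \<noteq> 0 \<Longrightarrow> x \<in> {\<alpha>..\<beta>}" by (rule testN_elim[OF f k]) blast
    thus "\<exists>N A. \<forall>x>0. cmod (f k x - (\<Sum>i\<le>N. A i * exp (- (of_nat (Suc i) * of_real x)))) \<le> e * exp (- x)"
      by (intro exp_polynomial_approx[OF testN_continuous[OF f k] _ e, of \<beta>]) auto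
  qed
  then obtain N A where NA: "\<And>k x. k \<in> {1..n} \<Longrightarrow> 0 < x \<Longrightarrow>
      cmod (f k x - (\<Sum>i\<le>N k. A k i * exp (- (of_nat (Suc i) * of_real x)))) \<le> e * exp (- x)" by metis
  define g where "g = (\<lambda>k x. \<Sum>e\<in>Sigma {1..n} (\<lambda>k. {..N k}). A (fst e) (snd e) * edge_exp (fst e) (of_real (real (Suc (snd e)))) k x)"
  have "expsum g"
    unfolding expsum_def g_def
    by (intro exI[of _ "Sigma {1..n} (\<lambda>k. {..N k})"] exI[of _ "\<lambda>e. A (fst e) (snd e)"]) auto
  moreover have "g k x = (\<Sum>i\<le>N k. A k i * exp (- (of_nat (Suc i) * of_real x)))" if k: "k \<in> {1..n}" for k x
  proof -
    have "g k x = (\<Sum>k'\<in>{1..n}. \<Sum>i\<le>N k'. A k' i * edge_exp k' (of_real (real (Suc i))) k x)"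
      unfolding g_def by (subst sum.Sigma) (auto simp: case_prod_beta)
    also have "\<dots> = (\<Sum>k'\<in>{1..n}. if k' = k then (\<Sum>i\<le>N k. A k i * exp (- (of_nat (Suc i) * of_real x))) else 0)"
      by (intro sum.cong refl) (auto simp: edge_exp_def)
    finally show ?thesis using k by simp
  qed
  ultimately show ?thesis using NA by (intro exI[of _ g]) (simp add: norm_minus_commute)
qed

lemma testN_isom:
  assumes f: "testN n f"
  shows "isom f"
proof -
  have "\<forall>m. \<exists>g. expsum g \<and> (\<forall>k\<in>{1..n}. \<forall>x>0. cmod (g k x - f k x) \<le> 1 / real (Suc m) * exp (- x))"
    by (intro allI testN_expsum_approx[OF f]) simp
  from choice[OF this] obtain F where F: "\<And>m. expsum (F m)"
    "\<And>m k x. k \<in> {1..n} \<Longrightarrow> 0 < x \<Longrightarrow> cmod (F m k x - f k x) \<le> 1 / real (Suc m) * exp (- x)" by blast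
  have iso: "isom (F m)" "isom (\<lambda>k x. F m k x - F l k x)" for m l
    by (intro expsum_isom expsum_diff F(1))+
  have "L12_conv n F f"
  proof (rule L12_conv_exp_bound[OF _ testN_L12[OF f] F(2)])
    show "L12 n (F m)" for m using iso(1) by (simp add: isom_def)
    show "(\<lambda>m. 1 / real (Suc m)) \<longlonglongrightarrow> 0" by (rule LIMSEQ_inverse_real_of_nat[unfolded inverse_eq_divide])
  qed auto
  from isom_limit(1)[OF iso testN_L12[OF f] this] show ?thesis .
qed

end

section \<open>Bounded Borel functions and density of the test functions\<close>

lemma bddBorel_const [simp]: "bddBorel (\<lambda>x. z)"
  by (auto simp: bddBorel_def bounded_iff)

lemma bddBorelI: "\<psi> \<in> borel_measurable borel \<Longrightarrow> (\<And>x. cmod (\<psi> x) \<le> B) \<Longrightarrow> bddBorel \<psi>"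
  by (auto simp: bddBorel_def bounded_iff)

lemma bddBorelE:
  assumes "bddBorel \<psi>"
  obtains B where "\<psi> \<in> borel_measurable borel" "\<And>x. cmod (\<psi> x) \<le> B"
  using assms by (auto simp: bddBorel_def bounded_iff)

lemma bddBorel_indicator [simp]: "bddBorel (indicator {b<..})"
  by (rule bddBorelI[where B = 1]) (auto simp: indicator_def)

lemma bddBorel_add_scale:
  assumes "bddBorel f" "bddBorel g"
  shows "bddBorel (\<lambda>x. f x + z * g x)"
proof -
  obtain B C where B: "f \<in> borel_measurable borel" "\<And>x. cmod (f x) \<le> B"
    and C: "g \<in> borel_measurable borel" "\<And>x. cmod (g x) \<le> C"
    using assms by (metis bddBorelE)
  note [measurable] = B(1) C(1)
  show ?thesis
  proof (rule bddBorelI[where B = "B + cmod z * C"])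
    show "(\<lambda>x. f x + z * g x) \<in> borel_measurable borel" by measurable
    show "cmod (f x + z * g x) \<le> B + cmod z * C" for x
      using norm_triangle_mono[OF B(2)[of x], of "z * g x" "cmod z * C"] C(2)[of x]
      by (simp add: norm_mult mult_left_mono)
  qed
qed

lemma bddBorel_mult:
  assumes "bddBorel f" "bddBorel g"
  shows "bddBorel (\<lambda>x. f x * g x)"
proof -
  obtain B C where B: "f \<in> borel_measurable borel" "\<And>x. cmod (f x) \<le> B"
    and C: "g \<in> borel_measurable borel" "\<And>x. cmod (g x) \<le> C"
    using assms by (metis bddBorelE)
  note [measurable] = B(1) C(1)
  have "0 \<le> B" using B(2) norm_ge_zero order_trans by blast
  thus ?thesis
    by (intro bddBorelI[where B = "B * C"]) (auto simp: norm_mult intro!: mult_mono B C)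
qed

lemma bddBorel_limit:
  assumes "\<And>m. bddBorel (F m)" "\<And>m x. cmod (F m x) \<le> B" "\<And>x. (\<lambda>m. F m x) \<longlonglongrightarrow> f x"
  shows "bddBorel f"
proof (rule bddBorelI)
  show "f \<in> borel_measurable borel"
    using assms(1) by (intro borel_measurable_LIMSEQ_metric[of F, OF _ assms(3)]) (auto simp: bddBorel_def)
  show "cmod (f x) \<le> B" for x
    using tendsto_norm[OF assms(3)[of x]] assms(2) by (intro LIMSEQ_le_const2[of "\<lambda>m. cmod (F m x)"]) auto
qed

text \<open>Monotone class theorem. Half-lines form a generating system closed under intersection,
  so Dynkin's lemma gives all indicators; increasing limits give nonnegative bounded functions, and
  linearity the rest. It serves both for the density of test functions and for the functional
  calculus.\<close>

lemma bddBorel_induct: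
  fixes P :: "(real \<Rightarrow> complex) \<Rightarrow> bool"
  assumes half: "\<And>b. P (indicator {b<..})" and one: "P (\<lambda>x. 1)"
    and lin: "\<And>f g z. P f \<Longrightarrow> P g \<Longrightarrow> P (\<lambda>x. f x + z * g x)"
    and lim: "\<And>F f B. (\<And>m. P (F m)) \<Longrightarrow> (\<And>m x. cmod (F m x) \<le> B) \<Longrightarrow> (\<And>x. (\<lambda>m. F m x) \<longlonglongrightarrow> f x) \<Longrightarrow> P f"
    and \<psi>: "bddBorel \<psi>"
  shows "P \<psi>"
proof -
  have zero: "P (\<lambda>x. 0)" using lin[OF one one, of "-1"] by simp
  have ind: "P (indicator A)" if "A \<in> sets borel" for A
  proof -
    have A: "A \<in> sigma_sets UNIV (range (\<lambda>a::real. {a<..}))"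
      using that unfolding borel_Ioi by simp
    have stable: "Int_stable (range (\<lambda>a::real. {a<..}))"
    proof (rule Int_stableI_image)
      show "\<exists>c\<in>UNIV. {a<..} \<inter> {b<..} = {c<..}" for a b :: real
        by (intro bexI[of _ "max a b"]) auto
    qed
    have sub: "range (\<lambda>a::real. {a<..}) \<subseteq> Pow UNIV" by simp
    from stable sub A show ?thesis
    proof (induction rule: sigma_sets_induct_disjoint)
      case (basic A)
      thus ?case using half by auto
    next
      case empty
      show ?case using zero by (simp add: indicator_def)
    next
      case (compl A)
      have eq: "(\<lambda>x. 1 + (-1) * indicator A x :: complex) = indicator (UNIV - A)"
        by (auto simp: indicator_def fun_eq_iff)
      show ?case using lin[OF one compl(2), of "-1"] unfolding eq .
    next
      case (union A)
      have fin: "P (indicator (\<Union>i<m. A i))" for m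
      proof (induction m)
        case 0
        show ?case using zero by (simp add: indicator_def)
      next
        case (Suc m)
        have disj: "x \<notin> A i" if "i < m" "x \<in> A m" for i x
          using disjoint_family_onD[OF union(1), of i m] that by auto
        have eq: "(\<lambda>x. indicator (\<Union>i<m. A i) x + 1 * indicator (A m) x :: complex) = indicator (\<Union>i<Suc m. A i)"
        proof
          fix x
          have "x \<in> (\<Union>i<Suc m. A i) \<longleftrightarrow> x \<in> (\<Union>i<m. A i) \<or> x \<in> A m" by (auto simp: less_Suc_eq)
          thus "indicator (\<Union>i<m. A i) x + 1 * indicator (A m) x = (indicator (\<Union>i<Suc m. A i) x :: complex)"
            using disj[of _ x] by (cases "x \<in> A m") (auto simp: indicator_def)
        qed
        show ?case using lin[OF Suc union(3), of 1 m] unfolding eq .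
      qed
      show ?case
      proof (rule lim[where B = 1, OF fin])
        show "cmod (indicator (\<Union>i<m. A i) x) \<le> 1" for m x by (simp add: indicator_def)
        fix x
        show "(\<lambda>m. indicator (\<Union>i<m. A i) x) \<longlonglongrightarrow> (indicator (\<Union>i. A i) x :: complex)"
        proof (cases "x \<in> (\<Union>i. A i)")
          case True
          then obtain i where "x \<in> A i" by blast
          hence "indicator (\<Union>i<m. A i) x = (indicator (\<Union>i. A i) x :: complex)" if "m \<ge> Suc i" for m
            using that by (auto simp: indicator_def)
          thus ?thesis by (intro tendsto_eventually eventually_sequentiallyI)
        next
          case False
          hence "indicator (\<Union>i<m. A i) x = (indicator (\<Union>i. A i) x :: complex)" for m
            by (auto simp: indicator_def)
          thus ?thesis by simp
        qed
      qed
    qed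
  qed
  \<comment> \<open>Boundedness is a premise inside the induction formula: it passes from a sum to
    its nonnegative summands and from an increasing limit to its members.\<close>
  have nonneg: "(\<exists>B. \<forall>x. u x \<le> B) \<longrightarrow> P (\<lambda>x. complex_of_real (u x))"
    if "u \<in> borel_measurable borel" "\<And>x. 0 \<le> u x" for u :: "real \<Rightarrow> real"
    using that
  proof (induction rule: borel_measurable_induct_real)
    case (set A)
    have "(\<lambda>x. complex_of_real (indicator A x)) = indicator A" by (auto simp: indicator_def)
    thus ?case using ind[OF set] by simp
  next
    case (mult u s)
    show ?case
    proof
      assume "\<exists>B. \<forall>x. s * u x \<le> B"
      then obtain B where B: "\<And>x. s * u x \<le> B" by blast
      show "P (\<lambda>x. complex_of_real (s * u x))"
      proof (cases "s = 0")
        case False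
        hence "u x \<le> B / s" for x using B[of x] mult(1) by (simp add: field_simps)
        hence "P (\<lambda>x. complex_of_real (u x))" using mult.IH by blast
        from lin[OF zero this, of "of_real s"] show ?thesis by simp
      qed (simp add: zero)
    qed
  next
    case (add u v)
    show ?case
    proof
      assume "\<exists>B. \<forall>x. v x + u x \<le> B"
      then obtain B where B: "\<And>x. v x + u x \<le> B" by blast
      have "u x \<le> B" "v x \<le> B" for x using B[of x] add(2)[of x] add(4)[of x] by linarith+
      hence "P (\<lambda>x. complex_of_real (u x))" "P (\<lambda>x. complex_of_real (v x))" using add by blast+
      from lin[OF this(2,1), of 1] show "P (\<lambda>x. complex_of_real (v x + u x))" by simp
    qed
  next
    case (seq U)
    show ?case
    proof
      assume "\<exists>B. \<forall>x. u x \<le> B"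
      then obtain B where B: "\<And>x. u x \<le> B" by blast
      have lim': "(\<lambda>i. U i x) \<longlonglongrightarrow> u x" for x using seq.hyps(4) by simp
      have "U i x \<le> u x" for i x
        using seq.hyps(3) lim'[of x] by (intro incseq_le) (auto simp: incseq_def le_fun_def)
      hence UB: "U i x \<le> B" for i x using B order_trans by blast
      hence "P (\<lambda>x. complex_of_real (U i x))" for i using seq.IH by blast
      thus "P (\<lambda>x. complex_of_real (u x))"
      proof (rule lim)
        show "cmod (complex_of_real (U i x)) \<le> B" for i x using seq(2)[of i x] UB[of i x] by simp
        show "(\<lambda>i. complex_of_real (U i x)) \<longlonglongrightarrow> complex_of_real (u x)" for x by (intro tendsto_of_real lim')
      qed
    qed
  qed
  obtain B where B: "\<psi> \<in> borel_measurable borel" "\<And>x. cmod (\<psi> x) \<le> B" by (rule bddBorelE[OF \<psi>]) blast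
  note [measurable] = B(1)
  have re: "\<bar>Re (\<psi> x)\<bar> \<le> B" "\<bar>Im (\<psi> x)\<bar> \<le> B" for x
    using B(2)[of x] abs_Re_le_cmod[of "\<psi> x"] abs_Im_le_cmod[of "\<psi> x"] by linarith+
  have pos: "P (\<lambda>x. complex_of_real (max 0 (g x)))" if "g \<in> borel_measurable borel" "\<And>x. \<bar>g x\<bar> \<le> B" for g
  proof -
    have "max 0 (g x) \<le> B" for x using that(2)[of x] by (auto simp: abs_le_iff)
    thus ?thesis using nonneg[of "\<lambda>x. max 0 (g x)"] that(1) by auto
  qed
  have real: "P (\<lambda>x. complex_of_real (g x))" if g: "g \<in> borel_measurable borel" "\<And>x. \<bar>g x\<bar> \<le> B" for g
  proof -
    have "P (\<lambda>x. complex_of_real (max 0 (g x)) + (-1) * complex_of_real (max 0 (- g x)))"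
      using g by (intro lin pos) auto
    moreover have "complex_of_real (max 0 (g x)) + (-1) * complex_of_real (max 0 (- g x)) = complex_of_real (g x)" for x
      by (simp add: max_def)
    ultimately show ?thesis by simp
  qed
  have "P (\<lambda>x. complex_of_real (Re (\<psi> x)) + \<i> * complex_of_real (Im (\<psi> x)))"
    using re by (intro lin real) auto
  thus ?thesis by (simp flip: complex_eq)
qed

section \<open>Smooth bumps built from exp (- 1 / s)\<close>

definition flat :: "nat \<Rightarrow> real \<Rightarrow> real" where
  "flat i s = (if s \<le> 0 then 0 else inverse s ^ i / exp (inverse s))"

text \<open>The negative powers of s times \<open>exp (- 1 / s)\<close>, extended by 0, form a
  family stable under differentiation. At 0 the right difference quotient is
  \<open>inverse y ^ Suc i / exp (inverse y)\<close>, a power against an exponential at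
  infinity.\<close>

lemma flat_has_derivative:
  "(flat i has_real_derivative (- real i * flat (Suc i) s + flat (Suc (Suc i)) s)) (at s)"
proof -
  consider "s < 0" | "s = 0" | "0 < s" by linarith
  thus ?thesis
  proof cases
    case 1
    have ev: "\<forall>\<^sub>F y in nhds s. y \<in> {..<0}" using 1 by (intro eventually_nhds_in_open) auto
    have "\<forall>\<^sub>F y in nhds s. flat i y = 0"
      using ev by eventually_elim (simp add: flat_def)
    hence "(flat i has_real_derivative 0) (at s)"
      using DERIV_cong_ev[of s s "flat i" "\<lambda>_. 0" 0 0] by simp
    thus ?thesis using 1 by (simp add: flat_def)
  next
    case 2
    have L: "((\<lambda>y. (flat i y - flat i 0) / (y - 0)) \<longlongrightarrow> 0) (at_left 0)"
    proof (rule tendsto_eventually)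
      show "\<forall>\<^sub>F y in at_left 0. (flat i y - flat i 0) / (y - 0) = 0"
        by (rule eventually_at_leftI[of "-1"]) (auto simp: flat_def)
    qed
    have R: "((\<lambda>y. (flat i y - flat i 0) / (y - 0)) \<longlongrightarrow> 0) (at_right 0)"
    proof (rule Lim_transform_eventually)
      show "((\<lambda>y::real. inverse y ^ Suc i / exp (inverse y)) \<longlongrightarrow> 0) (at_right 0)"
        by (rule filterlim_compose[OF tendsto_power_div_exp_0 filterlim_inverse_at_top_right])
      show "\<forall>\<^sub>F y in at_right 0. inverse y ^ Suc i / exp (inverse y) = (flat i y - flat i 0) / (y - 0)"
        by (rule eventually_at_rightI[of 0 1]) (simp_all add: flat_def divide_inverse mult_ac)
    qed
    have "(flat i has_real_derivative 0) (at 0)"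
      unfolding has_field_derivative_iff using L R by (simp add: filterlim_split_at)
    thus ?thesis using 2 by (simp add: flat_def)
  next
    case 3
    let ?w = "inverse s"
    have s0: "s \<noteq> 0" using 3 by simp
    have A: "((\<lambda>y. inverse y ^ i) has_real_derivative - real i * ?w ^ Suc i) (at s)"
    proof (cases i)
      case (Suc j)
      show ?thesis unfolding Suc
        by (rule DERIV_cong[OF DERIV_power[OF DERIV_inverse[OF s0]]]) (simp add: algebra_simps)
    qed simp
    have B: "((\<lambda>y. exp (inverse y)) has_real_derivative exp ?w * - (?w ^ Suc (Suc 0))) (at s)"
      by (rule DERIV_chain2[OF DERIV_exp DERIV_inverse[OF s0]])
    have "((\<lambda>y. inverse y ^ i / exp (inverse y)) has_real_derivative
      ((- real i * ?w ^ Suc i) * exp ?w - ?w ^ i * (exp ?w * - (?w ^ Suc (Suc 0)))) / (exp ?w * exp ?w)) (at s)"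
      by (rule DERIV_divide[OF A B exp_not_eq_zero])
    moreover have "((- real i * ?w ^ Suc i) * exp ?w - ?w ^ i * (exp ?w * - (?w ^ Suc (Suc 0)))) / (exp ?w * exp ?w)
      = - real i * flat (Suc i) s + flat (Suc (Suc i)) s"
    proof -
      have fl: "flat j s = ?w ^ j / exp ?w" for j using 3 by (simp add: flat_def)
      have num: "(- real i * ?w ^ Suc i) * exp ?w - ?w ^ i * (exp ?w * - (?w ^ Suc (Suc 0)))
          = (- real i * ?w ^ Suc i + ?w ^ Suc (Suc i)) * exp ?w"
        by (simp only: power_Suc power_0) (simp add: algebra_simps)
      show ?thesis unfolding num fl by (simp add: diff_divide_distrib)
    qed
    ultimately have D: "((\<lambda>y. inverse y ^ i / exp (inverse y)) has_real_derivative - real i * flat (Suc i) s + flat (Suc (Suc i)) s) (at s)"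
      by simp
    have ev: "\<forall>\<^sub>F y in nhds s. y \<in> {0<..}" using 3 by (intro eventually_nhds_in_open) auto
    have "\<forall>\<^sub>F y in nhds s. flat i y = inverse y ^ i / exp (inverse y)"
      using ev by eventually_elim (simp add: flat_def)
    thus ?thesis using D DERIV_cong_ev[of s s "flat i" "\<lambda>y. inverse y ^ i / exp (inverse y)"] by blast
  qed
qed

text \<open>A class stable under differentiation: smoothness follows by iterating the existence of a
  derivative inside it, without formulas for the higher derivatives.\<close>

inductive bump_span :: "real \<Rightarrow> real \<Rightarrow> real \<Rightarrow> (real \<Rightarrow> real) \<Rightarrow> bool" for \<mu> \<alpha> \<beta> where
  gen: "bump_span \<mu> \<alpha> \<beta> (\<lambda>x. exp (- x) * (flat i (\<mu> * (x - \<alpha>)) * flat j (\<mu> * (\<beta> - x))))"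
| lin: "bump_span \<mu> \<alpha> \<beta> f \<Longrightarrow> bump_span \<mu> \<alpha> \<beta> g \<Longrightarrow> bump_span \<mu> \<alpha> \<beta> (\<lambda>x. f x + z * g x)"

lemma bump_span_derivative:
  assumes "bump_span \<mu> \<alpha> \<beta> f"
  shows "\<exists>g. bump_span \<mu> \<alpha> \<beta> g \<and> (\<forall>x. (f has_real_derivative g x) (at x))"
  using assms
proof induction
  case (gen i j)
  let ?u = "\<lambda>i j x. exp (- x) * (flat i (\<mu> * (x - \<alpha>)) * flat j (\<mu> * (\<beta> - x)))"
  \<comment> \<open>The opening \<open>?u i j x + (-2) * ?u i j x\<close> stands for
    \<open>- ?u i j x\<close>: the span offers only sums of the shape \<open>f + z * g\<close>,
    starting from a generator.\<close>
  define g where "g = (\<lambda>x. ((((?u i j x + (-2) * ?u i j x) + (- \<mu> * real i) * ?u (Suc i) j x) + \<mu> * ?u (Suc (Suc i)) j x)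
      + (\<mu> * real j) * ?u i (Suc j) x) + (- \<mu>) * ?u i (Suc (Suc j)) x)"
  have "bump_span \<mu> \<alpha> \<beta> g" unfolding g_def by (intro bump_span.intros)
  moreover have "(?u i j has_real_derivative g x) (at x)" for x
  proof -
    have "((\<lambda>x. x - \<alpha>) has_real_derivative 1) (at x)" "((\<lambda>x. \<beta> - x) has_real_derivative - 1) (at x)"
      by (auto intro!: derivative_eq_intros)
    from DERIV_cmult[OF this(1), of \<mu>] DERIV_cmult[OF this(2), of \<mu>]
    have l: "((\<lambda>x. \<mu> * (x - \<alpha>)) has_real_derivative \<mu>) (at x)" "((\<lambda>x. \<mu> * (\<beta> - x)) has_real_derivative - \<mu>) (at x)"
      by simp_all
    note a = DERIV_chain2[where f = "flat i", OF flat_has_derivative l(1)]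
    note b = DERIV_chain2[where f = "flat j", OF flat_has_derivative l(2)]
    have ring: "- E * (A0 * B0) + ((- ri * A1 + A2) * \<mu> * B0 + (- rj * B1 + B2) * (- \<mu>) * A0) * E
      = ((((E * (A0 * B0) + (-2) * (E * (A0 * B0))) + (- \<mu> * ri) * (E * (A1 * B0))) + \<mu> * (E * (A2 * B0)))
      + (\<mu> * rj) * (E * (A0 * B1))) + (- \<mu>) * (E * (A0 * B2))" for E A0 A1 A2 B0 B1 B2 ri rj :: real
      by (simp add: algebra_simps)
    have e: "((\<lambda>x. exp (- x)) has_real_derivative - exp (- x)) (at x)"
      by (auto intro!: derivative_eq_intros)
    show ?thesis
      unfolding g_def by (rule DERIV_cong[OF DERIV_mult[OF e DERIV_mult[OF a b]] ring])
  qed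
  ultimately show ?case by blast
next
  case (lin f g z)
  then obtain f' g' where "bump_span \<mu> \<alpha> \<beta> f'" "\<And>x. (f has_real_derivative f' x) (at x)"
    "bump_span \<mu> \<alpha> \<beta> g'" "\<And>x. (g has_real_derivative g' x) (at x)" by blast
  thus ?case by (intro exI[of _ "\<lambda>x. f' x + z * g' x"] conjI allI bump_span.lin DERIV_add DERIV_cmult)
qed

lemma bump_span_smooth:
  assumes "bump_span \<mu> \<alpha> \<beta> f"
  shows "smooth_on T (\<lambda>x. complex_of_real (f x))"
proof -
  have "\<forall>g. \<exists>h. bump_span \<mu> \<alpha> \<beta> g \<longrightarrow> bump_span \<mu> \<alpha> \<beta> h \<and> (\<forall>x. (g has_real_derivative h x) (at x))"
    using bump_span_derivative by blast
  from choice[OF this] obtain d where d: "\<And>g. bump_span \<mu> \<alpha> \<beta> g \<Longrightarrow> bump_span \<mu> \<alpha> \<beta> (d g)"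
    "\<And>g x. bump_span \<mu> \<alpha> \<beta> g \<Longrightarrow> (g has_real_derivative d g x) (at x)" by blast
  define D where "D m = (d ^^ m) f" for m
  have "bump_span \<mu> \<alpha> \<beta> (D m)" for m
    by (induction m) (simp_all add: D_def assms d(1))
  hence D: "D 0 = f" "\<And>m x. (D m has_real_derivative D (Suc m) x) (at x)"
    using d(2) by (simp_all add: D_def)
  show ?thesis unfolding smooth_on_def
  proof (rule exI[of _ "\<lambda>m x. complex_of_real (D m x)"], intro conjI ballI allI)
    fix m x
    have "(D m has_real_derivative D (Suc m) x) (at x within T)"
      using D(2)[of m x] by (rule has_field_derivative_at_within)
    thus "((\<lambda>x. complex_of_real (D m x)) has_vector_derivative complex_of_real (D (Suc m) x)) (at x within T)"
      by (rule has_vector_derivative_of_real)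
  qed (simp add: D(1))
qed

text \<open>The factor \<open>exp (- x)\<close> puts all bumps under one majorant from L^1 and L^2;
  increasing \<mu> steepens the flanks and lifts the plateau towards that majorant.\<close>

definition bump :: "real \<Rightarrow> real \<Rightarrow> real \<Rightarrow> real \<Rightarrow> real" where
  "bump \<mu> \<alpha> \<beta> x = exp (- x) * (flat 0 (\<mu> * (x - \<alpha>)) * flat 0 (\<mu> * (\<beta> - x)))"

lemma flat0: "0 \<le> flat 0 s" "flat 0 s \<le> 1"
  by (auto simp: flat_def field_simps)

lemma bump_bounds: "0 \<le> bump \<mu> \<alpha> \<beta> x" "bump \<mu> \<alpha> \<beta> x \<le> exp (- x)"
proof -
  have "flat 0 (\<mu> * (x - \<alpha>)) * flat 0 (\<mu> * (\<beta> - x)) \<le> 1" by (intro mult_le_one flat0)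
  from mult_left_mono[OF this, of "exp (- x)"] show "bump \<mu> \<alpha> \<beta> x \<le> exp (- x)" by (simp add: bump_def)
qed (simp add: bump_def flat0)

lemma testN_bump:
  assumes "0 < \<mu>" "0 < \<alpha>" "\<alpha> \<le> \<beta>"
  shows "testN n (\<lambda>i x. if i = k then complex_of_real (bump \<mu> \<alpha> \<beta> x) else 0)"
  unfolding testN_def
proof (intro ballI conjI)
  fix i
  have supp: "bump \<mu> \<alpha> \<beta> x = 0" if "x \<notin> {\<alpha>..\<beta>}" for x
  proof -
    have "\<mu> * (x - \<alpha>) \<le> 0 \<or> \<mu> * (\<beta> - x) \<le> 0"
      using that assms(1) by (auto simp: mult_le_0_iff)
    thus ?thesis by (auto simp: bump_def flat_def)
  qed
  have sm: "smooth_on {0<..} (\<lambda>x. complex_of_real (bump \<mu> \<alpha> \<beta> x))"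
    unfolding bump_def by (rule bump_span_smooth[OF bump_span.gen])
  have sm0: "smooth_on {0<..} (\<lambda>x. 0 :: complex)"
    unfolding smooth_on_def by (rule exI[of _ "\<lambda>m x. 0"]) auto
  show "smooth_on {0<..} (\<lambda>x. if i = k then complex_of_real (bump \<mu> \<alpha> \<beta> x) else 0)"
    using sm sm0 by (cases "i = k") auto
  show "\<forall>x\<le>0. (if i = k then complex_of_real (bump \<mu> \<alpha> \<beta> x) else 0) = 0"
    using supp assms by auto
  show "\<exists>\<alpha>' \<beta>'. 0 < \<alpha>' \<and> \<alpha>' \<le> \<beta>' \<and> (\<forall>x. (if i = k then complex_of_real (bump \<mu> \<alpha> \<beta> x) else 0) \<noteq> 0 \<longrightarrow> x \<in> {\<alpha>'..\<beta>'})"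
    by (intro exI[of _ \<alpha>] exI[of _ \<beta>]) (use supp assms in auto)
qed

text \<open>With \<open>\<mu> = m + 1\<close> the bumps supported on \<open>[max b 0 + 1 / \<mu>, max b 0 + 1 / \<mu> + \<mu>]\<close> converge to
  \<open>exp (- x)\<close> on \<open>x > max b 0\<close>.\<close>
lemma bump_tendsto:
  fixes b x :: real
  assumes x: "0 < x"
  defines "\<mu> \<equiv> \<lambda>m. real (Suc m)" and "\<alpha> \<equiv> \<lambda>m. max b 0 + 1 / real (Suc m)"
  shows "(\<lambda>m. bump (\<mu> m) (\<alpha> m) (\<alpha> m + \<mu> m) x) \<longlonglongrightarrow> exp (- x) * indicator {b<..} x"
proof (cases "b < x")
  case False
  have "bump (\<mu> m) (\<alpha> m) (\<alpha> m + \<mu> m) x = 0" for m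
  proof -
    have "x \<le> \<alpha> m" using False by (auto simp: \<alpha>_def max_def add_increasing2)
    hence "\<mu> m * (x - \<alpha> m) \<le> 0" by (simp add: \<mu>_def mult_le_0_iff)
    thus ?thesis by (simp add: bump_def flat_def)
  qed
  thus ?thesis using False by simp
next
  case True
  have flat1: "(\<lambda>m. flat 0 (g m)) \<longlonglongrightarrow> 1" if "filterlim g at_top sequentially" for g
  proof -
    have "\<forall>\<^sub>F m in sequentially. 0 < g m" using that by (simp add: filterlim_at_top_dense)
    hence ev: "\<forall>\<^sub>F m in sequentially. 1 / exp (inverse (g m)) = flat 0 (g m)"
      by eventually_elim (simp add: flat_def)
    have "(\<lambda>m. inverse (g m)) \<longlonglongrightarrow> 0"
      by (rule filterlim_compose[OF tendsto_inverse_0_at_top[OF filterlim_ident] that])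
    hence "(\<lambda>m. 1 / exp (inverse (g m))) \<longlonglongrightarrow> 1 / exp 0" by (intro tendsto_intros) auto
    thus ?thesis using Lim_transform_eventually[OF _ ev] by simp
  qed
  have mu: "filterlim \<mu> at_top sequentially"
    unfolding \<mu>_def by (rule filterlim_compose[OF filterlim_real_sequentially filterlim_Suc])
  have d: "0 < x - max b 0" using True x by simp
  have "filterlim (\<lambda>m. (x - max b 0) * \<mu> m) at_top sequentially"
    by (rule filterlim_tendsto_pos_mult_at_top[OF tendsto_const d mu])
  from filterlim_tendsto_add_at_top[OF tendsto_const[of "-1"] this]
  have 1: "filterlim (\<lambda>m. \<mu> m * (x - \<alpha> m)) at_top sequentially"
  proof -
    \<comment> \<open>The left end is shifted by \<open>1 / \<mu> m\<close>, which costs exactly 1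
      after scaling and so does not disturb the divergence.\<close>
    have "\<mu> m * (x - \<alpha> m) = - 1 + (x - max b 0) * \<mu> m" for m
      by (simp add: \<mu>_def \<alpha>_def right_diff_distrib left_diff_distrib distrib_left mult.commute)
    thus ?thesis using \<open>filterlim (\<lambda>m. - 1 + (x - max b 0) * \<mu> m) at_top sequentially\<close> by simp
  qed
  have 2: "filterlim (\<lambda>m. \<mu> m * (\<alpha> m + \<mu> m - x)) at_top sequentially"
  proof (rule filterlim_at_top_mult_at_top[OF mu])
    have "filterlim (\<lambda>m. - x + \<mu> m) at_top sequentially"
      by (rule filterlim_tendsto_add_at_top[OF tendsto_const mu])
    thus "filterlim (\<lambda>m. \<alpha> m + \<mu> m - x) at_top sequentially"
      by (rule filterlim_at_top_mono) (auto simp: \<alpha>_def add_nonneg_nonneg intro!: always_eventually)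
  qed
  have "(\<lambda>m. exp (- x) * (flat 0 (\<mu> m * (x - \<alpha> m)) * flat 0 (\<mu> m * (\<alpha> m + \<mu> m - x)))) \<longlonglongrightarrow> exp (- x) * (1 * 1)"
    by (intro tendsto_intros flat1 1 2)
  thus ?thesis using True by (simp add: bump_def)
qed

section \<open>Density of the test functions in both norms simultaneously\<close>

lemma L12_conv_add_scale:
  assumes "\<And>m. L12 n (F m)" "\<And>m. L12 n (G m)" "L12 n f" "L12 n g" "L12_conv n F f" "L12_conv n G g"
  shows "L12_conv n (\<lambda>m k x. F m k x + z * G m k x) (\<lambda>k x. f k x + z * g k x)"
  unfolding L12_conv_def
proof (intro ballI conjI)
  fix k assume k: "k \<in> {1..n}"
  let ?u = "\<lambda>m x. F m k x - f k x" and ?v = "\<lambda>m x. G m k x - g k x"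
  have split: "F m k x + z * G m k x - (f k x + z * g k x) = ?u m x + z * ?v m x" for m x
    by (simp add: algebra_simps)
  have u: "integrable MN (?u m)" "integrable MN (\<lambda>x. (cmod (?u m x))\<^sup>2)" for m
    using L12_diff[OF assms(1,3)] k by (auto simp: L12_def)
  have v: "integrable MN (?v m)" "integrable MN (\<lambda>x. (cmod (?v m x))\<^sup>2)" for m
    using L12_diff[OF assms(2,4)] k by (auto simp: L12_def)
  have w: "integrable MN (\<lambda>x. ?u m x + z * ?v m x)" "integrable MN (\<lambda>x. (cmod (?u m x + z * ?v m x))\<^sup>2)" for m
    using L12_add_scale[OF L12_diff[OF assms(1,3)] L12_diff[OF assms(2,4)], where z = z] k by (auto simp: L12_def)
  have le1: "norm (\<integral>x. cmod (?u m x + z * ?v m x) \<partial>MN) \<le> (\<integral>x. cmod (?u m x) \<partial>MN) + cmod z * (\<integral>x. cmod (?v m x) \<partial>MN)" for m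
  proof -
    have "(\<integral>x. cmod (?u m x + z * ?v m x) \<partial>MN) \<le> (\<integral>x. cmod (?u m x) + cmod z * cmod (?v m x) \<partial>MN)"
    proof (rule integral_mono)
      show "cmod (?u m x + z * ?v m x) \<le> cmod (?u m x) + cmod z * cmod (?v m x)" for x
        using norm_triangle_ineq[of "?u m x" "z * ?v m x"] by (simp only: norm_mult)
    qed (use u v w in \<open>auto intro!: Bochner_Integration.integrable_add integrable_mult_right integrable_norm\<close>)
    also have "\<dots> = (\<integral>x. cmod (?u m x) \<partial>MN) + cmod z * (\<integral>x. cmod (?v m x) \<partial>MN)"
      using u v by (simp add: integrable_norm)
    finally show ?thesis by simp
  qed
  have le2: "norm (\<integral>x. (cmod (?u m x + z * ?v m x))\<^sup>2 \<partial>MN) \<le> 2 * (\<integral>x. (cmod (?u m x))\<^sup>2 \<partial>MN) + 2 * (cmod z)\<^sup>2 * (\<integral>x. (cmod (?v m x))\<^sup>2 \<partial>MN)" for m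
  proof -
    have "(\<integral>x. (cmod (?u m x + z * ?v m x))\<^sup>2 \<partial>MN) \<le> (\<integral>x. 2 * (cmod (?u m x))\<^sup>2 + 2 * (cmod z)\<^sup>2 * (cmod (?v m x))\<^sup>2 \<partial>MN)"
    proof (rule integral_mono)
      fix x
      have "(cmod (?u m x + z * ?v m x))\<^sup>2 \<le> (cmod (?u m x) + cmod (z * ?v m x))\<^sup>2"
        by (intro power_mono norm_triangle_ineq) auto
      also have "\<dots> \<le> 2 * (cmod (?u m x))\<^sup>2 + 2 * (cmod (z * ?v m x))\<^sup>2"
        using sum_squares_bound[of "cmod (?u m x)" "cmod (z * ?v m x)"] by (simp add: power2_sum)
      finally show "(cmod (?u m x + z * ?v m x))\<^sup>2 \<le> 2 * (cmod (?u m x))\<^sup>2 + 2 * (cmod z)\<^sup>2 * (cmod (?v m x))\<^sup>2"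
        by (simp add: norm_mult power_mult_distrib)
    qed (use u v w in \<open>auto intro!: Bochner_Integration.integrable_add integrable_mult_right\<close>)
    also have "\<dots> = 2 * (\<integral>x. (cmod (?u m x))\<^sup>2 \<partial>MN) + 2 * (cmod z)\<^sup>2 * (\<integral>x. (cmod (?v m x))\<^sup>2 \<partial>MN)"
      using u v by simp
    finally show ?thesis by simp
  qed
  have F: "(\<lambda>m. \<integral>x. cmod (?u m x) \<partial>MN) \<longlonglongrightarrow> 0" "(\<lambda>m. \<integral>x. (cmod (?u m x))\<^sup>2 \<partial>MN) \<longlonglongrightarrow> 0"
    and G: "(\<lambda>m. \<integral>x. cmod (?v m x) \<partial>MN) \<longlonglongrightarrow> 0" "(\<lambda>m. \<integral>x. (cmod (?v m x))\<^sup>2 \<partial>MN) \<longlonglongrightarrow> 0"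
    using assms(5,6) k by (auto simp: L12_conv_def)
  have "(\<lambda>m. (\<integral>x. cmod (?u m x) \<partial>MN) + cmod z * (\<integral>x. cmod (?v m x) \<partial>MN)) \<longlonglongrightarrow> 0"
    using tendsto_add[OF F(1) tendsto_mult_left[OF G(1), of "cmod z"]] by simp
  thus "(\<lambda>m. \<integral>x. cmod (F m k x + z * G m k x - (f k x + z * g k x)) \<partial>MN) \<longlonglongrightarrow> 0"
    unfolding split by (rule Lim_null_comparison[OF always_eventually, rotated]) (use le1 in blast)
  have "(\<lambda>m. 2 * (\<integral>x. (cmod (?u m x))\<^sup>2 \<partial>MN) + 2 * (cmod z)\<^sup>2 * (\<integral>x. (cmod (?v m x))\<^sup>2 \<partial>MN)) \<longlonglongrightarrow> 0"
    using tendsto_add[OF tendsto_mult_left[OF F(2), of 2] tendsto_mult_left[OF G(2), of "2 * (cmod z)\<^sup>2"]] by simp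
  thus "(\<lambda>m. \<integral>x. (cmod (F m k x + z * G m k x - (f k x + z * g k x)))\<^sup>2 \<partial>MN) \<longlonglongrightarrow> 0"
    unfolding split by (rule Lim_null_comparison[OF always_eventually, rotated]) (use le2 in blast)
qed

lemma L12_conv_dominated:
  assumes h: "L12 n h"
    and meas: "\<And>m k. k \<in> {1..n} \<Longrightarrow> F m k \<in> borel_measurable borel" "\<And>k. k \<in> {1..n} \<Longrightarrow> f k \<in> borel_measurable borel"
    and bound: "\<And>m k x. k \<in> {1..n} \<Longrightarrow> 0 < x \<Longrightarrow> cmod (F m k x - f k x) \<le> cmod (h k x)"
    and lim: "\<And>k x. k \<in> {1..n} \<Longrightarrow> 0 < x \<Longrightarrow> (\<lambda>m. F m k x) \<longlonglongrightarrow> f k x"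
  shows "L12_conv n F f"
  unfolding L12_conv_def
proof (intro ballI conjI)
  fix k assume k: "k \<in> {1..n}"
  note [measurable] = meas(1)[OF k] meas(2)[OF k]
  have hk: "integrable MN (\<lambda>x. cmod (h k x))" "integrable MN (\<lambda>x. (cmod (h k x))\<^sup>2)" using h k by (auto simp: L12_def)
  have lim0: "(\<lambda>m. cmod (F m k x - f k x)) \<longlonglongrightarrow> 0" if "0 < x" for x
    using tendsto_norm[OF LIM_zero[OF lim[OF k that]]] by simp
  have "(\<lambda>m. \<integral>x. cmod (F m k x - f k x) \<partial>MN) \<longlonglongrightarrow> (\<integral>x. 0 \<partial>MN)"
  proof (rule integral_dominated_convergence[OF _ _ hk(1)])
    show "AE x in MN. (\<lambda>m. cmod (F m k x - f k x)) \<longlonglongrightarrow> 0" by (rule AE_MN_I) (rule lim0)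
    show "AE x in MN. norm (cmod (F m k x - f k x)) \<le> cmod (h k x)" for m
      by (rule AE_MN_I) (use bound[OF k] in simp)
  qed measurable
  thus "(\<lambda>m. \<integral>x. cmod (F m k x - f k x) \<partial>MN) \<longlonglongrightarrow> 0" by simp
  have "(\<lambda>m. \<integral>x. (cmod (F m k x - f k x))\<^sup>2 \<partial>MN) \<longlonglongrightarrow> (\<integral>x. 0 \<partial>MN)"
  proof (rule integral_dominated_convergence[OF _ _ hk(2)])
    show "AE x in MN. (\<lambda>m. (cmod (F m k x - f k x))\<^sup>2) \<longlonglongrightarrow> 0"
    proof (rule AE_MN_I)
      fix x :: real assume "0 < x"
      from tendsto_power[OF lim0[OF this], of 2] show "(\<lambda>m. (cmod (F m k x - f k x))\<^sup>2) \<longlonglongrightarrow> 0" by simp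
    qed
    show "AE x in MN. norm ((cmod (F m k x - f k x))\<^sup>2) \<le> (cmod (h k x))\<^sup>2" for m
    proof (rule AE_MN_I)
      fix x :: real assume "0 < x"
      from power_mono[OF bound[OF k this, of m], of 2] show "norm ((cmod (F m k x - f k x))\<^sup>2) \<le> (cmod (h k x))\<^sup>2" by simp
    qed
  qed measurable
  thus "(\<lambda>m. \<integral>x. (cmod (F m k x - f k x))\<^sup>2 \<partial>MN) \<longlonglongrightarrow> 0" by simp
qed

definition tests_approx :: "nat \<Rightarrow> (nat \<Rightarrow> real \<Rightarrow> complex) \<Rightarrow> bool" where
  "tests_approx n f \<longleftrightarrow> L12 n f \<and> (\<exists>F. (\<forall>m. testN n (F m)) \<and> L12_conv n F f)"

lemma tests_approx_add_scale:
  assumes "tests_approx n f" "tests_approx n g"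
  shows "tests_approx n (\<lambda>k x. f k x + z * g k x)"
proof -
  obtain F G where F: "\<And>m. testN n (F m)" "L12_conv n F f" and G: "\<And>m. testN n (G m)" "L12_conv n G g"
    using assms unfolding tests_approx_def by blast
  have L: "L12 n f" "L12 n g" using assms by (auto simp: tests_approx_def)
  have "L12_conv n (\<lambda>m k x. F m k x + z * G m k x) (\<lambda>k x. f k x + z * g k x)"
    by (rule L12_conv_add_scale[OF testN_L12[OF F(1)] testN_L12[OF G(1)] L F(2) G(2)])
  thus ?thesis unfolding tests_approx_def using L12_add_scale[OF L] testN_add_scale[OF F(1) G(1)]
    by (intro conjI exI[of _ "\<lambda>m k x. F m k x + z * G m k x"]) auto
qed

lemma tests_approx_limit:
  assumes F: "\<And>m. tests_approx n (F m)" and f: "L12 n f" and conv: "L12_conv n F f"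
  shows "tests_approx n f"
proof -
  have FL: "L12 n (F m)" for m using F by (simp add: tests_approx_def)
  have "\<exists>g. testN n g \<and> (\<forall>k\<in>{1..n}. (\<integral>x. cmod (g k x - F m k x) \<partial>MN) \<le> 1 / real (Suc m)
      \<and> (\<integral>x. (cmod (g k x - F m k x))\<^sup>2 \<partial>MN) \<le> 1 / real (Suc m))" for m
  proof -
    obtain G where G: "\<And>l. testN n (G l)" "L12_conv n G (F m)" using F[of m] unfolding tests_approx_def by blast
    have "\<forall>\<^sub>F l in sequentially. \<forall>k\<in>{1..n}. (\<integral>x. cmod (G l k x - F m k x) \<partial>MN) < 1 / real (Suc m)
      \<and> (\<integral>x. (cmod (G l k x - F m k x))\<^sup>2 \<partial>MN) < 1 / real (Suc m)"
    proof (intro eventually_ball_finite ballI eventually_conj)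
      fix k assume k: "k \<in> {1..n}"
      have "(\<lambda>l. \<integral>x. cmod (G l k x - F m k x) \<partial>MN) \<longlonglongrightarrow> 0" "(\<lambda>l. \<integral>x. (cmod (G l k x - F m k x))\<^sup>2 \<partial>MN) \<longlonglongrightarrow> 0"
        using G(2) k by (auto simp: L12_conv_def)
      note lim = this
      have p: "0 < 1 / real (Suc m)" by simp
      show "\<forall>\<^sub>F l in sequentially. (\<integral>x. cmod (G l k x - F m k x) \<partial>MN) < 1 / real (Suc m)"
        by (rule order_tendstoD(2)[OF lim(1) p])
      show "\<forall>\<^sub>F l in sequentially. (\<integral>x. (cmod (G l k x - F m k x))\<^sup>2 \<partial>MN) < 1 / real (Suc m)"
        by (rule order_tendstoD(2)[OF lim(2) p])
    qed simp
    then obtain l where "\<forall>k\<in>{1..n}. (\<integral>x. cmod (G l k x - F m k x) \<partial>MN) < 1 / real (Suc m)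
      \<and> (\<integral>x. (cmod (G l k x - F m k x))\<^sup>2 \<partial>MN) < 1 / real (Suc m)"
      using eventually_happens'[OF sequentially_bot] by blast
    thus ?thesis using G(1) by (intro exI[of _ "G l"] conjI ballI less_imp_le) blast+
  qed
  hence "\<forall>m. \<exists>g. testN n g \<and> (\<forall>k\<in>{1..n}. (\<integral>x. cmod (g k x - F m k x) \<partial>MN) \<le> 1 / real (Suc m)
      \<and> (\<integral>x. (cmod (g k x - F m k x))\<^sup>2 \<partial>MN) \<le> 1 / real (Suc m))" ..
  from choice[OF this] obtain G where G: "\<And>m. testN n (G m)"
    "\<And>m k. k \<in> {1..n} \<Longrightarrow> (\<integral>x. cmod (G m k x - F m k x) \<partial>MN) \<le> 1 / real (Suc m)"
    "\<And>m k. k \<in> {1..n} \<Longrightarrow> (\<integral>x. (cmod (G m k x - F m k x))\<^sup>2 \<partial>MN) \<le> 1 / real (Suc m)"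
    by blast
  have n0: "(\<lambda>m. 1 / real (Suc m)) \<longlonglongrightarrow> 0" by (rule LIMSEQ_inverse_real_of_nat[unfolded inverse_eq_divide])
  have D: "L12_conv n (\<lambda>m k x. G m k x - F m k x) (\<lambda>k x. 0)"
    unfolding L12_conv_def
  proof (intro ballI conjI)
    fix k assume k: "k \<in> {1..n}"
    show "(\<lambda>m. \<integral>x. cmod (G m k x - F m k x - 0) \<partial>MN) \<longlonglongrightarrow> 0"
      by (rule Lim_null_comparison[OF always_eventually n0]) (use G(2)[OF k] in simp)
    show "(\<lambda>m. \<integral>x. (cmod (G m k x - F m k x - 0))\<^sup>2 \<partial>MN) \<longlonglongrightarrow> 0"
      by (rule Lim_null_comparison[OF always_eventually n0]) (use G(3)[OF k] in simp)
  qed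
  have "L12_conv n (\<lambda>m k x. (G m k x - F m k x) + 1 * F m k x) (\<lambda>k x. 0 + 1 * f k x)"
    by (rule L12_conv_add_scale[OF L12_diff[OF testN_L12[OF G(1)] FL] FL L12_zero f D conv])
  hence "L12_conv n G f" by simp
  thus ?thesis unfolding tests_approx_def using f G(1) by blast
qed

lemma L12_exp_weight:
  assumes "\<psi> \<in> borel_measurable borel" "\<And>x. cmod (\<psi> x) \<le> B"
  shows "L12 n (\<lambda>i x. if i = k then of_real (exp (- x)) * \<psi> x else 0)"
proof -
  note [measurable] = assms(1)
  have B: "0 \<le> B" using assms(2) norm_ge_zero order_trans by blast
  have m: "(\<lambda>x. of_real (exp (- x)) * \<psi> x) \<in> borel_measurable borel" by measurable
  have "cmod (of_real (exp (- x)) * \<psi> x) \<le> B * exp (- x)" for x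
    using mult_left_mono[OF assms(2)[of x], of "exp (- x)"] by (simp add: norm_mult mult.commute)
  note b = integrable_exp_bound[OF m this B]
  have "(\<lambda>x. if i = k then of_real (exp (- x)) * \<psi> x else 0) = (if i = k then (\<lambda>x. of_real (exp (- x)) * \<psi> x) else (\<lambda>x. 0))" for i
    by auto
  thus ?thesis using m b by (auto simp: L12_def)
qed

text \<open>Prescribing \<psi> for positive x only lets the choice b = 0 cover the constant 1 as
  well, so both base cases of \<open>bddBorel_induct\<close> come from here.\<close>

lemma tests_approx_halfline:
  assumes \<psi>: "bddBorel \<psi>" and eq: "\<And>x. 0 < x \<Longrightarrow> \<psi> x = indicator {b<..} x"
  shows "tests_approx n (\<lambda>i x. if i = k then of_real (exp (- x)) * \<psi> x else 0)"
proof -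
  obtain B where B: "\<psi> \<in> borel_measurable borel" "\<And>x. cmod (\<psi> x) \<le> B" by (rule bddBorelE[OF \<psi>]) blast
  note [measurable] = B(1)
  define \<mu> where "\<mu> m = real (Suc m)" for m
  define \<alpha> where "\<alpha> m = max b 0 + 1 / real (Suc m)" for m
  let ?u = "\<lambda>m. bump (\<mu> m) (\<alpha> m) (\<alpha> m + \<mu> m)"
  define F where "F = (\<lambda>m i x. if i = k then complex_of_real (?u m x) else 0)"
  have test: "testN n (F m)" for m
    unfolding F_def by (rule testN_bump) (auto simp: \<mu>_def \<alpha>_def add_nonneg_pos)
  have "L12_conv n F (\<lambda>i x. if i = k then of_real (exp (- x)) * \<psi> x else 0)"
  proof (rule L12_conv_dominated)
    show "L12 n (\<lambda>i x. if i = k then of_real (exp (- x)) * 2 else 0)"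
      by (rule L12_exp_weight[where B = 2]) auto
    fix i m assume i: "i \<in> {1..n}"
    show "F m i \<in> borel_measurable borel" using testN_L12[OF test[of m]] i by (auto simp: L12_def)
    show "(\<lambda>x. if i = k then of_real (exp (- x)) * \<psi> x else 0) \<in> borel_measurable borel" by measurable
    fix x :: real assume x: "0 < x"
    have "cmod (complex_of_real (?u m x) - of_real (exp (- x)) * indicator {b<..} x) \<le> cmod (complex_of_real (?u m x)) + cmod (of_real (exp (- x)) * indicator {b<..} x)"
      by (rule norm_triangle_ineq4)
    also have "\<dots> \<le> exp (- x) + exp (- x)"
      using bump_bounds[of "\<mu> m" "\<alpha> m" "\<alpha> m + \<mu> m" x] by (intro add_mono) (auto simp: indicator_def)
    finally show "cmod (F m i x - (if i = k then of_real (exp (- x)) * \<psi> x else 0)) \<le> cmod (if i = k then of_real (exp (- x)) * 2 else 0)"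
      using eq[OF x] by (simp add: F_def norm_mult)
    have "(\<lambda>m. complex_of_real (?u m x)) \<longlonglongrightarrow> complex_of_real (exp (- x) * indicator {b<..} x)"
      unfolding \<mu>_def \<alpha>_def by (intro tendsto_of_real bump_tendsto x)
    moreover have "complex_of_real (exp (- x) * indicator {b<..} x) = of_real (exp (- x)) * \<psi> x"
      using eq[OF x] by (simp add: indicator_def)
    ultimately show "(\<lambda>m. F m i x) \<longlonglongrightarrow> (if i = k then of_real (exp (- x)) * \<psi> x else 0)"
      by (simp add: F_def)
  qed
  thus ?thesis unfolding tests_approx_def using L12_exp_weight[OF B] test by blast
qed

lemma tests_approx_bddBorel:
  assumes "bddBorel \<psi>"
  shows "tests_approx n (\<lambda>i x. if i = k then of_real (exp (- x)) * \<psi> x else 0)"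
proof -
  let ?w = "\<lambda>\<psi> i x. if i = k then complex_of_real (exp (- x)) * \<psi> x else 0"
  have "bddBorel \<psi> \<and> tests_approx n (?w \<psi>)"
  proof (rule bddBorel_induct[OF _ _ _ _ assms])
    fix b show "bddBorel (indicator {b<..}) \<and> tests_approx n (?w (indicator {b<..}))"
      by (intro conjI tests_approx_halfline[where b = b]) auto
    show "bddBorel (\<lambda>x. 1) \<and> tests_approx n (?w (\<lambda>x. 1))"
      by (intro conjI tests_approx_halfline[where b = 0]) auto
  next
    fix f g z assume fg: "bddBorel f \<and> tests_approx n (?w f)" "bddBorel g \<and> tests_approx n (?w g)"
    have "(\<lambda>i x. ?w f i x + z * ?w g i x) = ?w (\<lambda>x. f x + z * g x)"
      by (auto simp: fun_eq_iff algebra_simps)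
    with tests_approx_add_scale[of n "?w f" "?w g" z] fg bddBorel_add_scale[of f g z]
    show "bddBorel (\<lambda>x. f x + z * g x) \<and> tests_approx n (?w (\<lambda>x. f x + z * g x))" by simp
  next
    fix F f B assume F: "\<And>m. bddBorel (F m) \<and> tests_approx n (?w (F m))" "\<And>m x. cmod (F m x) \<le> B"
      "\<And>x. (\<lambda>m. F m x) \<longlonglongrightarrow> f x"
    have f: "bddBorel f" using F by (intro bddBorel_limit[of F B f]) auto
    have Bf: "cmod (f x) \<le> B" for x
      using tendsto_norm[OF F(3)[of x]] F(2) by (intro LIMSEQ_le_const2[of "\<lambda>m. cmod (F m x)"]) auto
    have fm: "f \<in> borel_measurable borel" and Fm: "F m \<in> borel_measurable borel" for m
      using f F(1) by (auto simp: bddBorel_def)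
    note [measurable] = fm Fm
    have conv: "L12_conv n (\<lambda>m. ?w (F m)) (?w f)"
    proof (rule L12_conv_dominated)
      show "L12 n (?w (\<lambda>x. of_real (2 * B)))" by (rule L12_exp_weight[where B = "\<bar>2 * B\<bar>"]) auto
      show "?w (F m) i \<in> borel_measurable borel" "?w f i \<in> borel_measurable borel" for m i by measurable
      show "(\<lambda>m. ?w (F m) i x) \<longlonglongrightarrow> ?w f i x" for i x
        by (cases "i = k") (auto intro!: tendsto_intros F(3))
      fix m i and x :: real
      have "cmod (F m x - f x) \<le> B + B" by (rule order_trans[OF norm_triangle_ineq4 add_mono[OF F(2) Bf]])
      moreover have "0 \<le> B" by (rule order_trans[OF norm_ge_zero Bf])
      ultimately have le: "cmod (F m x - f x) \<le> cmod (complex_of_real (2 * B))" unfolding norm_of_real by linarith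
      show "cmod (?w (F m) i x - ?w f i x) \<le> cmod (?w (\<lambda>x. of_real (2 * B)) i x)"
      proof (cases "i = k")
        case True
        show ?thesis unfolding if_P[OF True] right_diff_distrib[symmetric] norm_mult[of "complex_of_real (exp (- x))"]
          by (rule mult_left_mono[OF le norm_ge_zero])
      next
        case False
        show ?thesis unfolding if_not_P[OF False] by simp
      qed
    qed
    have Fa: "tests_approx n (?w (F m))" for m using F(1) by blast
    have "tests_approx n (?w f)"
      by (rule tests_approx_limit[OF Fa L12_exp_weight[OF fm Bf] conv])
    with f show "bddBorel f \<and> tests_approx n (?w f)" by simp
  qed
  thus ?thesis by simp
qed

lemma L12_edge:
  assumes "L12 n f" "J \<subseteq> {1..n}"
  shows "L12 n (\<lambda>i x. if i \<in> J then f i x else 0)"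
proof -
  have "(\<lambda>x. if i \<in> J then f i x else 0) = (if i \<in> J then f i else (\<lambda>x. 0))" for i by auto
  thus ?thesis using assms by (auto simp: L12_def)
qed

text \<open>On one edge f is \<open>exp (- x)\<close> times \<open>exp x * f\<close>. Truncating the
  second factor where its modulus exceeds m makes it bounded and Borel, and the error is dominated
  by f itself. The edges are then added one at a time.\<close>

lemma L12_tests_approx:
  assumes f: "L12 n f"
  shows "tests_approx n f"
proof -
  have single: "tests_approx n (\<lambda>i x. if i = k then f k x else 0)" if k: "k \<in> {1..n}" for k
  proof -
    have [measurable]: "f k \<in> borel_measurable borel" using f k by (simp add: L12_def)
    define \<psi> where "\<psi> m x = (if cmod (of_real (exp x) * f k x) \<le> real m then of_real (exp x) * f k x else 0)" for m x
    have bdd: "bddBorel (\<psi> m)" for m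
    proof (rule bddBorelI[where B = "real m"])
      show "\<psi> m \<in> borel_measurable borel" unfolding \<psi>_def by measurable
    qed (auto simp: \<psi>_def)
    have e: "complex_of_real (exp (- x)) * (of_real (exp x) * y) = y" for x y
      by (simp add: exp_minus flip: mult.assoc of_real_mult)
    have \<psi>eq: "of_real (exp (- x)) * \<psi> m x = (if cmod (of_real (exp x) * f k x) \<le> real m then f k x else 0)" for m x
      by (simp add: \<psi>_def e)
    have sing: "L12 n (\<lambda>i x. if i = k then f k x else 0)"
      using L12_edge[OF f, of "{k}"] k by (simp cong: if_cong)
    have "L12_conv n (\<lambda>m i x. if i = k then of_real (exp (- x)) * \<psi> m x else 0) (\<lambda>i x. if i = k then f k x else 0)"
    proof (rule L12_conv_dominated[OF sing])
      fix i m assume i: "i \<in> {1..n}"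
      show "(\<lambda>x. if i = k then of_real (exp (- x)) * \<psi> m x else 0) \<in> borel_measurable borel"
        unfolding \<psi>eq by measurable
      show "(\<lambda>x. if i = k then f k x else 0) \<in> borel_measurable borel" by measurable
      fix x :: real
      show "cmod ((if i = k then of_real (exp (- x)) * \<psi> m x else 0) - (if i = k then f k x else 0)) \<le> cmod (if i = k then f k x else 0)"
        unfolding \<psi>eq by simp
      obtain m0 where m0: "cmod (of_real (exp x) * f k x) \<le> real m0" using real_arch_simple by blast
      have "(if i = k then of_real (exp (- x)) * \<psi> m x else 0) = (if i = k then f k x else 0)" if "m \<ge> m0" for m
        unfolding \<psi>eq using m0 that by auto
      thus "(\<lambda>m. if i = k then of_real (exp (- x)) * \<psi> m x else 0) \<longlonglongrightarrow> (if i = k then f k x else 0)"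
        by (intro tendsto_eventually eventually_sequentiallyI)
    qed
    thus ?thesis
      by (rule tests_approx_limit[OF tests_approx_bddBorel[OF bdd] sing])
  qed
  have "tests_approx n (\<lambda>i x. if i \<in> J then f i x else 0)" if "finite J" "J \<subseteq> {1..n}" for J
    using that
  proof (induction J rule: finite_induct)
    case empty
    have "testN n (\<lambda>i x. 0)"
      using testN_add_scale[OF testN_bump[of 1 1 1 n 0] testN_bump[of 1 1 1 n 0], of "-1"] by simp
    thus ?case unfolding tests_approx_def by (auto simp: L12_conv_def intro!: exI[of _ "\<lambda>m i x. 0"])
  next
    case (insert k J)
    have "(\<lambda>i x. (if i \<in> J then f i x else 0) + 1 * (if i = k then f k x else 0)) = (\<lambda>i x. if i \<in> insert k J then f i x else 0)"
      using insert(2) by (auto simp: fun_eq_iff)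
    thus ?case using tests_approx_add_scale[OF insert(3) single[of k], of 1] insert(4) by simp
  qed
  from this[of "{1..n}"] have "tests_approx n (\<lambda>i x. if i \<in> {1..n} then f i x else 0)" by simp
  then obtain F where "\<And>m. testN n (F m)" "L12_conv n F (\<lambda>i x. if i \<in> {1..n} then f i x else 0)"
    unfolding tests_approx_def by blast
  thus ?thesis using f unfolding tests_approx_def L12_conv_def by (intro conjI exI[of _ F]) auto
qed

text \<open>Cutting f off where \<open>exp x * f\<close> exceeds m leaves a function bounded by
  \<open>m * exp (- x)\<close>, which therefore lies in L^1 too.\<close>

lemma L12_dense:
  assumes "sqints n (\<lambda>_. MN) f"
  shows "\<exists>F. (\<forall>m. L12 n (F m)) \<and> (\<lambda>m. nrm n (\<lambda>_. MN) (\<lambda>k x. F m k x - f k x)) \<longlonglongrightarrow> 0"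
proof -
  define F where "F m k x = (if cmod (of_real (exp x) * f k x) \<le> real m then f k x else 0)" for m :: nat and k x
  have fk: "f k \<in> borel_measurable borel" "integrable MN (\<lambda>x. (cmod (f k x))\<^sup>2)" if "k \<in> {1..n}" for k
    using assms that by (auto simp: sqints_def sqint_def cong: measurable_cong_sets)
  have L: "L12 n (F m)" for m
    unfolding L12_def
  proof
    fix k assume k: "k \<in> {1..n}"
    note [measurable] = fk(1)[OF k]
    have m: "F m k \<in> borel_measurable borel" unfolding F_def by measurable
    have b: "cmod (F m k x) \<le> real m * exp (- x)" for x
    proof (cases "cmod (of_real (exp x) * f k x) \<le> real m")
      case True
      hence "exp (- x) * (exp x * cmod (f k x)) \<le> exp (- x) * real m" by (intro mult_left_mono) (auto simp: norm_mult)
      moreover have "exp (- x) * (exp x * cmod (f k x)) = cmod (f k x)" by (simp add: exp_minus)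
      ultimately show ?thesis using True by (simp add: F_def mult.commute)
    qed (simp add: F_def)
    show "F m k \<in> borel_measurable borel \<and> integrable MN (F m k) \<and> integrable MN (\<lambda>x. (cmod (F m k x))\<^sup>2)"
      using m integrable_exp_bound[OF m b] by simp
  qed
  have "(\<lambda>m. nrm n (\<lambda>_. MN) (\<lambda>k x. F m k x - f k x)) \<longlonglongrightarrow> 0"
  proof (rule nrm_dominated[OF assms])
    fix m k assume k: "k \<in> {1..n}"
    note [measurable] = fk(1)[OF k]
    show "(\<lambda>x. F m k x - f k x) \<in> borel_measurable MN" unfolding F_def by measurable
    show "cmod (F m k x - f k x) \<le> cmod (f k x)" for x by (simp add: F_def)
    show "AE x in MN. (\<lambda>m. F m k x - f k x) \<longlonglongrightarrow> 0"
    proof (rule AE_MN_I)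
      fix x
      obtain m0 where m0: "cmod (of_real (exp x) * f k x) \<le> real m0" using real_arch_simple by blast
      have "F m k x - f k x = 0" if "m \<ge> m0" for m using m0 that by (auto simp: F_def)
      thus "(\<lambda>m. F m k x - f k x) \<longlonglongrightarrow> 0" by (intro tendsto_eventually eventually_sequentiallyI)
    qed
  qed
  with L show ?thesis by blast
qed

section \<open>The extended transform as a closed isometric graph\<close>

context star
begin

abbreviation W where "W \<equiv> Vt n c a"

lemma Vt_iff: "W f G \<longleftrightarrow> sqints n (\<lambda>_. MN) f \<and> sqints n (Mq n c a) G \<and>
    (\<exists>\<phi>. (\<forall>m. testN n (\<phi> m)) \<and> (\<lambda>m. nH (\<lambda>k x. \<phi> m k x - f k x)) \<longlonglongrightarrow> 0 \<and>
      (\<lambda>m. nq (\<lambda>k t. V (\<phi> m) k t - G k t)) \<longlonglongrightarrow> 0)"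
  unfolding Vt_def inH_eq inLq_eq normH_eq normq_eq by simp

lemma L12_isom:
  assumes f: "L12 n f"
  shows "isom f" "W f (V f)"
proof -
  obtain F where F: "\<And>m. testN n (F m)" "L12_conv n F f"
    using L12_tests_approx[OF f] unfolding tests_approx_def by blast
  note lim = isom_limit[OF testN_isom[OF F(1)] testN_isom[OF testN_diff[OF F(1) F(1)]] f F(2)]
  show "isom f" by (rule lim(1))
  thus "W f (V f)" unfolding Vt_iff using F(1) L12_sqints[OF f] L12_conv_nrm[OF F(2)] lim(2)
    by (auto simp: isom_def)
qed

lemma Vt_sqints: "W f G \<Longrightarrow> sqints n (\<lambda>_. MN) f" "W f G \<Longrightarrow> sqints n (Mq n c a) G"
  by (auto simp: Vt_iff)

lemma Vt_norm:
  assumes "W f G"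
  shows "nH f = nq G"
proof -
  obtain \<phi> where \<phi>: "\<And>m. testN n (\<phi> m)" "(\<lambda>m. nH (\<lambda>k x. \<phi> m k x - f k x)) \<longlonglongrightarrow> 0"
      "(\<lambda>m. nq (\<lambda>k t. V (\<phi> m) k t - G k t)) \<longlonglongrightarrow> 0" using assms by (auto simp: Vt_iff)
  have i: "isom (\<phi> m)" for m by (rule testN_isom[OF \<phi>(1)])
  have "(\<lambda>m. nH (\<phi> m)) \<longlonglongrightarrow> nH f"
    by (rule nrm_tendsto[OF L12_sqints[OF testN_L12[OF \<phi>(1)]] Vt_sqints(1)[OF assms] \<phi>(2)])
  moreover have "(\<lambda>m. nq (V (\<phi> m))) \<longlonglongrightarrow> nq G"
    using i by (intro nrm_tendsto[OF _ Vt_sqints(2)[OF assms] \<phi>(3)]) (simp add: isom_def)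
  hence "(\<lambda>m. nH (\<phi> m)) \<longlonglongrightarrow> nq G" using i by (simp add: isom_def)
  ultimately show ?thesis by (rule LIMSEQ_unique)
qed

lemma Vt_add_scale:
  assumes f: "W f G" and g: "W g H"
  shows "W (\<lambda>k x. f k x + z * g k x) (\<lambda>k t. G k t + z * H k t)"
proof -
  obtain \<phi> where \<phi>: "\<And>m. testN n (\<phi> m)" "(\<lambda>m. nH (\<lambda>k x. \<phi> m k x - f k x)) \<longlonglongrightarrow> 0"
      "(\<lambda>m. nq (\<lambda>k t. V (\<phi> m) k t - G k t)) \<longlonglongrightarrow> 0" using f by (auto simp: Vt_iff)
  obtain \<theta> where \<theta>: "\<And>m. testN n (\<theta> m)" "(\<lambda>m. nH (\<lambda>k x. \<theta> m k x - g k x)) \<longlonglongrightarrow> 0"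
      "(\<lambda>m. nq (\<lambda>k t. V (\<theta> m) k t - H k t)) \<longlonglongrightarrow> 0" using g by (auto simp: Vt_iff)
  note sq = Vt_sqints[OF f] Vt_sqints[OF g]
  have L: "L12 n (\<phi> m)" "L12 n (\<theta> m)" for m by (intro testN_L12 \<phi>(1) \<theta>(1))+
  let ?u = "\<lambda>m k x. \<phi> m k x + z * \<theta> m k x"
  have VL: "sqints n (Mq n c a) (V (\<phi> m))" "sqints n (Mq n c a) (V (\<theta> m))" "sqints n (Mq n c a) (V (?u m))" for m
    using testN_isom[OF \<phi>(1)] testN_isom[OF \<theta>(1)] testN_isom[OF testN_add_scale[OF \<phi>(1) \<theta>(1)]] by (auto simp: isom_def)
  have "(\<lambda>m. nH (\<lambda>k x. ?u m k x - (f k x + z * g k x))) \<longlonglongrightarrow> 0"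
  proof (rule Lim_null_comparison[OF always_eventually])
    show "(\<lambda>m. nH (\<lambda>k x. \<phi> m k x - f k x) + cmod z * nH (\<lambda>k x. \<theta> m k x - g k x)) \<longlonglongrightarrow> 0"
      using tendsto_add[OF \<phi>(2) tendsto_mult_left[OF \<theta>(2), of "cmod z"]] by simp
    have "nH (\<lambda>k x. ?u m k x - (f k x + z * g k x)) = nH (\<lambda>k x. (\<phi> m k x - f k x) + z * (\<theta> m k x - g k x))" for m
      by (simp add: algebra_simps)
    also have "\<dots> m \<le> nH (\<lambda>k x. \<phi> m k x - f k x) + nH (\<lambda>k x. z * (\<theta> m k x - g k x))" for m
      by (intro nrm_triangle sqints_diff sqints_scale L12_sqints L sq)
    finally show "\<forall>m. norm (nH (\<lambda>k x. ?u m k x - (f k x + z * g k x))) \<le> nH (\<lambda>k x. \<phi> m k x - f k x) + cmod z * nH (\<lambda>k x. \<theta> m k x - g k x)"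
      by (simp add: nrm_scale)
  qed
  moreover have "(\<lambda>m. nq (\<lambda>k t. V (?u m) k t - (G k t + z * H k t))) \<longlonglongrightarrow> 0"
  proof (rule Lim_null_comparison[OF always_eventually])
    show "(\<lambda>m. nq (\<lambda>k t. V (\<phi> m) k t - G k t) + cmod z * nq (\<lambda>k t. V (\<theta> m) k t - H k t)) \<longlonglongrightarrow> 0"
      using tendsto_add[OF \<phi>(3) tendsto_mult_left[OF \<theta>(3), of "cmod z"]] by simp
    show "\<forall>m. norm (nq (\<lambda>k t. V (?u m) k t - (G k t + z * H k t))) \<le> nq (\<lambda>k t. V (\<phi> m) k t - G k t) + cmod z * nq (\<lambda>k t. V (\<theta> m) k t - H k t)"
    proof
      fix m
      have "nq (\<lambda>k t. V (?u m) k t - (G k t + z * H k t)) = nq (\<lambda>k t. (V (\<phi> m) k t - G k t) + z * (V (\<theta> m) k t - H k t))"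
      proof (rule nrm_cong_AE)
        fix k assume k: "k \<in> {1..n}"
        show "AE t in Mq n c a k. V (?u m) k t - (G k t + z * H k t) = (V (\<phi> m) k t - G k t) + z * (V (\<theta> m) k t - H k t)"
          by (rule AE_Mq_I[OF k]) (simp add: Vop_add_scale[OF k _ L] algebra_simps)
      qed (intro sqints_add sqints_diff sqints_scale VL sq)+
      also have "\<dots> \<le> nq (\<lambda>k t. V (\<phi> m) k t - G k t) + nq (\<lambda>k t. z * (V (\<theta> m) k t - H k t))"
        by (intro nrm_triangle sqints_diff sqints_scale VL sq)
      finally show "norm (nq (\<lambda>k t. V (?u m) k t - (G k t + z * H k t))) \<le> nq (\<lambda>k t. V (\<phi> m) k t - G k t) + cmod z * nq (\<lambda>k t. V (\<theta> m) k t - H k t)"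
        by (simp add: nrm_scale)
    qed
  qed
  ultimately show ?thesis unfolding Vt_iff
    using testN_add_scale[OF \<phi>(1) \<theta>(1)] by (intro conjI sqints_add sqints_scale sq exI[of _ ?u]) auto
qed

lemma Vt_diff: "W f G \<Longrightarrow> W g H \<Longrightarrow> W (\<lambda>k x. f k x - g k x) (\<lambda>k t. G k t - H k t)"
  using Vt_add_scale[of f G g H "-1"] by simp

text \<open>The graph is a closure already, so a diagonal choice of test functions with errors
  \<open>1 / Suc m\<close> on both sides suffices.\<close>

lemma Vt_closed:
  assumes F: "\<And>m. W (F m) (G m)" and f: "sqints n (\<lambda>_. MN) f" "(\<lambda>m. nH (\<lambda>k x. F m k x - f k x)) \<longlonglongrightarrow> 0"
    and g: "sqints n (Mq n c a) g" "(\<lambda>m. nq (\<lambda>k t. G m k t - g k t)) \<longlonglongrightarrow> 0"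
  shows "W f g"
proof -
  have "\<exists>\<phi>. testN n \<phi> \<and> nH (\<lambda>k x. \<phi> k x - F m k x) \<le> 1 / real (Suc m) \<and> nq (\<lambda>k t. V \<phi> k t - G m k t) \<le> 1 / real (Suc m)" for m
  proof -
    obtain \<phi> where \<phi>: "\<And>l. testN n (\<phi> l)" "(\<lambda>l. nH (\<lambda>k x. \<phi> l k x - F m k x)) \<longlonglongrightarrow> 0"
      "(\<lambda>l. nq (\<lambda>k t. V (\<phi> l) k t - G m k t)) \<longlonglongrightarrow> 0" using F[of m] by (auto simp: Vt_iff)
    have p: "0 < 1 / real (Suc m)" by simp
    have "\<forall>\<^sub>F l in sequentially. nH (\<lambda>k x. \<phi> l k x - F m k x) < 1 / real (Suc m) \<and> nq (\<lambda>k t. V (\<phi> l) k t - G m k t) < 1 / real (Suc m)"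
      by (intro eventually_conj order_tendstoD(2)[OF \<phi>(2) p] order_tendstoD(2)[OF \<phi>(3) p])
    then obtain l where "nH (\<lambda>k x. \<phi> l k x - F m k x) < 1 / real (Suc m) \<and> nq (\<lambda>k t. V (\<phi> l) k t - G m k t) < 1 / real (Suc m)"
      using eventually_happens'[OF sequentially_bot] by blast
    thus ?thesis using \<phi>(1) by (intro exI[of _ "\<phi> l"] conjI less_imp_le) blast+
  qed
  hence "\<forall>m. \<exists>\<phi>. testN n \<phi> \<and> nH (\<lambda>k x. \<phi> k x - F m k x) \<le> 1 / real (Suc m) \<and> nq (\<lambda>k t. V \<phi> k t - G m k t) \<le> 1 / real (Suc m)" ..
  from choice[OF this] obtain \<phi> where \<phi>: "\<And>m. testN n (\<phi> m)" "\<And>m. nH (\<lambda>k x. \<phi> m k x - F m k x) \<le> 1 / real (Suc m)"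
    "\<And>m. nq (\<lambda>k t. V (\<phi> m) k t - G m k t) \<le> 1 / real (Suc m)" by blast
  have n0: "(\<lambda>m. 1 / real (Suc m)) \<longlonglongrightarrow> 0" by (rule LIMSEQ_inverse_real_of_nat[unfolded inverse_eq_divide])
  have Vsq: "sqints n (Mq n c a) (V (\<phi> m))" for m using testN_isom[OF \<phi>(1)] by (simp add: isom_def)
  have "(\<lambda>m. nH (\<lambda>k x. \<phi> m k x - f k x)) \<longlonglongrightarrow> 0"
  proof (rule Lim_null_comparison[OF always_eventually])
    show "(\<lambda>m. 1 / real (Suc m) + nH (\<lambda>k x. F m k x - f k x)) \<longlonglongrightarrow> 0" using tendsto_add[OF n0 f(2)] by simp
    show "\<forall>m. norm (nH (\<lambda>k x. \<phi> m k x - f k x)) \<le> 1 / real (Suc m) + nH (\<lambda>k x. F m k x - f k x)"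
    proof
      fix m
      show "norm (nH (\<lambda>k x. \<phi> m k x - f k x)) \<le> 1 / real (Suc m) + nH (\<lambda>k x. F m k x - f k x)"
        using nrm_diff_triangle[OF L12_sqints[OF testN_L12[OF \<phi>(1)]] Vt_sqints(1)[OF F] f(1), of m m] \<phi>(2)[of m] by simp
    qed
  qed
  moreover have "(\<lambda>m. nq (\<lambda>k t. V (\<phi> m) k t - g k t)) \<longlonglongrightarrow> 0"
  proof (rule Lim_null_comparison[OF always_eventually])
    show "(\<lambda>m. 1 / real (Suc m) + nq (\<lambda>k t. G m k t - g k t)) \<longlonglongrightarrow> 0" using tendsto_add[OF n0 g(2)] by simp
    show "\<forall>m. norm (nq (\<lambda>k t. V (\<phi> m) k t - g k t)) \<le> 1 / real (Suc m) + nq (\<lambda>k t. G m k t - g k t)"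
    proof
      fix m
      show "norm (nq (\<lambda>k t. V (\<phi> m) k t - g k t)) \<le> 1 / real (Suc m) + nq (\<lambda>k t. G m k t - g k t)"
        using nrm_diff_triangle[OF Vsq Vt_sqints(2)[OF F] g(1), of m m] \<phi>(3)[of m] by simp
    qed
  qed
  ultimately show ?thesis unfolding Vt_iff using \<phi>(1) f(1) g(1) by blast
qed

text \<open>A representative changed on a null set is the norm limit of the constant sequence, so
  this is an instance of closedness.\<close>

lemma Vt_cong:
  assumes W: "W f G" and f: "sqints n (\<lambda>_. MN) f'" "\<And>k. k \<in> {1..n} \<Longrightarrow> AE x in MN. f k x = f' k x"
    and g: "sqints n (Mq n c a) G'" "\<And>k. k \<in> {1..n} \<Longrightarrow> AE t in Mq n c a k. G k t = G' k t"
  shows "W f' G'"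
proof (rule Vt_closed[of "\<lambda>m. f" "\<lambda>m. G", OF W f(1) _ g(1)])
  have "nH (\<lambda>k x. f k x - f' k x) = 0"
    using nrm_zero_iff[OF sqints_diff[OF Vt_sqints(1)[OF W] f(1)]] f(2) by simp
  thus "(\<lambda>m. nH (\<lambda>k x. f k x - f' k x)) \<longlonglongrightarrow> 0" by simp
  have "nq (\<lambda>k t. G k t - G' k t) = 0"
    using nrm_zero_iff[OF sqints_diff[OF Vt_sqints(2)[OF W] g(1)]] g(2) by simp
  thus "(\<lambda>m. nq (\<lambda>k t. G k t - G' k t)) \<longlonglongrightarrow> 0" by simp
qed

text \<open>The range is closed, because the transform is isometric and the domain complete.\<close>
lemma Vt_range_closed:
  assumes F: "\<And>m. W (F m) (G m)" and g: "sqints n (Mq n c a) g" "(\<lambda>m. nq (\<lambda>k t. G m k t - g k t)) \<longlonglongrightarrow> 0"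
  shows "\<exists>f. W f g"
proof -
  have "\<exists>m0. \<forall>m\<ge>m0. \<forall>l\<ge>m0. nH (\<lambda>k x. F m k x - F l k x) < e" if e: "0 < e" for e
  proof -
    obtain m0 where m0: "\<And>m. m \<ge> m0 \<Longrightarrow> nq (\<lambda>k t. G m k t - g k t) < e / 2"
      using LIMSEQ_D[OF g(2), of "e / 2"] e by auto
    have "nH (\<lambda>k x. F m k x - F l k x) < e" if "m \<ge> m0" "l \<ge> m0" for m l
    proof -
      have "nH (\<lambda>k x. F m k x - F l k x) = nq (\<lambda>k t. G m k t - G l k t)"
        by (rule Vt_norm[OF Vt_diff[OF F F]])
      also have "\<dots> \<le> nq (\<lambda>k t. G m k t - g k t) + nq (\<lambda>k t. g k t - G l k t)"
        by (rule nrm_diff_triangle[OF Vt_sqints(2)[OF F] g(1) Vt_sqints(2)[OF F]])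
      also have "nq (\<lambda>k t. g k t - G l k t) = nq (\<lambda>k t. G l k t - g k t)" by (rule nrm_minus_commute)
      finally show ?thesis using m0[OF that(1)] m0[OF that(2)] by linarith
    qed
    thus ?thesis by blast
  qed
  from nrm_complete[where F = F, OF Vt_sqints(1)[OF F] this]
  obtain f where "sqints n (\<lambda>_. MN) f" "(\<lambda>m. nH (\<lambda>k x. F m k x - f k x)) \<longlonglongrightarrow> 0" by blast
  from Vt_closed[OF F this g] show ?thesis by blast
qed

end

section \<open>The resolvent and the functional calculus\<close>

lemma cmod_resolvent_le:
  assumes "Im z \<noteq> 0"
  shows "cmod (1 / (complex_of_real t - z)) \<le> 1 / \<bar>Im z\<bar>"
proof -
  have "\<bar>Im z\<bar> \<le> cmod (complex_of_real t - z)" using abs_Im_le_cmod[of "complex_of_real t - z"] by simp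
  hence "1 / cmod (complex_of_real t - z) \<le> 1 / \<bar>Im z\<bar>" using assms by (intro frac_le) auto
  thus ?thesis by (simp add: norm_divide)
qed

lemma inL2N_iff: "inL2N g \<longleftrightarrow> sqint MN g"
  by (simp add: inL2N_def sqint_def cong: measurable_cong_sets)

section \<open>Square integrable solutions of the equation on one edge\<close>

lemma has_vector_derivative_exp_linear:
  "((\<lambda>x. exp (w * of_real x)) has_vector_derivative (w * exp (w * of_real x))) (at x within T)" for w :: complex
proof -
  have "((\<lambda>z. exp (w * z)) has_field_derivative w * exp (w * of_real x)) (at (of_real x))"
    by (auto intro!: derivative_eq_intros)
  hence "((\<lambda>x. exp (w * of_real x)) has_vector_derivative (w * exp (w * of_real x))) (at x)"
    by (rule has_vector_derivative_real_field)
  thus ?thesis by (rule has_vector_derivative_at_within)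
qed

text \<open>The weak second derivative agrees almost everywhere with h, which is continuous because
  \<open>U0\<close> is. Under the integral one may replace the other, so \<open>U1\<close> is
  differentiable in the classical sense.\<close>

lemma H2rep_classical:
  assumes H: "H2rep U0 U1 U2" and h: "h = (\<lambda>x. z * U0 x - g * exp (- (p * of_real x)))"
    and ae: "AE x in MN. U2 x = h x" and x: "x \<in> {0..X}"
  shows "(U0 has_vector_derivative U1 x) (at x within {0..X})"
    and "(U1 has_vector_derivative h x) (at x within {0..X})"
proof -
  have X: "0 \<le> X" using x by simp
  have int: "set_integrable lborel {0..y} U2" "set_integrable lborel {0..y} U1"
    and U1: "U1 y = U1 0 + set_lebesgue_integral lborel {0..y} U2"
    and U0: "U0 y = U0 0 + set_lebesgue_integral lborel {0..y} U1" if "0 \<le> y" for y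
    using H that unfolding H2rep_def by blast+
  have meas [measurable]: "U0 \<in> borel_measurable borel" "U2 \<in> borel_measurable borel"
    using H by (auto simp: H2rep_def inL2N_def)
  have hk: "U2 integrable_on {0..X}" "U1 integrable_on {0..X}"
    using int[OF X] by (auto intro: set_borel_integral_eq_integral(1))
  have U1': "U1 y = U1 0 + integral {0..y} U2" and U0': "U0 y = U0 0 + integral {0..y} U1" if "y \<in> {0..X}" for y
    using U1[of y] U0[of y] int[of y] that by (auto simp: set_borel_integral_eq_integral(2))
  have c1: "continuous_on {0..X} U1"
  proof -
    have "continuous_on {0..X} (\<lambda>y. U1 0 + integral {0..y} U2)"
      by (intro continuous_intros indefinite_integral_continuous_1 hk)
    thus ?thesis using U1' by (rule continuous_on_cong[THEN iffD2, OF refl, rotated])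
  qed
  have c0: "continuous_on {0..X} U0"
  proof -
    have "continuous_on {0..X} (\<lambda>y. U0 0 + integral {0..y} U1)"
      by (intro continuous_intros indefinite_integral_continuous_1 hk)
    thus ?thesis using U0' by (rule continuous_on_cong[THEN iffD2, OF refl, rotated])
  qed
  have ch: "continuous_on {0..X} h" unfolding h by (intro continuous_intros c0)
  have U1h: "U1 y = U1 0 + integral {0..y} h" if y: "y \<in> {0..X}" for y
  proof -
    have hm: "h \<in> borel_measurable borel" unfolding h by measurable
    have sub: "continuous_on {0..y} h" using ch y by (auto intro: continuous_on_subset)
    have ih: "set_integrable lborel {0..y} h"
      by (rule borel_integrable_atLeastAtMost'[OF sub])
    have "set_lebesgue_integral lborel {0..y} U2 = set_lebesgue_integral lborel {0..y} h"
    proof (rule set_lebesgue_integral_cong_AE)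
      have "AE x in lborel. 0 < x \<longrightarrow> U2 x = h x" using ae by (simp add: AE_MN_iff)
      moreover have "AE x in lborel. x \<noteq> (0::real)" by (rule AE_lborel_singleton)
      ultimately show "AE x\<in>{0..y} in lborel. U2 x = h x" by eventually_elim auto
    qed (use hm in measurable)
    also have "\<dots> = integral {0..y} h" by (rule set_borel_integral_eq_integral(2)[OF ih])
    finally show ?thesis using U1[of y] y by simp
  qed
  have "((\<lambda>y. U0 0 + integral {0..y} U1) has_vector_derivative 0 + U1 x) (at x within {0..X})"
    by (intro has_vector_derivative_add has_vector_derivative_const integral_has_vector_derivative[OF c1 x])
  hence d0: "((\<lambda>y. U0 0 + integral {0..y} U1) has_vector_derivative U1 x) (at x within {0..X})" by simp
  show "(U0 has_vector_derivative U1 x) (at x within {0..X})"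
    by (rule has_vector_derivative_transform[OF x U0' d0])
  have "((\<lambda>y. U1 0 + integral {0..y} h) has_vector_derivative 0 + h x) (at x within {0..X})"
    by (intro has_vector_derivative_add has_vector_derivative_const integral_has_vector_derivative[OF ch x])
  hence d1: "((\<lambda>y. U1 0 + integral {0..y} h) has_vector_derivative h x) (at x within {0..X})" by simp
  show "(U1 has_vector_derivative h x) (at x within {0..X})"
    by (rule has_vector_derivative_transform[OF x U1h d1])
qed

text \<open>The half-line has infinite measure, so an integrable function has no positive lower
  bound. This is what excludes the growing solution.\<close>

lemma integrable_MN_const_bound:
  assumes "integrable MN f" "\<And>x. 0 < x \<Longrightarrow> C \<le> f x" "0 \<le> C"
  shows "C = (0::real)"
proof (rule ccontr)
  assume "C \<noteq> 0"
  hence C: "0 < C" using assms(3) by simp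
  obtain m :: nat where m: "(\<integral>x. f x \<partial>MN) / C < real m" using reals_Archimedean2 by blast
  have ind: "integrable lborel (\<lambda>x. C * indicator {0<..<real m} x)"
    by (intro integrable_mult_right) auto
  have meas: "(\<lambda>x::real. C * indicator {0<..<real m} x) \<in> borel_measurable borel" by measurable
  have eq: "(\<lambda>x. indicator {0<..} x *\<^sub>R (C * indicator {0<..<real m} x)) = (\<lambda>x::real. C * indicator {0<..<real m} x)"
    by (auto simp: indicator_def)
  have i: "integrable MN (\<lambda>x. C * indicator {0<..<real m} x)"
    using ind unfolding integrable_MN_iff[OF meas] eq .
  have "C * real m = (\<integral>x. C * indicator {0<..<real m} x \<partial>MN)"
    unfolding integral_MN[OF meas] eq by simp
  also have "\<dots> \<le> (\<integral>x. f x \<partial>MN)"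
  proof (rule integral_mono_AE[OF i assms(1)], rule AE_MN_I)
    fix x :: real assume "0 < x"
    from assms(2)[OF this] C show "C * indicator {0<..<real m} x \<le> f x" by (auto simp: indicator_def)
  qed
  finally show False using m C by (simp add: field_simps)
qed

text \<open>With \<open>y0 = U0 - P\<close> for the particular solution \<open>P\<close>, the function \<open>(y0' + \<kappa> y0) exp (- \<kappa> x)\<close> is
  constant; square integrability forces the constant to vanish, which leaves a first order equation.\<close>
lemma helmholtz_decaying:
  fixes p :: real
  assumes H: "H2rep U0 U1 U2" and re: "0 < Re \<kappa>" and p: "0 < p" and D: "\<kappa>\<^sup>2 - (of_real p)\<^sup>2 \<noteq> 0"
    and ae: "AE x in MN. U2 x = \<kappa>\<^sup>2 * U0 x - g * exp (- (of_real p * of_real x))"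
  defines "\<gamma> \<equiv> g / (\<kappa>\<^sup>2 - (of_real p)\<^sup>2)"
  shows "0 \<le> x \<Longrightarrow> U0 x = (U0 0 - \<gamma>) * exp (- (\<kappa> * of_real x)) + \<gamma> * exp (- (of_real p * of_real x))"
    and "U1 0 = - \<kappa> * (U0 0 - \<gamma>) - of_real p * \<gamma>"
proof -
  let ?P = "complex_of_real p" and ?e = "\<lambda>w x. exp (w * complex_of_real x)"
  define h where "h = (\<lambda>x. \<kappa>\<^sup>2 * U0 x - g * exp (- (?P * of_real x)))"
  define y0 where "y0 x = U0 x - \<gamma> * ?e (- ?P) x" for x
  define y1 where "y1 x = U1 x - \<gamma> * (- ?P * ?e (- ?P) x)" for x
  \<comment> \<open>Exactly this relation makes \<open>\<gamma> * exp (- p x)\<close> a particular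
    solution.\<close>
  have g: "g = \<gamma> * (\<kappa>\<^sup>2 - ?P\<^sup>2)" using D by (simp add: \<gamma>_def)
  have ae': "AE x in MN. U2 x = h x" using ae unfolding h_def .
  note cl = H2rep_classical[OF H h_def ae']
  have dy0: "(y0 has_vector_derivative y1 x) (at x within {0..X})" if "x \<in> {0..X}" for x X
    unfolding y0_def[abs_def] y1_def
    by (intro has_vector_derivative_diff cl(1)[OF that] has_vector_derivative_mult_right has_vector_derivative_exp_linear)
  have dy1: "(y1 has_vector_derivative \<kappa>\<^sup>2 * y0 x) (at x within {0..X})" if "x \<in> {0..X}" for x X
  proof -
    have "(y1 has_vector_derivative h x - \<gamma> * (- ?P * (- ?P * ?e (- ?P) x))) (at x within {0..X})"
      unfolding y1_def[abs_def]
      by (intro has_vector_derivative_diff cl(2)[OF that] has_vector_derivative_mult_right has_vector_derivative_exp_linear)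
    also have "h x - \<gamma> * (- ?P * (- ?P * ?e (- ?P) x)) = \<kappa>\<^sup>2 * y0 x"
      unfolding h_def y0_def g by (simp add: algebra_simps power2_eq_square)
    finally show ?thesis .
  qed
  have const: "f X = f 0" if X: "0 \<le> X" and der: "\<And>x. x \<in> {0..X} \<Longrightarrow> (f has_vector_derivative 0) (at x within {0..X})" for f :: "real \<Rightarrow> complex" and X
  proof -
    obtain C where "\<And>x. x \<in> {0..X} \<Longrightarrow> f x = C"
      using has_vector_derivative_zero_constant[of "{0..X}" f] der by auto
    thus ?thesis using X by simp
  qed
  define w where "w x = y1 x + \<kappa> * y0 x" for x
  have wc: "w X * ?e (- \<kappa>) X = w 0 * ?e (- \<kappa>) 0" if X: "0 \<le> X" for X
  proof (rule const[OF X])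
    fix x assume x: "x \<in> {0..X}"
    have "(w has_vector_derivative \<kappa>\<^sup>2 * y0 x + \<kappa> * y1 x) (at x within {0..X})"
      unfolding w_def[abs_def] by (intro has_vector_derivative_add dy1[OF x] has_vector_derivative_mult_right dy0[OF x])
    from has_vector_derivative_mult[OF this has_vector_derivative_exp_linear[of "- \<kappa>" x]]
    have "((\<lambda>x. w x * ?e (- \<kappa>) x) has_vector_derivative w x * (- \<kappa> * ?e (- \<kappa>) x) + (\<kappa>\<^sup>2 * y0 x + \<kappa> * y1 x) * ?e (- \<kappa>) x) (at x within {0..X})" .
    also have "w x * (- \<kappa> * ?e (- \<kappa>) x) + (\<kappa>\<^sup>2 * y0 x + \<kappa> * y1 x) * ?e (- \<kappa>) x = 0"
      unfolding w_def by (simp add: algebra_simps power2_eq_square)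
    finally show "((\<lambda>x. w x * ?e (- \<kappa>) x) has_vector_derivative 0) (at x within {0..X})" .
  qed
  have wx: "w x = w 0 * ?e \<kappa> x" if "0 \<le> x" for x
  proof -
    have "w x = w x * ?e (- \<kappa>) x * ?e \<kappa> x" by (simp add: mult.assoc flip: exp_add)
    thus ?thesis unfolding wc[OF that] by simp
  qed
  have ex: "sqint MN (\<lambda>x. ?e (- ?P) x)"
    using L12_edge_exp[of ?P 1 1] p by (auto simp: L12_def sqint_def edge_exp_def cong: measurable_cong_sets)
  have sq: "sqint MN U0" "sqint MN U1" using H by (auto simp: H2rep_def inL2N_iff)
  have "sqint MN w"
    unfolding w_def[abs_def] y0_def[abs_def] y1_def[abs_def]
    by (intro sqint_add sqint_diff sqint_scale ex sq)
  hence wint: "integrable MN (\<lambda>x. (cmod (w x))\<^sup>2)" by (simp add: sqint_def)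
  have wlow: "(cmod (w 0))\<^sup>2 \<le> (cmod (w x))\<^sup>2" if "0 < x" for x
  proof (rule power_mono)
    have "1 \<le> exp (Re \<kappa> * x)" using re that by simp
    hence "cmod (w 0) * 1 \<le> cmod (w 0) * exp (Re \<kappa> * x)" by (rule mult_left_mono) simp
    thus "cmod (w 0) \<le> cmod (w x)" using wx[of x] that by (simp add: norm_mult norm_exp_eq_Re)
  qed simp
  have "(cmod (w 0))\<^sup>2 = 0" by (rule integrable_MN_const_bound[OF wint wlow zero_le_power2])
  hence w0: "w 0 = 0" by simp
  have y1: "y1 x = - \<kappa> * y0 x" if "0 \<le> x" for x
    using wx[OF that] w0 unfolding w_def by (simp add: eq_neg_iff_add_eq_0)
  have yc: "y0 X * ?e \<kappa> X = y0 0 * ?e \<kappa> 0" if X: "0 \<le> X" for X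
  proof (rule const[OF X])
    fix x assume x: "x \<in> {0..X}"
    have "((\<lambda>x. y0 x * ?e \<kappa> x) has_vector_derivative y0 x * (\<kappa> * ?e \<kappa> x) + y1 x * ?e \<kappa> x) (at x within {0..X})"
      by (rule has_vector_derivative_mult[OF dy0[OF x] has_vector_derivative_exp_linear])
    also have "y0 x * (\<kappa> * ?e \<kappa> x) + y1 x * ?e \<kappa> x = 0" using y1[of x] x by simp
    finally show "((\<lambda>x. y0 x * ?e \<kappa> x) has_vector_derivative 0) (at x within {0..X})" .
  qed
  have y00: "y0 0 = U0 0 - \<gamma>" by (simp add: y0_def)
  show "U0 x = (U0 0 - \<gamma>) * exp (- (\<kappa> * of_real x)) + \<gamma> * exp (- (?P * of_real x))" if "0 \<le> x"
  proof -
    have "y0 x = y0 x * ?e \<kappa> x * ?e (- \<kappa>) x" by (simp add: mult.assoc flip: exp_add)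
    hence "y0 x = (U0 0 - \<gamma>) * ?e (- \<kappa>) x" unfolding yc[OF that] y00 by simp
    thus ?thesis unfolding y0_def by (simp add: algebra_simps)
  qed
  have "y1 0 = - \<kappa> * y0 0" by (rule y1) simp
  thus "U1 0 = - \<kappa> * (U0 0 - \<gamma>) - ?P * \<gamma>" unfolding y00 by (simp add: y1_def algebra_simps)
qed

section \<open>The resolvent under the transform\<close>

context star
begin

lemma kap_square_real: "k \<in> {1..n} \<Longrightarrow> of_real (c k) * (K k z)\<^sup>2 = of_real (a k) - z"
  using c_pos[of k] by (simp add: kap_square)

lemma cnj_kap_square: "k \<in> {1..n} \<Longrightarrow> of_real (c k) * (cnj (K k (of_real t)))\<^sup>2 = of_real (a k) - of_real t"
proof -
  assume k: "k \<in> {1..n}"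
  have "cnj (of_real (c k) * (K k (of_real t))\<^sup>2) = cnj (of_real (a k) - of_real t)"
    by (simp only: kap_square_real[OF k])
  thus ?thesis by simp
qed

lemma Re_cnj_kap_nonneg: "0 \<le> Re (cnj (K k z))" by (simp add: Re_kap_nonneg)

text \<open>For the rate \<open>K l z\<close> the squared root satisfies
  \<open>c l * (K l z)\<^sup>2 = a l - z\<close>. Both denominators of \<open>expV\<close> then
  reduce to \<open>t - z\<close>, the first after multiplication by the conjugate factor. The
  condition on z admits nonreal points as well as the point -1.\<close>

lemma expV_kap:
  assumes l: "l \<in> {1..n}" and z: "Im z \<noteq> 0 \<or> Re z < 0" and tz: "of_real t \<noteq> z"
  shows "expV l (K l z) i t = (of_real (c l) * (K l z - cnj (K l (of_real t))) + (if i = l then cnj (S (of_real t)) else 0)) / (of_real t - z)"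
proof -
  let ?u = "K l z" and ?v = "cnj (K l (of_real t))"
  have "0 < Re ?u" using z a_nonneg[OF l] by (intro Re_kap_pos c_pos l) auto
  hence "0 < Re (?u + ?v)" using Re_cnj_kap_nonneg[of l "of_real t"] by (simp add: add_pos_nonneg)
  hence uv: "?u + ?v \<noteq> 0" by (metis less_irrefl zero_complex.sel(1))
  have "(of_real (c l) * (?u - ?v)) * (?u + ?v) = of_real (c l) * ?u\<^sup>2 - of_real (c l) * ?v\<^sup>2"
    by (simp add: algebra_simps power2_eq_square)
  also have "\<dots> = of_real t - z" unfolding kap_square_real[OF l] cnj_kap_square[OF l] by simp
  finally have "1 / (?u + ?v) = (of_real (c l) * (?u - ?v)) / (of_real t - z)"
    using uv tz by (simp add: divide_simps)
  moreover have "of_real (c l) * ?u\<^sup>2 - of_real (a l) + of_real t = of_real t - z"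
    unfolding kap_square_real[OF l] by simp
  ultimately show ?thesis unfolding expV_def by (simp add: add_divide_distrib)
qed

text \<open>On each edge square integrability leaves only the value at the vertex undetermined; by
  continuity it is one number \<beta>, and the Kirchhoff condition fixes it. So u is an explicit
  combination of exponentials, each with a known transform.\<close>

lemma resolvent_edge_exp:
  assumes k: "k \<in> {1..n}" and p: "0 < p" and z: "Im z \<noteq> 0"
    and A: "isA n c a u v" and eq: "eqH n (\<lambda>j x. v j x - z * u j x) (edge_exp k (of_real p))"
  shows "W u (\<lambda>i t. 1 / (of_real t - z) * expV k (of_real p) i t)"
proof -
  let ?P = "complex_of_real p" and ?\<kappa> = "\<lambda>j. K j z"
  obtain U0 U1 U2 where H: "\<And>j. j \<in> {1..n} \<Longrightarrow> H2rep (U0 j) (U1 j) (U2 j)"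
    and uU: "\<And>j. j \<in> {1..n} \<Longrightarrow> AE x in MN. u j x = U0 j x"
    and cont: "\<And>i j. i \<in> {1..n} \<Longrightarrow> j \<in> {1..n} \<Longrightarrow> U0 i 0 = U0 j 0"
    and kir: "(\<Sum>j\<in>{1..n}. of_real (c j) * U1 j 0) = 0"
    and vU: "eqH n v (\<lambda>j x. - of_real (c j) * U2 j x + of_real (a j) * U0 j x)"
    using A unfolding isA_def by blast
  have usq: "sqints n (\<lambda>_. MN) u" using A by (simp add: isA_def inH_eq)
  have re: "0 < Re (?\<kappa> j)" if "j \<in> {1..n}" for j using z that by (intro Re_kap_pos c_pos) auto
  have cne: "complex_of_real (c j) \<noteq> 0" if "j \<in> {1..n}" for j using c_pos[OF that] by simp
  have D: "(?\<kappa> j)\<^sup>2 - ?P\<^sup>2 \<noteq> 0" if j: "j \<in> {1..n}" for j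
  proof
    assume "(?\<kappa> j)\<^sup>2 - ?P\<^sup>2 = 0"
    hence "of_real (a j) - z = of_real (c j) * ?P\<^sup>2" using kap_square_real[OF j, of z] by simp
    hence "Im (of_real (a j) - z) = Im (complex_of_real (c j * p\<^sup>2))" by simp
    thus False using z by simp
  qed
  define g where "g j = (if j = k then 1 / complex_of_real (c k) else 0)" for j
  define \<gamma> where "\<gamma> j = g j / ((?\<kappa> j)\<^sup>2 - ?P\<^sup>2)" for j
  define d where "d = of_real (c k) * ((?\<kappa> k)\<^sup>2 - ?P\<^sup>2)"
  have d0: "d \<noteq> 0" using D[OF k] cne[OF k] by (simp add: d_def)
  have \<gamma>: "\<gamma> j = (if j = k then 1 / d else 0)" for j by (simp add: \<gamma>_def g_def d_def)
  define \<beta> where "\<beta> = U0 k 0"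
  have U00: "U0 j 0 = \<beta>" if "j \<in> {1..n}" for j unfolding \<beta>_def using cont[OF that k] .
  have ae: "AE x in MN. U2 j x = (?\<kappa> j)\<^sup>2 * U0 j x - g j * exp (- (?P * of_real x))" if j: "j \<in> {1..n}" for j
  proof -
    have "AE x in MN. v j x - z * u j x = edge_exp k ?P j x" using eq j by (simp add: eqH_def)
    moreover have "AE x in MN. v j x = - of_real (c j) * U2 j x + of_real (a j) * U0 j x" using vU j by (simp add: eqH_def)
    ultimately show ?thesis using uU[OF j]
    proof eventually_elim
      case (elim x)
      have "of_real (c j) * U2 j x = (of_real (a j) - z) * U0 j x - edge_exp k ?P j x"
        using elim by (simp add: algebra_simps)
      also have "of_real (a j) - z = of_real (c j) * (?\<kappa> j)\<^sup>2" by (rule kap_square_real[OF j, symmetric])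
      also have "edge_exp k ?P j x = of_real (c j) * (g j * exp (- (?P * of_real x)))"
        using cne[OF k] by (simp add: edge_exp_def g_def)
      finally have "of_real (c j) * U2 j x = of_real (c j) * ((?\<kappa> j)\<^sup>2 * U0 j x - g j * exp (- (?P * of_real x)))"
        by (simp add: algebra_simps)
      thus ?case using cne[OF j] by simp
    qed
  qed
  have sol: "0 \<le> x \<Longrightarrow> U0 j x = (\<beta> - \<gamma> j) * exp (- (?\<kappa> j * of_real x)) + \<gamma> j * exp (- (?P * of_real x))"
    and U10: "U1 j 0 = - ?\<kappa> j * (\<beta> - \<gamma> j) - ?P * \<gamma> j" if j: "j \<in> {1..n}" for j x
    using helmholtz_decaying[OF H[OF j] re[OF j] p D[OF j] ae[OF j]] unfolding U00[OF j] \<gamma>_def by blast+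
  \<comment> \<open>The Kirchhoff condition, cleared of the denominator \<open>d\<close>. It will
    eliminate \<open>S z\<close> from the transform.\<close>
  have S\<beta>: "d * (S z * \<beta>) = of_real (c k) * (?\<kappa> k - ?P)"
  proof -
    have "0 = (\<Sum>j\<in>{1..n}. of_real (c j) * U1 j 0)" by (rule kir[symmetric])
    also have "\<dots> = (\<Sum>j\<in>{1..n}. - \<beta> * (of_real (c j) * ?\<kappa> j) + (if j = k then of_real (c k) * (?\<kappa> k - ?P) / d else 0))"
      by (intro sum.cong refl) (simp add: U10 \<gamma> algebra_simps diff_divide_distrib)
    also have "\<dots> = - \<beta> * S z + of_real (c k) * (?\<kappa> k - ?P) / d"
      unfolding sum.distrib sum_distrib_left[symmetric] using k by (simp add: sig_def)
    finally have "S z * \<beta> = of_real (c k) * (?\<kappa> k - ?P) / d" by (simp add: eq_neg_iff_add_eq_0 mult.commute)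
    thus ?thesis using d0 by simp
  qed
  let ?G = "\<lambda>l. edge_exp l (?\<kappa> l)"
  have GL: "L12 n (?G l)" if "l \<in> {1..n}" for l by (rule L12_edge_exp[OF re[OF that]])
  have PL: "L12 n (edge_exp k ?P)" by (rule L12_edge_exp) (use p in simp)
  define s where "s = (\<lambda>j x. \<Sum>l\<in>{1..n}. (\<beta> - \<gamma> l) * ?G l j x)"
  define u' where "u' = (\<lambda>j x. s j x + (1 / d) * edge_exp k ?P j x)"
  have sL: "L12 n s" unfolding s_def using Vop_sum[of 1 "a 1 + 1" "{1..n}" ?G] GL n_pos by auto
  have uL: "L12 n u'" unfolding u'_def by (rule L12_add_scale[OF sL PL])
  have "AE x in MN. u' j x = u j x" if j: "j \<in> {1..n}" for j
  proof -
    have "u' j x = U0 j x" if x: "0 < x" for x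
    proof -
      have "s j x = (\<Sum>l\<in>{1..n}. if l = j then (\<beta> - \<gamma> j) * exp (- (?\<kappa> j * of_real x)) else 0)"
        unfolding s_def by (intro sum.cong refl) (auto simp: edge_exp_def)
      hence "s j x = (\<beta> - \<gamma> j) * exp (- (?\<kappa> j * of_real x))" using j by simp
      thus ?thesis unfolding u'_def using sol[OF j, of x] x by (simp add: \<gamma> edge_exp_def)
    qed
    hence "AE x in MN. u' j x = U0 j x" by (rule AE_MN_I)
    with uU[OF j] show ?thesis by eventually_elim simp
  qed
  moreover have "V u' i t = 1 / (of_real t - z) * expV k ?P i t" if i: "i \<in> {1..n}" and t: "a i < t" for i t
  proof -
    let ?\<tau> = "of_real t - z" and ?v = "\<lambda>l. cnj (K l (of_real t))" and ?sb = "cnj (S (of_real t))"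
    have tz: "of_real t \<noteq> z" using z by auto
    hence \<tau>: "?\<tau> \<noteq> 0" by simp
    have ring: "y / T * A - y / T * B + y / T * B - 1 / e * (X / T) = (e * (A * y) - X) / (e * T)"
      if "e \<noteq> 0" "T \<noteq> 0" for y T A B X e :: complex
      using that by (simp add: diff_divide_distrib mult.commute)
    have Vs: "V s i t = (\<Sum>l\<in>{1..n}. (\<beta> - \<gamma> l) * V (?G l) i t)"
      unfolding s_def using Vop_sum[of i t "{1..n}" ?G "\<lambda>l. \<beta> - \<gamma> l", OF i t finite_atLeastAtMost GL] by blast
    also have "\<dots> = (\<Sum>l\<in>{1..n}. (\<beta> - \<gamma> l) * ((of_real (c l) * (?\<kappa> l - ?v l) + (if i = l then ?sb else 0)) / ?\<tau>))"
    proof (intro sum.cong refl arg_cong2[where f = "(*)"])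
      fix l assume l: "l \<in> {1..n}"
      show "V (?G l) i t = (of_real (c l) * (?\<kappa> l - ?v l) + (if i = l then ?sb else 0)) / ?\<tau>"
        unfolding Vop_edge_exp[OF l i t re[OF l]] using z tz by (intro expV_kap l) auto
    qed
    also have "\<dots> = (\<Sum>l\<in>{1..n}. \<beta> / ?\<tau> * (of_real (c l) * ?\<kappa> l) - \<beta> / ?\<tau> * (of_real (c l) * ?v l)
        + (if l = i then \<beta> / ?\<tau> * ?sb else 0) - (if l = k then 1 / d * ((of_real (c k) * (?\<kappa> k - ?v k) + (if i = k then ?sb else 0)) / ?\<tau>) else 0))"
      by (intro sum.cong refl) (auto simp: \<gamma> algebra_simps add_divide_distrib diff_divide_distrib)
    \<comment> \<open>The \<open>c l * ?v l\<close> add up to \<open>?sb\<close>, which cancels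
      against the additional term of component i. Hence the part proportional to \<beta> is the same
      in all components.\<close>
    also have "\<dots> = \<beta> / ?\<tau> * S z - \<beta> / ?\<tau> * ?sb + \<beta> / ?\<tau> * ?sb - 1 / d * ((of_real (c k) * (?\<kappa> k - ?v k) + (if i = k then ?sb else 0)) / ?\<tau>)"
      unfolding sum.distrib sum_subtractf sum_distrib_left[symmetric] using i k by (simp add: sig_def)
    also have "\<dots> = (d * (S z * \<beta>) - (of_real (c k) * (?\<kappa> k - ?v k) + (if i = k then ?sb else 0))) / (d * ?\<tau>)"
      using d0 \<tau> by (rule ring)
    finally have Vs: "V s i t = (of_real (c k) * (?v k - ?P) - (if i = k then ?sb else 0)) / (d * ?\<tau>)"
      unfolding S\<beta> by (simp add: algebra_simps)
    \<comment> \<open>Both \<open>?\<tau>\<close> and \<open>d\<close> contain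
      \<open>c k * (K k z)\<^sup>2\<close>, so their difference is free of z; it is the factor that
      clears the denominators of \<open>expV\<close>.\<close>
    have td: "?\<tau> - d = of_real (c k) * (?P - ?v k) * (?P + ?v k)"
    proof -
      have "?\<tau> = of_real (c k) * (?\<kappa> k)\<^sup>2 - of_real (c k) * (?v k)\<^sup>2"
        unfolding kap_square_real[OF k] cnj_kap_square[OF k] by simp
      thus ?thesis unfolding d_def by (simp add: algebra_simps power2_eq_square)
    qed
    have "0 < Re (?P + ?v k)" using p Re_cnj_kap_nonneg[of k "of_real t"] by (simp add: add_pos_nonneg)
    hence Pv: "?P + ?v k \<noteq> 0" by (metis less_irrefl zero_complex.sel(1))
    have "(?\<tau> - d) * expV k ?P i t = of_real (c k) * (?P - ?v k) + (if i = k then ?sb else 0)"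
    proof -
      have 1: "(?\<tau> - d) * (1 / (?P + ?v k)) = of_real (c k) * (?P - ?v k)" unfolding td using Pv by simp
      have 2: "(?\<tau> - d) * (if i = k then ?sb / (of_real (c k) * ?P\<^sup>2 - of_real (a k) + of_real t) else 0) = (if i = k then ?sb else 0)"
      proof (cases "i = k")
        case True
        have den: "of_real (c k) * ?P\<^sup>2 - of_real (a k) + of_real t = complex_of_real (c k * p\<^sup>2 + (t - a k))" by simp
        have "0 < c k * p\<^sup>2 + (t - a k)" using True t c_pos[OF k] p by (simp add: add_pos_pos)
        hence ne: "of_real (c k) * ?P\<^sup>2 - of_real (a k) + of_real t \<noteq> (0::complex)"
          unfolding den of_real_eq_0_iff by simp
        have "?\<tau> - d = of_real (c k) * ?P\<^sup>2 - of_real (c k) * (?v k)\<^sup>2"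
          unfolding td by (simp add: algebra_simps power2_eq_square)
        hence eqd: "?\<tau> - d = of_real (c k) * ?P\<^sup>2 - of_real (a k) + of_real t"
          unfolding cnj_kap_square[OF k] by simp
        show ?thesis unfolding eqd if_P[OF True] using ne by (metis nonzero_mult_div_cancel_left times_divide_eq_right)
      qed simp
      show ?thesis unfolding expV_def distrib_left 1 2 ..
    qed
    hence E: "of_real (c k) * (?v k - ?P) - (if i = k then ?sb else 0) = (d - ?\<tau>) * expV k ?P i t"
      by (simp add: algebra_simps)
    have "V u' i t = V s i t + 1 / d * expV k ?P i t"
      unfolding u'_def using Vop_add_scale[OF i t sL PL, of "1 / d"] Vop_edge_exp[OF k i t, of ?P] p by simp
    also have "\<dots> = (d - ?\<tau>) * expV k ?P i t / (d * ?\<tau>) + 1 / d * expV k ?P i t"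
      unfolding Vs E ..
    also have "\<dots> = 1 / ?\<tau> * expV k ?P i t"
      using d0 \<tau> by (simp add: divide_simps) (simp add: algebra_simps)
    finally show ?thesis .
  qed
  hence AEV: "AE t in Mq n c a i. V u' i t = 1 / (of_real t - z) * expV k ?P i t" if "i \<in> {1..n}" for i
    using that by (intro AE_Mq_I) auto
  have Esq: "sqints n (Mq n c a) (\<lambda>i t. 1 / (of_real t - z) * expV k ?P i t)"
  proof (rule sqints_bounded_mult(1)[OF sqints_expV[OF k p]])
    show "(\<lambda>t. 1 / (complex_of_real t - z)) \<in> borel_measurable (Mq n c a j)" for j by measurable
    show "cmod (1 / (complex_of_real t - z)) \<le> 1 / \<bar>Im z\<bar>" for t
      by (rule cmod_resolvent_le[OF z])
  qed
  ultimately show ?thesis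
    by (intro Vt_cong[OF L12_isom(2)[OF uL] usq _ Esq AEV])
qed

end

lemma LIMSEQ_pos_indicator: "(\<lambda>m. min 1 (max 0 (real m * s))) \<longlonglongrightarrow> (if 0 < s then 1 else 0)"
proof (cases "0 < s")
  case True
  obtain m0 where m0: "1 / s \<le> real m0" using real_arch_simple by blast
  have "min 1 (max 0 (real m * s)) = 1" if "m \<ge> m0" for m
  proof -
    have "1 / s \<le> real m" using m0 that by linarith
    hence "1 \<le> real m * s" using True by (simp add: field_simps)
    thus ?thesis by simp
  qed
  thus ?thesis using True by (intro tendsto_eventually eventually_sequentiallyI[of m0]) simp
next
  case False
  hence "real m * s \<le> 0" for m by (simp add: mult_nonneg_nonpos)
  hence "max 0 (real m * s) = 0" for m by (simp add: max_absorb1)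
  thus ?thesis using False by simp
qed

lemma eqH_AE_sym: "eqH n u v \<Longrightarrow> k \<in> {1..n} \<Longrightarrow> AE x in MN. v k x = u k x"
proof -
  assume "eqH n u v" "k \<in> {1..n}"
  hence "AE x in MN. u k x = v k x" by (simp add: eqH_def)
  thus ?thesis by eventually_elim simp
qed

context star
begin

lemma Vt_unique:
  assumes "W f G" "W f G'" "k \<in> {1..n}"
  shows "AE t in Mq n c a k. G k t = G' k t"
proof -
  have "nq (\<lambda>k t. G k t - G' k t) = nH (\<lambda>k x. f k x - f k x)"
    by (rule Vt_norm[OF Vt_diff[OF assms(1,2)], symmetric])
  hence "nq (\<lambda>k t. G k t - G' k t) = 0" by simp
  thus ?thesis
    using nrm_zero_iff[OF sqints_diff[OF Vt_sqints(2)[OF assms(1)] Vt_sqints(2)[OF assms(2)]]] assms(3) by auto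
qed

lemma testN_expsum_close:
  assumes f: "testN n f" and e: "0 < e"
  shows "\<exists>g. expsum g \<and> nH (\<lambda>k x. g k x - f k x) < e"
proof -
  \<comment> \<open>Chosen so that the sum of n squares of \<open>d\<close>, crudely at most
    \<open>((n + 1) * d)\<^sup>2\<close>, is at most \<open>(e / 2)\<^sup>2\<close>.\<close>
  define d where "d = e / (2 * (real n + 1))"
  have d: "0 < d" using e by (simp add: d_def)
  obtain g where g: "expsum g" "\<And>k x. k \<in> {1..n} \<Longrightarrow> 0 < x \<Longrightarrow> cmod (g k x - f k x) \<le> d * exp (- x)"
    using testN_expsum_approx[OF f d] by blast
  have "(\<integral>x. (cmod (g k x - f k x))\<^sup>2 \<partial>MN) \<le> d\<^sup>2" if k: "k \<in> {1..n}" for k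
  proof (rule integrable_exp_bound(4))
    show "(\<lambda>x. g k x - f k x) \<in> borel_measurable borel"
      using L12_diff[OF _ testN_L12[OF f], of g] expsum_isom[OF g(1)] k by (auto simp: isom_def L12_def)
  qed (use g(2)[OF k] d in auto)
  hence "(nH (\<lambda>k x. g k x - f k x))\<^sup>2 \<le> (\<Sum>k\<in>{1..n}. d\<^sup>2)"
    unfolding nrm_square by (rule sum_mono)
  also have "\<dots> \<le> ((real n + 1) * d)\<^sup>2"
  proof -
    have "real n * 1 \<le> (real n + 1) * (real n + 1)" by (intro mult_mono) auto
    hence "real n * d\<^sup>2 \<le> ((real n + 1) * (real n + 1)) * d\<^sup>2" by (intro mult_right_mono) auto
    thus ?thesis unfolding power_mult_distrib power2_eq_square[of "real n + 1"] by simp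
  qed
  also have "(real n + 1) * d = e / 2" by (simp add: d_def field_simps)
  finally have "nH (\<lambda>k x. g k x - f k x) \<le> e / 2" by (rule power2_le_imp_le) (use e in simp)
  hence "nH (\<lambda>k x. g k x - f k x) < e" using e by linarith
  with g(1) show ?thesis by blast
qed

lemma expsum_sqints: "expsum g \<Longrightarrow> sqints n (\<lambda>_. MN) g"
  using expsum_isom[of g] L12_sqints[of n g] by (auto simp: isom_def)

text \<open>The resolvent is explicit on exponentials only. Three successive approximations, by
  members of \<open>L12\<close>, by test functions and by exponential sums, reach all of H.\<close>

lemma expsum_dense:
  assumes f: "sqints n (\<lambda>_. MN) f"
  shows "\<exists>F. (\<forall>m. expsum (F m)) \<and> (\<lambda>m. nH (\<lambda>k x. F m k x - f k x)) \<longlonglongrightarrow> 0"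
proof -
  have close: "\<exists>g. expsum g \<and> nH (\<lambda>k x. g k x - f k x) < e" if e: "0 < e" for e
  proof -
    have e3: "0 < e / 3" using e by simp
    obtain F where F: "\<And>m. L12 n (F m)" "(\<lambda>m. nH (\<lambda>k x. F m k x - f k x)) \<longlonglongrightarrow> 0"
      using L12_dense[OF f] by blast
    obtain m where m: "nH (\<lambda>k x. F m k x - f k x) < e / 3"
      using eventually_happens'[OF sequentially_bot order_tendstoD(2)[OF F(2) e3]] by blast
    obtain T where T: "\<And>l. testN n (T l)" "L12_conv n T (F m)"
      using L12_tests_approx[OF F(1)[of m]] unfolding tests_approx_def by blast
    obtain l where l: "nH (\<lambda>k x. T l k x - F m k x) < e / 3"
      using eventually_happens'[OF sequentially_bot order_tendstoD(2)[OF L12_conv_nrm[OF T(2)] e3]] by blast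
    obtain g where g: "expsum g" "nH (\<lambda>k x. g k x - T l k x) < e / 3"
      using testN_expsum_close[OF T(1) e3] by blast
    note sq = expsum_sqints[OF g(1)] L12_sqints[OF testN_L12[OF T(1)]] L12_sqints[OF F(1)]
    have "nH (\<lambda>k x. g k x - f k x) \<le> nH (\<lambda>k x. g k x - T l k x) + nH (\<lambda>k x. T l k x - f k x)"
      by (rule nrm_diff_triangle[OF sq(1,2) f])
    moreover have "nH (\<lambda>k x. T l k x - f k x) \<le> nH (\<lambda>k x. T l k x - F m k x) + nH (\<lambda>k x. F m k x - f k x)"
      by (rule nrm_diff_triangle[OF sq(2,3) f])
    ultimately have "nH (\<lambda>k x. g k x - f k x) < e" using m l g(2) by linarith
    with g(1) show ?thesis by blast
  qed
  have "\<forall>m. \<exists>g. expsum g \<and> nH (\<lambda>k x. g k x - f k x) < 1 / real (Suc m)"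
    by (intro allI close) simp
  from choice[OF this] obtain F where F: "\<And>m. expsum (F m)" "\<And>m. nH (\<lambda>k x. F m k x - f k x) < 1 / real (Suc m)" by blast
  have "(\<lambda>m. nH (\<lambda>k x. F m k x - f k x)) \<longlonglongrightarrow> 0"
  proof (rule Lim_null_comparison[OF always_eventually LIMSEQ_inverse_real_of_nat[unfolded inverse_eq_divide]])
    show "\<forall>m. norm (nH (\<lambda>k x. F m k x - f k x)) \<le> 1 / real (Suc m)" using F(2) by (simp add: less_imp_le)
  qed
  with F(1) show ?thesis by blast
qed

lemma sqints_Mq_mult:
  assumes "sqints n (Mq n c a) G" "bddBorel \<psi>"
  shows "sqints n (Mq n c a) (\<lambda>k t. \<psi> t * G k t)"
proof -
  obtain B where B: "\<psi> \<in> borel_measurable borel" "\<And>x. cmod (\<psi> x) \<le> B" by (rule bddBorelE[OF assms(2)]) blast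
  show ?thesis
    by (rule sqints_bounded_mult(1)[OF assms(1) _ B(2)]) (use B(1) in \<open>simp cong: measurable_cong_sets\<close>)
qed

lemma nq_mult_le:
  assumes "sqints n (Mq n c a) G" "\<psi> \<in> borel_measurable borel" "\<And>x. cmod (\<psi> x) \<le> B"
  shows "nq (\<lambda>k t. \<psi> t * G k t) \<le> B * nq G"
  by (rule sqints_bounded_mult(2)[OF assms(1) _ assms(3)]) (use assms(2) in \<open>simp cong: measurable_cong_sets\<close>)

lemma bddBorel_resolvent: "Im z \<noteq> 0 \<Longrightarrow> bddBorel (\<lambda>t. 1 / (complex_of_real t - z))"
  by (rule bddBorelI[OF _ cmod_resolvent_le]) measurable

end

section \<open>The intertwining relation for the functional calculus\<close>

locale star_calculus = star +
  fixes \<Phi> :: "(real \<Rightarrow> complex) \<Rightarrow> (nat \<Rightarrow> real \<Rightarrow> complex) \<Rightarrow> (nat \<Rightarrow> real \<Rightarrow> complex)"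
  assumes calculus: "is_fcalc n c a \<Phi>"
begin

abbreviation sqH where "sqH \<equiv> sqints n (\<lambda>_. MN)"

lemma
  shows calc_sqints: "bddBorel \<psi> \<Longrightarrow> sqH f \<Longrightarrow> sqH (\<Phi> \<psi> f)"
    and calc_add_scale: "bddBorel \<psi> \<Longrightarrow> sqH f \<Longrightarrow> sqH g \<Longrightarrow>
      eqH n (\<Phi> \<psi> (\<lambda>k x. f k x + z * g k x)) (\<lambda>k x. \<Phi> \<psi> f k x + z * \<Phi> \<psi> g k x)"
    and calc_bounded: "bddBorel \<psi> \<Longrightarrow> \<exists>C. \<forall>f. sqH f \<longrightarrow> nH (\<Phi> \<psi> f) \<le> C * nH f"
    and calc_lin: "bddBorel \<psi>1 \<Longrightarrow> bddBorel \<psi>2 \<Longrightarrow> sqH f \<Longrightarrow>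
      eqH n (\<Phi> (\<lambda>t. \<psi>1 t + z * \<psi>2 t) f) (\<lambda>k x. \<Phi> \<psi>1 f k x + z * \<Phi> \<psi>2 f k x)"
    and calc_mult: "bddBorel \<psi>1 \<Longrightarrow> bddBorel \<psi>2 \<Longrightarrow> sqH f \<Longrightarrow> eqH n (\<Phi> (\<lambda>t. \<psi>1 t * \<psi>2 t) f) (\<Phi> \<psi>1 (\<Phi> \<psi>2 f))"
    and calc_one: "sqH f \<Longrightarrow> eqH n (\<Phi> (\<lambda>t. 1) f) f"
    and calc_lim: "(\<And>m. bddBorel (F m)) \<Longrightarrow> bddBorel \<psi> \<Longrightarrow> (\<And>m t. cmod (F m t) \<le> B) \<Longrightarrow>
      (\<And>t. (\<lambda>m. F m t) \<longlonglongrightarrow> \<psi> t) \<Longrightarrow> sqH f \<Longrightarrow> (\<lambda>m. nH (\<lambda>k x. \<Phi> (F m) f k x - \<Phi> \<psi> f k x)) \<longlonglongrightarrow> 0"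
    and calc_resolvent: "Im z \<noteq> 0 \<Longrightarrow> sqH f \<Longrightarrow> \<exists>v. isA n c a (\<Phi> (\<lambda>t. 1 / (of_real t - z)) f) v \<and>
             eqH n (\<lambda>k x. v k x - z * \<Phi> (\<lambda>t. 1 / (of_real t - z)) f k x) f"
proof -
  note C = calculus[unfolded is_fcalc_def inH_eq normH_eq]
  note C1 = C[THEN conjunct1] and C' = C[THEN conjunct2, THEN conjunct2]
  note C3 = C'[THEN conjunct1] and C'' = C'[THEN conjunct2]
  note C4 = C''[THEN conjunct1] and C5 = C''[THEN conjunct2, THEN conjunct1] and D = C''[THEN conjunct2, THEN conjunct2]
  note C6 = D[THEN conjunct1] and C7 = D[THEN conjunct2, THEN conjunct1] and D' = D[THEN conjunct2, THEN conjunct2, THEN conjunct2]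
  note C9 = D'[THEN conjunct1] and C10 = D'[THEN conjunct2]
  show "bddBorel \<psi> \<Longrightarrow> sqH f \<Longrightarrow> sqH (\<Phi> \<psi> f)" using C1 by blast
  show "bddBorel \<psi> \<Longrightarrow> sqH f \<Longrightarrow> sqH g \<Longrightarrow>
      eqH n (\<Phi> \<psi> (\<lambda>k x. f k x + z * g k x)) (\<lambda>k x. \<Phi> \<psi> f k x + z * \<Phi> \<psi> g k x)" using C3 by blast
  show "bddBorel \<psi> \<Longrightarrow> \<exists>C. \<forall>f. sqH f \<longrightarrow> nH (\<Phi> \<psi> f) \<le> C * nH f" using C4 by blast
  show "bddBorel \<psi>1 \<Longrightarrow> bddBorel \<psi>2 \<Longrightarrow> sqH f \<Longrightarrow>
      eqH n (\<Phi> (\<lambda>t. \<psi>1 t + z * \<psi>2 t) f) (\<lambda>k x. \<Phi> \<psi>1 f k x + z * \<Phi> \<psi>2 f k x)" using C5 by blast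
  show "bddBorel \<psi>1 \<Longrightarrow> bddBorel \<psi>2 \<Longrightarrow> sqH f \<Longrightarrow> eqH n (\<Phi> (\<lambda>t. \<psi>1 t * \<psi>2 t) f) (\<Phi> \<psi>1 (\<Phi> \<psi>2 f))"
    using C6 by blast
  show "sqH f \<Longrightarrow> eqH n (\<Phi> (\<lambda>t. 1) f) f" using C7 by blast
  show "(\<And>m. bddBorel (F m)) \<Longrightarrow> bddBorel \<psi> \<Longrightarrow> (\<And>m t. cmod (F m t) \<le> B) \<Longrightarrow>
      (\<And>t. (\<lambda>m. F m t) \<longlonglongrightarrow> \<psi> t) \<Longrightarrow> sqH f \<Longrightarrow> (\<lambda>m. nH (\<lambda>k x. \<Phi> (F m) f k x - \<Phi> \<psi> f k x)) \<longlonglongrightarrow> 0"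
    by (rule C9[rule_format]) blast
  show "Im z \<noteq> 0 \<Longrightarrow> sqH f \<Longrightarrow> \<exists>v. isA n c a (\<Phi> (\<lambda>t. 1 / (of_real t - z)) f) v \<and>
             eqH n (\<lambda>k x. v k x - z * \<Phi> (\<lambda>t. 1 / (of_real t - z)) f k x) f" using C10 by blast
qed

text \<open>Boundedness is part of the property so that \<open>bddBorel_induct\<close>, whose step
  for limits knows nothing about the functions, carries it along.\<close>

definition intertwined :: "(real \<Rightarrow> complex) \<Rightarrow> bool" where
  "intertwined \<psi> \<longleftrightarrow> bddBorel \<psi> \<and> (\<forall>f G. W f G \<longrightarrow> W (\<Phi> \<psi> f) (\<lambda>k t. \<psi> t * G k t))"

lemma intertwinedD: "intertwined \<psi> \<Longrightarrow> bddBorel \<psi>" "intertwined \<psi> \<Longrightarrow> W f G \<Longrightarrow> W (\<Phi> \<psi> f) (\<lambda>k t. \<psi> t * G k t)"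
  by (auto simp: intertwined_def)

lemma intertwined_one: "intertwined (\<lambda>t. 1)"
  unfolding intertwined_def
proof (intro conjI allI impI)
  fix f G assume fG: "W f G"
  note sq = Vt_sqints[OF fG]
  have "AE x in MN. f k x = \<Phi> (\<lambda>t. 1) f k x" if "k \<in> {1..n}" for k
    by (rule eqH_AE_sym[OF calc_one[OF sq(1)] that])
  thus "W (\<Phi> (\<lambda>t. 1) f) (\<lambda>k t. 1 * G k t)"
    by (intro Vt_cong[OF fG calc_sqints]) (use sq in auto)
qed simp

lemma intertwined_add_scale:
  assumes "intertwined \<psi>" "intertwined \<phi>"
  shows "intertwined (\<lambda>t. \<psi> t + z * \<phi> t)"
  unfolding intertwined_def
proof (intro conjI allI impI)
  note b = intertwinedD(1)[OF assms(1)] intertwinedD(1)[OF assms(2)]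
  show b': "bddBorel (\<lambda>t. \<psi> t + z * \<phi> t)" by (rule bddBorel_add_scale[OF b])
  fix f G assume fG: "W f G"
  note sq = Vt_sqints[OF fG]
  have AE: "AE x in MN. \<Phi> \<psi> f k x + z * \<Phi> \<phi> f k x = \<Phi> (\<lambda>t. \<psi> t + z * \<phi> t) f k x" if "k \<in> {1..n}" for k
    by (rule eqH_AE_sym[OF calc_lin[OF b sq(1)] that])
  show "W (\<Phi> (\<lambda>t. \<psi> t + z * \<phi> t) f) (\<lambda>k t. (\<psi> t + z * \<phi> t) * G k t)"
    by (rule Vt_cong[OF Vt_add_scale[OF intertwinedD(2)[OF assms(1) fG] intertwinedD(2)[OF assms(2) fG]] calc_sqints[OF b' sq(1)] AE sqints_Mq_mult[OF sq(2) b']])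
       (auto simp: algebra_simps)
qed

lemma intertwined_mult:
  assumes "intertwined \<psi>" "intertwined \<phi>"
  shows "intertwined (\<lambda>t. \<psi> t * \<phi> t)"
  unfolding intertwined_def
proof (intro conjI allI impI)
  note b = intertwinedD(1)[OF assms(1)] intertwinedD(1)[OF assms(2)]
  show b': "bddBorel (\<lambda>t. \<psi> t * \<phi> t)" by (rule bddBorel_mult[OF b])
  fix f G assume fG: "W f G"
  note sq = Vt_sqints[OF fG]
  have AE: "AE x in MN. \<Phi> \<psi> (\<Phi> \<phi> f) k x = \<Phi> (\<lambda>t. \<psi> t * \<phi> t) f k x" if "k \<in> {1..n}" for k
    by (rule eqH_AE_sym[OF calc_mult[OF b sq(1)] that])
  show "W (\<Phi> (\<lambda>t. \<psi> t * \<phi> t) f) (\<lambda>k t. \<psi> t * \<phi> t * G k t)"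
    by (rule Vt_cong[OF intertwinedD(2)[OF assms(1) intertwinedD(2)[OF assms(2) fG]] calc_sqints[OF b' sq(1)] AE sqints_Mq_mult[OF sq(2) b']])
       (auto simp: mult.assoc)
qed

text \<open>The calculus converges in H by its continuity under bounded pointwise limits,
  multiplication converges in L^2_q by domination, and the graph is closed.\<close>

lemma intertwined_limit:
  assumes F: "\<And>m. intertwined (F m)" "\<And>m t. cmod (F m t) \<le> B" "\<And>t. (\<lambda>m. F m t) \<longlonglongrightarrow> \<psi> t"
  shows "intertwined \<psi>"
  unfolding intertwined_def
proof (intro conjI allI impI)
  note b = intertwinedD(1)[OF F(1)]
  show b': "bddBorel \<psi>" by (rule bddBorel_limit[OF b F(2,3)])
  have B0: "0 \<le> B" by (rule order_trans[OF norm_ge_zero F(2)[of 0 0]])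
  have \<psi>B: "cmod (\<psi> t) \<le> B" for t
    using tendsto_norm[OF F(3)[of t]] F(2) by (intro LIMSEQ_le_const2[of "\<lambda>m. cmod (F m t)"]) auto
  fix f G assume fG: "W f G"
  note sq = Vt_sqints[OF fG]
  have Gm: "G k \<in> borel_measurable borel" if "k \<in> {1..n}" for k
    using sq(2) that by (auto simp: sqints_def sqint_def cong: measurable_cong_sets)
  have Fm: "F m \<in> borel_measurable borel" "\<psi> \<in> borel_measurable borel" for m
    using b b' by (auto simp: bddBorel_def)
  show "W (\<Phi> \<psi> f) (\<lambda>k t. \<psi> t * G k t)"
  proof (rule Vt_closed[OF intertwinedD(2)[OF F(1) fG] calc_sqints[OF b' sq(1)] calc_lim[OF b b' F(2,3) sq(1)] sqints_Mq_mult[OF sq(2) b']])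
    show "(\<lambda>m. nq (\<lambda>k t. F m t * G k t - \<psi> t * G k t)) \<longlonglongrightarrow> 0"
    proof (rule nrm_dominated[OF sqints_scale[OF sq(2), of "of_real (2 * B)"]])
      fix m k assume k: "k \<in> {1..n}"
      note [measurable] = Gm[OF k] Fm
      show "(\<lambda>t. F m t * G k t - \<psi> t * G k t) \<in> borel_measurable (Mq n c a k)" by measurable
      show "AE t in Mq n c a k. (\<lambda>m. F m t * G k t - \<psi> t * G k t) \<longlonglongrightarrow> 0"
      proof (rule AE_I2)
        fix t
        have "(\<lambda>m. F m t * G k t - \<psi> t * G k t) \<longlonglongrightarrow> \<psi> t * G k t - \<psi> t * G k t" by (intro tendsto_intros F(3))
        thus "(\<lambda>m. F m t * G k t - \<psi> t * G k t) \<longlonglongrightarrow> 0" by simp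
      qed
      fix t
      have "cmod (F m t - \<psi> t) \<le> B + B" by (rule order_trans[OF norm_triangle_ineq4 add_mono[OF F(2) \<psi>B]])
      hence "cmod (F m t - \<psi> t) * cmod (G k t) \<le> cmod (complex_of_real (2 * B)) * cmod (G k t)"
        using B0 unfolding norm_of_real by (intro mult_right_mono) auto
      thus "cmod (F m t * G k t - \<psi> t * G k t) \<le> cmod (of_real (2 * B) * G k t)"
        unfolding norm_mult[symmetric] left_diff_distrib .
    qed
  qed
qed

text \<open>Single exponentials are settled by the differential equation and their sums by
  linearity. For general f both sides depend continuously on it, and closedness of the graph
  finishes.\<close>

lemma intertwined_resolvent:
  assumes z: "Im z \<noteq> 0"
  shows "intertwined (\<lambda>t. 1 / (complex_of_real t - z))"
  unfolding intertwined_def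
proof (intro conjI allI impI)
  let ?r = "\<lambda>t. 1 / (complex_of_real t - z)"
  show b: "bddBorel ?r" by (rule bddBorel_resolvent[OF z])
  note rB = cmod_resolvent_le[OF z]
  have rm: "?r \<in> borel_measurable borel" by measurable
  have edge: "W (\<Phi> ?r (edge_exp k (of_real p))) (\<lambda>i t. ?r t * expV k (of_real p) i t)" if k: "k \<in> {1..n}" and p: "0 < p" for k p
  proof -
    have "sqH (edge_exp k (of_real p))" by (rule L12_sqints[OF L12_edge_exp]) (use p in simp)
    from calc_resolvent[OF z this] obtain v where "isA n c a (\<Phi> ?r (edge_exp k (of_real p))) v"
      "eqH n (\<lambda>j x. v j x - z * \<Phi> ?r (edge_exp k (of_real p)) j x) (edge_exp k (of_real p))" by blast
    from resolvent_edge_exp[OF k p z this] show ?thesis .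
  qed
  \<comment> \<open>The transform of the sum is left as an unspecified \<open>G\<close> during the
    induction; uniqueness identifies it with \<open>V f\<close> afterwards.\<close>
  have sum: "\<exists>G. W f G \<and> W (\<Phi> ?r f) (\<lambda>i t. ?r t * G i t)"
    if f: "f = (\<lambda>k x. \<Sum>e\<in>E. A e * edge_exp (fst e) (of_real (real (Suc (snd e)))) k x)"
      and E: "finite E" "\<forall>e\<in>E. fst e \<in> {1..n}" for f A and E :: "(nat \<times> nat) set"
    using E unfolding f
  proof (induction E rule: finite_induct)
    case empty
    have L: "L12 n (\<lambda>k x. 0)" by simp
    have W0: "W (\<lambda>k x. 0) (\<lambda>k t. 0)" 
    proof -
      have "V (\<lambda>k x. 0) = (\<lambda>k t. 0)" by (intro ext) (simp add: Vop_def)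
      thus ?thesis using L12_isom(2)[OF L] by simp
    qed
    \<comment> \<open>The calculus is linear only up to null sets; that the zero function is mapped
      to a null function is read off from the norm bound.\<close>
    obtain C where C: "\<And>f. sqH f \<Longrightarrow> nH (\<Phi> ?r f) \<le> C * nH f" using calc_bounded[OF b] by blast
    have sq0: "sqH (\<lambda>k x. 0)" by simp
    have s: "sqH (\<Phi> ?r (\<lambda>k x. 0))" by (rule calc_sqints[OF b sq0])
    have "nH (\<Phi> ?r (\<lambda>k x. 0)) \<le> 0" using C[OF sq0] by simp
    hence n0: "nH (\<Phi> ?r (\<lambda>k x. 0)) = 0" using nrm_nonneg[of n "\<lambda>_. MN" "\<Phi> ?r (\<lambda>k x. 0)"] by linarith
    have "AE x in MN. 0 = \<Phi> ?r (\<lambda>k x. 0) k x" if "k \<in> {1..n}" for k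
    proof -
      have "AE x in MN. \<Phi> ?r (\<lambda>k x. 0) k x = 0" using nrm_zero_iff[OF s] n0 that by blast
      thus ?thesis by eventually_elim simp
    qed
    hence "W (\<Phi> ?r (\<lambda>k x. 0)) (\<lambda>k t. 0)" by (intro Vt_cong[OF W0 s]) auto
    thus ?case using W0 by (intro exI[of _ "\<lambda>k t. 0"]) simp
  next
    case (insert e E)
    let ?s = "\<lambda>k x. \<Sum>e\<in>E. A e * edge_exp (fst e) (of_real (real (Suc (snd e)))) k x"
    let ?g = "edge_exp (fst e) (of_real (real (Suc (snd e))))" and ?v = "expV (fst e) (of_real (real (Suc (snd e))))"
    have e: "fst e \<in> {1..n}" and p: "0 < real (Suc (snd e))" using insert(4) by auto
    obtain G where G: "W ?s G" "W (\<Phi> ?r ?s) (\<lambda>i t. ?r t * G i t)" using insert(3,4) by auto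
    have gL: "L12 n ?g" by (rule L12_edge_exp) simp
    have Wg: "W ?g ?v"
      by (rule Vt_cong[OF L12_isom(2)[OF gL] L12_sqints[OF gL] _ sqints_expV[OF e p]])
         (auto intro!: AE_Mq_I Vop_edge_exp[OF e])
    have eq: "(\<lambda>k x. \<Sum>e\<in>insert e E. A e * edge_exp (fst e) (of_real (real (Suc (snd e)))) k x) = (\<lambda>k x. ?s k x + A e * ?g k x)"
      using insert(1,2) by (simp add: add.commute)
    have 1: "W (\<lambda>k x. ?s k x + A e * ?g k x) (\<lambda>k t. G k t + A e * ?v k t)" by (rule Vt_add_scale[OF G(1) Wg])
    have "AE x in MN. \<Phi> ?r ?s k x + A e * \<Phi> ?r ?g k x = \<Phi> ?r (\<lambda>k x. ?s k x + A e * ?g k x) k x" if "k \<in> {1..n}" for k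
      by (rule eqH_AE_sym[OF calc_add_scale[OF b Vt_sqints(1)[OF G(1)] L12_sqints[OF gL]] that])
    hence "W (\<Phi> ?r (\<lambda>k x. ?s k x + A e * ?g k x)) (\<lambda>k t. ?r t * (G k t + A e * ?v k t))"
      by (intro Vt_cong[OF Vt_add_scale[OF G(2) edge[OF e p], of "A e"] calc_sqints[OF b Vt_sqints(1)[OF 1]] _ sqints_Mq_mult[OF Vt_sqints(2)[OF 1] b]])
         (auto simp: algebra_simps)
    with 1 show ?case unfolding eq by blast
  qed
  have expsum: "W (\<Phi> ?r f) (\<lambda>i t. ?r t * V f i t)" if "expsum f" for f
  proof -
    from that[unfolded expsum_def] obtain E A where EA: "finite E \<and> (\<forall>e\<in>E. fst e \<in> {1..n}) \<and>
        f = (\<lambda>k x. \<Sum>e\<in>E. A e * edge_exp (fst e) (of_real (real (Suc (snd e)))) k x)"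
      by (elim exE)
    from sum[OF EA[THEN conjunct2, THEN conjunct2] EA[THEN conjunct1] EA[THEN conjunct2, THEN conjunct1]]
    obtain G where WG: "W f G \<and> W (\<Phi> ?r f) (\<lambda>i t. ?r t * G i t)" by (elim exE)
    note G = WG[THEN conjunct1] WG[THEN conjunct2]
    have Wf: "W f (V f)" using expsum_isom[OF that] by (intro L12_isom(2)) (simp add: isom_def)
    have "AE t in Mq n c a i. ?r t * G i t = ?r t * V f i t" if "i \<in> {1..n}" for i
      using Vt_unique[OF G(1) Wf that] by eventually_elim simp
    thus ?thesis by (intro Vt_cong[OF G(2) Vt_sqints(1)[OF G(2)] _ sqints_Mq_mult[OF Vt_sqints(2)[OF Wf] b]]) auto
  qed
  fix f G assume fG: "W f G"
  note sq = Vt_sqints[OF fG]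
  obtain F where F: "\<And>m. expsum (F m)" "(\<lambda>m. nH (\<lambda>k x. F m k x - f k x)) \<longlonglongrightarrow> 0"
    using expsum_dense[OF sq(1)] by blast
  have WF: "W (F m) (V (F m))" for m using expsum_isom[OF F(1)] by (intro L12_isom(2)) (simp add: isom_def)
  obtain C where C: "\<And>f. sqH f \<Longrightarrow> nH (\<Phi> ?r f) \<le> C * nH f" using calc_bounded[OF b] by blast
  show "W (\<Phi> ?r f) (\<lambda>k t. ?r t * G k t)"
  proof (rule Vt_closed[OF expsum[OF F(1)] calc_sqints[OF b sq(1)] _ sqints_Mq_mult[OF sq(2) b]])
    have le: "nH (\<lambda>k x. \<Phi> ?r (F m) k x - \<Phi> ?r f k x) \<le> C * nH (\<lambda>k x. F m k x - f k x)" for m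
    proof -
      note Fs = expsum_sqints[OF F(1)[of m]]
      have d: "sqH (\<lambda>k x. F m k x - f k x)" by (rule sqints_diff[OF Fs sq(1)])
      have eq: "(\<lambda>k x. F m k x + (-1) * f k x) = (\<lambda>k x. F m k x - f k x)" by simp
      have "nH (\<lambda>k x. \<Phi> ?r (F m) k x - \<Phi> ?r f k x) = nH (\<Phi> ?r (\<lambda>k x. F m k x - f k x))"
      proof (rule nrm_cong_AE)
        fix k assume "k \<in> {1..n}"
        with calc_add_scale[OF b Fs sq(1), of "-1"]
        have "AE x in MN. \<Phi> ?r (\<lambda>k x. F m k x - f k x) k x = \<Phi> ?r (F m) k x + (-1) * \<Phi> ?r f k x"
          unfolding eq eqH_def by blast
        thus "AE x in MN. \<Phi> ?r (F m) k x - \<Phi> ?r f k x = \<Phi> ?r (\<lambda>k x. F m k x - f k x) k x"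
          by eventually_elim simp
      qed (intro sqints_diff calc_sqints b Fs sq d)+
      thus ?thesis using C[OF d] by simp
    qed
    have lim: "(\<lambda>m. C * nH (\<lambda>k x. F m k x - f k x)) \<longlonglongrightarrow> 0" using tendsto_mult_left[OF F(2), of C] by simp
    show "(\<lambda>m. nH (\<lambda>k x. \<Phi> ?r (F m) k x - \<Phi> ?r f k x)) \<longlonglongrightarrow> 0"
      by (rule Lim_null_comparison[OF always_eventually lim]) (use le in simp)
    have le': "nq (\<lambda>k t. ?r t * V (F m) k t - ?r t * G k t) \<le> 1 / \<bar>Im z\<bar> * nH (\<lambda>k x. F m k x - f k x)" for m
    proof -
      have "nq (\<lambda>k t. ?r t * V (F m) k t - ?r t * G k t) = nq (\<lambda>k t. ?r t * (V (F m) k t - G k t))"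
        by (simp only: right_diff_distrib)
      also have "\<dots> \<le> 1 / \<bar>Im z\<bar> * nq (\<lambda>k t. V (F m) k t - G k t)"
        by (rule nq_mult_le[OF sqints_diff[OF Vt_sqints(2)[OF WF] sq(2)] rm rB])
      also have "nq (\<lambda>k t. V (F m) k t - G k t) = nH (\<lambda>k x. F m k x - f k x)"
        by (rule Vt_norm[OF Vt_diff[OF WF fG], symmetric])
      finally show ?thesis .
    qed
    have lim': "(\<lambda>m. 1 / \<bar>Im z\<bar> * nH (\<lambda>k x. F m k x - f k x)) \<longlonglongrightarrow> 0"
      using tendsto_mult_left[OF F(2), of "1 / \<bar>Im z\<bar>"] by simp
    show "(\<lambda>m. nq (\<lambda>k t. ?r t * V (F m) k t - ?r t * G k t)) \<longlonglongrightarrow> 0"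
      by (rule Lim_null_comparison[OF always_eventually lim']) (use le' in simp)
  qed
qed

text \<open>The real part of \<open>1 / (t - b - i)\<close> is positive exactly for \<open>t > b\<close>, so continuous functions of it
  converge to the indicator of the half-line.\<close>
lemma intertwined_halfline: "intertwined (indicator {b<..})"
proof -
  define g where "g t = (t - b) / ((t - b)\<^sup>2 + 1)" for t :: real
  have den: "0 < (t - b)\<^sup>2 + 1" for t :: real by (simp add: add_nonneg_pos)
  have gint: "intertwined (\<lambda>t. complex_of_real (g t))"
  proof -
    \<comment> \<open>The mean of the resolvents at \<open>b + i\<close> and \<open>b - i\<close> is
      the real part of either one on the real line.\<close>
    have "intertwined (\<lambda>t. (0 + (1/2) * (1 / (complex_of_real t - Complex b 1))) + (1/2) * (1 / (complex_of_real t - Complex b (-1))))"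
    proof (intro intertwined_add_scale intertwined_resolvent)
      show "intertwined (\<lambda>t. 0)" using intertwined_add_scale[OF intertwined_one intertwined_one, of "-1"] by simp
    qed auto
    moreover have "(0 + (1/2) * (1 / (complex_of_real t - Complex b 1))) + (1/2) * (1 / (complex_of_real t - Complex b (-1))) = complex_of_real (g t)" for t
    proof -
      let ?u = "complex_of_real t - Complex b 1" and ?v = "complex_of_real t - Complex b (-1)"
      have ne: "?u \<noteq> 0" "?v \<noteq> 0" by (auto simp: complex_eq_iff)
      have uv: "?u * ?v = complex_of_real ((t - b)\<^sup>2 + 1)" "?u + ?v = complex_of_real (2 * (t - b))"
        by (auto simp: complex_eq_iff power2_eq_square algebra_simps)
      have half: "(0 + (1/2) * (1 / u)) + (1/2) * (1 / v) = (u + v) / (2 * (u * v))" if "u \<noteq> 0" "v \<noteq> 0" for u v :: complex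
        using that by (simp add: field_simps)
      have "complex_of_real (2 * x) / (2 * complex_of_real y) = complex_of_real (x / y)" for x y by simp
      thus ?thesis unfolding half[OF ne] uv g_def .
    qed
    ultimately show ?thesis by simp
  qed
  have g1: "\<bar>g t\<bar> \<le> 1" for t
  proof -
    have "2 * (\<bar>t - b\<bar> * 1) \<le> \<bar>t - b\<bar>\<^sup>2 + 1\<^sup>2" using sum_squares_bound[of "\<bar>t - b\<bar>" 1] by simp
    hence "2 * \<bar>t - b\<bar> \<le> (t - b)\<^sup>2 + 1" by simp
    hence "\<bar>t - b\<bar> \<le> (t - b)\<^sup>2 + 1" by (rule order_trans[rotated]) simp
    moreover have "\<bar>g t\<bar> = \<bar>t - b\<bar> / ((t - b)\<^sup>2 + 1)" using den[of t] by (simp add: g_def)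
    ultimately show ?thesis using den[of t] by (simp add: pos_divide_le_eq)
  qed
  have pow: "intertwined (\<lambda>t. complex_of_real (g t) ^ i)" for i
    by (induction i) (auto intro: intertwined_one intertwined_mult[OF gint])
  have poly: "intertwined (\<lambda>t. complex_of_real (\<Sum>i\<le>N. p i * g t ^ i))" for p :: "nat \<Rightarrow> real" and N
  proof (induction N)
    case 0
    show ?case using intertwined_add_scale[OF intertwined_one intertwined_one, of "of_real (p 0) - 1"] by simp
  next
    case (Suc N)
    show ?case using intertwined_add_scale[OF Suc pow, of "of_real (p (Suc N))" "Suc N"] by simp
  qed
  \<comment> \<open>g takes values in \<open>{-1..1}\<close>, so uniform polynomial approximation of
    h there suffices; the approximants stay bounded by 2.\<close>
  have cont: "intertwined (\<lambda>t. complex_of_real (h (g t)))" if h: "continuous_on {-1..1} h" and h1: "\<And>s. \<bar>h s\<bar> \<le> 1" for h :: "real \<Rightarrow> real"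
  proof -
    have "\<exists>q. intertwined (\<lambda>t. complex_of_real (q (g t))) \<and> (\<forall>s\<in>{-1..1}. \<bar>h s - q s\<bar> < 1 / real (Suc m))" for m
    proof -
      obtain q where q: "real_polynomial_function q" "\<And>s. s \<in> {-1..1} \<Longrightarrow> \<bar>h s - q s\<bar> < 1 / real (Suc m)"
        using Stone_Weierstrass_real_polynomial_function[OF compact_Icc h, of "1 / real (Suc m)"] by auto
      obtain p N where "q = (\<lambda>s. \<Sum>i\<le>N. p i * s ^ i)" using q(1) unfolding real_polynomial_function_iff_sum by blast
      thus ?thesis using poly[where p = p and N = N] q(2) by (intro exI[of _ q]) auto
    qed
    hence "\<forall>m. \<exists>q. intertwined (\<lambda>t. complex_of_real (q (g t))) \<and> (\<forall>s\<in>{-1..1}. \<bar>h s - q s\<bar> < 1 / real (Suc m))" ..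
    from choice[OF this] obtain Q where Q: "\<And>m. intertwined (\<lambda>t. complex_of_real (Q m (g t)))"
      "\<And>m s. s \<in> {-1..1} \<Longrightarrow> \<bar>h s - Q m s\<bar> < 1 / real (Suc m)" by blast
    have Qg: "\<bar>h (g t) - Q m (g t)\<bar> < 1 / real (Suc m)" for m t
      using Q(2)[of "g t" m] g1[of t] by (simp add: abs_le_iff)
    show ?thesis
    proof (rule intertwined_limit[OF Q(1)])
      fix m t
      have "1 / real (Suc m) \<le> 1" by simp
      thus "cmod (complex_of_real (Q m (g t))) \<le> 2" using Qg[of t m] h1[of "g t"] unfolding norm_of_real by linarith
    next
      fix t
      have "(\<lambda>m. h (g t) - Q m (g t)) \<longlonglongrightarrow> 0"
        by (rule Lim_null_comparison[OF always_eventually LIMSEQ_inverse_real_of_nat[unfolded inverse_eq_divide]])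
           (use Qg less_imp_le in \<open>simp add: less_imp_le\<close>)
      from tendsto_diff[OF tendsto_const[of "h (g t)"] this]
      show "(\<lambda>m. complex_of_real (Q m (g t))) \<longlonglongrightarrow> complex_of_real (h (g t))" by (intro tendsto_of_real) simp
    qed
  qed
  show ?thesis
  proof (rule intertwined_limit[of "\<lambda>m t. complex_of_real (min 1 (max 0 (real m * g t)))" 1])
    show "intertwined (\<lambda>t. complex_of_real (min 1 (max 0 (real m * g t))))" for m
      by (rule cont) (auto intro!: continuous_intros)
    show "cmod (complex_of_real (min 1 (max 0 (real m * g t)))) \<le> 1" for m t by simp
    fix t
    have "0 < g t \<longleftrightarrow> t \<in> {b<..}" using den[of t] by (auto simp: g_def zero_less_divide_iff)
    hence "indicator {b<..} t = complex_of_real (if 0 < g t then 1 else 0)" by (simp add: indicator_def)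
    thus "(\<lambda>m. complex_of_real (min 1 (max 0 (real m * g t)))) \<longlonglongrightarrow> indicator {b<..} t"
      using tendsto_of_real[OF LIMSEQ_pos_indicator[of "g t"]] by simp
  qed
qed

lemma bddBorel_intertwined: "bddBorel \<psi> \<Longrightarrow> intertwined \<psi>"
  by (rule bddBorel_induct[OF intertwined_halfline intertwined_one intertwined_add_scale intertwined_limit])

end

section \<open>Surjectivity and the kernel of the synthesis operator\<close>

context star
begin

text \<open>Polarization: equality of the norms of \<open>f + z * g\<close> and of its transform
  yields the real part of the inner product for z = 1 and the imaginary part for z = \<i>.\<close>

lemma Vt_inn:
  assumes "W f G" "W g H"
  shows "inn n (\<lambda>_. MN) f g = inn n (Mq n c a) G H"
proof -
  note sf = Vt_sqints[OF assms(1)] and sg = Vt_sqints[OF assms(2)]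
  have re: "Re (cnj z * inn n (\<lambda>_. MN) f g) = Re (cnj z * inn n (Mq n c a) G H)" for z
  proof -
    have "(nH (\<lambda>k x. f k x + z * g k x))\<^sup>2 = (nq (\<lambda>k t. G k t + z * H k t))\<^sup>2"
      using Vt_norm[OF Vt_add_scale[OF assms]] by simp
    thus ?thesis
      unfolding nrm_add_scale_square[OF sf(1) sg(1)] nrm_add_scale_square[OF sf(2) sg(2)]
        Vt_norm[OF assms(1)] Vt_norm[OF assms(2)] by linarith
  qed
  from re[of 1] re[of \<i>] show ?thesis by (simp add: complex_eq_iff)
qed

end

section \<open>The range of the transform\<close>

context star_calculus
begin

definition in_range :: "(nat \<Rightarrow> real \<Rightarrow> complex) \<Rightarrow> bool" where
  "in_range G \<longleftrightarrow> (\<exists>f. W f G)"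

lemma in_range_add_scale: "in_range G \<Longrightarrow> in_range H \<Longrightarrow> in_range (\<lambda>k t. G k t + z * H k t)"
  unfolding in_range_def using Vt_add_scale by blast

lemma in_range_mult: "in_range G \<Longrightarrow> bddBorel \<psi> \<Longrightarrow> in_range (\<lambda>k t. \<psi> t * G k t)"
  unfolding in_range_def using intertwinedD(2)[OF bddBorel_intertwined] by blast

lemma in_range_cong:
  assumes G: "in_range G" and G': "\<And>k. k \<in> {1..n} \<Longrightarrow> G' k \<in> borel_measurable borel"
    and eq: "\<And>k t. k \<in> {1..n} \<Longrightarrow> a k < t \<Longrightarrow> G' k t = G k t"
  shows "in_range G'"
proof -
  obtain f where f: "W f G" using G by (auto simp: in_range_def)
  have AE: "AE t in Mq n c a k. G' k t = G k t" "AE t in Mq n c a k. G k t = G' k t" if "k \<in> {1..n}" for k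
    using eq[OF that] by (auto intro!: AE_Mq_I[OF that])
  have "sqints n (Mq n c a) G'"
    by (rule sqints_cong_AE[OF Vt_sqints(2)[OF f] _ AE(1)]) (use G' in \<open>simp cong: measurable_cong_sets\<close>)
  from Vt_cong[OF f Vt_sqints(1)[OF f] _ this AE(2)] show ?thesis unfolding in_range_def by auto
qed

text \<open>The exponentials of rate \<open>K l (- 1)\<close> on all edges join to a continuous
  function that solves the homogeneous equation off the vertex and violates only the Kirchhoff
  condition. In its transform the sum of the conjugated roots cancels against the term of the own
  component, as in \<open>resolvent_edge_exp\<close>.\<close>

lemma in_range_resolvent_constant:
  "\<exists>G. in_range G \<and> (\<forall>i\<in>{1..n}. \<forall>t>a i. G i t = S (- 1) / (of_real t + 1))"
proof -
  let ?g = "\<lambda>l. edge_exp l (K l (- 1))"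
  have re: "0 < Re (K l (- 1))" if "l \<in> {1..n}" for l
    using a_nonneg[OF that] by (intro Re_kap_pos c_pos that) auto
  have gL: "L12 n (?g l)" if "l \<in> {1..n}" for l by (rule L12_edge_exp[OF re[OF that]])
  define s where "s = (\<lambda>j x. \<Sum>l\<in>{1..n}. 1 * ?g l j x)"
  have sL: "L12 n s" unfolding s_def using Vop_sum[of 1 "a 1 + 1" "{1..n}" ?g "\<lambda>_. 1"] gL n_pos by auto
  have "V s i t = S (- 1) / (of_real t + 1)" if i: "i \<in> {1..n}" and t: "a i < t" for i t
  proof -
    let ?\<tau> = "complex_of_real t - - 1" and ?sb = "cnj (S (of_real t))"
    have "Re (complex_of_real t) \<noteq> Re (- 1)" using t a_nonneg[OF i] by simp
    hence tz: "complex_of_real t \<noteq> - 1" by metis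
    have "V s i t = (\<Sum>l\<in>{1..n}. 1 * V (?g l) i t)"
      unfolding s_def using Vop_sum[of i t "{1..n}" ?g "\<lambda>_. 1", OF i t finite_atLeastAtMost gL] by blast
    also have "\<dots> = (\<Sum>l\<in>{1..n}. (of_real (c l) * K l (- 1) - cnj (of_real (c l) * K l (of_real t)) + (if l = i then ?sb else 0)) / ?\<tau>)"
    proof (intro sum.cong refl)
      fix l assume l: "l \<in> {1..n}"
      have "V (?g l) i t = (of_real (c l) * (K l (- 1) - cnj (K l (of_real t))) + (if i = l then ?sb else 0)) / ?\<tau>"
        unfolding Vop_edge_exp[OF l i t re[OF l]] using tz by (intro expV_kap l) auto
      thus "1 * V (?g l) i t = (of_real (c l) * K l (- 1) - cnj (of_real (c l) * K l (of_real t)) + (if l = i then ?sb else 0)) / ?\<tau>"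
        by (simp add: right_diff_distrib eq_commute[of i l])
    qed
    also have "\<dots> = (S (- 1) - ?sb + ?sb) / ?\<tau>"
      unfolding sum_divide_distrib[symmetric] sum.distrib sum_subtractf cnj_sum[symmetric] using i by (simp add: sig_def)
    finally show ?thesis by simp
  qed
  moreover have "in_range (V s)" unfolding in_range_def using L12_isom(2)[OF sL] by blast
  ultimately show ?thesis by blast
qed

text \<open>The transform of \<open>exp (- x)\<close> on the edge \<open>k\<close> is \<open>1 / (1 + cnj (K k t))\<close> in every component plus a
  term in component \<open>k\<close>; the common part is removed with a multiple of the previous element.\<close>
lemma in_range_component:
  assumes k: "k \<in> {1..n}" and \<theta>: "bddBorel \<theta>" and supp: "\<And>t. \<theta> t \<noteq> 0 \<Longrightarrow> a k < t \<and> t \<le> m"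
  shows "in_range (\<lambda>i t. if i = k then \<theta> t * (cnj (S (of_real t)) / of_real (c k - a k + t)) else 0)"
proof -
  obtain B where B: "\<theta> \<in> borel_measurable borel" "\<And>x. cmod (\<theta> x) \<le> B" by (rule bddBorelE[OF \<theta>]) blast
  note [measurable] = B(1) kap_measurable[OF k]
  obtain G0 where G0: "in_range G0" "\<And>i t. i \<in> {1..n} \<Longrightarrow> a i < t \<Longrightarrow> G0 i t = S (- 1) / (of_real t + 1)"
    using in_range_resolvent_constant by blast
  let ?kb = "\<lambda>t. cnj (K k (of_real t))"
  have S1: "S (- 1) \<noteq> 0" using Re_sig_pos[of "- 1"] by auto
  \<comment> \<open>The quotient of the common part \<open>\<theta> t / (1 + ?kb t)\<close> by
    \<open>G0\<close>. It involves the unbounded factor \<open>t + 1\<close>, and the bounded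
    support of \<theta> keeps it bounded.\<close>
  define \<psi> where "\<psi> t = \<theta> t * (of_real t + 1) / ((1 + ?kb t) * S (- 1))" for t
  have kb: "1 \<le> cmod (1 + ?kb t)" for t
    using complex_Re_le_cmod[of "1 + ?kb t"] Re_cnj_kap_nonneg[of k "of_real t"] by simp
  have \<psi>: "bddBorel \<psi>"
  proof (rule bddBorelI)
    show "\<psi> \<in> borel_measurable borel" unfolding \<psi>_def by measurable
    fix t
    show "cmod (\<psi> t) \<le> B * (\<bar>m\<bar> + 1) / cmod (S (- 1))"
    proof (cases "\<theta> t = 0")
      case True
      have "0 \<le> B" by (rule order_trans[OF norm_ge_zero B(2)[of 0]])
      hence "0 \<le> B * (\<bar>m\<bar> + 1) / cmod (S (- 1))" by (intro divide_nonneg_nonneg mult_nonneg_nonneg) auto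
      moreover have "cmod (\<psi> t) = 0" unfolding \<psi>_def True by simp
      ultimately show ?thesis by linarith
    next
      case False
      note t = supp[OF this, THEN conjunct1] supp[OF this, THEN conjunct2]
      have "cmod (complex_of_real t + 1) = t + 1"
      proof -
        have e: "complex_of_real t + 1 = complex_of_real (t + 1)" by simp
        have "\<bar>t + 1\<bar> = t + 1" using t a_nonneg[OF k] by simp
        thus ?thesis unfolding e norm_of_real .
      qed
      hence "cmod (\<theta> t * (of_real t + 1)) \<le> B * (\<bar>m\<bar> + 1)"
        unfolding norm_mult using B(2)[of t] order_trans[OF norm_ge_zero B(2)[of 0]] t a_nonneg[OF k]
        by (intro mult_mono) auto
      moreover have "cmod (S (- 1)) \<le> cmod ((1 + ?kb t) * S (- 1))"
        using mult_right_mono[OF kb[of t] norm_ge_zero[of "S (- 1)"]] by (simp only: norm_mult mult_1)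
      moreover have "0 \<le> B" by (rule order_trans[OF norm_ge_zero B(2)[of 0]])
      hence "0 \<le> B * (\<bar>m\<bar> + 1)" by simp
      moreover have "0 < cmod (S (- 1))" using S1 by simp
      ultimately show ?thesis unfolding \<psi>_def norm_divide by (intro frac_le)
    qed
  qed
  have E: "in_range (expV k (of_real 1))"
  proof (rule in_range_cong)
    show "in_range (V (edge_exp k (of_real 1)))" unfolding in_range_def
      using L12_isom(2)[OF L12_edge_exp[of "of_real 1" n k]] by auto
    show "expV k (of_real 1) i t = V (edge_exp k (of_real 1)) i t" if "i \<in> {1..n}" "a i < t" for i t
      using Vop_edge_exp[OF k that, of "of_real 1"] by simp
  qed (rule expV_measurable[OF k])
  have "in_range (\<lambda>i t. \<theta> t * expV k (of_real 1) i t + (-1) * (\<psi> t * G0 i t))"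
    by (intro in_range_add_scale in_range_mult E G0(1) \<theta> \<psi>)
  thus ?thesis
  proof (rule in_range_cong)
    show "(\<lambda>t. if i = k then \<theta> t * (cnj (S (of_real t)) / of_real (c k - a k + t)) else 0) \<in> borel_measurable borel" for i
      by measurable
    fix i t assume i: "i \<in> {1..n}" and t: "a i < t"
    have "Re (complex_of_real t + 1) \<noteq> 0" using t a_nonneg[OF i] by simp
    hence t1: "complex_of_real t + 1 \<noteq> 0" by (metis zero_complex.sel(1))
    have kb0: "1 + ?kb t \<noteq> 0" using kb[of t] by auto
    have "\<psi> t * G0 i t = \<theta> t * (1 / (1 + ?kb t))"
      unfolding G0(2)[OF i t] \<psi>_def using t1 S1 kb0 by simp
    moreover have "expV k (of_real 1) i t = 1 / (1 + ?kb t) + (if i = k then cnj (S (of_real t)) / of_real (c k - a k + t) else 0)"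
      by (simp add: expV_def)
    ultimately show "(if i = k then \<theta> t * (cnj (S (of_real t)) / of_real (c k - a k + t)) else 0) = \<theta> t * expV k (of_real 1) i t + (-1) * (\<psi> t * G0 i t)"
      by (simp add: distrib_left)
  qed
qed

text \<open>Division by the nowhere vanishing component from \<open>in_range_component\<close> gives
  a multiplier \<open>r\<close>. Truncated to bounded values and bounded t it is admissible, the
  products are dominated by \<open>G k\<close>, and the range is closed.\<close>

lemma in_range_single:
  assumes G: "sqints n (Mq n c a) G" and k: "k \<in> {1..n}"
  shows "in_range (\<lambda>i t. if i = k then G k t else 0)"
proof -
  let ?D = "\<lambda>t. complex_of_real (c k - a k + t)" and ?sb = "\<lambda>t. cnj (S (of_real t))"
  have [measurable]: "G k \<in> borel_measurable borel"
    using G k by (auto simp: sqints_def sqint_def cong: measurable_cong_sets)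
  define r where "r t = G k t * ?D t / ?sb t" for t
  have [measurable]: "r \<in> borel_measurable borel" unfolding r_def by measurable
  define \<theta> where "\<theta> m t = (if a k < t \<and> t \<le> real m \<and> cmod (r t) \<le> real m then r t else 0)" for m t
  have \<theta>: "bddBorel (\<theta> m)" for m
  proof (rule bddBorelI[where B = "real m"])
    show "\<theta> m \<in> borel_measurable borel" unfolding \<theta>_def by measurable
  qed (auto simp: \<theta>_def)
  define F where "F m = (\<lambda>i t. if i = k then \<theta> m t * (?sb t / ?D t) else 0)" for m
  have F: "in_range (F m)" for m
    unfolding F_def by (rule in_range_component[OF k \<theta>, where m = "real m"]) (auto simp: \<theta>_def split: if_splits)
  have Feq: "F m i t = (if i = k \<and> a k < t \<and> t \<le> real m \<and> cmod (r t) \<le> real m then G k t else 0)" for m i t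
  proof (cases "a k < t")
    case True
    have "c k - a k + t \<noteq> 0" using True c_pos[OF k] by linarith
    hence "?D t \<noteq> 0" unfolding of_real_eq_0_iff .
    moreover have "?sb t \<noteq> 0" using sig_nonzero[OF k, of "of_real t"] True by auto
    ultimately have "r t * (?sb t / ?D t) = G k t" by (simp add: r_def)
    thus ?thesis by (simp add: F_def \<theta>_def)
  qed (simp add: F_def \<theta>_def)
  have tgt: "sqints n (Mq n c a) (\<lambda>i t. if i = k then G k t else 0)"
    unfolding sqints_def
  proof
    fix i assume "i \<in> {1..n}"
    thus "sqint (Mq n c a i) (\<lambda>t. if i = k then G k t else 0)"
      using G by (cases "i = k") (auto simp: sqints_def)
  qed
  from F have "\<forall>m. \<exists>f. W f (F m)" by (simp add: in_range_def)
  from choice[OF this] obtain f where f: "\<And>m. W (f m) (F m)" by blast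
  have "(\<lambda>m. nq (\<lambda>i t. F m i t - (if i = k then G k t else 0))) \<longlonglongrightarrow> 0"
  proof (rule nrm_dominated[OF tgt])
    fix m i assume i: "i \<in> {1..n}"
    show "(\<lambda>t. F m i t - (if i = k then G k t else 0)) \<in> borel_measurable (Mq n c a i)"
      unfolding Feq by measurable
    show "cmod (F m i t - (if i = k then G k t else 0)) \<le> cmod (if i = k then G k t else 0)" for t
      unfolding Feq by simp
    show "AE t in Mq n c a i. (\<lambda>m. F m i t - (if i = k then G k t else 0)) \<longlonglongrightarrow> 0"
    proof (rule AE_Mq_I[OF i])
      fix t assume t: "a i < t"
      obtain m0 where m0: "max t (cmod (r t)) \<le> real m0" using real_arch_simple by blast
      have "F m i t - (if i = k then G k t else 0) = 0" if "m \<ge> m0" for m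
      proof -
        have "t \<le> real m" "cmod (r t) \<le> real m" using m0 that by auto
        thus ?thesis unfolding Feq using t by auto
      qed
      thus "(\<lambda>m. F m i t - (if i = k then G k t else 0)) \<longlonglongrightarrow> 0"
        by (intro tendsto_eventually eventually_sequentiallyI)
    qed
  qed
  from Vt_range_closed[OF f tgt this] show ?thesis by (simp add: in_range_def)
qed

lemma Vt_surjective:
  assumes G: "sqints n (Mq n c a) G"
  shows "\<exists>f. W f G"
proof -
  have Gm: "G k \<in> borel_measurable borel" if "k \<in> {1..n}" for k
    using G that by (auto simp: sqints_def sqint_def cong: measurable_cong_sets)
  have "in_range (\<lambda>i t. if i \<in> J then G i t else 0)" if "finite J" "J \<subseteq> {1..n}" for J
    using that
  proof (induction J rule: finite_induct)
    case empty
    have "in_range (\<lambda>i t. 0 * (if i = 1 then G 1 t else 0))"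
      by (rule in_range_mult[OF in_range_single[OF G]]) (use n_pos in auto)
    thus ?case by simp
  next
    case (insert k J)
    have "(\<lambda>i t. (if i \<in> J then G i t else 0) + 1 * (if i = k then G k t else 0)) = (\<lambda>i t. if i \<in> insert k J then G i t else 0)"
      using insert(2) by (auto simp: fun_eq_iff)
    thus ?case using in_range_add_scale[OF insert(3) in_range_single[OF G, of k], of 1] insert(4) by simp
  qed
  from this[of "{1..n}"] have "in_range (\<lambda>i t. if i \<in> {1..n} then G i t else 0)" by simp
  from in_range_cong[OF this Gm] show ?thesis unfolding in_range_def by simp
qed

end

section \<open>The synthesis operator\<close>

context star
begin

text \<open>The only property of the space X used for Fubini: one order of decay, which together
  with the order -1/2 of the kernel is integrable at infinity.\<close>

definition decaying :: "(nat \<Rightarrow> real \<Rightarrow> complex) \<Rightarrow> bool" where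
  "decaying G \<longleftrightarrow> (\<forall>k\<in>{1..n}. \<exists>M. \<forall>t>a k. cmod (G k t) * (1 + \<bar>t - a k\<bar>) \<le> M)"

text \<open>Up to \<open>a n + 2\<close> smoothness on the closed half-line gives a bound by
  compactness. Beyond, \<open>chi\<close> is 1 and the Schwartz bounds with powers 0 and 1
  apply.\<close>

lemma inX_decaying:
  assumes X: "inX n c a chi G" and chi: "\<And>t. a n + 2 < t \<Longrightarrow> chi t = 1" and an: "\<And>k. k \<in> {1..n} \<Longrightarrow> a k \<le> a n"
  shows "decaying G"
  unfolding decaying_def
proof
  fix k assume k: "k \<in> {1..n}"
  have sm: "smooth_on {a k..} (G k)" and sch: "schwartz (\<lambda>t. if a k \<le> t then of_real (chi t) * G k t else 0)"
    using X k by (auto simp: inX_def)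
  from sch[unfolded schwartz_def] obtain D where
    "D 0 = (\<lambda>t. if a k \<le> t then of_real (chi t) * G k t else 0) \<and>
      (\<forall>m x. (D m has_vector_derivative D (Suc m) x) (at x)) \<and>
      (\<forall>m p. \<exists>B. \<forall>x. cmod (of_real (x ^ p) * D m x) \<le> B)" by (elim exE)
  note D = this[THEN conjunct1] this[THEN conjunct2, THEN conjunct2]
  obtain B0 where B0: "\<And>x. cmod (of_real (x ^ 0) * D 0 x) \<le> B0" using D(2) by blast
  obtain B1 where B1: "\<And>x. cmod (of_real (x ^ 1) * D 0 x) \<le> B1" using D(2) by blast
  obtain E where E: "\<And>x. x \<in> {a k..} \<Longrightarrow> E 0 x = G k x"
    "\<And>m x. x \<in> {a k..} \<Longrightarrow> (E m has_vector_derivative E (Suc m) x) (at x within {a k..})"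
    using sm unfolding smooth_on_def by blast
  have "continuous_on {a k..} (E 0)"
    unfolding continuous_on_eq_continuous_within
    using E(2)[of _ 0] has_vector_derivative_continuous by blast
  hence "continuous_on {a k..a n + 2} (E 0)" by (rule continuous_on_subset) auto
  hence "bounded (E 0 ` {a k..a n + 2})" by (intro compact_imp_bounded compact_continuous_image) auto
  then obtain B2 where B2: "\<And>x. x \<in> {a k..a n + 2} \<Longrightarrow> cmod (E 0 x) \<le> B2" unfolding bounded_iff by blast
  have B2nn: "0 \<le> B2" by (rule order_trans[OF norm_ge_zero B2[of "a k"]]) (use an[OF k] in simp)
  have B0nn: "0 \<le> B0" by (rule order_trans[OF norm_ge_zero B0[of 0]])
  have B1nn: "0 \<le> B1" by (rule order_trans[OF norm_ge_zero B1[of 0]])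
  have ak: "0 \<le> a k" by (rule a_nonneg[OF k])
  have "cmod (G k t) * (1 + \<bar>t - a k\<bar>) \<le> B2 * (a n + 3) + (B0 + B1)" if t: "a k < t" for t
  proof (cases "t \<le> a n + 2")
    case True
    have "cmod (G k t) \<le> B2" using B2[of t] E(1)[of t] t True by simp
    moreover have "1 + \<bar>t - a k\<bar> \<le> a n + 3" using t True ak by simp
    ultimately have "cmod (G k t) * (1 + \<bar>t - a k\<bar>) \<le> B2 * (a n + 3)"
      using B2nn by (intro mult_mono) auto
    thus ?thesis using B0nn B1nn by linarith
  next
    case False
    hence chi1: "chi t = 1" by (intro chi) simp
    have Dt: "D 0 t = G k t" unfolding D(1) using chi1 t by simp
    have 0: "cmod (G k t) \<le> B0" using B0[of t] Dt by simp
    have 1: "t * cmod (G k t) \<le> B1" using B1[of t] Dt t ak by (simp add: norm_mult)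
    have "cmod (G k t) * (1 + \<bar>t - a k\<bar>) \<le> cmod (G k t) * (1 + t)"
      using t ak by (intro mult_left_mono) auto
    also have "\<dots> = cmod (G k t) + t * cmod (G k t)" by (simp add: algebra_simps)
    also have "\<dots> \<le> B0 + B1" using 0 1 by linarith
    also have "\<dots> \<le> B2 * (a n + 3) + (B0 + B1)"
    proof -
      have "0 \<le> a n" using an[OF k] ak by linarith
      thus ?thesis using B2nn by simp
    qed
    finally show ?thesis .
  qed
  thus "\<exists>M. \<forall>t>a k. cmod (G k t) * (1 + \<bar>t - a k\<bar>) \<le> M" by blast
qed

definition zker :: "(nat \<Rightarrow> real \<Rightarrow> complex) \<Rightarrow> nat \<Rightarrow> nat \<Rightarrow> real \<Rightarrow> real \<Rightarrow> complex" where
  "zker G j k t x = indicator {a j<..} t *\<^sub>R (of_real (q j t) * G j t * Fm n c a (of_real t) j k x)"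

lemma Zop_zker: "Zop n c a G k x = (\<Sum>j\<in>{1..n}. \<integral>t. zker G j k t x \<partial>lborel)"
  by (simp add: Zop_def zker_def set_lebesgue_integral_def)

text \<open>\<open>qfun_Fm_le\<close> and \<open>sig_ge\<close> give the inverse square root of the
  distance to the threshold, the decay of \<open>G\<close> gives the other factor. The bound is
  uniform in x, so it also serves as majorant for the double integral.\<close>

lemma zker_bound:
  assumes dec: "decaying G" and j: "j \<in> {1..n}"
  shows "\<exists>M\<ge>0. \<forall>k\<in>{1..n}. \<forall>t. \<forall>x\<ge>0. cmod (zker G j k t x) \<le> M * (1 / (sqrt \<bar>t - a j\<bar> * (1 + \<bar>t - a j\<bar>)))"
proof -
  obtain M where M: "\<And>t. a j < t \<Longrightarrow> cmod (G j t) * (1 + \<bar>t - a j\<bar>) \<le> M" using dec j unfolding decaying_def by blast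
  have cj: "0 < c j" by (rule c_pos[OF j])
  define C where "C = \<bar>M\<bar> * (2 / (pi * sqrt (c j)))"
  have C: "0 \<le> C" using cj by (simp add: C_def)
  have "cmod (zker G j k t x) \<le> C * (1 / (sqrt \<bar>t - a j\<bar> * (1 + \<bar>t - a j\<bar>)))"
    if k: "k \<in> {1..n}" and x: "0 \<le> x" for k t x
  proof (cases "a j < t")
    case True
    let ?y = "\<bar>t - a j\<bar>"
    have y: "0 < ?y" using True by simp
    have "c j * cmod (K j (of_real t)) = sqrt (c j) * sqrt ?y"
    proof -
      have "cmod (complex_of_real t - of_real (a j)) = ?y" by (simp flip: of_real_diff)
      hence "c j * cmod (K j (of_real t)) = c j / sqrt (c j) * sqrt ?y"
        using cj by (simp add: cmod_kap real_sqrt_divide)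
      thus ?thesis using cj by (simp add: real_div_sqrt)
    qed
    hence S: "sqrt (c j) * sqrt ?y \<le> cmod (S (of_real t))" using sig_ge[OF j, of "of_real t"] by simp
    have "q j t * cmod (Fm n c a (of_real t) j k x) \<le> 2 / (pi * cmod (S (of_real t)))"
      by (rule qfun_Fm_le[OF j k True x])
    also have "\<dots> \<le> 2 / (pi * (sqrt (c j) * sqrt ?y))"
    proof -
      have "0 < sqrt (c j) * sqrt ?y" using y cj by simp
      thus ?thesis by (intro frac_le mult_left_mono S mult_pos_pos pi_gt_zero) (use cj y in auto)
    qed
    finally have qF: "q j t * cmod (Fm n c a (of_real t) j k x) \<le> 2 / (pi * (sqrt (c j) * sqrt ?y))" .
    have GM: "cmod (G j t) \<le> \<bar>M\<bar> / (1 + ?y)" using M[OF True] y by (simp add: pos_le_divide_eq)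
    have "cmod (zker G j k t x) = cmod (G j t) * (q j t * cmod (Fm n c a (of_real t) j k x))"
      using True qfun_nonneg[OF j, of t] by (simp add: zker_def norm_mult)
    also have "\<dots> \<le> (\<bar>M\<bar> / (1 + ?y)) * (2 / (pi * (sqrt (c j) * sqrt ?y)))"
      using qfun_nonneg[OF j, of t] y by (intro mult_mono GM qF) auto
    also have "\<dots> = C * (1 / (sqrt ?y * (1 + ?y)))" by (simp add: C_def mult_ac)
    finally show ?thesis .
  next
    case False
    thus ?thesis using C by (simp add: zker_def)
  qed
  with C show ?thesis by blast
qed

lemma zker_measurable:
  assumes G: "sqints n (Mq n c a) G" and j: "j \<in> {1..n}" and k: "k \<in> {1..n}"
  shows "(\<lambda>(t, x). zker G j k t x) \<in> borel_measurable (borel \<Otimes>\<^sub>M borel)"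
proof -
  have [measurable]: "G j \<in> borel_measurable borel"
    using G j by (auto simp: sqints_def sqint_def cong: measurable_cong_sets)
  note [measurable] = qfun_measurable[OF j] Fm_measurable[OF j k]
  show ?thesis unfolding zker_def by measurable
qed

lemma Zop_measurable:
  assumes G: "sqints n (Mq n c a) G" and k: "k \<in> {1..n}"
  shows "Zop n c a G k \<in> borel_measurable borel"
proof -
  have "(\<lambda>x. \<Sum>j\<in>{1..n}. \<integral>t. zker G j k t x \<partial>lborel) \<in> borel_measurable borel"
  proof (intro borel_measurable_sum)
    fix j assume j: "j \<in> {1..n}"
    note [measurable] = zker_measurable[OF G j k]
    show "(\<lambda>x. \<integral>t. zker G j k t x \<partial>lborel) \<in> borel_measurable borel"
      by (rule lborel.borel_measurable_lebesgue_integral) measurable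
  qed
  thus ?thesis unfolding Zop_zker[abs_def] .
qed

lemma Zop_bound:
  assumes G: "sqints n (Mq n c a) G" and dec: "decaying G" and k: "k \<in> {1..n}"
  shows "\<exists>C. \<forall>x>0. cmod (Zop n c a G k x) \<le> C"
proof -
  have "\<forall>j\<in>{1..n}. \<exists>C. \<forall>x>0. cmod (\<integral>t. zker G j k t x \<partial>lborel) \<le> C"
  proof
    fix j assume j: "j \<in> {1..n}"
    obtain M where M: "\<And>t x. 0 \<le> x \<Longrightarrow> cmod (zker G j k t x) \<le> M * (1 / (sqrt \<bar>t - a j\<bar> * (1 + \<bar>t - a j\<bar>)))"
      using zker_bound[OF dec j] k by blast
    have w: "integrable lborel (\<lambda>t. M * (1 / (sqrt \<bar>t - a j\<bar> * (1 + \<bar>t - a j\<bar>))))"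
      by (intro integrable_mult_right sqrt_weight_integrable)
    have "cmod (\<integral>t. zker G j k t x \<partial>lborel) \<le> (\<integral>t. M * (1 / (sqrt \<bar>t - a j\<bar> * (1 + \<bar>t - a j\<bar>))) \<partial>lborel)" if "0 < x" for x
    proof (rule Bochner_Integration.integral_norm_bound_integral[OF _ w])
      note [measurable] = zker_measurable[OF G j k]
      have le: "norm (zker G j k t x) \<le> M * (1 / (sqrt \<bar>t - a j\<bar> * (1 + \<bar>t - a j\<bar>)))" for t
        using that by (intro M) simp
      show "integrable lborel (\<lambda>t. zker G j k t x)"
      proof (rule Bochner_Integration.integrable_bound[OF w])
        show "AE t in lborel. norm (zker G j k t x) \<le> norm (M * (1 / (sqrt \<bar>t - a j\<bar> * (1 + \<bar>t - a j\<bar>))))"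
          unfolding real_norm_def by (intro AE_I2 order_trans[OF le abs_ge_self])
      qed measurable
    qed (rule M, use that in simp)
    thus "\<exists>C. \<forall>x>0. cmod (\<integral>t. zker G j k t x \<partial>lborel) \<le> C" by blast
  qed
  then obtain C where C: "\<And>j x. j \<in> {1..n} \<Longrightarrow> 0 < x \<Longrightarrow> cmod (\<integral>t. zker G j k t x \<partial>lborel) \<le> C j" by metis
  have "cmod (Zop n c a G k x) \<le> (\<Sum>j\<in>{1..n}. C j)" if "0 < x" for x
    unfolding Zop_zker using that by (intro sum_norm_le C)
  thus ?thesis by blast
qed

text \<open>\<open>Zop\<close> is the formal adjoint of \<open>Vop\<close>, by Fubini. Testing with
  functions on a single edge is enough to recover each component.\<close>

lemma Zop_pairing:
  assumes G: "sqints n (Mq n c a) G" and dec: "decaying G" and k: "k \<in> {1..n}"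
    and g: "g \<in> borel_measurable borel" "integrable MN g"
  shows "inn n (Mq n c a) G (V (\<lambda>i x. if i = k then g x else 0)) = (\<integral>x. Zop n c a G k x * cnj (g x) \<partial>MN)"
proof -
  note [measurable] = g(1)
  let ?e = "\<lambda>i x. if i = k then g x else 0"
  define h where "h x = indicator {0<..} x *\<^sub>R cnj (g x)" for x :: real
  have gi: "integrable lborel (\<lambda>x. indicator {0<..} x *\<^sub>R g x)" using g integrable_MN_iff[OF g(1)] by simp
  have hi: "integrable lborel h"
  proof -
    have eq: "h = (\<lambda>x. cnj (indicator {0<..} x *\<^sub>R g x))" by (auto simp: h_def indicator_def)
    show ?thesis unfolding eq by (rule integrable_cnj[OF gi])
  qed
  have [measurable]: "h \<in> borel_measurable borel" using hi by (auto dest: borel_measurable_integrable)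
  have em: "?e i \<in> borel_measurable borel" for i by measurable
  have Ve: "cnj (V ?e j t) = (\<integral>x. Fm n c a (of_real t) j k x * h x \<partial>lborel)" if j: "j \<in> {1..n}" for j t
  proof -
    note [measurable] = Fm_measurable2[OF j k, of t]
    have "V ?e j t = (\<Sum>i\<in>{1..n}. if i = k then (\<integral>x. g x * cnj (Fm n c a (of_real t) j k x) \<partial>MN) else 0)"
      unfolding Vop_def by (intro sum.cong refl) auto
    also have "\<dots> = (\<integral>x. g x * cnj (Fm n c a (of_real t) j k x) \<partial>MN)" using k by simp
    also have "cnj \<dots> = (\<integral>x. cnj (g x * cnj (Fm n c a (of_real t) j k x)) \<partial>MN)" by (rule Bochner_Integration.integral_cnj[symmetric])
    also have "\<dots> = (\<integral>x. indicator {0<..} x *\<^sub>R cnj (g x * cnj (Fm n c a (of_real t) j k x)) \<partial>lborel)"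
      by (rule integral_MN) measurable
    also have "\<dots> = (\<integral>x. Fm n c a (of_real t) j k x * h x \<partial>lborel)"
      by (rule Bochner_Integration.integral_cong) (auto simp: h_def indicator_def)
    finally show ?thesis .
  qed
  have main: "(\<integral>t. G j t * cnj (V ?e j t) \<partial>Mq n c a j) = (\<integral>x. (\<integral>t. zker G j k t x \<partial>lborel) * h x \<partial>lborel)
      \<and> integrable lborel (\<lambda>x. (\<integral>t. zker G j k t x \<partial>lborel) * h x)" if j: "j \<in> {1..n}" for j
  proof -
    have Gj [measurable]: "G j \<in> borel_measurable borel"
      using G j by (auto simp: sqints_def sqint_def cong: measurable_cong_sets)
    have Vm [measurable]: "V ?e j \<in> borel_measurable borel" by (rule Vop_measurable[OF j em])
    note [measurable] = zker_measurable[OF G j k]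
    obtain M where M: "0 \<le> M" "\<And>t x. 0 \<le> x \<Longrightarrow> cmod (zker G j k t x) \<le> M * (1 / (sqrt \<bar>t - a j\<bar> * (1 + \<bar>t - a j\<bar>)))"
      using zker_bound[OF dec j] k by blast
    let ?w = "\<lambda>t. M * (1 / (sqrt \<bar>t - a j\<bar> * (1 + \<bar>t - a j\<bar>)))"
    have w: "integrable lborel ?w" by (intro integrable_mult_right sqrt_weight_integrable)
    \<comment> \<open>The majorant is a product of an integrable function of t and an integrable
      function of x.\<close>
    have wh: "integrable (lborel \<Otimes>\<^sub>M lborel) (\<lambda>(t, x). ?w t * cmod (h x))"
    proof (rule lborel_pair.Fubini_integrable)
      show "integrable lborel (\<lambda>t. \<integral>x. norm (case (t, x) of (t, x) \<Rightarrow> ?w t * cmod (h x)) \<partial>lborel)"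
      proof -
        have "(\<lambda>t. \<integral>x. norm (case (t, x) of (t, x) \<Rightarrow> ?w t * cmod (h x)) \<partial>lborel) = (\<lambda>t. ?w t * (\<integral>x. cmod (h x) \<partial>lborel))"
          using M(1) by (simp add: abs_mult)
        thus ?thesis using w by (simp only: integrable_mult_left)
      qed
      show "AE t in lborel. integrable lborel (\<lambda>x. case (t, x) of (t, x) \<Rightarrow> ?w t * cmod (h x))"
        using hi by (intro AE_I2) (simp add: integrable_norm)
    qed measurable
    have int: "integrable (lborel \<Otimes>\<^sub>M lborel) (\<lambda>(t, x). zker G j k t x * h x)"
    proof (rule Bochner_Integration.integrable_bound[OF wh])
      have "norm (zker G j k t x * h x) \<le> norm (?w t * cmod (h x))" for t x
      proof (cases "0 < x")
        case True
        have "cmod (zker G j k t x) * cmod (h x) \<le> ?w t * cmod (h x)"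
          using True by (intro mult_right_mono M(2)) auto
        thus ?thesis unfolding norm_mult real_norm_def using M(1) by simp
      qed (simp add: h_def)
      thus "AE p in lborel \<Otimes>\<^sub>M lborel. norm (case p of (t, x) \<Rightarrow> zker G j k t x * h x) \<le> norm (case p of (t, x) \<Rightarrow> ?w t * cmod (h x))"
        by (intro AE_I2) (auto simp: split_beta)
    qed measurable
    have "(\<integral>t. G j t * cnj (V ?e j t) \<partial>Mq n c a j) = (\<integral>t. q j t *\<^sub>R (G j t * cnj (V ?e j t)) \<partial>lborel)"
      by (rule integral_Mq[OF j]) measurable
    also have "\<dots> = (\<integral>t. (\<integral>x. zker G j k t x * h x \<partial>lborel) \<partial>lborel)"
    proof (rule Bochner_Integration.integral_cong[OF refl])
      fix t
      have q0: "q j t = 0" if "\<not> a j < t" using that by (simp add: qfun_def)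
      have "(\<integral>x. zker G j k t x * h x \<partial>lborel) = (\<integral>x. (indicator {a j<..} t *\<^sub>R (of_real (q j t) * G j t)) * (Fm n c a (of_real t) j k x * h x) \<partial>lborel)"
        by (simp add: zker_def mult.assoc)
      also have "\<dots> = (indicator {a j<..} t *\<^sub>R (of_real (q j t) * G j t)) * cnj (V ?e j t)"
        unfolding Ve[OF j] by (rule integral_mult_right_zero)
      also have "\<dots> = q j t *\<^sub>R (G j t * cnj (V ?e j t))"
        using q0 by (cases "a j < t") (auto simp: scaleR_conv_of_real)
      finally show "q j t *\<^sub>R (G j t * cnj (V ?e j t)) = (\<integral>x. zker G j k t x * h x \<partial>lborel)" by simp
    qed
    also have "\<dots> = (\<integral>x. (\<integral>t. zker G j k t x * h x \<partial>lborel) \<partial>lborel)"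
      by (rule lborel_pair.Fubini_integral[OF int, symmetric])
    also have "\<dots> = (\<integral>x. (\<integral>t. zker G j k t x \<partial>lborel) * h x \<partial>lborel)" by simp
    finally have 1: "(\<integral>t. G j t * cnj (V ?e j t) \<partial>Mq n c a j) = (\<integral>x. (\<integral>t. zker G j k t x \<partial>lborel) * h x \<partial>lborel)" .
    have "integrable lborel (\<lambda>x. \<integral>t. zker G j k t x * h x \<partial>lborel)"
      by (rule lborel_pair.integrable_snd[OF int])
    with 1 show ?thesis by simp
  qed
  have "inn n (Mq n c a) G (V ?e) = (\<Sum>j\<in>{1..n}. \<integral>x. (\<integral>t. zker G j k t x \<partial>lborel) * h x \<partial>lborel)"
    unfolding inn_def using main by (intro sum.cong refl) blast
  also have "\<dots> = (\<integral>x. (\<Sum>j\<in>{1..n}. (\<integral>t. zker G j k t x \<partial>lborel) * h x) \<partial>lborel)"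
    using main by (intro Bochner_Integration.integral_sum[symmetric]) blast
  also have "\<dots> = (\<integral>x. indicator {0<..} x *\<^sub>R (Zop n c a G k x * cnj (g x)) \<partial>lborel)"
    unfolding Zop_zker h_def by (rule Bochner_Integration.integral_cong) (auto simp: sum_distrib_right indicator_def)
  also have "\<dots> = (\<integral>x. Zop n c a G k x * cnj (g x) \<partial>MN)"
    by (rule integral_MN[symmetric]) (use Zop_measurable[OF G k] g(1) in measurable)
  finally show ?thesis .
qed

text \<open>\<open>Zop G\<close> is known to be bounded on each edge but not yet to lie in H, so the
  two functions are compared by pairing with functions of L^1 and L^2 rather than in norm.\<close>

lemma Zop_eq_preimage:
  assumes fG: "W f G" and dec: "decaying G" and k: "k \<in> {1..n}"
  shows "AE x in MN. Zop n c a G k x = f k x"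
proof -
  note sq = Vt_sqints[OF fG]
  have [measurable]: "f k \<in> borel_measurable borel" using sq(1) k by (auto simp: sqints_def sqint_def cong: measurable_cong_sets)
  have [measurable]: "Zop n c a G k \<in> borel_measurable borel" by (rule Zop_measurable[OF sq(2) k])
  obtain C where C: "\<And>x. 0 < x \<Longrightarrow> cmod (Zop n c a G k x) \<le> C" using Zop_bound[OF sq(2) dec k] by blast
  define h where "h x = f k x - Zop n c a G k x" for x
  have hm [measurable]: "h \<in> borel_measurable borel" unfolding h_def by measurable
  have "AE x in MN. \<not> cmod (h x) \<le> real m \<or> h x = 0" for m :: nat
  proof -
    \<comment> \<open>The test function is the difference \<open>h\<close> itself, truncated at m
      and damped by \<open>exp (- x)\<close>. The pairing then becomes the integral of
      \<open>exp (- x) * (cmod (\<psi> x))\<^sup>2\<close>, and its vanishing forces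
      \<open>h\<close> to be 0 wherever its modulus is at most m.\<close>
    define \<psi> where "\<psi> x = (if cmod (h x) \<le> real m then h x else 0)" for x
    have \<psi>m [measurable]: "\<psi> \<in> borel_measurable borel" unfolding \<psi>_def by measurable
    have \<psi>b: "cmod (\<psi> x) \<le> real m" for x by (simp add: \<psi>_def)
    define g where "g x = of_real (exp (- x)) * \<psi> x" for x
    have gm [measurable]: "g \<in> borel_measurable borel" unfolding g_def by measurable
    let ?e = "\<lambda>i x. if i = k then g x else 0"
    have eL: "L12 n ?e" using L12_exp_weight[OF \<psi>m \<psi>b, of n k] unfolding g_def .
    have "integrable MN g \<and> integrable MN (\<lambda>x. (cmod (g x))\<^sup>2)"
      using eL[unfolded L12_def, rule_format, OF k] by simp
    hence gi: "integrable MN g" "sqint MN g" using gm by (auto simp: sqint_def cong: measurable_cong_sets)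
    have "(\<integral>x. f k x * cnj (g x) \<partial>MN) = inn n (\<lambda>_. MN) f ?e"
    proof -
      have "inn n (\<lambda>_. MN) f ?e = (\<Sum>i\<in>{1..n}. if i = k then (\<integral>x. f k x * cnj (g x) \<partial>MN) else 0)"
        unfolding inn_def by (intro sum.cong refl) auto
      thus ?thesis using k by simp
    qed
    also have "\<dots> = inn n (Mq n c a) G (V ?e)" by (rule Vt_inn[OF fG L12_isom(2)[OF eL]])
    also have "\<dots> = (\<integral>x. Zop n c a G k x * cnj (g x) \<partial>MN)" by (rule Zop_pairing[OF sq(2) dec k gm gi(1)])
    finally have eq: "(\<integral>x. f k x * cnj (g x) \<partial>MN) = (\<integral>x. Zop n c a G k x * cnj (g x) \<partial>MN)" .
    have fi: "integrable MN (\<lambda>x. f k x * cnj (g x))"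
      using sq(1) gi(2) k by (intro sqint_cnj_integrable) (auto simp: sqints_def)
    have zi: "integrable MN (\<lambda>x. Zop n c a G k x * cnj (g x))"
    proof (rule Bochner_Integration.integrable_bound)
      show "integrable MN (\<lambda>x. C * cmod (g x))" using gi(1) by (intro integrable_mult_right integrable_norm)
      show "AE x in MN. norm (Zop n c a G k x * cnj (g x)) \<le> norm (C * cmod (g x))"
      proof (rule AE_MN_I)
        fix x :: real assume "0 < x"
        from mult_right_mono[OF C[OF this] norm_ge_zero[of "g x"]]
        show "norm (Zop n c a G k x * cnj (g x)) \<le> norm (C * cmod (g x))"
          unfolding norm_mult complex_mod_cnj real_norm_def by (simp add: order_trans[OF _ abs_ge_self] abs_mult[symmetric])
      qed
    qed measurable
    define u where "u x = exp (- x) * (cmod (\<psi> x))\<^sup>2" for x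
    have u: "h x * cnj (g x) = complex_of_real (u x)" for x
    proof -
      have "h x * cnj (\<psi> x) = complex_of_real ((cmod (\<psi> x))\<^sup>2)"
        by (simp add: \<psi>_def complex_norm_square del: of_real_power)
      hence "complex_of_real (exp (- x)) * (h x * cnj (\<psi> x)) = complex_of_real (u x)" by (simp add: u_def)
      thus ?thesis by (simp add: g_def mult.left_commute)
    qed
    have hi: "integrable MN (\<lambda>x. h x * cnj (g x))" and h0: "(\<integral>x. h x * cnj (g x) \<partial>MN) = 0"
      unfolding h_def left_diff_distrib using fi zi eq by auto
    have ui: "integrable MN u" using integrable_Re[OF hi] unfolding u by simp
    have "complex_of_real (\<integral>x. u x \<partial>MN) = 0" using h0 unfolding u by simp
    hence u0: "(\<integral>x. u x \<partial>MN) = 0" unfolding of_real_eq_0_iff .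
    have "AE x in MN. 0 \<le> u x" by (simp add: u_def)
    from integral_nonneg_eq_0_iff_AE[OF ui this] u0 have "AE x in MN. u x = 0" by blast
    thus ?thesis by eventually_elim (auto simp: u_def \<psi>_def split: if_splits)
  qed
  hence "AE x in MN. \<forall>m::nat. \<not> cmod (h x) \<le> real m \<or> h x = 0" by (subst AE_all_countable) blast
  thus ?thesis
  proof eventually_elim
    case (elim x)
    obtain m where "cmod (h x) \<le> real m" using real_arch_simple by blast
    hence "h x = 0" using elim by blast
    thus ?case by (simp add: h_def)
  qed
qed

end

text \<open>By surjectivity every element of X is the transform of some f, and \<open>Zop\<close>
  returns f; so \<open>Zop\<close> preserves norms on X. In the limit the norm of G equals that of
  its image, which is 0.\<close>

lemma (in star_calculus) Zt_kernel:
  assumes Z: "Zt n c a chi G (\<lambda>k x. 0)" and chi: "\<And>t. a n + 2 < t \<Longrightarrow> chi t = 1" and an: "\<And>k. k \<in> {1..n} \<Longrightarrow> a k \<le> a n"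
  shows "eqq n c a G (\<lambda>k t. 0)"
proof -
  obtain Gs where G: "sqints n (Mq n c a) G" and X: "\<And>m. inX n c a chi (Gs m)"
    and lim: "(\<lambda>m. nq (\<lambda>k t. Gs m k t - G k t)) \<longlonglongrightarrow> 0"
    and Zlim: "(\<lambda>m. nH (\<lambda>k x. Zop n c a (Gs m) k x - 0)) \<longlonglongrightarrow> 0"
    using Z unfolding Zt_def inLq_eq normq_eq normH_eq by blast
  have Gs: "sqints n (Mq n c a) (Gs m)" for m using X[of m] by (simp add: inX_def inLq_eq)
  have dec: "decaying (Gs m)" for m by (rule inX_decaying[OF X chi an])
  have "nH (\<lambda>k x. Zop n c a (Gs m) k x - 0) = nq (Gs m)" for m
  proof -
    obtain f where f: "W f (Gs m)" using Vt_surjective[OF Gs[of m]] by blast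
    note sq = Vt_sqints[OF f]
    have AE: "AE x in MN. Zop n c a (Gs m) k x = f k x" if "k \<in> {1..n}" for k
      by (rule Zop_eq_preimage[OF f dec that])
    have "sqints n (\<lambda>_. MN) (Zop n c a (Gs m))"
      by (rule sqints_cong_AE[OF sq(1) _ AE]) (use Zop_measurable[OF Gs] in \<open>simp cong: measurable_cong_sets\<close>)
    hence "nH (Zop n c a (Gs m)) = nH f" by (rule nrm_cong_AE[OF _ sq(1) AE])
    thus ?thesis using Vt_norm[OF f] by simp
  qed
  hence "(\<lambda>m. nq (Gs m)) \<longlonglongrightarrow> 0" using Zlim by simp
  moreover have "(\<lambda>m. nq (Gs m)) \<longlonglongrightarrow> nq G" by (rule nrm_tendsto[OF Gs G lim])
  ultimately have "nq G = 0" using LIMSEQ_unique by blast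
  thus ?thesis using nrm_zero_iff[OF G] by (simp add: eqq_def)
qed

theorem theorem7p9:
  fixes n :: nat and c a :: "nat \<Rightarrow> real" and chi :: "real \<Rightarrow> real"
    and \<Phi> :: "(real \<Rightarrow> complex) \<Rightarrow> (nat \<Rightarrow> real \<Rightarrow> complex) \<Rightarrow> (nat \<Rightarrow> real \<Rightarrow> complex)"
  assumes n2: "2 \<le> n"
    and cpos: "\<forall>k\<in>{1..n}. 0 < c k"
    and a1: "0 \<le> a 1"
    and amono: "\<forall>i\<in>{1..n}. \<forall>k\<in>{1..n}. i \<le> k \<longrightarrow> a i \<le> a k"
    and chi_smooth: "smooth_on UNIV chi"
    and chi0: "\<forall>t. t < a n + 1 \<longrightarrow> chi t = 0"
    and chi1: "\<forall>t. a n + 2 < t \<longrightarrow> chi t = 1"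
    and Phi: "is_fcalc n c a \<Phi>"
  shows "(\<forall>G. Zt n c a chi G (\<lambda>k x. 0) \<longrightarrow> eqq n c a G (\<lambda>k t. 0))
       \<and> (\<forall>G. inLq n c a G \<longrightarrow> (\<exists>f. Vt n c a f G))
       \<and> (\<forall>f G. Vt n c a f G \<longrightarrow> normH n f = normq n c a G)
       \<and> (\<forall>\<psi> f G. bddBorel \<psi> \<and> Vt n c a f G \<longrightarrow> Vt n c a (\<Phi> \<psi> f) (\<lambda>k t. \<psi> t * G k t))"
proof -
  interpret star_calculus n c a \<Phi>
  proof
    show "1 \<le> n" using n2 by simp
    show "0 < c k" if "k \<in> {1..n}" for k using cpos that by blast
    show "0 \<le> a k" if "k \<in> {1..n}" for k
    proof -
      have "1 \<in> {1..n}" "1 \<le> k" using that by auto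
      hence "a 1 \<le> a k" using amono that by blast
      thus ?thesis using a1 by linarith
    qed
    show "is_fcalc n c a \<Phi>" by (rule Phi)
  qed
  have an: "a k \<le> a n" if "k \<in> {1..n}" for k
  proof -
    have "n \<in> {1..n}" "k \<le> n" using that by auto
    thus ?thesis using amono that by blast
  qed
  show ?thesis
  proof (intro conjI allI impI)
    show "eqq n c a G (\<lambda>k t. 0)" if "Zt n c a chi G (\<lambda>k x. 0)" for G
      by (rule Zt_kernel[OF that chi1[rule_format] an])
    show "\<exists>f. Vt n c a f G" if "inLq n c a G" for G
      using that unfolding inLq_eq by (rule Vt_surjective)
    show "normH n f = normq n c a G" if "Vt n c a f G" for f G
      unfolding normH_eq normq_eq by (rule Vt_norm[OF that])
    show "Vt n c a (\<Phi> \<psi> f) (\<lambda>k t. \<psi> t * G k t)" if "bddBorel \<psi> \<and> Vt n c a f G" for \<psi> f G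
      using that by (intro intertwinedD(2)[OF bddBorel_intertwined]) auto
  qed
qed

end
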